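(* For any continuous definable function germ $f\colon(\mathbb{R}^2,0)\to(\mathbb{R},0)$ there exists a pizza associated with $f$.
   Context: Fix a polynomially bounded o-minimal structure $\mathcal{A}$ over $\mathbb{R}$ with field of exponents $\mathbb{F}\subset\mathbb{R}$; $\mathbb{F}_+$ denotes the set of positive elements of $\mathbb{F}$. "Definable" means definable in $\mathcal{A}$. Functions are identified with their germs at the origin of $\mathbb{R}^2$. Arcs, orders. An arc is (the germ at the origin of) a continuous definable map $\gamma\colon[0,\epsilon)\to\mathbb{R}^2$ with $\gamma(0)=0$, parameterized by the distance to the origin, $|\gamma(t)|=t$; it is identified with its image. The order of tangency of two distinct arcs is the exponent $\mathrm{tord}(\gamma_1,\gamma_2)=\beta\in\mathbb{F}$, $\beta\ge1$, with $|\gamma_1(t)-\gamma_2(t)|=bt^\beta+o(t^\beta)$, $b\ne0$. For a continuous definable function $f$ vanishing at $0$, $\mathrm{ord}_\gamma(f)\in\mathbb{F}_+$ is the exponent $\alpha$ with $f(\gamma(t))=at^\alpha+o(t^\alpha)$, $a\neq0$; $\mathrm{ord}_\gamma(f)=\infty$ if $f|_\gamma\equiv0$. Hölder triangles. Two arcs $\gamma_1,\gamma_2$ divide the germ of $\mathbb{R}^2$ at the origin into two components. If $\beta=\mathrm{tord}(\gamma_1,\gamma_2)>1$, the closure of the smaller component (the one not containing a half-plane) is a $\beta$-Hölder triangle; if $\mathrm{tord}(\gamma_1,\gamma_2)=1$, the closure of each of the two components is a $1$-Hölder triangle. $\beta$ is its exponent, $\gamma_1,\gamma_2$ its sides, and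 $T(\gamma_1,\gamma_2)$ denotes a Hölder triangle with sides $\gamma_1,\gamma_2$. For a Hölder triangle $T$, $Q_f(T)=\{\mathrm{ord}_\gamma(f):\gamma\subset T \text{ an arc}\}\subset\mathbb{F}_+\cup\{\infty\}$. $T$ is elementary with respect to $f$ if for any two disjoint arcs $\gamma_1,\gamma_2\subset T$ with $\mathrm{ord}_{\gamma_1}(f)=\mathrm{ord}_{\gamma_2}(f)=q$, the order of $f$ is $q$ on any arc in the Hölder triangle $T(\gamma_1,\gamma_2)\subset T$. For an arc $\gamma\subset T$, the relative width $\mu_T^*(\gamma)=\mu_T^*(\gamma,f)$ is the infimum of the exponents of Hölder triangles $\tilde T$ with $\gamma\subset\tilde T\subset T$ such that $Q_f(\tilde T)$ is a point ($\infty$ if there are none). Pizzas. A Hölder complex on $\mathbb{R}^2$ is a definable triangulation of the germ of $\mathbb{R}^2$ at the origin (into Hölder triangles, cyclically ordered). An abstract Hölder complex is a finite sequence of exponents $\beta_i\in\mathbb{F}$, $\beta_i\ge1$, considered with the cyclic order, at least one of which equals $1$; a Hölder complex $\{T_i\}$ corresponds to it if $T_i$ has exponent $\beta_i$ for all $i$. An abstract pizza (or pizza) is a finite collection $\mathcal{H}=\{\beta_i,Q_i,s_i,\mu_i\}_{i\in I}$, where $I=\{1,\dots,k\}$ mod $k$ with the cyclic order, such that: (1) $\{\beta_i\}$ is an abstract Hölder complex; (2) each $Q_i=[a_i,b_i]$ is a closed directed segment of $\mathbb{F}_+\cup\{\infty\}$ (either $a_i<b_i$, or $a_i>b_i$,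 or $a_i=b_i$ when $Q_i$ is a point), with $a_{i+1}=b_i$ for all $i$; (3) each $s_i$ is a sign $+$, $-$ or $0$, with $s_i=s_{i+1}$ unless $b_i=a_{i+1}=\infty$; (4) $\mu_i\colon Q_i\to\mathbb{F}\cup\{\infty\}$ is an affine function with $\min(\mu_i(a_i),\mu_i(b_i))=\beta_i$. Here affine means of the form $q\mapsto cq+d$, $c,d\in\mathbb{F}$; if $\infty\in Q_i\ne\{\infty\}$ the value at $\infty$ is the limit as $q\to\infty$, and if $Q_i=\{\infty\}$ the value is any element of $\mathbb{F}\cup\{\infty\}$. A pizza $\mathcal{H}=\{\beta_i,Q_i,s_i,\mu_i\}_{i\in I}$ is associated with a continuous definable germ $f\colon(\mathbb{R}^2,0)\to(\mathbb{R},0)$ if there is a Hölder complex $\{T_i\}_{i\in I}$ on $\mathbb{R}^2$, where each $T_i=T(\gamma_i,\gamma_{i+1})$ is a $\beta_i$-Hölder triangle elementary with respect to $f$ and the arcs $\gamma_i$ are either counterclockwise or clockwise oriented with respect to the cyclic order on $I$, such that (1) $Q_i=Q_f(T_i)$, as directed segments with $a_i=\mathrm{ord}_{\gamma_i}(f)$, $b_i=\mathrm{ord}_{\gamma_{i+1}}(f)$; (2) for each arc $\gamma\subset T_i$, $\mu_{T_i}^*(\gamma)=\mu_i(\mathrm{ord}_\gamma(f))$; (3) the sign of $f$ on the interior of $T_i$ is $s_i$. *)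

theory Defs
  imports "HOL-Analysis.Analysis" "HOL-Library.Landau_Symbols"
begin

section \<open>Polynomially bounded o-minimal structures over the reals\<close>

text \<open>
  A structure is given by the sets \<open>S n\<close> of its definable subsets of \<open>\<real>\<^sup>n\<close>; points of \<open>\<real>\<^sup>n\<close> are
  real lists of length \<open>n\<close>.  Definability is meant with parameters, in an expansion of the ordered
  field of reals.
\<close>

locale ominimal_structure =
  fixes S :: "nat \<Rightarrow> real list set set"
  assumes carrier: "A \<in> S n \<Longrightarrow> A \<subseteq> {xs. length xs = n}"
    and empty: "{} \<in> S n"
    and union: "A \<in> S n \<Longrightarrow> B \<in> S n \<Longrightarrow> A \<union> B \<in> S n"
    and complement: "A \<in> S n \<Longrightarrow> {xs. length xs = n} - A \<in> S n"
    and product_left: "A \<in> S n \<Longrightarrow> {x # xs | x xs. xs \<in> A} \<in> S (Suc n)"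
    and product_right: "A \<in> S n \<Longrightarrow> {xs @ [x] | xs x. xs \<in> A} \<in> S (Suc n)"
    and diagonal: "i < n \<Longrightarrow> j < n \<Longrightarrow> {xs. length xs = n \<and> xs ! i = xs ! j} \<in> S n"
    and projection: "A \<in> S (Suc n) \<Longrightarrow> butlast ` A \<in> S n"
    and singleton: "{[r]} \<in> S 1"
    and order: "{[x, y] | x y. x < y} \<in> S 2"
    and addition: "{[x, y, x + y] | x y. True} \<in> S 3"
    and multiplication: "{[x, y, x * y] | x y. True} \<in> S 3"
    and ominimal: "A \<in> S 1 \<Longrightarrow>
      \<exists>\<I>. finite \<I> \<and> (\<forall>I\<in>\<I>. is_interval (I :: real set)) \<and> {x. [x] \<in> A} = \<Union>\<I>"

locale polynomially_bounded_ominimal_structure = ominimal_structure +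
  assumes polynomially_bounded: "{[x, g x] | x. True} \<in> S 2 \<Longrightarrow>
      \<exists>N. \<forall>\<^sub>F x in at_top. \<bar>g x\<bar> \<le> x ^ N"

definition exponent_field :: "(nat \<Rightarrow> real list set set) \<Rightarrow> real set" where
  "exponent_field S = {r. {[x, x powr r] | x. 0 < x} \<in> S 2}"

definition order_values :: "(nat \<Rightarrow> real list set set) \<Rightarrow> ereal set" where
  "order_values S = insert \<infinity> (ereal ` {r \<in> exponent_field S. 0 < r})"


section \<open>Germs at the origin of the plane\<close>

text \<open>
  A germ is given by a representative: a total function, or a subset of the plane, whose values
  away from the origin are irrelevant to all notions below.
\<close>

definition germ_subset :: "(real \<times> real) set \<Rightarrow> (real \<times> real) set \<Rightarrow> bool" where
  "germ_subset A B \<longleftrightarrow> (\<forall>\<^sub>F x in nhds 0. x \<in> A \<longrightarrow> x \<in> B)"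

definition germ_eq :: "(real \<times> real) set \<Rightarrow> (real \<times> real) set \<Rightarrow> bool" where
  "germ_eq A B \<longleftrightarrow> (\<forall>\<^sub>F x in nhds 0. x \<in> A \<longleftrightarrow> x \<in> B)"

definition continuous_definable_germ ::
    "(nat \<Rightarrow> real list set set) \<Rightarrow> (real \<times> real \<Rightarrow> real) \<Rightarrow> bool" where
  "continuous_definable_germ S f \<longleftrightarrow> f 0 = 0 \<and>
     (\<exists>\<epsilon>>0. continuous_on (ball 0 \<epsilon>) f \<and>
        {[x, y, f (x, y)] | x y. (x, y) \<in> ball 0 \<epsilon>} \<in> S 3)"

definition definable_arc ::
    "(nat \<Rightarrow> real list set set) \<Rightarrow> (real \<Rightarrow> real \<times> real) \<Rightarrow> bool" where
  "definable_arc S \<gamma> \<longleftrightarrow> \<gamma> 0 = 0 \<and>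
     (\<exists>\<epsilon>>0. continuous_on {0..<\<epsilon>} \<gamma> \<and> (\<forall>t\<in>{0..<\<epsilon>}. norm (\<gamma> t) = t) \<and>
        {[t, fst (\<gamma> t), snd (\<gamma> t)] | t. t \<in> {0..<\<epsilon>}} \<in> S 3)"

text \<open>
  Since \<open>\<gamma>\<close> is parameterized by the distance to the origin, near the origin this is the image of
  \<open>[0, \<epsilon>)\<close> under \<open>\<gamma>\<close>; unlike \<open>range \<gamma>\<close>, its germ does not depend on \<open>\<gamma>\<close> outside \<open>[0, \<epsilon>)\<close>.
\<close>

definition arc_image :: "(real \<Rightarrow> real \<times> real) \<Rightarrow> (real \<times> real) set" where
  "arc_image \<gamma> = {x. \<gamma> (norm x) = x}"

definition arc_in ::
    "(nat \<Rightarrow> real list set set) \<Rightarrow> (real \<Rightarrow> real \<times> real) \<Rightarrow> (real \<times> real) set \<Rightarrow> bool" where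
  "arc_in S \<gamma> T \<longleftrightarrow> definable_arc S \<gamma> \<and> germ_subset (arc_image \<gamma>) T"

definition disjoint_arcs :: "(real \<Rightarrow> real \<times> real) \<Rightarrow> (real \<Rightarrow> real \<times> real) \<Rightarrow> bool" where
  "disjoint_arcs \<gamma>\<^sub>1 \<gamma>\<^sub>2 \<longleftrightarrow> germ_eq (arc_image \<gamma>\<^sub>1 \<inter> arc_image \<gamma>\<^sub>2) {0}"


section \<open>Orders\<close>

text \<open>\<open>g t = a t\<^sup>\<alpha> + o(t\<^sup>\<alpha>)\<close> as \<open>t \<rightarrow> 0+\<close>, with \<open>a \<noteq> 0\<close>.\<close>

definition has_order :: "(real \<Rightarrow> real) \<Rightarrow> real \<Rightarrow> bool" where
  "has_order g \<alpha> \<longleftrightarrow> (\<exists>a. a \<noteq> 0 \<and>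
     (\<lambda>t. g t - a * t powr \<alpha>) \<in> o[at_right 0](\<lambda>t. t powr \<alpha>))"

text \<open>
  The exponent is unique when it exists, and it exists for every definable germ \<open>g\<close> that is not
  identically zero, because the structure is polynomially bounded.
\<close>

definition order_at_0 :: "(real \<Rightarrow> real) \<Rightarrow> ereal" where
  "order_at_0 g = (if \<forall>\<^sub>F t in at_right 0. g t = 0 then \<infinity> else ereal (THE \<alpha>. has_order g \<alpha>))"

definition tord :: "(real \<Rightarrow> real \<times> real) \<Rightarrow> (real \<Rightarrow> real \<times> real) \<Rightarrow> ereal" where
  "tord \<gamma>\<^sub>1 \<gamma>\<^sub>2 = order_at_0 (\<lambda>t. norm (\<gamma>\<^sub>1 t - \<gamma>\<^sub>2 t))"

definition ord_along :: "(real \<times> real \<Rightarrow> real) \<Rightarrow> (real \<Rightarrow> real \<times> real) \<Rightarrow> ereal" where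
  "ord_along f \<gamma> = order_at_0 (\<lambda>t. f (\<gamma> t))"


section \<open>Hoelder triangles\<close>

definition germ_component ::
    "(real \<Rightarrow> real \<times> real) \<Rightarrow> (real \<Rightarrow> real \<times> real) \<Rightarrow> (real \<times> real) set \<Rightarrow> bool" where
  "germ_component \<gamma>\<^sub>1 \<gamma>\<^sub>2 C \<longleftrightarrow> (\<forall>\<^sub>F r in at_right 0.
     C \<inter> ball 0 r \<in> components (ball 0 r - (arc_image \<gamma>\<^sub>1 \<union> arc_image \<gamma>\<^sub>2)))"

text \<open>\<open>T\<close> is a Hoelder triangle with sides \<open>\<gamma>\<^sub>1\<close>, \<open>\<gamma>\<^sub>2\<close> and exponent \<open>\<beta>\<close>.\<close>

definition holder_triangle ::
    "(nat \<Rightarrow> real list set set) \<Rightarrow> (real \<times> real) set \<Rightarrow>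
     (real \<Rightarrow> real \<times> real) \<Rightarrow> (real \<Rightarrow> real \<times> real) \<Rightarrow> real \<Rightarrow> bool" where
  "holder_triangle S T \<gamma>\<^sub>1 \<gamma>\<^sub>2 \<beta> \<longleftrightarrow>
     definable_arc S \<gamma>\<^sub>1 \<and> definable_arc S \<gamma>\<^sub>2 \<and> tord \<gamma>\<^sub>1 \<gamma>\<^sub>2 = ereal \<beta> \<and>
     (\<exists>C. germ_component \<gamma>\<^sub>1 \<gamma>\<^sub>2 C \<and> germ_eq T (closure C) \<and>
        (\<beta> > 1 \<longrightarrow> \<not> (\<exists>v. v \<noteq> 0 \<and> germ_subset {x. v \<bullet> x > 0} C)))"

definition Q_of ::
    "(nat \<Rightarrow> real list set set) \<Rightarrow> (real \<times> real \<Rightarrow> real) \<Rightarrow> (real \<times> real) set \<Rightarrow> ereal set" where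
  "Q_of S f T = {ord_along f \<gamma> | \<gamma>. arc_in S \<gamma> T}"

definition elementary ::
    "(nat \<Rightarrow> real list set set) \<Rightarrow> (real \<times> real \<Rightarrow> real) \<Rightarrow> (real \<times> real) set \<Rightarrow> bool" where
  "elementary S f T \<longleftrightarrow> (\<forall>\<gamma>\<^sub>1 \<gamma>\<^sub>2 T' \<beta>' q.
     arc_in S \<gamma>\<^sub>1 T \<and> arc_in S \<gamma>\<^sub>2 T \<and> disjoint_arcs \<gamma>\<^sub>1 \<gamma>\<^sub>2 \<and>
     ord_along f \<gamma>\<^sub>1 = q \<and> ord_along f \<gamma>\<^sub>2 = q \<and>
     holder_triangle S T' \<gamma>\<^sub>1 \<gamma>\<^sub>2 \<beta>' \<and> germ_subset T' T \<longrightarrow>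
     (\<forall>\<gamma>. arc_in S \<gamma> T' \<longrightarrow> ord_along f \<gamma> = q))"

text \<open>The infimum is taken in the extended reals, hence \<open>\<infinity>\<close> for the empty set.\<close>

definition relative_width ::
    "(nat \<Rightarrow> real list set set) \<Rightarrow> (real \<times> real \<Rightarrow> real) \<Rightarrow> (real \<times> real) set \<Rightarrow>
     (real \<Rightarrow> real \<times> real) \<Rightarrow> ereal" where
  "relative_width S f T \<gamma> = Inf {ereal \<beta> | \<beta> T' \<gamma>\<^sub>1 \<gamma>\<^sub>2.
     holder_triangle S T' \<gamma>\<^sub>1 \<gamma>\<^sub>2 \<beta> \<and> arc_in S \<gamma> T' \<and> germ_subset T' T \<and>
     (\<exists>q. Q_of S f T' = {q})}"


section \<open>Hoelder complexes\<close>

text \<open>Indices \<open>i < k\<close> are taken modulo \<open>k\<close>.\<close>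

definition counterclockwise :: "nat \<Rightarrow> (nat \<Rightarrow> real \<Rightarrow> real \<times> real) \<Rightarrow> bool" where
  "counterclockwise k \<gamma> \<longleftrightarrow> (\<forall>\<^sub>F t in at_right 0. \<exists>\<theta> :: nat \<Rightarrow> real.
     (\<forall>i<k. \<gamma> i t = (t * cos (\<theta> i), t * sin (\<theta> i))) \<and>
     (\<forall>i j. i < j \<and> j < k \<longrightarrow> \<theta> i < \<theta> j \<and> \<theta> j < \<theta> i + 2 * pi))"

text \<open>
  A triangulation of the germ of the plane: the triangles \<open>T i\<close>, with sides \<open>\<gamma> i\<close> and \<open>\<gamma> (i + 1)\<close>,
  cover a neighbourhood of the origin, and any two of them meet in a common face, i.e. in the
  vertex or in a common side (which forces \<open>k \<ge> 3\<close>).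
\<close>

definition holder_complex ::
    "(nat \<Rightarrow> real list set set) \<Rightarrow> nat \<Rightarrow> (nat \<Rightarrow> real) \<Rightarrow>
     (nat \<Rightarrow> real \<Rightarrow> real \<times> real) \<Rightarrow> (nat \<Rightarrow> (real \<times> real) set) \<Rightarrow> bool" where
  "holder_complex S k \<beta> \<gamma> T \<longleftrightarrow>
     (\<forall>i<k. holder_triangle S (T i) (\<gamma> i) (\<gamma> (Suc i mod k)) (\<beta> i)) \<and>
     germ_eq (\<Union>i<k. T i) UNIV \<and>
     (\<forall>i<k. \<forall>j<k. i \<noteq> j \<longrightarrow>
        germ_eq (T i \<inter> T j) {0} \<or>
        (\<exists>l \<in> {i, Suc i mod k} \<inter> {j, Suc j mod k}. germ_eq (T i \<inter> T j) (arc_image (\<gamma> l)))) \<and>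
     (counterclockwise k \<gamma> \<or> counterclockwise k (\<lambda>i. \<gamma> (k - 1 - i)))"


section \<open>Pizzas\<close>

text \<open>
  The directed segment \<open>Q\<close> of a slice is given by its initial and final points \<open>q0\<close> and \<open>q1\<close>.
  Only the values of \<open>slice_width\<close> on \<open>Q\<close> matter.
\<close>

record pizza_slice =
  slice_exponent :: real
  q0 :: ereal
  q1 :: ereal
  slice_sign :: int
  slice_width :: "ereal \<Rightarrow> ereal"

definition slice_segment :: "(nat \<Rightarrow> real list set set) \<Rightarrow> pizza_slice \<Rightarrow> ereal set" where
  "slice_segment S s = {q \<in> order_values S. min (q0 s) (q1 s) \<le> q \<and> q \<le> max (q0 s) (q1 s)}"

definition affine_width ::
    "(nat \<Rightarrow> real list set set) \<Rightarrow> ereal set \<Rightarrow> (ereal \<Rightarrow> ereal) \<Rightarrow> bool" where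
  "affine_width S Q \<mu> \<longleftrightarrow>
     (\<forall>q\<in>Q. \<mu> q \<in> insert \<infinity> (ereal ` exponent_field S)) \<and>
     (Q \<noteq> {\<infinity>} \<longrightarrow> (\<exists>c\<in>exponent_field S. \<exists>d\<in>exponent_field S.
        (\<forall>q. ereal q \<in> Q \<longrightarrow> \<mu> (ereal q) = ereal (c * q + d)) \<and>
        (\<infinity> \<in> Q \<longrightarrow> ((\<lambda>q. ereal (c * q + d)) \<longlongrightarrow> \<mu> \<infinity>) at_top)))"

definition abstract_holder_complex ::
    "(nat \<Rightarrow> real list set set) \<Rightarrow> real list \<Rightarrow> bool" where
  "abstract_holder_complex S \<beta>s \<longleftrightarrow>
     (\<forall>\<beta>\<in>set \<beta>s. \<beta> \<in> exponent_field S \<and> \<beta> \<ge> 1) \<and> 1 \<in> set \<beta>s"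

definition pizza :: "(nat \<Rightarrow> real list set set) \<Rightarrow> pizza_slice list \<Rightarrow> bool" where
  "pizza S H \<longleftrightarrow>
     abstract_holder_complex S (map slice_exponent H) \<and>
     (\<forall>i<length H. let s = H ! i; s' = H ! (Suc i mod length H) in
        q0 s \<in> order_values S \<and> q1 s \<in> order_values S \<and> q0 s' = q1 s \<and>
        slice_sign s \<in> {-1, 0, 1} \<and> (q1 s \<noteq> \<infinity> \<longrightarrow> slice_sign s = slice_sign s') \<and>
        affine_width S (slice_segment S s) (slice_width s) \<and>
        min (slice_width s (q0 s)) (slice_width s (q1 s)) = ereal (slice_exponent s))"

definition associated_pizza ::
    "(nat \<Rightarrow> real list set set) \<Rightarrow> pizza_slice list \<Rightarrow> (real \<times> real \<Rightarrow> real) \<Rightarrow> bool" where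
  "associated_pizza S H f \<longleftrightarrow> (\<exists>\<gamma> T.
     holder_complex S (length H) (\<lambda>i. slice_exponent (H ! i)) \<gamma> T \<and>
     (\<forall>i<length H. let s = H ! i in
        elementary S f (T i) \<and>
        slice_segment S s = Q_of S f (T i) \<and>
        q0 s = ord_along f (\<gamma> i) \<and> q1 s = ord_along f (\<gamma> (Suc i mod length H)) \<and>
        (\<forall>\<delta>. arc_in S \<delta> (T i) \<longrightarrow> relative_width S f (T i) \<delta> = slice_width s (ord_along f \<delta>)) \<and>
        (\<forall>\<^sub>F x in nhds 0. x \<in> interior (T i) \<longrightarrow> sgn (f x) = of_int (slice_sign s))))"

end

theory Submission
 imports Defs "HOL-Real_Asymp.Real_Asymp"
begin

text \<open>
 In the sector of opening \<open>\<pi>/2\<close> around a direction, arcs are given by their definable slopes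
 \<open>s\<close>; let \<open>g t s\<close> be the value of \<open>\<bar>f\<bar>\<close> at distance \<open>t\<close> and slope \<open>s\<close>.  Finitely many arcs cut
 the sector into pieces on which \<open>g t\<close> is constant or strictly monotone.  On an increasing piece, let
 \<open>\<sigma> t\<close> be the inverse of \<open>g t\<close> and \<open>D t u = \<sigma> t (2 * u) - \<sigma> t u\<close> the width of the dyadic band at level
 \<open>u\<close>.  The order \<open>m q\<close> of \<open>D t (t powr q)\<close> controls the relative width of the arcs on which \<open>f\<close> has
 order \<open>q\<close>.  The ratio \<open>D t (2 * u) / D t u\<close> is piecewise monotone in \<open>u\<close>, and by polynomial
 boundedness its breakpoints and level curves have only finitely many orders.  Away from these
 exceptional \<open>q\<close> the ratio stays on one side of each constant, and summing over dyadic bands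
 shows that \<open>m\<close> is affine there.  The arcs at the levels \<open>\<kappa> * t powr q\<close> with exceptional \<open>q\<close> and
 suitable \<open>\<kappa>\<close> thus cut the piece into slices.
\<close>

section \<open>A calculus of definable predicates\<close>

text \<open>Widths are measured by the difference \<open>D\<close> and not by a derivative, so
  continuity and monotonicity of definable functions suffice. The main obstacle lies at an
  exceptional q. There the order of D t (\<kappa> * t powr q) may depend on \<kappa>, but it takes
  finitely many values, each on a definable set of \<kappa>, so it is constant for all small
  \<kappa> and for all large \<kappa>. Letting \<kappa> be a small power of t identifies the two
  constants with the limits of the affine functions on the two sides of q. Hence each exceptional q
  contributes two levels, one with a small constant and one with a large constant. Between them f
  has order exactly q, and this strip becomes a slice of its own. Finiteness of the orders in a
  definable family rests on polynomial boundedness: an interval of exponents would make a function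
  growing like a logarithm definable. A second obstacle is that about log (1 / t) dyadic bands lie
  over an interval of exponents, so the width of a slice is not a finite sum. A loss of t powr -
  \<delta>, for every \<delta> > 0, absorbs the logarithm.\<close>

named_theorems dint

context ominimal_structure
begin

text \<open>
 Predicates are evaluated in environments \<open>e :: nat \<Rightarrow> real\<close>; variable \<open>0\<close> is the innermost bound
 one, so going under a quantifier shifts the environment by \<open>Suc\<close>.
\<close>

definition dpred :: "((nat \<Rightarrow> real) \<Rightarrow> bool) \<Rightarrow> bool" where
 "dpred P \<longleftrightarrow> (\<exists>n. \<exists>A\<in>S n. \<forall>e. P e \<longleftrightarrow> map e [0..<n] \<in> A)"

definition dterm :: "((nat \<Rightarrow> real) \<Rightarrow> real) \<Rightarrow> bool" where
 "dterm t \<longleftrightarrow> dpred (\<lambda>e. e 0 = t (\<lambda>i. e (Suc i)))"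

lemma inter: "A \<in> S n \<Longrightarrow> B \<in> S n \<Longrightarrow> A \<inter> B \<in> S n"
proof -
 assume a: "A \<in> S n" "B \<in> S n"
 have "{xs. length xs = n} - (({xs. length xs = n} - A) \<union> ({xs. length xs = n} - B)) \<in> S n"
  using a by (intro complement union)
 also have "{xs. length xs = n} - (({xs. length xs = n} - A) \<union> ({xs. length xs = n} - B)) = A \<inter> B"
  using carrier[OF a(1)] carrier[OF a(2)] by auto
 finally show ?thesis .
qed

lemma prod_left: "A \<in> S n \<Longrightarrow> {xs @ ys | xs ys. length xs = m \<and> ys \<in> A} \<in> S (m + n)"
proof (induction m)
 case 0
 then show ?case by simp
next
 case (Suc m)
 have "{x # zs | x zs. zs \<in> {xs @ ys | xs ys. length xs = m \<and> ys \<in> A}} \<in> S (Suc (m + n))"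
  using Suc by (intro product_left) auto
 also have "{x # zs | x zs. zs \<in> {xs @ ys | xs ys. length xs = m \<and> ys \<in> A}} =
   {xs @ ys | xs ys. length xs = Suc m \<and> ys \<in> A}"
  by (force simp: length_Suc_conv intro: exI[of _ "_ # _"])
 finally show ?case by simp
qed

lemma proj_many: "A \<in> S (n + m) \<Longrightarrow> {xs. length xs = n \<and> (\<exists>ys. length ys = m \<and> xs @ ys \<in> A)} \<in> S n"
proof (induction m arbitrary: A)
 case 0
 then have "{xs. length xs = n \<and> (\<exists>ys. length ys = 0 \<and> xs @ ys \<in> A)} = A" using carrier[of A n] by auto
 with 0 show ?case by simp
next
 case (Suc m)
 have "butlast ` A \<in> S (n + m)" using Suc.prems by (intro projection) simp
 from Suc.IH[OF this]
 have *: "{xs. length xs = n \<and> (\<exists>ys. length ys = m \<and> xs @ ys \<in> butlast ` A)} \<in> S n" .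
 have "(\<exists>ys. length ys = m \<and> xs @ ys \<in> butlast ` A) \<longleftrightarrow> (\<exists>ys. length ys = Suc m \<and> xs @ ys \<in> A)"
  if "length xs = n" for xs
 proof
  assume "\<exists>ys. length ys = m \<and> xs @ ys \<in> butlast ` A"
  then obtain ys zs where h: "length ys = m" "zs \<in> A" "xs @ ys = butlast zs" by auto
  have "length zs = n + Suc m" using carrier[OF Suc.prems] h by auto
  then have "zs = xs @ (ys @ [last zs])"
   using h(3) by (metis append.assoc append_butlast_last_id add_Suc_right length_0_conv nat.distinct(1))
  then show "\<exists>ys. length ys = Suc m \<and> xs @ ys \<in> A" using h by (intro exI[of _ "ys @ [last zs]"]) auto
 next
  assume "\<exists>ys. length ys = Suc m \<and> xs @ ys \<in> A"
  then obtain ys where h: "length ys = Suc m" "xs @ ys \<in> A" by auto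
  then have "butlast (xs @ ys) = xs @ butlast ys" by (auto simp: butlast_append)
  then show "\<exists>ys. length ys = m \<and> xs @ ys \<in> butlast ` A"
   using h by (intro exI[of _ "butlast ys"]) (auto intro: rev_image_eqI)
 qed
 then have "{xs. length xs = n \<and> (\<exists>ys. length ys = m \<and> xs @ ys \<in> butlast ` A)} =
   {xs. length xs = n \<and> (\<exists>ys. length ys = Suc m \<and> xs @ ys \<in> A)}" by auto
 with * show ?case by simp
qed

text \<open>Renaming, permuting and duplicating variables is a projection: append m coordinates
  constrained to \<open>A\<close>, tie each of them by a diagonal to the coordinate it copies, and
  project the copies away.\<close>

lemma reindex:
 assumes A: "A \<in> S m" and g: "\<And>j. j < m \<Longrightarrow> g j < n"
 shows "{xs. length xs = n \<and> map (\<lambda>j. xs ! g j) [0..<m] \<in> A} \<in> S n"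
proof -
 define B where "B = {xs @ ys | xs ys. length xs = n \<and> ys \<in> A}"
 have B: "B \<in> S (n + m)" unfolding B_def by (rule prod_left[OF A])
 define C where "C l = B \<inter> {zs. length zs = n + m \<and> (\<forall>j<l. zs ! (n + j) = zs ! g j)}" for l
 have C: "l \<le> m \<Longrightarrow> C l \<in> S (n + m)" for l
 proof (induction l)
  case 0
  then show ?case using carrier[OF B] B by (simp add: C_def Int_absorb2)
 next
  case (Suc l)
  have "C (Suc l) = C l \<inter> {zs. length zs = n + m \<and> zs ! (n + l) = zs ! g l}"
   by (auto simp: C_def less_Suc_eq)
  moreover have "{zs. length zs = n + m \<and> zs ! (n + l) = zs ! g l} \<in> S (n + m)"
   using Suc.prems g[of l] by (intro diagonal) auto
  ultimately show ?case using Suc by (simp add: inter)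
 qed
 have "{xs. length xs = n \<and> (\<exists>ys. length ys = m \<and> xs @ ys \<in> C m)} \<in> S n" by (intro proj_many C) simp
 moreover have "(\<exists>ys. length ys = m \<and> xs @ ys \<in> C m) \<longleftrightarrow> map (\<lambda>j. xs ! g j) [0..<m] \<in> A"
  if "length xs = n" for xs
 proof
  assume "\<exists>ys. length ys = m \<and> xs @ ys \<in> C m"
  then obtain ys where h: "length ys = m" "xs @ ys \<in> B" "\<forall>j<m. (xs @ ys) ! (n + j) = (xs @ ys) ! g j"
   by (auto simp: C_def)
  have "map (\<lambda>j. xs ! g j) [0..<m] = ys"
   using h(1,3) that g by (intro nth_equalityI) (auto simp: nth_append)
  moreover have "ys \<in> A" using h(2) that by (auto simp: B_def)
  ultimately show "map (\<lambda>j. xs ! g j) [0..<m] \<in> A" by simp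
 next
  assume a: "map (\<lambda>j. xs ! g j) [0..<m] \<in> A"
  then show "\<exists>ys. length ys = m \<and> xs @ ys \<in> C m"
   using that g by (intro exI[of _ "map (\<lambda>j. xs ! g j) [0..<m]"]) (auto simp: C_def B_def nth_append)
 qed
 ultimately show ?thesis by (simp cong: conj_cong)
qed

lemma dpred_base:
 assumes "A \<in> S m" shows "dpred (\<lambda>e. map (\<lambda>j. e (g j)) [0..<m] \<in> A)"
proof -
 define n where "n = Suc (Max (insert 0 (g ` {..<m})))"
 have g: "g j < n" if "j < m" for j using that unfolding n_def by (intro le_imp_less_Suc Max_ge) auto
 have "map (\<lambda>j. e (g j)) [0..<m] \<in> A \<longleftrightarrow>
   map e [0..<n] \<in> {xs. length xs = n \<and> map (\<lambda>j. xs ! g j) [0..<m] \<in> A}" for e :: "nat \<Rightarrow> real"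
 proof -
  have "map (\<lambda>j. e (g j)) [0..<m] = map (\<lambda>j. map e [0..<n] ! g j) [0..<m]" using g by auto
  then show ?thesis by (simp only: mem_Collect_eq length_map length_upt) simp
 qed
 then show ?thesis unfolding dpred_def by (intro exI[of _ n] bexI[OF _ reindex[OF assms g]] allI) auto
qed

lemma dpred_reindex: "dpred P \<Longrightarrow> dpred (\<lambda>e. P (\<lambda>i. e (g i)))"
proof -
 assume "dpred P"
 then obtain n A where "A \<in> S n" "\<And>e. P e \<longleftrightarrow> map e [0..<n] \<in> A" unfolding dpred_def by auto
 then show ?thesis using dpred_base[of A n g] by simp
qed

lemma dpred_common:
 assumes "dpred P" "n \<le> m" "\<And>e. P e \<longleftrightarrow> map e [0..<n] \<in> A" "A \<in> S n"
 shows "\<exists>B\<in>S m. \<forall>e. P e \<longleftrightarrow> map e [0..<m] \<in> B"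
proof -
 define B where "B = {xs. length xs = m \<and> map (\<lambda>j. xs ! j) [0..<n] \<in> A}"
 have "B \<in> S m" unfolding B_def using assms(2) by (intro reindex[OF assms(4)]) simp
 moreover have "P e \<longleftrightarrow> map e [0..<m] \<in> B" for e
 proof -
  have "map (\<lambda>j. map e [0..<m] ! j) [0..<n] = map e [0..<n]"
   using assms(2) by (intro nth_equalityI) simp_all
  then show ?thesis by (simp only: B_def assms(3) mem_Collect_eq length_map length_upt) simp
 qed
 ultimately show ?thesis by (intro bexI[of _ B]) simp_all
qed

lemma dpred_obtain2:
 assumes "dpred P" "dpred Q"
 obtains n A B where "A \<in> S n" "B \<in> S n" "\<And>e. P e \<longleftrightarrow> map e [0..<n] \<in> A" "\<And>e. Q e \<longleftrightarrow> map e [0..<n] \<in> B"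
proof -
 obtain n A m B where a: "A \<in> S n" "\<And>e. P e \<longleftrightarrow> map e [0..<n] \<in> A"
  and b: "B \<in> S m" "\<And>e. Q e \<longleftrightarrow> map e [0..<m] \<in> B" using assms unfolding dpred_def by meson
 obtain A' where "A' \<in> S (max n m)" "\<And>e. P e \<longleftrightarrow> map e [0..<max n m] \<in> A'"
  using dpred_common[OF assms(1) _ a(2,1), of "max n m"] by auto
 moreover obtain B' where "B' \<in> S (max n m)" "\<And>e. Q e \<longleftrightarrow> map e [0..<max n m] \<in> B'"
  using dpred_common[OF assms(2) _ b(2,1), of "max n m"] by auto
 ultimately show ?thesis by (intro that)
qed

lemma dpred_not [dint]: "dpred P \<Longrightarrow> dpred (\<lambda>e. \<not> P e)"
proof -
 assume "dpred P"
 then obtain n A where A: "A \<in> S n" "\<And>e. P e \<longleftrightarrow> map e [0..<n] \<in> A" unfolding dpred_def by auto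
 show ?thesis unfolding dpred_def using complement[OF A(1)] A(2)
  by (intro exI[of _ n] bexI[of _ "{xs. length xs = n} - A"]) auto
qed

lemma dpred_disj [dint]: "dpred P \<Longrightarrow> dpred Q \<Longrightarrow> dpred (\<lambda>e. P e \<or> Q e)"
proof (erule dpred_obtain2, assumption)
 fix n A B
 assume "A \<in> S n" "B \<in> S n" "\<And>e. P e \<longleftrightarrow> map e [0..<n] \<in> A" "\<And>e. Q e \<longleftrightarrow> map e [0..<n] \<in> B"
 then show "dpred (\<lambda>e. P e \<or> Q e)"
  unfolding dpred_def by (intro exI[of _ n] bexI[OF _ union[of A n B]]) simp_all
qed

lemma dpred_conj [dint]: "dpred P \<Longrightarrow> dpred Q \<Longrightarrow> dpred (\<lambda>e. P e \<and> Q e)"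
 using dpred_not[OF dpred_disj[OF dpred_not dpred_not]] by simp

lemma dpred_imp [dint]: "dpred P \<Longrightarrow> dpred Q \<Longrightarrow> dpred (\<lambda>e. P e \<longrightarrow> Q e)"
 unfolding imp_conv_disj by (intro dint)

lemma dpred_ex [dint]:
 assumes "dpred (\<lambda>e. P (\<lambda>i. e (Suc i)) (e 0))" shows "dpred (\<lambda>e. \<exists>y. P e y)"
proof -
 obtain n A where A: "A \<in> S n" "\<And>e. P (\<lambda>i. e (Suc i)) (e 0) \<longleftrightarrow> map e [0..<n] \<in> A"
  using assms unfolding dpred_def by auto
 obtain B where B: "B \<in> S (Suc n)" "\<And>e. P (\<lambda>i. e (Suc i)) (e 0) \<longleftrightarrow> map e [0..<Suc n] \<in> B"
  using dpred_common[OF assms, of n "Suc n", OF _ A(2) A(1)] by auto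
 \<comment> \<open>\<open>projection\<close> forgets the last coordinate, while the bound variable
   sits in slot 0; \<open>g\<close> moves that slot to the end.\<close>
 define g where "g = (\<lambda>j. if j = 0 then n else j - 1)"
 define C where "C = {xs. length xs = Suc n \<and> map (\<lambda>j. xs ! g j) [0..<Suc n] \<in> B}"
 have "C \<in> S (Suc n)" unfolding C_def by (rule reindex[OF B(1)]) (auto simp: g_def)
 then have "butlast ` C \<in> S n" by (rule projection)
 moreover have "(\<exists>y. P e y) \<longleftrightarrow> map e [0..<n] \<in> butlast ` C" for e
 proof -
  have *: "map (case_nat y e) [0..<Suc n] = map (\<lambda>j. (map e [0..<n] @ [y]) ! g j) [0..<Suc n]" for y
   by (intro nth_equalityI) (auto simp: g_def nth_append nth_Cons' simp del: upt_Suc split: nat.splits)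
  have "P e y \<longleftrightarrow> map e [0..<n] @ [y] \<in> C" for y
   using B(2)[of "case_nat y e"] unfolding C_def * by (simp del: upt_Suc)
  moreover have "(\<exists>y. map e [0..<n] @ [y] \<in> C) \<longleftrightarrow> map e [0..<n] \<in> butlast ` C"
  proof
   assume "map e [0..<n] \<in> butlast ` C"
   then obtain zs where "zs \<in> C" "map e [0..<n] = butlast zs" by auto
   moreover from this have "zs \<noteq> []" by (auto simp: C_def)
   ultimately show "\<exists>y. map e [0..<n] @ [y] \<in> C" by (metis append_butlast_last_id)
  next
   assume "\<exists>y. map e [0..<n] @ [y] \<in> C"
   then obtain y where "map e [0..<n] @ [y] \<in> C" by blast
   then show "map e [0..<n] \<in> butlast ` C" by (rule rev_image_eqI) simp
  qed
  ultimately show ?thesis by simp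
 qed
 ultimately show ?thesis unfolding dpred_def by (intro exI[of _ n] bexI[of _ "butlast ` C"] allI) auto
qed

lemma dpred_all [dint]:
 assumes "dpred (\<lambda>e. P (\<lambda>i. e (Suc i)) (e 0))" shows "dpred (\<lambda>e. \<forall>y. P e y)"
 using dpred_not[OF dpred_ex[of "\<lambda>e y. \<not> P e y"]] dpred_not[OF assms] by simp

lemma dpred_eq_var: "dpred (\<lambda>e. e i = e j)"
 using dpred_base[OF diagonal[of 0 2 1], of "\<lambda>l. if l = 0 then i else j"]
 by (simp add: upt_rec numeral_2_eq_2)

lemma dpred_less_var: "dpred (\<lambda>e. e i < e j)"
 using dpred_base[OF order, of "\<lambda>l. if l = 0 then i else j"] by (simp add: upt_rec numeral_2_eq_2)

lemma dpred_add_var: "dpred (\<lambda>e. e k = e i + e j)"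
 using dpred_base[OF addition, of "\<lambda>l. if l = 0 then i else if l = 1 then j else k"]
 by (simp add: upt_rec numeral_3_eq_3)

lemma dpred_mult_var: "dpred (\<lambda>e. e k = e i * e j)"
 using dpred_base[OF multiplication, of "\<lambda>l. if l = 0 then i else if l = 1 then j else k"]
 by (simp add: upt_rec numeral_3_eq_3)

lemma dterm_const [dint]: "dterm (\<lambda>e. c)"
 unfolding dterm_def using dpred_base[OF singleton[of c], of "\<lambda>l. 0"] by simp

lemma dterm_var [dint]: "dterm (\<lambda>e. e i)"
 unfolding dterm_def using dpred_eq_var by simp

lemma dterm_shift: "dterm t \<Longrightarrow> dterm (\<lambda>e. t (\<lambda>i. e (g i)))"
 unfolding dterm_def using dpred_reindex[of _ "\<lambda>i. if i = 0 then 0 else Suc (g (i - 1))"] by fastforce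

lemma dpred_subst1:
 assumes "dterm t" "dpred (\<lambda>e. P (\<lambda>i. e (Suc i)) (e 0))" shows "dpred (\<lambda>e. P e (t e))"
proof -
 have "dpred (\<lambda>e. \<exists>y. y = t e \<and> P e y)" using assms unfolding dterm_def by (intro dint)
 then show ?thesis by simp
qed

lemma dpred_substn:
 assumes "dpred P" "\<And>i. dterm (\<tau> i)" shows "dpred (\<lambda>e. P (\<lambda>i. if i < n then \<tau> i e else e (i - n)))"
 using assms(2)
proof (induction n arbitrary: \<tau>)
 case 0
 then show ?case using assms(1) by simp
next
 case (Suc n)
 have "dpred (\<lambda>e. P (\<lambda>i. if i < n then \<tau> i (\<lambda>i. e (Suc i)) else e (i - n)))"
  by (rule Suc.IH) (rule dterm_shift[OF Suc.prems])
 then have *: "dpred (\<lambda>e. P (\<lambda>i. if i < n then \<tau> i (\<lambda>i. e (Suc i)) else if i = n then e 0 else e (Suc (i - Suc n))))"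
  by (rule back_subst[of dpred]) (intro ext arg_cong[of _ _ P], auto simp: Suc_diff_Suc)
 have "dpred (\<lambda>e. P (\<lambda>i. if i < n then \<tau> i e else if i = n then \<tau> n e else e (i - Suc n)))"
  by (rule dpred_subst1[OF Suc.prems[of n] *]) then show ?case
  by (rule back_subst[of dpred]) (intro ext arg_cong[of _ _ P], auto simp: less_Suc_eq)
qed

text \<open>A definable predicate reads only the first n slots for some n, so substituting into
  those, one slot at a time, is already the full substitution.\<close>

lemma dpred_subst:
 assumes "dpred P" "\<And>i. dterm (\<tau> i)" shows "dpred (\<lambda>e. P (\<lambda>i. \<tau> i e))"
proof -
 obtain n A where A: "A \<in> S n" "\<And>e. P e \<longleftrightarrow> map e [0..<n] \<in> A" using assms unfolding dpred_def by auto
 have "P (\<lambda>i. if i < n then \<tau> i e else e (i - n)) \<longleftrightarrow> P (\<lambda>i. \<tau> i e)" for e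
  unfolding A(2) by (intro arg_cong[of _ _ "\<lambda>xs. xs \<in> A"]) auto
 then show ?thesis using dpred_substn[of P \<tau> n, OF assms] by (simp only:)
qed

lemma dterm_subst:
 assumes "dterm t" "\<And>i. dterm (\<tau> i)" shows "dterm (\<lambda>e. t (\<lambda>i. \<tau> i e))"
proof -
 have "dterm (case i of 0 \<Rightarrow> (\<lambda>e. e 0) | Suc i \<Rightarrow> \<lambda>e. \<tau> i (\<lambda>i. e (Suc i)))" for i
  using dterm_var[of 0] dterm_shift[OF assms(2), of _ Suc] by (cases i) simp_all
 from dpred_subst[OF assms(1)[unfolded dterm_def],
   of "\<lambda>i. case i of 0 \<Rightarrow> (\<lambda>e. e 0) | Suc i \<Rightarrow> \<lambda>e. \<tau> i (\<lambda>i. e (Suc i))", OF this]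
 show ?thesis unfolding dterm_def by simp
qed

lemma dpred2: 
 assumes "dpred (\<lambda>e. P (e 0) (e 1))" "dterm a" "dterm b" shows "dpred (\<lambda>e. P (a e) (b e))"
 using dpred_subst[OF assms(1), of "\<lambda>i. if i = 0 then a else b"] assms(2,3) by simp

lemma dpred3: 
 assumes "dpred (\<lambda>e. P (e 0) (e 1) (e 2))" "dterm a" "dterm b" "dterm c"
 shows "dpred (\<lambda>e. P (a e) (b e) (c e))"
 using dpred_subst[OF assms(1), of "\<lambda>i. if i = 0 then a else if i = 1 then b else c"] assms(2-) by simp

lemma dpred_eq [dint]: "dterm a \<Longrightarrow> dterm b \<Longrightarrow> dpred (\<lambda>e. a e = b e)"
 by (rule dpred2) (rule dpred_eq_var)

lemma dpred_less [dint]: "dterm a \<Longrightarrow> dterm b \<Longrightarrow> dpred (\<lambda>e. a e < b e)"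
 by (rule dpred2) (rule dpred_less_var)

lemma dpred_le [dint]: "dterm a \<Longrightarrow> dterm b \<Longrightarrow> dpred (\<lambda>e. a e \<le> b e)"
 unfolding le_less by (intro dint)

lemma dpred_ex1 [dint]:
 assumes "dpred (\<lambda>e. P (\<lambda>i. e (Suc i)) (e 0))" shows "dpred (\<lambda>e. \<exists>!y. P e y)"
proof -
 have "dpred (\<lambda>e. P (\<lambda>i. e (Suc (Suc i))) (e 0))"
  using dpred_reindex[OF assms(1), of "\<lambda>i. if i = 0 then 0 else Suc i"] by simp then show ?thesis
  unfolding Ex1_def by (intro dint assms(1))
qed

lemma dtermI:
 assumes "dpred (\<lambda>e. Q (\<lambda>i. e (Suc i)) (e 0))" "\<And>e y. Q e y \<longleftrightarrow> y = t e" shows "dterm t"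
 using assms unfolding dterm_def by simp

lemma dterm_add [dint]: "dterm a \<Longrightarrow> dterm b \<Longrightarrow> dterm (\<lambda>e. a e + b e)"
proof -
 assume a: "dterm a" "dterm b"
 have "dterm (\<lambda>e. e 0 + e 1)" unfolding dterm_def using dpred_add_var by simp
 from dterm_subst[OF this, of "\<lambda>i. if i = 0 then a else b"] a show ?thesis by simp
qed

lemma dterm_mult [dint]: "dterm a \<Longrightarrow> dterm b \<Longrightarrow> dterm (\<lambda>e. a e * b e)"
proof -
 assume a: "dterm a" "dterm b"
 have "dterm (\<lambda>e. e 0 * e 1)" unfolding dterm_def using dpred_mult_var by simp
 from dterm_subst[OF this, of "\<lambda>i. if i = 0 then a else b"] a show ?thesis by simp
qed

lemma dterm_uminus [dint]: "dterm a \<Longrightarrow> dterm (\<lambda>e. - a e)"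
 using dterm_mult[OF dterm_const[of "-1"]] by fastforce

lemma dterm_diff [dint]: "dterm a \<Longrightarrow> dterm b \<Longrightarrow> dterm (\<lambda>e. a e - b e)"
 unfolding diff_conv_add_uminus by (intro dint)

lemma dterm_if [dint]: "dpred P \<Longrightarrow> dterm a \<Longrightarrow> dterm b \<Longrightarrow> dterm (\<lambda>e. if P e then a e else b e)"
proof -
 assume a: "dpred P" "dterm a" "dterm b"
 have "dpred (\<lambda>e. P (\<lambda>i. e (Suc i)) \<and> e 0 = a (\<lambda>i. e (Suc i)) \<or> \<not> P (\<lambda>i. e (Suc i)) \<and> e 0 = b (\<lambda>i. e (Suc i)))"
  by (intro dint dpred_reindex[OF a(1), of Suc] a(2,3)[THEN dterm_shift, of Suc])
 then show ?thesis by (rule dtermI) auto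
qed

lemma dterm_abs [dint]: "dterm a \<Longrightarrow> dterm (\<lambda>e. \<bar>a e\<bar>)"
 unfolding abs_if by (intro dint)

lemma dterm_min [dint]: "dterm a \<Longrightarrow> dterm b \<Longrightarrow> dterm (\<lambda>e. min (a e) (b e))"
 unfolding min_def by (intro dint)

lemma dterm_max [dint]: "dterm a \<Longrightarrow> dterm b \<Longrightarrow> dterm (\<lambda>e. max (a e) (b e))"
 unfolding max_def by (intro dint)

lemma dterm_inverse [dint]: "dterm a \<Longrightarrow> dterm (\<lambda>e. inverse (a e))"
proof -
 assume a: "dterm a"
 have "dpred (\<lambda>e. a (\<lambda>i. e (Suc i)) = 0 \<and> e 0 = 0 \<or> a (\<lambda>i. e (Suc i)) * e 0 = 1)"
  by (intro dint a[THEN dterm_shift, of Suc]) then show ?thesis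
 proof (rule dtermI)
  fix e y
  show "a e = 0 \<and> y = 0 \<or> a e * y = 1 \<longleftrightarrow> y = inverse (a e)"
   by (metis inverse_unique inverse_zero mult_zero_left right_inverse zero_neq_one)
 qed
qed

lemma dterm_divide [dint]: "dterm a \<Longrightarrow> dterm b \<Longrightarrow> dterm (\<lambda>e. a e / b e)"
 unfolding divide_inverse by (intro dint)

lemma dterm_power [dint]: "dterm a \<Longrightarrow> dterm (\<lambda>e. a e ^ n)"
 by (induction n) (auto intro: dint)

lemma dterm_sqrt [dint]: "dterm a \<Longrightarrow> dterm (\<lambda>e. sqrt (a e))"
proof -
 assume a: "dterm a"
 \<comment> \<open>\<open>sqrt\<close> is an odd function here, with negative values at negative
   arguments; hence the second clause.\<close>
 have "dpred (\<lambda>e. (a (\<lambda>i. e (Suc i)) \<ge> 0 \<and> e 0 \<ge> 0 \<and> e 0 * e 0 = a (\<lambda>i. e (Suc i))) \<or>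
   (a (\<lambda>i. e (Suc i)) < 0 \<and> e 0 < 0 \<and> e 0 * e 0 = - a (\<lambda>i. e (Suc i))))"
  by (intro dint a[THEN dterm_shift, of Suc]) then show ?thesis
 proof (rule dtermI, safe)
  fix e y
  show "a e \<ge> 0 \<Longrightarrow> y \<ge> 0 \<Longrightarrow> y * y = a e \<Longrightarrow> y = sqrt (a e)"
   by (metis abs_of_nonneg real_sqrt_mult_self real_sqrt_abs2)
  assume "a e < 0" "y < 0" "y * y = - a e"
  then have "- a e = (- y)\<^sup>2" "- y \<ge> 0" by (auto simp: power2_eq_square)
  then have "sqrt (- a e) = - y" using real_sqrt_unique by metis
  then show "y = sqrt (a e)" by (simp add: real_sqrt_minus)
 qed (auto simp: real_sqrt_minus not_le intro: real_sqrt_ge_0_iff)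
qed

end

text \<open>The default 0 makes the description total with a definable graph, whereas the value of
  \<open>THE\<close> without unique existence is unspecified.\<close>

definition the0 :: "(real \<Rightarrow> bool) \<Rightarrow> real" where
 "the0 P = (if \<exists>!y. P y then THE y. P y else 0)"

lemma the0_eq: "P y \<Longrightarrow> (\<And>z. P z \<Longrightarrow> z = y) \<Longrightarrow> the0 P = y"
using the_equality by (metis the0_def)

context ominimal_structure
begin

lemma dterm_the0 [dint]:
 assumes "dpred (\<lambda>e. Q (\<lambda>i. e (Suc i)) (e 0))" shows "dterm (\<lambda>e. the0 (Q e))"
proof -
 have "dpred (\<lambda>e. \<exists>!y. Q e y)" using assms by (rule dpred_ex1)
 then have "dpred (\<lambda>e. (\<exists>!y. Q (\<lambda>i. e (Suc i)) y) \<and> Q (\<lambda>i. e (Suc i)) (e 0) \<or> \<not> (\<exists>!y. Q (\<lambda>i. e (Suc i)) y) \<and> e 0 = 0)"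
  by (intro dint assms dpred_reindex[OF \<open>dpred (\<lambda>e. \<exists>!y. Q e y)\<close>, of Suc]) then show ?thesis
 proof (rule dtermI)
  fix e y
  show "(\<exists>!y. Q e y) \<and> Q e y \<or> \<not> (\<exists>!y. Q e y) \<and> y = 0 \<longleftrightarrow> y = the0 (Q e)"
  proof (cases "\<exists>!y. Q e y")
   case True
   then show ?thesis using theI'[OF True] the1_equality[OF True, of y] by (auto simp: the0_def)
  qed (simp add: the0_def)
 qed
qed

end

section \<open>Definable subsets of the line: finite frontiers, dichotomies, continuity\<close>

context ominimal_structure
begin

definition drel1 :: "(real \<Rightarrow> bool) \<Rightarrow> bool" where "drel1 A \<longleftrightarrow> dpred (\<lambda>e. A (e 0))"
definition drel2 :: "(real \<Rightarrow> real \<Rightarrow> bool) \<Rightarrow> bool" where "drel2 A \<longleftrightarrow> dpred (\<lambda>e. A (e 0) (e 1))"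
definition drel3 :: "(real \<Rightarrow> real \<Rightarrow> real \<Rightarrow> bool) \<Rightarrow> bool" where "drel3 A \<longleftrightarrow> dpred (\<lambda>e. A (e 0) (e 1) (e 2))"
definition dfun1 :: "(real \<Rightarrow> real) \<Rightarrow> bool" where "dfun1 f \<longleftrightarrow> dterm (\<lambda>e. f (e 0))"
definition dfun2 :: "(real \<Rightarrow> real \<Rightarrow> real) \<Rightarrow> bool" where "dfun2 f \<longleftrightarrow> dterm (\<lambda>e. f (e 0) (e 1))"

lemma drel2_app: "drel2 A \<Longrightarrow> dterm a \<Longrightarrow> dterm b \<Longrightarrow> dpred (\<lambda>e. A (a e) (b e))"
 unfolding drel2_def by (rule dpred2)

lemma drel3_app: "drel3 A \<Longrightarrow> dterm a \<Longrightarrow> dterm b \<Longrightarrow> dterm c \<Longrightarrow> dpred (\<lambda>e. A (a e) (b e) (c e))"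
 unfolding drel3_def by (rule dpred3)

lemma dfun1_app: "dfun1 f \<Longrightarrow> dterm a \<Longrightarrow> dterm (\<lambda>e. f (a e))"
 unfolding dfun1_def using dterm_subst[of "\<lambda>e. f (e 0)" "\<lambda>i. a"] by simp

lemma dfun2_app:
 assumes "dfun2 f" "dterm a" "dterm b" shows "dterm (\<lambda>e. f (a e) (b e))"
 using dterm_subst[OF assms(1)[unfolded dfun2_def], of "\<lambda>i. if i = 0 then a else b"] assms(2,3) by simp

text \<open>The set representing \<open>P\<close> may have further coordinates; as \<open>P\<close>
  does not see them, they can be projected away.\<close>

lemma dpred_S:
 assumes "dpred P" "\<And>e e'. (\<forall>i<n. e i = e' i) \<Longrightarrow> P e \<longleftrightarrow> P e'"
 shows "{xs. length xs = n \<and> P (\<lambda>i. xs ! i)} \<in> S n"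
proof -
 obtain k B where B: "B \<in> S k" "\<And>e. P e \<longleftrightarrow> map e [0..<k] \<in> B" using assms(1) unfolding dpred_def by auto
 from dpred_common[OF assms(1) _ B(2,1), of "n + k"]
 obtain C where C: "C \<in> S (n + k)" "\<And>e. P e \<longleftrightarrow> map e [0..<n + k] \<in> C" by auto
 have "P (\<lambda>i. xs ! i) \<longleftrightarrow> (\<exists>ys. length ys = k \<and> xs @ ys \<in> C)" if "length xs = n" for xs
 proof -
  have "P (\<lambda>i. xs ! i) \<longleftrightarrow> xs @ ys \<in> C" if "length ys = k" for ys
  proof -
   have "map (\<lambda>i. (xs @ ys) ! i) [0..<n + k] = xs @ ys"
    using that \<open>length xs = n\<close> by (intro nth_equalityI) (simp_all del: upt_Suc)
   moreover have "P (\<lambda>i. xs ! i) \<longleftrightarrow> P (\<lambda>i. (xs @ ys) ! i)"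
    using \<open>length xs = n\<close> by (intro assms(2)) (simp add: nth_append)
   ultimately show ?thesis using C(2)[of "\<lambda>i. (xs @ ys) ! i"] by simp
  qed
  moreover have "length (replicate k (0::real)) = k" by simp
  ultimately show ?thesis by blast
 qed
 then have "{xs. length xs = n \<and> P (\<lambda>i. xs ! i)} = {xs. length xs = n \<and> (\<exists>ys. length ys = k \<and> xs @ ys \<in> C)}"
  by (intro Collect_cong conj_cong refl)
 then show ?thesis using proj_many[OF C(1)] by simp
qed

lemma length1: "length xs = 1 \<longleftrightarrow> (\<exists>x. xs = [x])"
 by (auto simp: length_Suc_conv)

lemma length2: "length xs = 2 \<longleftrightarrow> (\<exists>x y. xs = [x, y])"
 by (auto simp: length_Suc_conv numeral_2_eq_2)

lemma length3: "length xs = 3 \<longleftrightarrow> (\<exists>x y z. xs = [x, y, z])"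
 by (auto simp: length_Suc_conv numeral_3_eq_3)

lemma drel1_S: "drel1 A \<longleftrightarrow> {[x] | x. A x} \<in> S 1"
proof
 assume "{[x] | x. A x} \<in> S 1"
 from dpred_base[OF this, of "\<lambda>i. 0"] show "drel1 A" unfolding drel1_def by simp
next
 assume "drel1 A"
 then have "{xs. length xs = 1 \<and> A (xs ! 0)} \<in> S 1" unfolding drel1_def by (rule dpred_S) simp
 also have "{xs. length xs = 1 \<and> A (xs ! 0)} = {[x] | x. A x}" unfolding length1 by auto
 finally show "{[x] | x. A x} \<in> S 1" .
qed

lemma drel2_S: "drel2 A \<longleftrightarrow> {[x, y] | x y. A x y} \<in> S 2"
proof
 assume "{[x, y] | x y. A x y} \<in> S 2"
 from dpred_base[OF this, of "\<lambda>i. i"] show "drel2 A" unfolding drel2_def by (simp add: upt_rec numeral_2_eq_2)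
next
 assume "drel2 A"
 then have "{xs. length xs = 2 \<and> A (xs ! 0) (xs ! 1)} \<in> S 2" unfolding drel2_def by (rule dpred_S) simp
 also have "{xs. length xs = 2 \<and> A (xs ! 0) (xs ! 1)} = {[x, y] | x y. A x y}" unfolding length2 by auto
 finally show "{[x, y] | x y. A x y} \<in> S 2" .
qed

lemma drel3_S: "drel3 A \<longleftrightarrow> {[x, y, z] | x y z. A x y z} \<in> S 3"
proof
 assume "{[x, y, z] | x y z. A x y z} \<in> S 3"
 from dpred_base[OF this, of "\<lambda>i. i"] show "drel3 A" unfolding drel3_def by (simp add: upt_rec numeral_3_eq_3 numeral_2_eq_2)
next
 assume "drel3 A"
 then have "{xs. length xs = 3 \<and> A (xs ! 0) (xs ! 1) (xs ! 2)} \<in> S 3"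
  unfolding drel3_def by (rule dpred_S) simp
 also have "{xs. length xs = 3 \<and> A (xs ! 0) (xs ! 1) (xs ! 2)} = {[x, y, z] | x y z. A x y z}" unfolding length3 by auto
 finally show "{[x, y, z] | x y z. A x y z} \<in> S 3" .
qed

text \<open>An interval has at most two frontier points, since none lies strictly between two
  others. Everything below draws on o-minimality through this finiteness.\<close>

lemma finite_frontier:
 assumes "drel1 A" shows "finite (frontier {x. A x})"
proof -
 have "{[x] | x. A x} \<in> S 1" using assms by (simp add: drel1_S)
 from ominimal[OF this] obtain I where I: "finite I" "\<And>J. J \<in> I \<Longrightarrow> is_interval J" "{x. A x} = \<Union>I" by auto
 have "finite (frontier J)" if "is_interval J" for J :: "real set"
 proof -
  have between: "\<not> (x < w \<and> w < y)" if fr: "x \<in> frontier J" "w \<in> frontier J" "y \<in> frontier J" for x w y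
  proof
   assume xwy: "x < w \<and> w < y"
   obtain p where p: "p \<in> J" "dist p x < w - x"
    using fr(1) xwy closure_approachable[of x J] unfolding frontier_def by (metis DiffD1 diff_gt_0_iff_gt)
   obtain q where q: "q \<in> J" "dist q y < y - w"
    using fr(3) xwy closure_approachable[of y J] unfolding frontier_def by (metis DiffD1 diff_gt_0_iff_gt)
   have "{p<..<q} \<subseteq> J"
    using \<open>is_interval J\<close> p(1) q(1) unfolding is_interval_1 by (meson greaterThanLessThan_iff less_imp_le subsetI)
   then have "w \<in> interior J" using p q by (intro interiorI[of "{p<..<q}"]) (auto simp: dist_real_def)
   then show False using fr(2) by (simp add: frontier_def)
  qed
  show ?thesis
  proof (rule ccontr)
   assume "infinite (frontier J)"
   then obtain T where T: "T \<subseteq> frontier J" "card T = 3" "finite T"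
    using infinite_arbitrarily_large by blast
   then obtain x y z where "T = {x, y, z}" "x \<noteq> y" "y \<noteq> z" "x \<noteq> z" by (auto simp: card_3_iff)
   then show False using T(1) between by (metis insert_subset linorder_less_linear)
  qed
 qed
 moreover have "frontier (\<Union>I) \<subseteq> (\<Union>J\<in>I. frontier J)" using frontier_Union_subset[OF I(1)] by simp
 ultimately show ?thesis unfolding I(3) using I(1,2) finite_subset[of "frontier (\<Union>I)" "\<Union>J\<in>I. frontier J"] by auto
qed

lemma interval_dichotomy:
 assumes "connected T" "T \<inter> frontier {x. A x} = {}" shows "(\<forall>x\<in>T. A x) \<or> (\<forall>x\<in>T. \<not> A x)"
 using connected_Int_frontier[OF assms(1), of "{x. A x}"] assms(2) by auto

text \<open>Finitely many frontier points leave an interval to the right of a on which the property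
  does not change. Throughout, this turns the failure of an eventual statement into its eventual
  negation.\<close>

lemma ev_dichotomy_right:
 assumes "drel1 A" shows "(\<forall>\<^sub>F x in at_right a. A x) \<or> (\<forall>\<^sub>F x in at_right a. \<not> A x)"
proof -
 define F where "F = {x \<in> frontier {x. A x}. x > a}"
 have "finite F" using finite_frontier[OF assms] by (simp add: F_def)
 define b where "b = Min (insert (a + 1) F)"
 have b: "b > a" "\<And>x. x \<in> F \<Longrightarrow> b \<le> x" using \<open>finite F\<close> by (auto simp: b_def F_def)
 have "{a<..<b} \<inter> frontier {x. A x} = {}" using b(2) by (force simp: F_def)
 then have "(\<forall>x\<in>{a<..<b}. A x) \<or> (\<forall>x\<in>{a<..<b}. \<not> A x)" by (intro interval_dichotomy) auto
 then show ?thesis using b(1) by (auto simp: eventually_at_right_field)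
qed

lemma ev_dichotomy_top:
 assumes "drel1 A" shows "(\<forall>\<^sub>F x in at_top. A x) \<or> (\<forall>\<^sub>F x in at_top. \<not> A x)"
proof -
 define F where "F = frontier {x. A x}"
 have "finite F" using finite_frontier[OF assms] by (simp add: F_def)
 define b where "b = Max (insert 0 F)"
 have b: "\<And>x. x \<in> F \<Longrightarrow> x \<le> b" using \<open>finite F\<close> by (auto simp: b_def)
 have "{b<..} \<inter> frontier {x. A x} = {}" using b by (force simp: F_def)
 then have "(\<forall>x\<in>{b<..}. A x) \<or> (\<forall>x\<in>{b<..}. \<not> A x)" by (intro interval_dichotomy) auto
 then show ?thesis using eventually_mono[OF eventually_gt_at_top[of b]] by (metis greaterThan_iff)
qed

text \<open>A countable set has empty interior and so is contained in its finite frontier. Arguments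
  over rational data, which by themselves only give countability, yield finiteness in this
  way.\<close>

lemma countable_imp_finite:
 assumes "drel1 A" "countable {x. A x}" shows "finite {x. A x}"
proof -
 have "interior {x. A x} = {}"
 proof (rule ccontr)
  assume "interior {x. A x} \<noteq> {}"
  then obtain x e where "e > 0" "cball x e \<subseteq> {x. A x}" by (auto simp: mem_interior_cball)
  then have "countable {x - e<..<x + e}"
   by (intro countable_subset[OF _ assms(2)]) (auto simp: cball_eq_atLeastAtMost subset_eq)
  then show False using \<open>e > 0\<close> uncountable_open_interval[of "x - e" "x + e"] by simp
 qed
 then have "{x. A x} \<subseteq> frontier {x. A x}" by (auto simp: frontier_def intro: closure_subset[THEN subsetD])
 then show ?thesis using finite_frontier[OF assms(1)] finite_subset by blast
qed

lemma infinite_imp_interval: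
 assumes "drel1 A" "infinite {x. A x}" shows "\<exists>a b. a < b \<and> (\<forall>x\<in>{a..b}. A x)"
proof -
 have "interior {x. A x} \<noteq> {}"
 proof
  assume "interior {x. A x} = {}"
  then have "{x. A x} \<subseteq> frontier {x. A x}" by (auto simp: frontier_def intro: closure_subset[THEN subsetD])
  then show False using finite_frontier[OF assms(1)] assms(2) finite_subset by blast
 qed
 then obtain x e where "e > 0" "cball x e \<subseteq> {x. A x}" by (auto simp: mem_interior_cball)
 then show ?thesis by (intro exI[of _ "x - e"] exI[of _ "x + e"]) (auto simp: cball_eq_atLeastAtMost)
qed

text \<open>The limit is the supremum of the constants that g eventually exceeds.\<close>

lemma limit_of_dichotomy:
 fixes g :: "real \<Rightarrow> real"
 assumes "\<And>c. (\<forall>\<^sub>F x in F. g x > c) \<or> (\<forall>\<^sub>F x in F. \<not> g x > c)" shows "\<exists>L. ((\<lambda>x. ereal (g x)) \<longlongrightarrow> L) F"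
proof
 define L where "L = Sup {ereal c | c. \<forall>\<^sub>F x in F. g x > c}"
 show "((\<lambda>x. ereal (g x)) \<longlongrightarrow> L) F"
 proof (rule order_tendstoI)
  fix a assume "a < L"
  then obtain c where "a < ereal c" "\<forall>\<^sub>F x in F. g x > c" unfolding L_def less_Sup_iff by auto
  then show "\<forall>\<^sub>F x in F. a < ereal (g x)"
   by (auto elim!: eventually_mono intro: less_trans[of a "ereal c"])
 next
  fix a assume "L < a"
  then obtain c where c: "L < ereal c" "ereal c < a" using ereal_dense2 by blast
  have "\<not> (\<forall>\<^sub>F x in F. g x > c)"
  proof
   assume "\<forall>\<^sub>F x in F. g x > c"
   then have "ereal c \<le> L" unfolding L_def by (intro Sup_upper) auto
   then show False using c by simp
  qed
  then have "\<forall>\<^sub>F x in F. \<not> g x > c" using assms by blast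
  then show "\<forall>\<^sub>F x in F. ereal (g x) < a"
   using c(2) by (auto elim!: eventually_mono intro: le_less_trans[of _ "ereal c"])
 qed
qed

lemma limit_top:
 assumes "dfun1 g" obtains L where "((\<lambda>x. ereal (g x)) \<longlongrightarrow> L) at_top"
proof -
 have "drel1 (\<lambda>x. g x > c)" for c unfolding drel1_def by (intro dint dfun1_app[OF assms])
 from limit_of_dichotomy[OF ev_dichotomy_top[OF this]] that show ?thesis by blast
qed

text \<open>
 For all but countably many \<open>x\<close>, each of the definable sets \<open>{g > c}\<close>, \<open>{g < c}\<close> with rational \<open>c\<close>
 is a neighbourhood of \<open>x\<close> or of a point outside, so \<open>g\<close> is continuous at \<open>x\<close>.
\<close>

lemma finite_discontinuities:
 assumes "dfun1 g" shows "finite {x. \<not> isCont g x}"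
proof -
 define Z where "Z = (\<Union>c\<in>\<rat>. frontier {x. g x > c} \<union> frontier {x. g x < c})"
 have "drel1 (\<lambda>x. g x > c)" "drel1 (\<lambda>x. g x < c)" for c
  unfolding drel1_def by (intro dint dfun1_app[OF assms])+
 then have "countable Z"
  unfolding Z_def by (intro countable_UN countable_rat countable_Un countable_finite finite_frontier)
 moreover have "{x. \<not> isCont g x} \<subseteq> Z"
 proof (rule subsetI, rule ccontr)
  fix x assume x: "x \<in> {x. \<not> isCont g x}" "x \<notin> Z"
  have nb: "\<forall>\<^sub>F y in at x. P y" if "P x" "x \<notin> frontier {x. P x}" for P
  proof -
   have "x \<in> interior {x. P x}" using that closure_subset[of "{x. P x}"] by (auto simp: frontier_def)
   then have "\<forall>\<^sub>F y in nhds x. P y"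
    using eventually_nhds_in_open[of "interior {x. P x}" x] interior_subset[of "{x. P x}"]
    by (auto elim!: eventually_mono)
   then show ?thesis by (simp add: eventually_at_filter eventually_mono)
  qed
  have "isCont g x" unfolding isCont_def
  proof (rule order_tendstoI)
   fix a assume "a < g x"
   then obtain c where c: "c \<in> \<rat>" "a < c" "c < g x" using Rats_dense_in_real by blast
   have "\<forall>\<^sub>F y in at x. g y > c" using c x(2) by (intro nb) (auto simp: Z_def)
   then show "\<forall>\<^sub>F y in at x. a < g y" using c(2) by (auto elim: eventually_mono)
  next
   fix a assume "g x < a"
   then obtain c where c: "c \<in> \<rat>" "c < a" "g x < c" using Rats_dense_in_real by blast
   have "\<forall>\<^sub>F y in at x. g y < c" using c x(2) by (intro nb) (auto simp: Z_def)
   then show "\<forall>\<^sub>F y in at x. g y < a" using c(2) by (auto elim: eventually_mono)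
  qed
  with x(1) show False by simp
 qed
 ultimately have "countable {x. \<not> isCont g x}" by (rule countable_subset[rotated])
 moreover have "drel1 (\<lambda>x. \<not> (\<forall>\<epsilon>. \<epsilon> > 0 \<longrightarrow> (\<exists>\<delta>. \<delta> > 0 \<and> (\<forall>y. \<bar>y - x\<bar> < \<delta> \<longrightarrow> \<bar>g y - g x\<bar> < \<epsilon>))))"
  unfolding drel1_def by (intro dint dfun1_app[OF assms])
 moreover have "isCont g x \<longleftrightarrow> (\<forall>\<epsilon>. \<epsilon> > 0 \<longrightarrow> (\<exists>\<delta>. \<delta> > 0 \<and> (\<forall>y. \<bar>y - x\<bar> < \<delta> \<longrightarrow> \<bar>g y - g x\<bar> < \<epsilon>)))" for x
  by (auto simp: continuous_at_eps_delta dist_real_def)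
 ultimately show ?thesis using countable_imp_finite[of "\<lambda>x. \<not> isCont g x"] by (simp only: )
qed

lemma ev_isCont:
 assumes "dfun1 g" shows "\<forall>\<^sub>F x in at_right a. isCont g x"
proof -
 have "finite {x. \<not> isCont g x}" by (rule finite_discontinuities[OF assms])
 then have "finite ({x. \<not> isCont g x} \<inter> {a<..})" by blast
 define b where "b = Min (insert (a + 1) ({x. \<not> isCont g x} \<inter> {a<..}))"
 have "a < b" using \<open>finite ({x. \<not> isCont g x} \<inter> {a<..})\<close> by (simp add: b_def)
 moreover have "isCont g x" if "a < x" "x < b" for x
 proof (rule ccontr)
  assume "\<not> isCont g x"
  then have "b \<le> x" unfolding b_def using that \<open>finite ({x. \<not> isCont g x} \<inter> {a<..})\<close>
   by (intro Min_le) auto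
  then show False using that by simp
 qed
 ultimately show ?thesis by (auto simp: eventually_at_right_field)
qed

end

section \<open>Orders of definable germs\<close>

text \<open>Nonnegativity makes h monotone. Then (n + 1) * h x and (n + 1) * x * h 1 both lie
  between k * h 1 and (k + 1) * h 1, where k is the integer part of (n + 1) * x.\<close>

lemma additive_nonneg_linear:
 fixes h :: "real \<Rightarrow> real"
 assumes add: "\<And>x y. h (x + y) = h x + h y" and pos: "\<And>x. x \<ge> 0 \<Longrightarrow> h x \<ge> 0" shows "h x = x * h 1"
proof -
 have h0: "h 0 = 0" using add[of 0 0] by simp
 have mono: "h x \<le> h y" if "x \<le> y" for x y using add[of x "y - x"] pos[of "y - x"] that by simp
 have hn: "h (of_nat n * x) = of_nat n * h x" for n x
 proof (induction n)
  case (Suc n)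
  have "h (of_nat (Suc n) * x) = h (of_nat n * x + x)" by (simp add: algebra_simps)
  then show ?case using Suc by (simp only: add) (simp add: algebra_simps)
 qed (simp add: h0)
 have nonneg: "h x = x * h 1" if "x \<ge> 0" for x
 proof -
  have "\<bar>h x - x * h 1\<bar> \<le> h 1 / real (Suc n)" for n
  proof -
   define k where "k = nat \<lfloor>real (Suc n) * x\<rfloor>"
   have k: "real k \<le> real (Suc n) * x" "real (Suc n) * x \<le> real (Suc k)"
    using that unfolding k_def by (auto simp: of_nat_nat zero_le_mult_iff) (linarith)
   have 1: "real k * h 1 \<le> real (Suc n) * h x" using mono[OF k(1)] hn[of k 1] hn[of "Suc n" x] by simp
   have 2: "real (Suc n) * h x \<le> real (Suc k) * h 1"
    using mono[OF k(2)] hn[of "Suc k" 1] hn[of "Suc n" x] by simp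
   have h1: "h 1 \<ge> 0" using pos by simp
   have 3: "real k * h 1 \<le> real (Suc n) * x * h 1" "real (Suc n) * x * h 1 \<le> real (Suc k) * h 1"
    using k h1 by (intro mult_right_mono; simp)+
   have "\<bar>real (Suc n) * h x - real (Suc n) * x * h 1\<bar> \<le> h 1"
    using 1 2 3 by (simp add: abs_le_iff algebra_simps)
   then have "real (Suc n) * \<bar>h x - x * h 1\<bar> \<le> h 1"
    by (metis abs_mult abs_of_nat mult.assoc right_diff_distrib)
   then show ?thesis by (simp add: field_simps)
  qed
  moreover have "(\<lambda>n. h 1 / real (Suc n)) \<longlonglongrightarrow> 0" by real_asymp
  ultimately have "\<bar>h x - x * h 1\<bar> \<le> 0" by (intro LIMSEQ_le_const) auto
  then show ?thesis by simp
 qed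
 show ?thesis
 proof (cases "x \<ge> 0")
  case False
  then show ?thesis using nonneg[of "-x"] add[of x "-x"] h0 by simp
 qed (rule nonneg)
qed

text \<open>Conjugation with \<open>exp\<close> gives an additive function that is nonnegative on
  nonnegative arguments.\<close>

lemma multiplicative_powr:
 fixes \<phi> :: "real \<Rightarrow> real"
 assumes pos: "\<And>s. s > 0 \<Longrightarrow> \<phi> s > 0" and mult: "\<And>s t. s > 0 \<Longrightarrow> t > 0 \<Longrightarrow> \<phi> (s * t) = \<phi> s * \<phi> t"
  and ge1: "\<And>s. s \<ge> 1 \<Longrightarrow> \<phi> s \<ge> 1"
 obtains r where "\<And>s. s > 0 \<Longrightarrow> \<phi> s = s powr r"
proof -
 define h where "h = (\<lambda>x. ln (\<phi> (exp x)))"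
 have "h x = x * h 1" for x by (rule additive_nonneg_linear)
    (use pos mult ge1 in \<open>auto simp: h_def exp_add ln_mult less_imp_neq[symmetric] intro!: ln_ge_zero\<close>)
 then have "\<phi> (exp x) = exp (x * h 1)" for x
  using pos[of "exp x"] unfolding h_def by (metis exp_gt_zero exp_ln)
 then have "\<phi> s = s powr (h 1)" if "s > 0" for s
  using that by (metis exp_ln mult.commute powr_def less_irrefl)
 then show ?thesis by (rule that)
qed

section \<open>Slowly varying functions and the field of exponents\<close>

context polynomially_bounded_ominimal_structure
begin

lemma poly_bound:
 assumes "dfun1 g" obtains N where "\<forall>\<^sub>F x in at_top. \<bar>g x\<bar> \<le> x ^ N"
proof -
 have "drel2 (\<lambda>x y. y = g x)" unfolding drel2_def by (intro dint dfun1_app[OF assms])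
 then have "{[x, y] | x y. y = g x} \<in> S 2" by (simp add: drel2_S)
 then have "{[x, g x] | x. True} \<in> S 2" by (rule back_subst[of "\<lambda>A. A \<in> S 2"]) auto
 from polynomially_bounded[OF this] that show ?thesis by blast
qed

text \<open>A slowly varying f stays below every root of x, so its inverse outgrows every power,
  against polynomial boundedness.\<close>

lemma not_slowly_varying:
 assumes f: "dfun1 f" and inf: "filterlim f at_top at_top" and lim: "((\<lambda>x. f (2 * x) / f x) \<longlongrightarrow> 1) at_top"
 shows False
proof -
 \<comment> \<open>If f ^ m > x held eventually, then along the points 2 ^ n * X the left side would
   gain at most the factor 3 / 2 per step, the right side the factor 2.\<close>
 have pow: "\<forall>\<^sub>F x in at_top. f x ^ m \<le> x" for m
 proof (rule ccontr)
  have "drel1 (\<lambda>x. f x ^ m \<le> x)" unfolding drel1_def by (intro dint dfun1_app[OF f])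
  moreover assume "\<not> (\<forall>\<^sub>F x in at_top. f x ^ m \<le> x)"
  ultimately have 1: "\<forall>\<^sub>F x in at_top. f x ^ m > x" using ev_dichotomy_top[of "\<lambda>x. f x ^ m \<le> x"] by (simp add: not_le)
  have "((\<lambda>x. (f (2 * x) / f x) ^ m) \<longlongrightarrow> 1 ^ m) at_top" by (intro tendsto_power lim)
  then have 2: "\<forall>\<^sub>F x in at_top. (f (2 * x) / f x) ^ m < 3 / 2" by (intro order_tendstoD) auto
  have 3: "\<forall>\<^sub>F x in at_top. f x > 0" using inf by (auto simp: filterlim_at_top_dense)
  have "\<forall>\<^sub>F x in at_top. f x ^ m > x \<and> (f (2 * x) / f x) ^ m < 3 / 2 \<and> f x > 0 \<and> x \<ge> 1"
   using 1 2 3 eventually_ge_at_top[of 1] by eventually_elim auto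
  then obtain X where X: "\<And>x. x \<ge> X \<Longrightarrow> f x ^ m > x \<and> (f (2 * x) / f x) ^ m < 3 / 2 \<and> f x > 0 \<and> x \<ge> 1"
   by (auto simp: eventually_at_top_linorder)
  have X1: "X \<ge> 1" using X[of X] by simp
  have X2: "2 ^ n * X \<ge> X" for n using X1 by simp
  have up: "f (2 ^ n * X) ^ m \<le> (3 / 2) ^ n * f X ^ m" for n
  proof (induction n)
   case (Suc n)
   have "f (2 * (2 ^ n * X)) ^ m \<le> 3 / 2 * f (2 ^ n * X) ^ m"
    using X[OF X2[of n]] by (auto simp: power_divide divide_less_eq)
   also have "\<dots> \<le> 3 / 2 * ((3 / 2) ^ n * f X ^ m)" using Suc by simp
   finally show ?case by (simp add: mult.assoc)
  qed simp
  have "X \<le> (3 / 4) ^ n * f X ^ m" for n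
  proof -
   have "2 ^ n * X \<le> (3 / 2) ^ n * f X ^ m" using up[of n] X[OF X2[of n]] by simp
   then have "X \<le> (3 / 2) ^ n / 2 ^ n * f X ^ m" by (simp add: field_simps)
   then show ?thesis by (simp flip: power_divide)
  qed
  moreover have "(\<lambda>n. (3 / 4) ^ n * f X ^ m) \<longlonglongrightarrow> 0" by real_asymp
  ultimately have "X \<le> 0" by (intro LIMSEQ_le_const) auto
  then show False using X1 by simp
 qed
 \<comment> \<open>The infimum of \<open>B y\<close> serves as an inverse of f without any
   monotonicity of f; the clause x \<ge> 1 bounds it below.\<close>
 define B where "B y = {x. x \<ge> 1 \<and> (\<forall>w. w \<ge> x \<longrightarrow> f w \<ge> y)}" for y
 have B: "B y \<noteq> {}" "bdd_below (B y)" for y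
 proof -
  have "\<forall>\<^sub>F x in at_top. f x \<ge> y" using inf by (auto simp: filterlim_at_top)
  then obtain X where "\<And>x. x \<ge> X \<Longrightarrow> f x \<ge> y" by (auto simp: eventually_at_top_linorder)
  then have "max 1 X \<in> B y" by (auto simp: B_def)
  then show "B y \<noteq> {}" by blast
  show "bdd_below (B y)" by (rule bdd_belowI[of _ 1]) (auto simp: B_def)
 qed
 define g where "g y = Inf (B y)" for y
 have g_iff: "(\<forall>x. x \<in> B y \<longrightarrow> z \<le> x) \<and> (\<forall>z'. (\<forall>x. x \<in> B y \<longrightarrow> z' \<le> x) \<longrightarrow> z' \<le> z) \<longleftrightarrow> z = g y" for y z
 proof
  show "z = g y \<Longrightarrow> (\<forall>x. x \<in> B y \<longrightarrow> z \<le> x) \<and> (\<forall>z'. (\<forall>x. x \<in> B y \<longrightarrow> z' \<le> x) \<longrightarrow> z' \<le> z)"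
   using B[of y] by (auto simp: g_def intro: cInf_lower cInf_greatest)
 next
  assume "(\<forall>x. x \<in> B y \<longrightarrow> z \<le> x) \<and> (\<forall>z'. (\<forall>x. x \<in> B y \<longrightarrow> z' \<le> x) \<longrightarrow> z' \<le> z)"
  then show "z = g y" unfolding g_def using B[of y] by (intro cInf_eq_non_empty[symmetric]) auto
 qed
 have "dpred (\<lambda>e. (\<forall>x. x \<in> B (e (Suc 0)) \<longrightarrow> e 0 \<le> x) \<and> (\<forall>z'. (\<forall>x. x \<in> B (e (Suc 0)) \<longrightarrow> z' \<le> x) \<longrightarrow> z' \<le> e 0))"
  unfolding B_def mem_Collect_eq by (intro dint dfun1_app[OF f])
 then have "dfun1 g" unfolding dfun1_def
  by (rule dtermI[of "\<lambda>e z. (\<forall>x. x \<in> B (e 0) \<longrightarrow> z \<le> x) \<and> (\<forall>z'. (\<forall>x. x \<in> B (e 0) \<longrightarrow> z' \<le> x) \<longrightarrow> z' \<le> z)"]) (rule g_iff)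
 then obtain N where N: "\<forall>\<^sub>F y in at_top. \<bar>g y\<bar> \<le> y ^ N" using poly_bound by blast
 obtain X where X: "\<And>x. x \<ge> X \<Longrightarrow> f x ^ Suc N \<le> x"
  using pow[of "Suc N"] by (auto simp: eventually_at_top_linorder)
 have g_ge: "y ^ Suc N \<le> g y" if "y > f X" "y > 1" for y unfolding g_def
 proof (rule cInf_greatest[OF B(1)])
  fix x assume x: "x \<in> B y"
  have "x \<ge> X"
  proof (rule ccontr)
   assume "\<not> x \<ge> X"
   then have "f X \<ge> y" using x by (auto simp: B_def)
   then show False using that by simp
  qed
  moreover have "y \<le> f x" using x by (simp add: B_def)
  ultimately show "y ^ Suc N \<le> x" using X[of x] power_mono[of y "f x" "Suc N"] that by simp
 qed
 have "\<forall>\<^sub>F y in at_top. y ^ Suc N \<le> y ^ N \<and> y > (1::real)"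
  using N eventually_gt_at_top[of "f X"] eventually_gt_at_top[of 1]
 proof eventually_elim
  case (elim y)
  then show ?case using g_ge[of y] by linarith
 qed
 then obtain y where "y ^ Suc N \<le> y ^ N" "y > (1::real)"
  using eventually_happens'[OF trivial_limit_at_top_linorder] by blast
 then show False by simp
qed

definition \<FF> :: "real set" where "\<FF> = exponent_field S"

text \<open>For \<open>x < 0\<close> the value of \<open>x powr r\<close> is a convention, which we avoid.\<close>

definition pw :: "real \<Rightarrow> real \<Rightarrow> real" where "pw r x = (if 0 < x then x powr r else 0)"

lemma FF_iff: "r \<in> \<FF> \<longleftrightarrow> drel2 (\<lambda>x y. 0 < x \<and> y = x powr r)"
by (simp add: \<FF>_def exponent_field_def drel2_S)

lemma dterm_pw [dint]:
 assumes "r \<in> \<FF>" "dterm a" shows "dterm (\<lambda>e. pw r (a e))"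
proof -
 have *: "drel2 (\<lambda>x y. 0 < x \<and> y = x powr r)" using assms(1) by (simp add: FF_iff)
 have "dpred (\<lambda>e. (0 < a (\<lambda>i. e (Suc i)) \<and> e 0 = a (\<lambda>i. e (Suc i)) powr r) \<or> \<not> 0 < a (\<lambda>i. e (Suc i)) \<and> e 0 = 0)"
  by (intro dint drel2_app[OF *] dterm_shift[OF assms(2), of Suc])
 then show ?thesis by (rule dtermI) (auto simp: pw_def)
qed

lemma FF_intro:
 assumes "dfun1 h" "\<And>x. x > 0 \<Longrightarrow> h x = x powr r" shows "r \<in> \<FF>"
proof -
 have "drel2 (\<lambda>x y. 0 < x \<and> y = h x)" unfolding drel2_def by (intro dint dfun1_app[OF assms(1)])
 moreover have "(\<lambda>x y. 0 < x \<and> y = h x) = (\<lambda>x y. 0 < x \<and> y = x powr r)" using assms(2) by (intro ext) auto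
 ultimately show ?thesis by (simp add: FF_iff)
qed

lemma dfun1_pw: "r \<in> \<FF> \<Longrightarrow> dfun1 (pw r)"
 unfolding dfun1_def by (intro dint)

lemma FF_1: "1 \<in> \<FF>"
 by (rule FF_intro[of "\<lambda>x. x"]) (auto simp: dfun1_def intro: dint)

lemma FF_0: "0 \<in> \<FF>"
 by (rule FF_intro[of "\<lambda>x. 1"]) (auto simp: dfun1_def intro: dint)

lemma FF_add: "r \<in> \<FF> \<Longrightarrow> s \<in> \<FF> \<Longrightarrow> r + s \<in> \<FF>"
 by (rule FF_intro[of "\<lambda>x. pw r x * pw s x"], unfold dfun1_def) ((intro dint; assumption), simp add: pw_def powr_add)

lemma FF_minus: "r \<in> \<FF> \<Longrightarrow> - r \<in> \<FF>"
 by (rule FF_intro[of "\<lambda>x. inverse (pw r x)"], unfold dfun1_def) ((intro dint; assumption), simp add: pw_def powr_minus)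

lemma FF_diff: "r \<in> \<FF> \<Longrightarrow> s \<in> \<FF> \<Longrightarrow> r - s \<in> \<FF>"
 using FF_add[OF _ FF_minus] by fastforce

lemma FF_mult: "r \<in> \<FF> \<Longrightarrow> s \<in> \<FF> \<Longrightarrow> r * s \<in> \<FF>"
 by (rule FF_intro[of "\<lambda>x. pw s (pw r x)"], unfold dfun1_def) ((intro dint; assumption), simp add: pw_def powr_powr)

lemma FF_inverse: assumes "r \<in> \<FF>" shows "inverse r \<in> \<FF>"
proof (cases "r = 0")
 case False
 have "drel2 (\<lambda>x y. 0 < x \<and> 0 < y \<and> x = pw r y)" unfolding drel2_def by (intro dint assms)
 moreover have "(\<lambda>x y. 0 < x \<and> 0 < y \<and> x = pw r y) = (\<lambda>x y. 0 < x \<and> y = x powr inverse r)"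
  using False by (intro ext) (auto simp: pw_def powr_powr)
 ultimately show ?thesis by (simp add: FF_iff)
qed (use FF_0 in simp)

lemma FF_divide: "r \<in> \<FF> \<Longrightarrow> s \<in> \<FF> \<Longrightarrow> r / s \<in> \<FF>"
 unfolding divide_inverse by (intro FF_mult FF_inverse)

lemma FF_of_nat: "of_nat n \<in> \<FF>"
 by (induction n) (auto intro: FF_0 FF_1 FF_add)

lemma FF_Rats: assumes "r \<in> \<rat>" shows "r \<in> \<FF>"
proof -
 have "of_int i \<in> \<FF>" for i using FF_of_nat FF_minus by (cases i rule: int_cases2) auto
 then show ?thesis using assms FF_divide by (auto elim!: Rats_cases')
qed

end

section \<open>Germs at 0 from the right, and their definability\<close>

abbreviation ev :: "(real \<Rightarrow> bool) \<Rightarrow> bool"  (binder "EV " 10) where "ev P \<equiv> eventually P (at_right 0)"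

lemma ev_pos: "EV t. t > 0"
 by (simp add: eventually_at_right_less)

lemma ev_less: "a > 0 \<Longrightarrow> EV t. t < a"
 by (auto simp: eventually_at_right_field)

context ominimal_structure
begin

lemma dpred_ev [dint]:
 assumes "dpred (\<lambda>e. P (\<lambda>i. e (Suc i)) (e 0))" shows "dpred (\<lambda>e. ev (P e))"
proof -
 have *: "dpred (\<lambda>e. P (\<lambda>i. e (Suc (Suc i))) (e 0))"
  using dpred_reindex[OF assms, of "\<lambda>i. if i = 0 then 0 else Suc i"] by simp
 have "dpred (\<lambda>e. \<exists>b. b > 0 \<and> (\<forall>t. t > 0 \<longrightarrow> t < b \<longrightarrow> P e t))" by (intro dint *)
 then show ?thesis by (simp add: eventually_at_right_field)
qed

lemma dpred_tendsto_right [dint]: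
 assumes "dterm (\<lambda>e. G (\<lambda>i. e (Suc i)) (e 0))" "dterm l" shows "dpred (\<lambda>e. (G e \<longlongrightarrow> l e) (at_right 0))"
proof -
 have *: "dterm (\<lambda>e. G (\<lambda>i. e (Suc (Suc i))) (e 0))"
  using dterm_shift[OF assms(1), of "\<lambda>i. if i = 0 then 0 else Suc i"] by simp
 have **: "dterm (\<lambda>e. l (\<lambda>i. e (Suc (Suc i))))" by (rule dterm_shift[OF assms(2)])
 have "dpred (\<lambda>e. \<forall>\<epsilon>. \<epsilon> > 0 \<longrightarrow> (EV t. \<bar>G e t - l e\<bar> < \<epsilon>))" by (intro dint * **)
 then show ?thesis by (simp add: tendsto_iff dist_real_def)
qed

lemma dpred_tendsto_top [dint]:
 assumes "dterm (\<lambda>e. G (\<lambda>i. e (Suc i)) (e 0))" "dterm l" shows "dpred (\<lambda>e. (G e \<longlongrightarrow> l e) at_top)"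
proof -
 have *: "dterm (\<lambda>e. G (\<lambda>i. e (Suc (Suc (Suc i)))) (e 0))"
  using dterm_shift[OF assms(1), of "\<lambda>i. if i = 0 then 0 else Suc (Suc i)"] by simp
 have **: "dterm (\<lambda>e. l (\<lambda>i. e (Suc (Suc (Suc i)))))" by (rule dterm_shift[OF assms(2)])
 have "dpred (\<lambda>e. \<forall>\<epsilon>. \<epsilon> > 0 \<longrightarrow> (\<exists>X. \<forall>x. x \<ge> X \<longrightarrow> \<bar>G e x - l e\<bar> < \<epsilon>))" by (intro dint * **)
 then show ?thesis by (simp add: tendsto_iff dist_real_def eventually_at_top_linorder)
qed

end

context polynomially_bounded_ominimal_structure
begin

text \<open>Let s > 1. A limit below 1 would keep f bounded along s ^ n * X, against f tending to
  infinity. An infinite limit would give growth by s ^ (N + 1) per step there, against the bound x ^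
  N. The case s < 1 follows by inversion.\<close>

lemma ratio_limit:
 assumes f: "dfun1 f" and inf: "filterlim f at_top at_top" and s: "s > 0"
 shows "\<exists>l. l > 0 \<and> (s \<ge> 1 \<longrightarrow> l \<ge> 1) \<and> ((\<lambda>x. f (s * x) / f x) \<longlongrightarrow> l) at_top"
proof -
 have pos: "\<forall>\<^sub>F x in at_top. f x > 0" using inf by (auto simp: filterlim_at_top_dense)
 have gt1: "\<exists>l. l \<ge> 1 \<and> ((\<lambda>x. f (s * x) / f x) \<longlongrightarrow> l) at_top" if s: "s > 1" for s
 proof -
  have "dfun1 (\<lambda>x. f (s * x) / f x)" unfolding dfun1_def by (intro dint dfun1_app[OF f])
  then obtain L where L: "((\<lambda>x. ereal (f (s * x) / f x)) \<longlongrightarrow> L) at_top" by (rule limit_top)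
  have "L \<ge> 1"
  proof (rule ccontr)
   assume "\<not> L \<ge> 1"
   then have "\<forall>\<^sub>F x in at_top. ereal (f (s * x) / f x) < 1" using L by (intro order_tendstoD) auto
   then have "\<forall>\<^sub>F x in at_top. f (s * x) < f x \<and> f x > 0 \<and> x > 0"
    using pos eventually_gt_at_top[of 0] by eventually_elim (auto simp: field_simps)
   then obtain X where X: "\<And>x. x \<ge> X \<Longrightarrow> f (s * x) < f x \<and> f x > 0 \<and> x > 0"
    by (auto simp: eventually_at_top_linorder)
   have X0: "X > 0" using X[of X] by simp
   have sX: "s ^ n * X \<ge> X" for n using s X0 by simp
   have le: "f (s ^ n * X) \<le> f X" for n
   proof (induction n)
    case (Suc n)
    then show ?case using X[OF sX[of n]] by (simp add: mult.assoc)
   qed simp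
   have "filterlim (\<lambda>n. s ^ n * X) at_top sequentially" using s X0 by real_asymp
   then have "filterlim (\<lambda>n. f (s ^ n * X)) at_top sequentially" by (rule filterlim_compose[OF inf])
   then have "\<forall>\<^sub>F n in sequentially. f (s ^ n * X) > f X" by (auto simp: filterlim_at_top_dense)
   then obtain n where "f (s ^ n * X) > f X" using eventually_happens'[OF sequentially_bot] by blast
   then show False using le[of n] by simp
  qed
  moreover have "L \<noteq> \<infinity>"
  proof
   assume "L = \<infinity>"
   obtain N where N: "\<forall>\<^sub>F x in at_top. \<bar>f x\<bar> \<le> x ^ N" using poly_bound[OF f] .
   have "\<forall>\<^sub>F x in at_top. ereal (f (s * x) / f x) > ereal (s ^ Suc N)"
    using L \<open>L = \<infinity>\<close> by (intro order_tendstoD) auto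
   then have "\<forall>\<^sub>F x in at_top. f (s * x) > s ^ Suc N * f x \<and> f x > 0 \<and> x > 0 \<and> f x \<le> x ^ N"
    using pos eventually_gt_at_top[of 0] N by eventually_elim (auto simp: field_simps)
   then obtain X where X: "\<And>x. x \<ge> X \<Longrightarrow> f (s * x) > s ^ Suc N * f x \<and> f x > 0 \<and> x > 0 \<and> f x \<le> x ^ N"
    by (auto simp: eventually_at_top_linorder)
   have X0: "X > 0" using X[of X] by simp
   have sX: "s ^ n * X \<ge> X" for n using s X0 by simp
   have ge: "f (s ^ n * X) \<ge> (s ^ Suc N) ^ n * f X" for n
   proof (induction n)
    case (Suc n)
    have "s ^ Suc N * ((s ^ Suc N) ^ n * f X) \<le> s ^ Suc N * f (s ^ n * X)"
     using Suc s by (intro mult_left_mono) auto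
    also have "\<dots> \<le> f (s * (s ^ n * X))" using X[OF sX[of n]] by simp
    finally show ?case by (simp add: mult.assoc)
   qed simp
   have "s ^ n * f X \<le> X ^ N" for n
   proof -
    have "(s ^ Suc N) ^ n * f X \<le> (s ^ n * X) ^ N" using ge[of n] X[OF sX[of n]] by linarith
    also have "(s ^ Suc N) ^ n = s ^ n * (s ^ n) ^ N"
     by (simp add: power_mult_distrib flip: power_mult) (simp add: mult.commute)
    also have "(s ^ n * X) ^ N = X ^ N * (s ^ n) ^ N" by (simp add: power_mult_distrib)
    finally have "(s ^ n * f X) * (s ^ n) ^ N \<le> X ^ N * (s ^ n) ^ N" by (simp add: mult_ac)
    then show ?thesis using s by (simp add: mult_le_cancel_right)
   qed
   moreover have "filterlim (\<lambda>n. s ^ n * f X) at_top sequentially" using s X[of X] by real_asymp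
   then have "\<forall>\<^sub>F n in sequentially. s ^ n * f X > X ^ N" by (auto simp: filterlim_at_top_dense)
   then obtain n where "s ^ n * f X > X ^ N" using eventually_happens'[OF sequentially_bot] by blast
   ultimately show False by (metis not_le)
  qed
  ultimately obtain l where "L = ereal l" "l \<ge> 1" by (cases L) auto
  then show ?thesis using L by (intro exI[of _ l]) simp
 qed
 consider "s > 1" | "s = 1" | "s < 1" by linarith then show ?thesis
 proof cases
  case 1
  then obtain l where "l \<ge> 1" "((\<lambda>x. f (s * x) / f x) \<longlongrightarrow> l) at_top" using gt1 by blast
  then show ?thesis by (intro exI[of _ l]) auto
 next
  case 2
  have "((\<lambda>x. f (1 * x) / f x) \<longlongrightarrow> 1) at_top"
   by (rule tendsto_eventually) (use pos in \<open>auto elim: eventually_mono\<close>)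
  then show ?thesis using 2 by (intro exI[of _ 1]) simp
 next
  case 3
  then have "1 / s > 1" using s by simp
  then obtain l where l: "l \<ge> 1" "((\<lambda>x. f (1 / s * x) / f x) \<longlongrightarrow> l) at_top" using gt1 by blast
  have "filterlim (\<lambda>x. s * x) at_top at_top" using s by real_asymp
  from filterlim_compose[OF l(2) this]
  have "((\<lambda>x. f x / f (s * x)) \<longlongrightarrow> l) at_top" using s by simp
  from tendsto_inverse[OF this] l(1) have "((\<lambda>x. f (s * x) / f x) \<longlongrightarrow> inverse l) at_top" by simp
  then show ?thesis using l(1) 3 by (intro exI[of _ "inverse l"]) auto
 qed
qed

text \<open>The limits of f (s * x) / f x are multiplicative in s, hence equal to s powr r, and
  definable in s, so r is an exponent of the structure. Division of f by x powr r leaves a slowly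
  varying function, and such a function tends neither to 0 nor to infinity.\<close>

lemma order_at_top_unbounded:
 assumes f: "dfun1 f" and inf: "filterlim f at_top at_top"
 shows "\<exists>r\<in>\<FF>. \<exists>a. a \<noteq> 0 \<and> ((\<lambda>x. f x / x powr r) \<longlongrightarrow> a) at_top"
proof -
 have pos: "\<forall>\<^sub>F x in at_top. f x > 0" using inf by (auto simp: filterlim_at_top_dense)
 have "\<forall>s. \<exists>l. s > 0 \<longrightarrow> l > 0 \<and> (s \<ge> 1 \<longrightarrow> l \<ge> 1) \<and> ((\<lambda>x. f (s * x) / f x) \<longlongrightarrow> l) at_top"
  using ratio_limit[OF f inf] by blast
 then obtain \<phi> where \<phi>: "\<And>s. s > 0 \<Longrightarrow> \<phi> s > 0" "\<And>s. s \<ge> 1 \<Longrightarrow> \<phi> s \<ge> 1"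
  "\<And>s. s > 0 \<Longrightarrow> ((\<lambda>x. f (s * x) / f x) \<longlongrightarrow> \<phi> s) at_top" by (metis less_le_trans zero_less_one)
 have "\<phi> (s * t) = \<phi> s * \<phi> t" if "s > 0" "t > 0" for s t
 proof -
  have lin: "filterlim (\<lambda>x. t * x) at_top at_top" using that by real_asymp
  have "((\<lambda>x. f (s * (t * x)) / f (t * x) * (f (t * x) / f x)) \<longlongrightarrow> \<phi> s * \<phi> t) at_top"
   by (intro tendsto_mult filterlim_compose[OF \<phi>(3) lin] \<phi>(3) that)
  moreover have "\<forall>\<^sub>F x in at_top. f (t * x) > 0"
   using filterlim_compose[OF inf lin] by (auto simp: filterlim_at_top_dense)
  then have "\<forall>\<^sub>F x in at_top. f (s * (t * x)) / f (t * x) * (f (t * x) / f x) = f (s * t * x) / f x"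
   by eventually_elim (simp add: mult.assoc)
  ultimately have "((\<lambda>x. f (s * t * x) / f x) \<longlongrightarrow> \<phi> s * \<phi> t) at_top" by (rule Lim_transform_eventually)
  moreover have "((\<lambda>x. f (s * t * x) / f x) \<longlongrightarrow> \<phi> (s * t)) at_top" using that by (intro \<phi>) simp
  ultimately show ?thesis by (intro tendsto_unique[OF trivial_limit_at_top_linorder])
 qed
 with \<phi>(1,2) obtain r where r: "\<And>s. s > 0 \<Longrightarrow> \<phi> s = s powr r" using multiplicative_powr[of \<phi>] by blast
 have "drel2 (\<lambda>s y. 0 < s \<and> ((\<lambda>x. f (s * x) / f x) \<longlongrightarrow> y) at_top)"
  unfolding drel2_def by (intro dint dfun1_app[OF f])
 moreover have "(\<lambda>s y. 0 < s \<and> ((\<lambda>x. f (s * x) / f x) \<longlongrightarrow> y) at_top) = (\<lambda>s y. 0 < s \<and> y = s powr r)"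
 proof (intro ext conj_cong refl iffI)
  fix s y :: real
  assume "0 < s"
  show "y = s powr r" if "((\<lambda>x. f (s * x) / f x) \<longlongrightarrow> y) at_top"
   using tendsto_unique[OF trivial_limit_at_top_linorder that \<phi>(3)] r \<open>0 < s\<close> by simp
  show "((\<lambda>x. f (s * x) / f x) \<longlongrightarrow> y) at_top" if "y = s powr r" using \<phi>(3) r \<open>0 < s\<close> that by metis
 qed
 ultimately have "r \<in> \<FF>" by (simp add: FF_iff)
 define g where "g x = f x / pw r x" for x
 have dg: "dfun1 g" unfolding dfun1_def g_def by (intro dint dfun1_app[OF f] \<open>r \<in> \<FF>\<close>)
 have g_eq: "\<forall>\<^sub>F x in at_top. g x = f x / x powr r"
  using eventually_gt_at_top[of 0] by eventually_elim (simp add: g_def pw_def)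
 have g_pos: "\<forall>\<^sub>F x in at_top. g x > 0"
  using eventually_gt_at_top[of 0] pos by eventually_elim (simp add: g_def pw_def)
 have "((\<lambda>x. (f (2 * x) / f x) / 2 powr r) \<longlongrightarrow> \<phi> 2 / 2 powr r) at_top"
  by (intro tendsto_divide \<phi>(3) tendsto_const) auto
 moreover have "\<forall>\<^sub>F x in at_top. (f (2 * x) / f x) / 2 powr r = g (2 * x) / g x"
  using eventually_gt_at_top[of 0] by eventually_elim (simp add: g_def pw_def powr_mult)
 ultimately have "((\<lambda>x. g (2 * x) / g x) \<longlongrightarrow> \<phi> 2 / 2 powr r) at_top" by (rule Lim_transform_eventually)
 then have g_slow: "((\<lambda>x. g (2 * x) / g x) \<longlongrightarrow> 1) at_top" using r[of 2] by simp
 obtain L where L: "((\<lambda>x. ereal (g x)) \<longlongrightarrow> L) at_top" using limit_top[OF dg] .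
 have "L \<ge> 0" using g_pos by (intro tendsto_lowerbound[OF L]) (auto elim: eventually_mono)
 moreover have "L \<noteq> \<infinity>"
 proof
  assume "L = \<infinity>"
  then have "filterlim g at_top at_top" using L by (auto simp: tendsto_PInfty filterlim_at_top_dense)
  then show False using not_slowly_varying[OF dg] g_slow by blast
 qed
 moreover have "L \<noteq> 0"
 proof
  assume "L = 0"
  then have "(g \<longlongrightarrow> 0) at_top" using L by (simp add: zero_ereal_def)
  then have "filterlim (\<lambda>x. inverse (g x)) at_top at_top" using g_pos by (intro filterlim_inverse_at_top)
  moreover have "dfun1 (\<lambda>x. inverse (g x))" unfolding dfun1_def by (intro dint dfun1_app[OF dg])
  moreover have "((\<lambda>x. inverse (g (2 * x)) / inverse (g x)) \<longlongrightarrow> 1) at_top"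
   using tendsto_inverse[OF g_slow] by (simp add: field_simps)
  ultimately show False by (intro not_slowly_varying) 
 qed
 ultimately obtain a where "L = ereal a" "a \<noteq> 0" by (cases L) (auto simp: zero_ereal_def)
 then have "(g \<longlongrightarrow> a) at_top" using L by simp
 then have "((\<lambda>x. f x / x powr r) \<longlongrightarrow> a) at_top" using g_eq by (rule Lim_transform_eventually)
 then show ?thesis using \<open>r \<in> \<FF>\<close> \<open>a \<noteq> 0\<close> by blast
qed

section \<open>Orders at the origin: existence, uniqueness, comparison, finiteness in
  families\<close>

definition ord_is :: "(real \<Rightarrow> real) \<Rightarrow> real \<Rightarrow> bool" where
 "ord_is g r \<longleftrightarrow> (\<exists>a. a \<noteq> 0 \<and> ((\<lambda>t. g t / t powr r) \<longlongrightarrow> a) (at_right 0))"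

text \<open>The substitution of 1 / x for t moves the germ to infinity. There the function or its
  reciprocal is unbounded, unless the limit is finite and nonzero and the order is 0.\<close>

lemma exists_order:
 assumes g: "dfun1 g" and nz: "\<not> (EV t. g t = 0)" shows "\<exists>r\<in>\<FF>. ord_is g r"
proof -
 have pos_case: "\<exists>r\<in>\<FF>. ord_is g r" if g: "dfun1 g" and pos: "EV t. g t > 0" for g
 proof -
  define f where "f x = g (inverse x)" for x
  have df: "dfun1 f" unfolding dfun1_def f_def by (intro dint dfun1_app[OF g])
  have df': "dfun1 (\<lambda>x. inverse (f x))" unfolding dfun1_def by (intro dint dfun1_app[OF df])
  have pos: "\<forall>\<^sub>F x in at_top. f x > 0" using pos unfolding f_def eventually_at_right_to_top .
  have conv: "ord_is g (-r)" if "a \<noteq> 0" "((\<lambda>x. f x / x powr r) \<longlongrightarrow> a) at_top" for r a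
  proof -
   have "((\<lambda>x. g (inverse x) / inverse x powr (- r)) \<longlongrightarrow> a) at_top"
    using that(2) eventually_gt_at_top[of 0]
    by (auto simp: f_def powr_minus inverse_powr[symmetric] cong: tendsto_cong elim!: Lim_transform_eventually eventually_mono)
   then have "((\<lambda>t. g t / t powr (- r)) \<longlongrightarrow> a) (at_right 0)" by (simp add: filterlim_at_right_to_top)
   then show ?thesis using that(1) by (auto simp: ord_is_def)
  qed
  obtain L where L: "((\<lambda>x. ereal (f x)) \<longlongrightarrow> L) at_top" using limit_top[OF df] .
  have "L \<ge> 0" using pos by (intro tendsto_lowerbound[OF L]) (auto elim: eventually_mono)
  then consider "L = \<infinity>" | "L = 0" | l where "L = ereal l" "l > 0"
   by (cases L) (auto simp: zero_ereal_def less_le) then show ?thesis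
  proof cases
   case 1
   then have "filterlim f at_top at_top" using L by (auto simp: tendsto_PInfty filterlim_at_top_dense)
   from order_at_top_unbounded[OF df this] show ?thesis using conv FF_minus by blast
  next
   case 2
   then have "(f \<longlongrightarrow> 0) at_top" using L by (simp add: zero_ereal_def)
   then have "filterlim (\<lambda>x. inverse (f x)) at_top at_top" using pos by (intro filterlim_inverse_at_top)
   from order_at_top_unbounded[OF df' this]
   obtain r a where r: "r \<in> \<FF>" "a \<noteq> 0" "((\<lambda>x. inverse (f x) / x powr r) \<longlongrightarrow> a) at_top" by blast
   from tendsto_inverse[OF r(3,2)] have "((\<lambda>x. f x / x powr (- r)) \<longlongrightarrow> inverse a) at_top"
    by (simp add: powr_minus field_simps)
   from conv[OF _ this] r(1,2) show ?thesis by auto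
  next
   case 3
   then have "(f \<longlongrightarrow> l) at_top" using L by simp
   then have "((\<lambda>x. f x / x powr 0) \<longlongrightarrow> l) at_top"
    by (rule Lim_transform_eventually) (use eventually_gt_at_top[of "0::real"] in eventually_elim, simp)
   from conv[OF _ this] 3 FF_0 show ?thesis by auto
  qed
 qed
 have "drel1 (\<lambda>t. g t > 0)" "drel1 (\<lambda>t. g t < 0)" unfolding drel1_def by (intro dint dfun1_app[OF g])+
 then consider "EV t. g t > 0" | "EV t. g t < 0" | "EV t. \<not> g t > 0" "EV t. \<not> g t < 0"
  using ev_dichotomy_right[of _ 0] by blast then show ?thesis
 proof cases
  case 1
  with g show ?thesis by (rule pos_case)
 next
  case 2
  have "dfun1 (\<lambda>t. - g t)" unfolding dfun1_def by (intro dint dfun1_app[OF g])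
  then have "\<exists>r\<in>\<FF>. ord_is (\<lambda>t. - g t) r" using 2 by (intro pos_case) auto
  then obtain r a where r: "r \<in> \<FF>" "a \<noteq> 0" "((\<lambda>t. - g t / t powr r) \<longlongrightarrow> a) (at_right 0)"
   by (auto simp: ord_is_def)
  from tendsto_minus[OF r(3)] r(1,2) show ?thesis
   unfolding ord_is_def by (intro bexI[of _ r] exI[of _ "-a"]) auto
 next
  case 3
  then have "EV t. g t = 0" by eventually_elim auto
  with nz show ?thesis by simp
 qed
qed

end

lemma order_cong: "EV t. g t = h t \<Longrightarrow> order_at_0 g = order_at_0 h"
proof -
 assume a: "EV t. g t = h t"
 have "(EV t. g t = 0) \<longleftrightarrow> (EV t. h t = 0)"
  using a by (intro eventually_subst) (auto elim: eventually_mono)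
 moreover have "has_order g = has_order h"
 proof
  fix \<alpha>
  have "(\<lambda>t. g t - b * t powr \<alpha>) \<in> o[at_right 0](\<lambda>t. t powr \<alpha>) \<longleftrightarrow>
    (\<lambda>t. h t - b * t powr \<alpha>) \<in> o[at_right 0](\<lambda>t. t powr \<alpha>)" for b
   by (rule landau_o.small.in_cong) (use a in \<open>auto elim: eventually_mono\<close>)
  then show "has_order g \<alpha> = has_order h \<alpha>" by (simp add: has_order_def)
 qed
 ultimately show ?thesis by (simp add: order_at_0_def)
qed

lemma powr_pos_ev: "EV t. t powr r > 0"
 using ev_pos by eventually_elim simp

context polynomially_bounded_ominimal_structure
begin

lemma has_order_iff: "has_order g r \<longleftrightarrow> ord_is g r"
proof -
 have nz: "EV t. t powr r \<noteq> 0" using ev_pos by eventually_elim simp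
 have "(\<lambda>t. g t - a * t powr r) \<in> o[at_right 0](\<lambda>t. t powr r) \<longleftrightarrow> ((\<lambda>t. g t / t powr r) \<longlongrightarrow> a) (at_right 0)" for a
 proof -
  have "(\<lambda>t. g t - a * t powr r) \<in> o[at_right 0](\<lambda>t. t powr r) \<longleftrightarrow>
    ((\<lambda>t. (g t - a * t powr r) / t powr r) \<longlongrightarrow> 0) (at_right 0)"
   using nz smalloI_tendsto[of "\<lambda>t. g t - a * t powr r" "\<lambda>t. t powr r" "at_right 0"]
    smalloD_tendsto[of "\<lambda>t. g t - a * t powr r" "at_right 0" "\<lambda>t. t powr r"] by blast
  also have "\<dots> \<longleftrightarrow> ((\<lambda>t. g t / t powr r - a) \<longlongrightarrow> 0) (at_right 0)"
   by (rule tendsto_cong) (use nz in \<open>eventually_elim, simp add: diff_divide_distrib\<close>)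
  also have "\<dots> \<longleftrightarrow> ((\<lambda>t. g t / t powr r) \<longlongrightarrow> a) (at_right 0)" by (rule LIM_zero_iff)
  finally show ?thesis .
 qed
 then show ?thesis by (simp add: has_order_def ord_is_def)
qed

lemma ord_is_bounds:
 assumes "ord_is g r"
 obtains c C where "c > 0" "C > 0" "EV t. c * t powr r \<le> \<bar>g t\<bar> \<and> \<bar>g t\<bar> \<le> C * t powr r"
proof -
 obtain a where a: "a \<noteq> 0" "((\<lambda>t. g t / t powr r) \<longlongrightarrow> a) (at_right 0)"
  using assms by (auto simp: ord_is_def)
 have lim: "((\<lambda>t. \<bar>g t / t powr r\<bar>) \<longlongrightarrow> \<bar>a\<bar>) (at_right 0)" by (intro tendsto_rabs a)
 have "EV t. \<bar>g t / t powr r\<bar> > \<bar>a\<bar> / 2" "EV t. \<bar>g t / t powr r\<bar> < 2 * \<bar>a\<bar>"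
  using a(1) by (intro order_tendstoD[OF lim]; simp)+
 then have "EV t. \<bar>a\<bar> / 2 * t powr r \<le> \<bar>g t\<bar> \<and> \<bar>g t\<bar> \<le> 2 * \<bar>a\<bar> * t powr r"
  using ev_pos by eventually_elim (simp add: field_simps)
 then show ?thesis using a(1) by (intro that[of "\<bar>a\<bar> / 2" "2 * \<bar>a\<bar>"]) auto
qed

lemma powr_compare:
 assumes "c > 0" "EV t. c * t powr r \<le> C * t powr s" shows "s \<le> r"
proof (rule ccontr)
 assume "\<not> s \<le> r"
 then have "((\<lambda>t. C * t powr (s - r)) \<longlongrightarrow> 0) (at_right 0)" by real_asymp
 then have "EV t. C * t powr (s - r) < c" using assms(1) by (rule order_tendstoD)
 then have "EV t. False" using assms(2) ev_pos by eventually_elim (auto simp: powr_diff field_simps)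
 then show False by (simp add: eventually_False trivial_limit_at_right_real)
qed

lemma ord_is_unique: "ord_is g r \<Longrightarrow> ord_is g s \<Longrightarrow> r = s"
proof -
 have "s \<le> r" if r: "ord_is g r" and s: "ord_is g s" for r s
 proof -
  obtain c where c: "c > 0" "EV t. c * t powr r \<le> \<bar>g t\<bar>"
   using ord_is_bounds[OF r] by (auto simp: eventually_conj_iff)
  obtain C where C: "EV t. \<bar>g t\<bar> \<le> C * t powr s"
   using ord_is_bounds[OF s] by (auto simp: eventually_conj_iff)
  have "EV t. c * t powr r \<le> C * t powr s" using c(2) C by eventually_elim simp
  then show ?thesis using c(1) powr_compare by blast
 qed
 then show "ord_is g r \<Longrightarrow> ord_is g s \<Longrightarrow> r = s" by (meson antisym)
qed

lemma ev_const [simp]: "(EV t. b) \<longleftrightarrow> b"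
 by (cases b) (auto simp: eventually_False trivial_limit_at_right_real)

lemma ord_is_order: assumes "ord_is g r" shows "order_at_0 g = ereal r"
proof -
 obtain c where c: "c > 0" "EV t. c * t powr r \<le> \<bar>g t\<bar>"
  using ord_is_bounds[OF assms] by (auto simp: eventually_conj_iff)
 have "\<not> (EV t. g t = 0)"
 proof
  assume "EV t. g t = 0"
  then have "EV t. False" using c(2) powr_pos_ev[of r]
   by eventually_elim (use c(1) in \<open>simp add: mult_le_0_iff\<close>)
  then show False by simp
 qed
 moreover have "(THE \<alpha>. has_order g \<alpha>) = r"
  using assms ord_is_unique by (intro the_equality) (auto simp: has_order_iff)
 ultimately show ?thesis by (simp add: order_at_0_def)
qed

lemma order_infty: "order_at_0 g = \<infinity> \<longleftrightarrow> (EV t. g t = 0)"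
 by (simp add: order_at_0_def)

lemma order_cases:
 assumes "dfun1 g"
 obtains "EV t. g t = 0" "order_at_0 g = \<infinity>" | r where "r \<in> \<FF>" "ord_is g r" "order_at_0 g = ereal r"
 using exists_order[OF assms] ord_is_order[of g] order_infty[of g] by blast

lemma order_finite:
 assumes "dfun1 g" "order_at_0 g = ereal r" shows "r \<in> \<FF>" "ord_is g r"
 using assms(2) by (cases rule: order_cases[OF assms(1)]; simp)+

lemma order_ge_iff:
 assumes "dfun1 g" shows "ereal r \<le> order_at_0 g \<longleftrightarrow> (\<exists>C. (EV t. \<bar>g t\<bar> \<le> C * t powr r))"
proof (cases rule: order_cases[OF assms])
 case 1
 have "EV t. \<bar>g t\<bar> \<le> 0 * t powr r" using 1(1) by eventually_elim simp
 then show ?thesis using 1(2) by (metis ereal_less_eq(1))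
next
 case (2 s)
 obtain c C where c: "c > 0" "C > 0" "EV t. c * t powr s \<le> \<bar>g t\<bar> \<and> \<bar>g t\<bar> \<le> C * t powr s"
  by (rule ord_is_bounds[OF 2(2)])
 show ?thesis
 proof
  assume "ereal r \<le> order_at_0 g"
  then have "r \<le> s" by (simp add: 2(3))
  have "EV t. \<bar>g t\<bar> \<le> C * t powr r" using c(3) ev_pos ev_less[OF zero_less_one]
  proof eventually_elim
   case (elim t)
   have "t powr s \<le> t powr r" using elim \<open>r \<le> s\<close> by (intro powr_mono') auto
   then show ?case using elim c(2) by (smt (verit) mult_left_mono)
  qed
  then show "\<exists>C. (EV t. \<bar>g t\<bar> \<le> C * t powr r)" by blast
 next
  assume "\<exists>C. (EV t. \<bar>g t\<bar> \<le> C * t powr r)"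
  then obtain D where D: "EV t. \<bar>g t\<bar> \<le> D * t powr r" by blast
  have "EV t. c * t powr s \<le> D * t powr r" using c(3) D by eventually_elim simp
  then show "ereal r \<le> order_at_0 g" using powr_compare[OF c(1)] by (simp add: 2(3))
 qed
qed

lemma order_le_iff:
 assumes "dfun1 g" shows "order_at_0 g \<le> ereal r \<longleftrightarrow> (\<exists>c>0. (EV t. c * t powr r \<le> \<bar>g t\<bar>))"
proof (cases rule: order_cases[OF assms])
 case 1
 have "\<not> (EV t. c * t powr r \<le> \<bar>g t\<bar>)" if "c > 0" for c
 proof
  assume "EV t. c * t powr r \<le> \<bar>g t\<bar>"
  then have "EV t. False" using 1(1) powr_pos_ev[of r]
   by eventually_elim (use that in \<open>simp add: mult_le_0_iff\<close>)
  then show False by simp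
 qed
 then show ?thesis using 1(2) by auto
next
 case (2 s)
 obtain c C where c: "c > 0" "C > 0" "EV t. c * t powr s \<le> \<bar>g t\<bar> \<and> \<bar>g t\<bar> \<le> C * t powr s"
  by (rule ord_is_bounds[OF 2(2)])
 show ?thesis
 proof
  assume "order_at_0 g \<le> ereal r"
  then have "s \<le> r" by (simp add: 2(3))
  have "EV t. c * t powr r \<le> \<bar>g t\<bar>" using c(3) ev_pos ev_less[OF zero_less_one]
  proof eventually_elim
   case (elim t)
   have "t powr r \<le> t powr s" using elim \<open>s \<le> r\<close> by (intro powr_mono') auto
   then show ?case using elim c(1) by (smt (verit) mult_left_mono)
  qed
  then show "\<exists>c>0. (EV t. c * t powr r \<le> \<bar>g t\<bar>)" using c(1) by blast
 next
  assume "\<exists>c>0. (EV t. c * t powr r \<le> \<bar>g t\<bar>)"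
  then obtain d where D: "d > 0" "EV t. d * t powr r \<le> \<bar>g t\<bar>" by blast
  have "EV t. d * t powr r \<le> C * t powr s" using c(3) D(2) by eventually_elim simp
  then show "order_at_0 g \<le> ereal r" using powr_compare[OF D(1)] by (simp add: 2(3))
 qed
qed

lemma order_gt_small:
 assumes "dfun1 g" "ereal r < order_at_0 g" "\<epsilon> > 0" shows "EV t. \<bar>g t\<bar> < \<epsilon> * t powr r"
proof -
 obtain s where s: "r < s" "ereal s \<le> order_at_0 g"
  using assms(2) ereal_dense2[OF assms(2)] by (metis less_ereal.simps(1) less_imp_le)
 then obtain C where C: "EV t. \<bar>g t\<bar> \<le> C * t powr s" using order_ge_iff[OF assms(1)] by blast
 have "((\<lambda>t. C * t powr (s - r)) \<longlongrightarrow> 0) (at_right 0)" using s(1) by real_asymp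
 then have "EV t. C * t powr (s - r) < \<epsilon>" using assms(3) by (rule order_tendstoD)
 then show ?thesis using C ev_pos by eventually_elim (auto simp: powr_diff field_simps)
qed

lemma order_lt_large:
 assumes "dfun1 g" "order_at_0 g < ereal r" shows "EV t. \<bar>g t\<bar> > K * t powr r"
proof -
 obtain s where s: "s < r" "order_at_0 g \<le> ereal s"
  using assms(2) ereal_dense2[OF assms(2)] by (metis less_ereal.simps(1) less_imp_le)
 then obtain c where c: "c > 0" "EV t. \<bar>g t\<bar> \<ge> c * t powr s" using order_le_iff[OF assms(1)] by blast
 have "((\<lambda>t. K * t powr (r - s)) \<longlongrightarrow> 0) (at_right 0)" using s(1) by real_asymp
 then have "EV t. K * t powr (r - s) < c" using c(1) by (rule order_tendstoD)
 then show ?thesis using c(2) ev_pos by eventually_elim (auto simp: powr_diff field_simps)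
qed


lemma order_antimono:
 assumes "dfun1 g" "dfun1 h" "EV t. \<bar>g t\<bar> \<le> C * \<bar>h t\<bar>" shows "order_at_0 h \<le> order_at_0 g"
proof (cases rule: order_cases[OF assms(1)])
 case (2 r)
 obtain c where c: "c > 0" "EV t. c * t powr r \<le> \<bar>g t\<bar>"
  using ord_is_bounds[OF 2(2)] by (auto simp: eventually_conj_iff)
 define C' where "C' = max C 1"
 have "EV t. c / C' * t powr r \<le> \<bar>h t\<bar>" using c(2) assms(3)
 proof eventually_elim
  case (elim t)
  have "C * \<bar>h t\<bar> \<le> C' * \<bar>h t\<bar>" unfolding C'_def by (intro mult_right_mono) auto
  with elim have "c * t powr r \<le> C' * \<bar>h t\<bar>" by linarith
  moreover have "C' > 0" by (simp add: C'_def)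
  ultimately show ?case by (simp add: field_simps)
 qed
 moreover have "c / C' > 0" using c(1) by (simp add: C'_def)
 ultimately show ?thesis using order_le_iff[OF assms(2), of r] 2(3) by auto
qed simp

lemma order_abs: "dfun1 g \<Longrightarrow> order_at_0 (\<lambda>t. \<bar>g t\<bar>) = order_at_0 g"
proof -
 assume g: "dfun1 g"
 then have g': "dfun1 (\<lambda>t. \<bar>g t\<bar>)" unfolding dfun1_def by (intro dint)
 show ?thesis using order_antimono[OF g g', of 1] order_antimono[OF g' g, of 1] by (simp add: antisym)
qed

lemma ord_is_pw: "c \<noteq> 0 \<Longrightarrow> ord_is (\<lambda>t. c * pw q t) q"
proof -
 assume "c \<noteq> 0"
 have "EV t. c = c * pw q t / t powr q" using ev_pos by eventually_elim (simp add: pw_def)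
 then have "((\<lambda>t. c * pw q t / t powr q) \<longlongrightarrow> c) (at_right 0)"
  by (rule Lim_transform_eventually[OF tendsto_const])
 then show ?thesis using \<open>c \<noteq> 0\<close> by (auto simp: ord_is_def)
qed

lemma pw_ev: "EV t. pw q t = t powr q"
 using ev_pos by eventually_elim (simp add: pw_def)

text \<open>With infinitely many orders, a whole interval of exponents would occur. Exponents whose
  difference is 1 / log 2 l can be recognised definably, by comparing how members of the family
  scale under l; so a function of l that grows like a logarithm would be definable, which
  \<open>not_slowly_varying\<close> excludes.\<close>

lemma finite_orders:
 assumes D: "dfun2 D" shows "finite (range (\<lambda>c. order_at_0 (D c)))"
proof -
 define E where "E c \<longleftrightarrow> \<not> (EV t. D c t = 0)" for c
 have Dc: "dfun1 (D c)" for c unfolding dfun1_def by (intro dint dfun2_app[OF D])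
 define m where "m c = (SOME r. ord_is (D c) r)" for c
 have m: "ord_is (D c) (m c)" if "E c" for c
  using exists_order[OF Dc] that unfolding m_def E_def by (metis someI)
 have lim: "((\<lambda>t. D c (l * t) / D c t) \<longlongrightarrow> l powr m c) (at_right 0)" if El: "E c" "l > 0" for c l
 proof -
  obtain a where a: "a \<noteq> 0" "((\<lambda>t. D c t / t powr m c) \<longlongrightarrow> a) (at_right 0)"
   using m[OF El(1)] by (auto simp: ord_is_def)
  have "filterlim (\<lambda>t. l * t) (at_right 0) (at_right 0)" using El(2) by real_asymp
  from filterlim_compose[OF a(2) this]
  have "((\<lambda>t. (D c (l * t) / (l * t) powr m c) / (D c t / t powr m c) * l powr m c) \<longlongrightarrow> a / a * l powr m c) (at_right 0)"
   by (intro tendsto_intros a)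
  moreover have "EV t. (D c (l * t) / (l * t) powr m c) / (D c t / t powr m c) * l powr m c = D c (l * t) / D c t"
   using ev_pos by eventually_elim (use El(2) in \<open>simp add: powr_mult\<close>)
  ultimately show ?thesis using a(1) by (simp add: Lim_transform_eventually)
 qed
 have nontriv: "at_right (0::real) \<noteq> bot" by (simp add: trivial_limit_at_right_real)
 define R where "R l c y \<longleftrightarrow> ((\<lambda>t. D c (l * t) / D c t) \<longlongrightarrow> y) (at_right 0)" for l c y
 have R: "R l c y \<longleftrightarrow> y = l powr m c" if "E c" "l > 0" for l c y
  using lim[OF that] tendsto_unique[OF nontriv] unfolding R_def by blast
 \<comment> \<open>An exponent m is encoded by 2 powr m, which is a limit of ratios of the family
   and therefore definable.\<close>
 define X where "X y \<longleftrightarrow> (\<exists>c. E c \<and> R 2 c y)" for y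
 have X: "X y \<longleftrightarrow> (\<exists>c. E c \<and> y = 2 powr m c)" for y unfolding X_def using R by auto
 have dX: "drel1 X" unfolding drel1_def X_def E_def R_def by (intro dint dfun2_app[OF D])
 have "finite {y. X y}"
 proof (rule ccontr)
  assume "infinite {y. X y}"
  then obtain x1 x2 where x: "x1 < x2" "\<And>y. y \<in> {x1..x2} \<Longrightarrow> X y" using infinite_imp_interval[OF dX] by blast
  have "x1 > 0" using x(2)[of x1] x(1) by (auto simp: X)
  \<comment> \<open>If x1 and y encode m1 and m2, the last clauses say l powr m2 = 2 * l powr m1,
    that is m2 - m1 = 1 / log 2 l. So y = x1 * 2 powr (1 / log 2 l) is obtained without a definable
    logarithm.\<close>
  define Y where "Y l y \<longleftrightarrow> x1 < y \<and> y \<le> x2 \<and> (\<exists>c1 c2 p. E c1 \<and> E c2 \<and> R 2 c1 x1 \<and> R 2 c2 y \<and> R l c1 p \<and> R l c2 (2 * p))" for l y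
  have dY: "drel2 Y" unfolding drel2_def Y_def E_def R_def by (intro dint dfun2_app[OF D])
  define h where "h l = x1 * 2 powr (1 / log 2 l)" for l
  have Y: "Y l y \<longleftrightarrow> y = h l" if l: "l > 1" "h l \<le> x2" for l y
  proof
   assume "Y l y"
   then obtain c1 c2 where c: "x1 < y" "y \<le> x2" "E c1" "E c2" "x1 = 2 powr m c1" "y = 2 powr m c2"
    "l powr m c2 = 2 * l powr m c1" using l(1) by (auto simp: Y_def R)
   have "log 2 (l powr m c2) = log 2 (2 * l powr m c1)" by (simp add: c(7))
   then have "m c2 * log 2 l = 1 + m c1 * log 2 l" using l(1) by (simp add: log_powr log_mult)
   moreover have "log 2 l > 0" using l(1) by simp
   ultimately have "m c2 = m c1 + 1 / log 2 l" by (simp add: field_simps)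
   then show "y = h l" by (simp add: c h_def powr_add)
  next
   assume y: "y = h l"
   have ll: "log 2 l > 0" using l(1) by simp
   then have "y > x1" using \<open>x1 > 0\<close> by (simp add: y h_def)
   then obtain c2 where c2: "E c2" "y = 2 powr m c2" using x(2)[of y] l(2) y by (auto simp: X)
   obtain c1 where c1: "E c1" "x1 = 2 powr m c1" using x(2)[of x1] x(1) by (auto simp: X)
   have "2 powr m c2 = 2 powr (m c1 + 1 / log 2 l)" using c1(2) c2(2) by (simp add: y h_def powr_add)
   then have "m c2 = m c1 + 1 / log 2 l" using powr_inj[of 2 "m c2" "m c1 + 1 / log 2 l"] by linarith
   then have "l powr m c2 = l powr m c1 * l powr (1 / log 2 l)" by (simp add: powr_add)
   also have "l powr (1 / log 2 l) = 2"
   proof -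
    have "l powr (1 / log 2 l) = (2 powr log 2 l) powr (1 / log 2 l)" using l(1) by simp
    also have "\<dots> = 2" using ll by (simp add: powr_powr del: powr_log_cancel)
    finally show ?thesis .
   qed
   finally have "l powr m c2 = 2 * l powr m c1" by simp
   then have "\<exists>c1 c2 p. E c1 \<and> E c2 \<and> R 2 c1 x1 \<and> R 2 c2 y \<and> R l c1 p \<and> R l c2 (2 * p)"
    using c1 c2 l(1) by (intro exI[of _ c1] exI[of _ c2] exI[of _ "l powr m c1"]) (simp add: R)
   then show "Y l y" using \<open>y > x1\<close> y l(2) by (simp add: Y_def)
  qed
  \<comment> \<open>k grows like a constant multiple of the logarithm: it is unbounded, but k (2 *
    l) / k l tends to 1.\<close>
  define k where "k l = 1 / (the0 (Y l) / x1 - 1)" for l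
  have dk: "dfun1 k" unfolding dfun1_def k_def by (intro dint drel2_app[OF dY])
  have "(h \<longlongrightarrow> x1 * 2 powr 0) at_top" unfolding h_def by real_asymp
  then have "\<forall>\<^sub>F l in at_top. h l < x2" using x(1) by (intro order_tendstoD(2)[of h x1]) simp_all
  then have keq: "\<forall>\<^sub>F l in at_top. 1 / (2 powr (1 / log 2 l) - 1) = k l" using eventually_gt_at_top[of 1]
  proof eventually_elim
   case (elim l)
   then have "the0 (Y l) = h l" by (intro the0_eq) (simp_all add: Y)
   then show ?case using \<open>x1 > 0\<close> by (simp add: k_def h_def)
  qed
  have "filterlim (\<lambda>l::real. 1 / (2 powr (1 / log 2 l) - 1)) at_top at_top" by real_asymp
  then have klim: "filterlim k at_top at_top" using keq by (simp cong: filterlim_cong)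
  have "((\<lambda>l::real. (1 / (2 powr (1 / log 2 (2 * l)) - 1)) / (1 / (2 powr (1 / log 2 l) - 1))) \<longlongrightarrow>
    inverse (ln 2) * inverse (ln 2) * (ln 2 * ln 2)) at_top" by real_asymp
  moreover have "inverse (ln 2) * inverse (ln 2) * (ln 2 * ln 2) = (1::real)" by (simp add: field_simps)
  ultimately have "((\<lambda>l::real. (1 / (2 powr (1 / log 2 (2 * l)) - 1)) / (1 / (2 powr (1 / log 2 l) - 1))) \<longlongrightarrow> 1) at_top"
   by (simp only:)
  then have "((\<lambda>l. k (2 * l) / k l) \<longlongrightarrow> 1) at_top"
  proof (rule Lim_transform_eventually)
   have "filterlim (\<lambda>l::real. 2 * l) at_top at_top" by real_asymp
   from eventually_compose_filterlim[OF keq this]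
   show "\<forall>\<^sub>F l in at_top. (1 / (2 powr (1 / log 2 (2 * l)) - 1)) / (1 / (2 powr (1 / log 2 l) - 1)) = k (2 * l) / k l"
    using keq by eventually_elim simp
  qed
  then show False by (rule not_slowly_varying[OF dk klim])
 qed
 moreover have "range (\<lambda>c. order_at_0 (D c)) \<subseteq> insert \<infinity> ((\<lambda>y. ereal (log 2 y)) ` {y. X y})"
 proof clarify
  fix c assume "order_at_0 (D c) \<notin> (\<lambda>y. ereal (log 2 y)) ` {y. X y}"
  moreover have "order_at_0 (D c) \<in> (\<lambda>y. ereal (log 2 y)) ` {y. X y}" if "E c"
   using ord_is_order[OF m[OF that]] that by (intro image_eqI[of _ _ "2 powr m c"]) (auto simp: X)
  ultimately have "\<not> E c" by blast
  then show "order_at_0 (D c) = \<infinity>" by (simp add: E_def order_infty)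
 qed
 ultimately show ?thesis by (meson finite.insertI finite_imageI finite_subset)
qed

end

section \<open>Uniform finiteness and piecewise monotonicity\<close>

definition locmax :: "(real \<Rightarrow> real) \<Rightarrow> real \<Rightarrow> bool" where
 "locmax f s \<longleftrightarrow> (\<exists>\<delta>. \<delta> > 0 \<and> (\<forall>s'. \<bar>s' - s\<bar> < \<delta> \<longrightarrow> f s' \<le> f s))"

definition incr_on :: "(real \<Rightarrow> real) \<Rightarrow> real \<Rightarrow> real \<Rightarrow> bool" where
 "incr_on f a b \<longleftrightarrow> (\<forall>s s'. a < s \<longrightarrow> s < s' \<longrightarrow> s' < b \<longrightarrow> f s < f s')"

definition const_on :: "(real \<Rightarrow> real) \<Rightarrow> real \<Rightarrow> real \<Rightarrow> bool" where
 "const_on f a b \<longleftrightarrow> (\<forall>s s'. a < s \<longrightarrow> s < s' \<longrightarrow> s' < b \<longrightarrow> f s = f s')"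

text \<open>For fixed y, the set where f is at most f y is closed by continuity and open because
  each of its points is a local maximum; so it is the whole interval, for every y.\<close>

lemma all_locmax_const:
 assumes cont: "continuous_on {a<..<b} f" and max: "\<And>s. s \<in> {a<..<b} \<Longrightarrow> locmax f s" shows "const_on f a b"
proof -
 have le: "f x \<le> f y" if xy: "x \<in> {a<..<b}" "y \<in> {a<..<b}" for x y
 proof -
  define W where "W = {s \<in> {a<..<b}. f s \<le> f y}"
  have "openin (top_of_set {a<..<b}) W"
  proof (subst openin_contains_ball, intro conjI ballI)
   fix s assume s: "s \<in> W"
   then obtain \<delta> where "\<delta> > 0" "\<And>s'. \<bar>s' - s\<bar> < \<delta> \<Longrightarrow> f s' \<le> f s"
    using max[of s] by (auto simp: W_def locmax_def)
   moreover from this have "f x \<le> f y" if "\<bar>x - s\<bar> < \<delta>" for x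
    using s that by (auto simp: W_def intro: order_trans[of "f x" "f s"])
   ultimately show "\<exists>e>0. ball s e \<inter> {a<..<b} \<subseteq> W"
    by (intro exI[of _ \<delta>]) (auto simp: W_def dist_real_def abs_minus_commute)
  qed (auto simp: W_def)
  moreover have "closedin (top_of_set {a<..<b}) W"
   using continuous_closedin_preimage[OF cont, of "{..f y}"] by (simp add: W_def Int_def vimage_def)
  moreover have "connected {a<..<b}" by simp
  moreover have "y \<in> W" using xy by (simp add: W_def)
  ultimately have "W = {a<..<b}" using connected_clopen by (metis empty_iff)
  then have "x \<in> W" using xy(1) by (simp only:)
  then show ?thesis by (simp add: W_def)
 qed
 show ?thesis unfolding const_on_def using le by (auto intro!: antisym)
qed

text \<open>If f s = f s', a maximum or minimum over [s, s'] would be attained inside, unless both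
  are attained at the ends; then f is constant on [s, s'] and the midpoint is a local
  maximum.\<close>

lemma no_extremum_inj:
 assumes cont: "continuous_on {a<..<b} f"
  and max: "\<And>s. s \<in> {a<..<b} \<Longrightarrow> \<not> locmax f s" and min: "\<And>s. s \<in> {a<..<b} \<Longrightarrow> \<not> locmax (\<lambda>s. - f s) s"
 shows "inj_on f {a<..<b}"
proof -
 have False if s: "a < s" "s < s'" "s' < b" "f s = f s'" for s s'
 proof -
  have c: "continuous_on {s..s'} f" by (rule continuous_on_subset[OF cont]) (use s in auto)
  obtain p where p: "p \<in> {s..s'}" "\<And>y. y \<in> {s..s'} \<Longrightarrow> f y \<le> f p"
   using continuous_attains_sup[OF compact_Icc _ c] s by auto
  obtain q where q: "q \<in> {s..s'}" "\<And>y. y \<in> {s..s'} \<Longrightarrow> f q \<le> f y"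
   using continuous_attains_inf[OF compact_Icc _ c] s by auto
  have loc: "locmax h p" if "s < p" "p < s'" "\<And>y. y \<in> {s..s'} \<Longrightarrow> h y \<le> h p" for h p
   unfolding locmax_def using that
   by (intro exI[of _ "min (p - s) (s' - p)"]) (auto simp: abs_if split: if_splits)
  have p': "p = s \<or> p = s'" using loc[of p f] max[of p] p s by force
  have q': "q = s \<or> q = s'" using loc[of q "\<lambda>s. - f s"] min[of q] q s by force
  have feq: "f y = f s" if "y \<in> {s..s'}" for y using p(2)[OF that] q(2)[OF that] p' q' \<open>f s = f s'\<close> by auto
  have "f y \<le> f ((s + s') / 2)" if "y \<in> {s..s'}" for y
   using feq[OF that] feq[of "(s + s') / 2"] s by simp
  then have "locmax f ((s + s') / 2)" using s by (intro loc) simp_all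
  then show False using max[of "(s + s') / 2"] s by auto
 qed
 then show ?thesis by (auto intro!: linorder_inj_onI)
qed

text \<open>On triples of points f is monotone. Comparing any pair with two outer points p and q
  shows that its direction is that of the pair p, q.\<close>

lemma inj_incr_or_decr:
 assumes cont: "continuous_on {a<..<b} f" and inj: "inj_on f {a<..<b}"
 shows "incr_on f a b \<or> incr_on (\<lambda>s. - f s) a b"
proof (rule ccontr)
 assume "\<not> ?thesis"
 then obtain s1 s2 s3 s4 where s: "a < s1" "s1 < s2" "s2 < b" "a < s3" "s3 < s4" "s4 < b"
  "\<not> f s1 < f s2" "\<not> f s4 < f s3" unfolding incr_on_def by auto
 define p where "p = (a + min s1 s3) / 2"
 define q where "q = (max s2 s4 + b) / 2"
 have pq: "a < p" "p < s1" "p < s3" "q < b" "s2 < q" "s4 < q"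
  using s by (auto simp: p_def q_def min_def max_def)
 have mono: "(f x < f y \<and> f y < f z) \<or> (f z < f y \<and> f y < f x)" if "p \<le> x" "x < y" "y < z" "z \<le> q" for x y z
 proof -
  have "{x..z} \<subseteq> {a<..<b}" using that pq by auto then show ?thesis
   by (intro continuous_inj_imp_mono that continuous_on_subset[OF cont] inj_on_subset[OF inj])
 qed
 show False using mono[of p s1 s2] mono[of p s3 s4] mono[of p s1 q] mono[of p s3 q] s pq by linarith
qed

section \<open>Uniform finiteness of fibres and piecewise monotonicity\<close>

context ominimal_structure
begin

lemma dpred_frontier [dint]:
 assumes "dpred (\<lambda>e. P (\<lambda>i. e (Suc i)) (e 0))" "dterm a" shows "dpred (\<lambda>e. a e \<in> frontier {y. P e y})"
proof -
 have *: "dpred (\<lambda>e. P (\<lambda>i. e (Suc (Suc i))) (e 0))"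
  using dpred_reindex[OF assms(1), of "\<lambda>i. if i = 0 then 0 else Suc i"] by simp
 have **: "dterm (\<lambda>e. a (\<lambda>i. e (Suc (Suc i))))" by (rule dterm_shift[OF assms(2)])
 have "dpred (\<lambda>e. \<forall>\<delta>. \<delta> > 0 \<longrightarrow> (\<exists>y. \<bar>y - a e\<bar> < \<delta> \<and> P e y) \<and> (\<exists>y. \<bar>y - a e\<bar> < \<delta> \<and> \<not> P e y))"
  by (intro dint * **)
 moreover have "a e \<in> frontier {y. P e y} \<longleftrightarrow>
   (\<forall>\<delta>. \<delta> > 0 \<longrightarrow> (\<exists>y. \<bar>y - a e\<bar> < \<delta> \<and> P e y) \<and> (\<exists>y. \<bar>y - a e\<bar> < \<delta> \<and> \<not> P e y))" for e
  unfolding frontier_closures closure_approachable Int_iff by (auto simp: dist_real_def Bex_def)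
 ultimately show ?thesis by simp
qed

lemma dpred_locmax [dint]:
 assumes "dterm (\<lambda>e. f (\<lambda>i. e (Suc i)) (e 0))" "dterm a" shows "dpred (\<lambda>e. locmax (f e) (a e))"
proof -
 have *: "dterm (\<lambda>e. f (\<lambda>i. e (Suc (Suc i))) (e 0))"
  using dterm_shift[OF assms(1), of "\<lambda>i. if i = 0 then 0 else Suc i"] by simp
 have **: "dterm (\<lambda>e. a (\<lambda>i. e (Suc (Suc i))))" by (rule dterm_shift[OF assms(2)])
 have "dterm (\<lambda>e. f e (a e))"
  using dterm_subst[OF assms(1), of "\<lambda>i. case i of 0 \<Rightarrow> a | Suc i \<Rightarrow> \<lambda>e. e i"] assms(2) dterm_var
  by (simp split: nat.splits)
 then have shifted: "dterm (\<lambda>e. f (\<lambda>i. e (Suc (Suc i))) (a (\<lambda>i. e (Suc (Suc i)))))" by (rule dterm_shift)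
 show ?thesis unfolding locmax_def by (intro dint * ** shifted)
qed

lemma dpred_incr_on [dint]:
 assumes "dterm (\<lambda>e. f (\<lambda>i. e (Suc i)) (e 0))" "dterm a" "dterm b"
 shows "dpred (\<lambda>e. incr_on (f e) (a e) (b e))"
proof -
 have *: "dterm (\<lambda>e. f (\<lambda>i. e (Suc (Suc i))) (e 0))" "dterm (\<lambda>e. f (\<lambda>i. e (Suc (Suc i))) (e (Suc 0)))"
  using dterm_shift[OF assms(1), of "\<lambda>i. if i = 0 then 0 else Suc i"]
   dterm_shift[OF assms(1), of "\<lambda>i. if i = 0 then Suc 0 else Suc i"] by simp_all
 have **: "dterm (\<lambda>e. a (\<lambda>i. e (Suc (Suc i))))" "dterm (\<lambda>e. b (\<lambda>i. e (Suc (Suc i))))"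
  by (rule dterm_shift[OF assms(2)], rule dterm_shift[OF assms(3)])
 show ?thesis unfolding incr_on_def by (intro dint * **)
qed

text \<open>
 Outside a countable set of \<open>t\<close>, the number of points of the fibre in each rational interval is
 locally constant.  As ``the fibres at \<open>t\<close> and at \<open>t'\<close> are matched by proximity for all \<open>t'\<close> near
 \<open>t\<close>'' is a definable condition on \<open>t\<close>, it fails for finitely many \<open>t\<close> only.
\<close>

lemma uniform_finiteness:
 assumes A: "drel2 A" and fin: "EV t. finite {y. A t y}" and bd: "EV t. \<forall>y. A t y \<longrightarrow> \<bar>y\<bar> \<le> M"
 shows "\<exists>n. (EV t. card {y. A t y} = n)"
proof -
 obtain \<epsilon> where \<epsilon>: "\<epsilon> > 0" "\<And>t. 0 < t \<Longrightarrow> t < \<epsilon> \<Longrightarrow> finite {y. A t y} \<and> (\<forall>y. A t y \<longrightarrow> \<bar>y\<bar> \<le> M)"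
  using eventually_conj[OF fin bd] by (auto simp: eventually_at_right_field)
 define B where "B t y \<longleftrightarrow> 0 < t \<and> t < \<epsilon> \<and> A t y" for t y
 have dB: "drel2 B" unfolding drel2_def B_def by (intro dint drel2_app[OF A])
 have finB: "finite {y. B t y}" for t using \<epsilon>(2)[of t] by (auto simp: B_def intro: rev_finite_subset)
 have bdB: "\<bar>y\<bar> \<le> M" if "B t y" for t y using \<epsilon>(2)[of t] that by (auto simp: B_def)
 \<comment> \<open>Each point of one fibre has exactly one partner in the other within distance
   \<eta>, and conversely; this is first-order in t and forces equal cardinalities.\<close>
 define near where "near t \<eta> t' \<longleftrightarrow> (\<forall>y. B t y \<longrightarrow> (\<exists>!y'. B t' y' \<and> \<bar>y - y'\<bar> < \<eta>)) \<and>
   (\<forall>y'. B t' y' \<longrightarrow> (\<exists>!y. B t y \<and> \<bar>y - y'\<bar> < \<eta>))" for t \<eta> t'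
 have near_card: "card {y. B t y} = card {y. B t' y}" if nr: "near t \<eta> t'" for t \<eta> t'
 proof (rule bij_betw_same_card)
  define \<phi> where "\<phi> y = (THE y'. B t' y' \<and> \<bar>y - y'\<bar> < \<eta>)" for y
  have \<phi>: "B t' (\<phi> y) \<and> \<bar>y - \<phi> y\<bar> < \<eta>" if "B t y" for y
   unfolding \<phi>_def by (rule theI') (use nr that in \<open>auto simp: near_def\<close>)
  have 1: "\<phi> y = y'" if "B t y" "B t' y'" "\<bar>y - y'\<bar> < \<eta>" for y y'
   using \<phi>[OF that(1)] nr that unfolding near_def by blast
  show "bij_betw \<phi> {y. B t y} {y. B t' y}" unfolding bij_betw_def
  proof (intro conjI inj_onI set_eqI iffI)
   fix y z assume "y \<in> {y. B t y}" "z \<in> {y. B t y}" "\<phi> y = \<phi> z"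
   then show "y = z" using \<phi>[of y] \<phi>[of z] nr unfolding near_def by (metis mem_Collect_eq)
  next
   fix y' assume "y' \<in> {y. B t' y}"
   then obtain y where "B t y" "\<bar>y - y'\<bar> < \<eta>" using nr unfolding near_def by blast
   then show "y' \<in> \<phi> ` {y. B t y}" using 1[of y y'] \<open>y' \<in> {y. B t' y}\<close> by (auto intro!: image_eqI[of _ _ y])
  qed (use \<phi> in auto)
 qed
 define G where "G t \<longleftrightarrow> (\<exists>\<eta>. \<eta> > 0 \<and> (\<exists>\<delta>. \<delta> > 0 \<and> (\<forall>t'. \<bar>t' - t\<bar> < \<delta> \<longrightarrow> near t \<eta> t')))" for t
 \<comment> \<open>Off this countable set, a rational interval with exactly one fibre point, or with
   none, keeps that property for nearby parameters.\<close>
 define Z where "Z = (\<Union>c\<in>\<rat>. \<Union>d\<in>\<rat>. frontier {t. \<exists>!y. B t y \<and> c < y \<and> y < d} \<union> frontier {t. \<exists>y. B t y \<and> c < y \<and> y < d})"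
 have "drel1 (\<lambda>t. \<exists>!y. B t y \<and> c < y \<and> y < d)" "drel1 (\<lambda>t. \<exists>y. B t y \<and> c < y \<and> y < d)" for c d
  unfolding drel1_def by (intro dint drel2_app[OF dB])+
 then have "countable Z"
  unfolding Z_def by (intro countable_UN countable_rat countable_Un countable_finite finite_frontier)
 moreover have "{t. \<not> G t} \<subseteq> Z"
 proof (rule subsetI, rule ccontr)
  fix t assume t: "t \<in> {t. \<not> G t}" "t \<notin> Z"
  have nb: "\<forall>\<^sub>F y in nhds x. P y" if "P x" "x \<notin> frontier {x. P x}" for P and x :: real
  proof -
   have "x \<in> interior {x. P x}" using that closure_subset[of "{x. P x}"] by (auto simp: frontier_def)
   then show "\<forall>\<^sub>F y in nhds x. P y"
    using eventually_nhds_in_open[of "interior {x. P x}" x] interior_subset[of "{x. P x}"]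
    by (auto elim!: eventually_mono)
  qed
  have nb1: "\<forall>\<^sub>F t' in nhds t. \<exists>!y. B t' y \<and> c < y \<and> y < d"
   if "c \<in> \<rat>" "d \<in> \<rat>" "\<exists>!y. B t y \<and> c < y \<and> y < d" for c d
   using that t(2) unfolding Z_def by (intro nb) blast+
  have nb2: "\<forall>\<^sub>F t' in nhds t. \<not> (\<exists>y. B t' y \<and> c < y \<and> y < d)"
   if "c \<in> \<rat>" "d \<in> \<rat>" "\<not> (\<exists>y. B t y \<and> c < y \<and> y < d)" for c d
  proof (rule nb)
   have "t \<notin> frontier {t. \<exists>y. B t y \<and> c < y \<and> y < d}" using that(1,2) t(2) unfolding Z_def by blast
   moreover have "frontier {t. \<not> (\<exists>y. B t y \<and> c < y \<and> y < d)} = frontier {t. \<exists>y. B t y \<and> c < y \<and> y < d}"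
    using frontier_complement[of "{t. \<exists>y. B t y \<and> c < y \<and> y < d}"] by (simp only: Collect_neg_eq)
   ultimately show "t \<notin> frontier {t. \<not> (\<exists>y. B t y \<and> c < y \<and> y < d)}" by simp
  qed (rule that)
  \<comment> \<open>Half the least distance between two fibre points, so that two of them within
    \<eta> of a common point coincide; the inserted 1 covers fibres with at most one point.\<close>
  define \<eta> where "\<eta> = Min (insert 1 ((\<lambda>(y, z). \<bar>y - z\<bar>) ` {(y, z). B t y \<and> B t z \<and> y \<noteq> z})) / 2"
  have "{(y, z). B t y \<and> B t z \<and> y \<noteq> z} \<subseteq> {y. B t y} \<times> {y. B t y}" by auto
  then have fin2: "finite {(y, z). B t y \<and> B t z \<and> y \<noteq> z}" using finB finite_subset by blast
  have \<eta>: "\<eta> > 0" "\<And>y z. B t y \<Longrightarrow> B t z \<Longrightarrow> y \<noteq> z \<Longrightarrow> 2 * \<eta> \<le> \<bar>y - z\<bar>"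
   unfolding \<eta>_def using fin2 by (auto intro!: Min_le)
  have "\<forall>p. \<exists>c d. c \<in> \<rat> \<and> d \<in> \<rat> \<and> p - \<eta> < c \<and> c < p \<and> p < d \<and> d < p + \<eta>"
   using Rats_dense_in_real \<eta>(1) by (metis diff_gt_0_iff_gt less_add_same_cancel1 diff_add_cancel)
  then obtain c d where cd: "\<And>p. c p \<in> \<rat>" "\<And>p. d p \<in> \<rat>" "\<And>p. p - \<eta> < c p" "\<And>p. c p < p" "\<And>p. p < d p" "\<And>p. d p < p + \<eta>"
   by metis
  have ex1: "\<exists>!y. B t y \<and> c p < y \<and> y < d p" if "B t p" for p
  proof (rule ex1I[of _ p])
   fix y assume y: "B t y \<and> c p < y \<and> y < d p"
   then have "\<bar>y - p\<bar> < 2 * \<eta>" using cd(3,6)[of p] by (auto simp: abs_if)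
   then show "y = p" using \<eta>(2)[of y p] y that by force
  qed (use that cd in auto)
  have ev1: "\<forall>\<^sub>F t' in nhds t. \<forall>p\<in>{p. B t p}. \<exists>!y. B t' y \<and> c p < y \<and> y < d p"
   by (intro eventually_ball_finite finB ballI nb1 cd ex1) simp
  \<comment> \<open>No new fibre points may appear away from the old ones. Every p has a
    neighbourhood in which this holds for nearby parameters, and compactness of [-M, M] leaves
    finitely many neighbourhoods to consider.\<close>
  define Q where "Q c' d' t' \<longleftrightarrow> (\<forall>y. B t' y \<longrightarrow> c' < y \<longrightarrow> y < d' \<longrightarrow> (\<exists>q. B t q \<and> c q < y \<and> y < d q))" for c' d' t'
  have "\<exists>c' d'. c' < p \<and> p < d' \<and> (\<forall>\<^sub>F t' in nhds t. Q c' d' t')" for p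
  proof (cases "B t p")
   case True
   then show ?thesis using cd(4,5)[of p] by (intro exI[of _ "c p"] exI[of _ "d p"]) (auto simp: Q_def intro!: always_eventually)
  next
   case False
   have "closed {y. B t y}" using finB by (rule finite_imp_closed)
   then obtain e where e: "e > 0" "ball p e \<subseteq> - {y. B t y}"
    using False open_contains_ball[of "- {y. B t y}"] by auto
   obtain c' where c': "c' \<in> \<rat>" "p - e < c'" "c' < p" using Rats_dense_in_real[of "p - e" p] e(1) by auto
   obtain d' where d': "d' \<in> \<rat>" "p < d'" "d' < p + e" using Rats_dense_in_real[of p "p + e"] e(1) by auto
   have "\<not> (\<exists>y. B t y \<and> c' < y \<and> y < d')" using c' d' e(2) by (force simp: dist_real_def)
   from nb2[OF c'(1) d'(1) this] show ?thesis
    using c' d' by (intro exI[of _ c'] exI[of _ d']) (auto simp: Q_def elim!: eventually_mono)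
  qed
  then have "\<forall>p. \<exists>c' d'. c' < p \<and> p < d' \<and> (\<forall>\<^sub>F t' in nhds t. Q c' d' t')" by (rule allI)
  then obtain c' d' where cd': "\<And>p. c' p < p" "\<And>p. p < d' p" "\<And>p. \<forall>\<^sub>F t' in nhds t. Q (c' p) (d' p) t'"
   unfolding choice_iff by blast
  have "p \<in> {c' p<..<d' p}" for p using cd'(1,2)[of p] by simp
  then have cov: "{-M..M} \<subseteq> (\<Union>p\<in>{-M..M}. {c' p<..<d' p})" by blast
  obtain K where K: "finite K" "{-M..M} \<subseteq> (\<Union>p\<in>K. {c' p<..<d' p})"
   by (rule compactE_image[OF compact_Icc _ cov]) simp_all
  have "\<forall>\<^sub>F t' in nhds t. \<forall>p\<in>K. Q (c' p) (d' p) t'" by (intro eventually_ball_finite K ballI cd')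
  then have "\<forall>\<^sub>F t' in nhds t. near t \<eta> t'" using ev1
  proof eventually_elim
   case (elim t')
   have cover: "\<exists>q. B t q \<and> c q < y \<and> y < d q" if "B t' y" for y
   proof -
    have "y \<in> {-M..M}" using bdB[OF that] by (auto simp: abs_le_iff)
    then obtain p where "p \<in> K" "c' p < y" "y < d' p" using K(2) by auto
    then show ?thesis using elim(1) that unfolding Q_def by blast
   qed
   have close: "\<bar>q - y\<bar> < \<eta>" if "c q < y" "y < d q" for q y
    using cd(3,6)[of q] that by (auto simp: abs_if)
   have same: "p = q" if "B t p" "B t q" "\<bar>p - y\<bar> < \<eta>" "\<bar>q - y\<bar> < \<eta>" for p q y
    using \<eta>(2)[OF that(1,2)] that(3,4) by (smt (verit))
   show "near t \<eta> t'" unfolding near_def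
   proof (intro conjI allI impI)
    fix y assume y: "B t y"
    then obtain y' where y': "B t' y'" "c y < y'" "y' < d y"
     "\<And>z. B t' z \<Longrightarrow> c y < z \<Longrightarrow> z < d y \<Longrightarrow> z = y'" using elim(2) by blast
    show "\<exists>!y'. B t' y' \<and> \<bar>y - y'\<bar> < \<eta>"
    proof (rule ex1I[of _ y'])
     show "B t' y' \<and> \<bar>y - y'\<bar> < \<eta>" using y'(1-3) close by blast
     fix z assume z: "B t' z \<and> \<bar>y - z\<bar> < \<eta>"
     then obtain q where q: "B t q" "c q < z" "z < d q" using cover by blast
     then have "q = y" using same[of q y z] close y z by blast
     then show "z = y'" using y'(4) z q by blast
    qed
   next
    fix y' assume "B t' y'"
    then obtain q where q: "B t q" "c q < y'" "y' < d q" using cover by blast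
    then show "\<exists>!y. B t y \<and> \<bar>y - y'\<bar> < \<eta>" using close same by (intro ex1I[of _ q]) blast+
   qed
  qed
  then have "G t" unfolding G_def eventually_nhds_metric dist_real_def using \<eta>(1) by blast
  then show False using t(1) by simp
 qed
 ultimately have "countable {t. \<not> G t}" by (rule countable_subset[rotated])
 moreover have dG: "drel1 (\<lambda>t. \<not> G t)" unfolding drel1_def G_def near_def by (intro dint drel2_app[OF dB])
 ultimately have finG: "finite {t. \<not> G t}" by (intro countable_imp_finite)
 have "ev G"
 proof -
  have "ev G \<or> (EV t. \<not> G t)" using ev_dichotomy_right[OF dG, of 0] by auto
  moreover have "\<not> (EV t. \<not> G t)"
  proof
   assume "EV t. \<not> G t"
   then obtain b where "b > 0" "\<forall>y>0. y < b \<longrightarrow> \<not> G y" by (auto simp: eventually_at_right_field)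
   moreover from this have "{0<..<b} \<subseteq> {t. \<not> G t}" by auto
   ultimately show False using finG finite_subset infinite_Ioo[of 0 b] by blast
  qed
  ultimately show ?thesis by blast
 qed
 then obtain b where b: "b > 0" "\<And>t. 0 < t \<Longrightarrow> t < b \<Longrightarrow> G t" by (auto simp: eventually_at_right_field)
 define N where "N t = card {y. B t y}" for t
 have const: "N t = N t'" if "t \<in> {0<..<b}" "t' \<in> {0<..<b}" for t t'
 proof (rule connected_local_const[OF _ that])
  show "\<forall>a\<in>{0<..<b}. \<forall>\<^sub>F t in at a within {0<..<b}. N a = N t"
  proof
   fix a assume "a \<in> {0<..<b}"
   then obtain \<eta> \<delta> where "\<delta> > 0" "\<And>t'. \<bar>t' - a\<bar> < \<delta> \<Longrightarrow> near a \<eta> t'" using b(2)[of a] by (auto simp: G_def)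
   then show "\<forall>\<^sub>F t in at a within {0<..<b}. N a = N t"
    unfolding eventually_at N_def using near_card by (intro exI[of _ \<delta>]) (auto simp: dist_real_def)
  qed
 qed simp
 have "EV t. card {y. A t y} = N (b / 2)" using ev_pos ev_less[OF b(1)] ev_less[OF \<epsilon>(1)]
 proof eventually_elim
  case (elim t)
  then have "card {y. A t y} = N t" by (simp add: N_def B_def)
  also have "\<dots> = N (b / 2)" using elim b(1) by (intro const) auto
  finally show ?case .
 qed
 then show ?thesis by blast
qed

definition mono_piece :: "(real \<Rightarrow> real \<Rightarrow> real) \<Rightarrow> (real \<Rightarrow> real) \<Rightarrow> (real \<Rightarrow> real) \<Rightarrow> bool" where
 "mono_piece g a b \<longleftrightarrow> dfun1 a \<and> dfun1 b \<and> (EV t. a t < b t) \<and>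
   ((EV t. incr_on (g t) (a t) (b t)) \<or> (EV t. incr_on (\<lambda>s. - g t s) (a t) (b t)) \<or>
   (EV t. const_on (g t) (a t) (b t)))"

text \<open>Between frontier points, being a local maximum is a constant property along the
  interval, and likewise for minima. If all points are extrema of one kind, g is constant; if there
  are no extrema, g is injective and hence strictly monotone. Which case occurs might still vary
  with t, and the dichotomy settles it.\<close>

lemma mono_pieceI:
 assumes g: "dfun2 g" and lo: "dfun1 lo" and hi: "dfun1 hi" and le: "EV t. lo t < hi t"
  and cont: "EV t. continuous_on {lo t<..<hi t} (g t)"
  and max: "EV t. {lo t<..<hi t} \<inter> frontier {y. locmax (g t) y} = {}"
  and min: "EV t. {lo t<..<hi t} \<inter> frontier {y. locmax (\<lambda>s. - g t s) y} = {}"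
 shows "mono_piece g lo hi"
proof -
 have 1: "EV t. incr_on (g t) (lo t) (hi t) \<or> incr_on (\<lambda>s. - g t s) (lo t) (hi t) \<or> const_on (g t) (lo t) (hi t)"
  using cont max min
 proof eventually_elim
  case (elim t)
  have c2: "continuous_on {lo t<..<hi t} (\<lambda>s. - g t s)" by (intro continuous_on_minus elim)
  from interval_dichotomy[OF _ elim(2)] interval_dichotomy[OF _ elim(3)]
  consider "\<forall>s\<in>{lo t<..<hi t}. locmax (g t) s" | "\<forall>s\<in>{lo t<..<hi t}. locmax (\<lambda>s. - g t s) s"
   | "\<forall>s\<in>{lo t<..<hi t}. \<not> locmax (g t) s" "\<forall>s\<in>{lo t<..<hi t}. \<not> locmax (\<lambda>s. - g t s) s" by auto
  then show ?case
  proof cases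
   case 1
   then show ?thesis using all_locmax_const[OF elim(1)] by blast
  next
   case 2
   then have "const_on (\<lambda>s. - g t s) (lo t) (hi t)" using all_locmax_const[OF c2] by blast
   then show ?thesis by (simp add: const_on_def)
  next
   case 3
   then show ?thesis using no_extremum_inj[OF elim(1)] inj_incr_or_decr[OF elim(1)] by blast
  qed
 qed
 have d: "drel1 (\<lambda>t. incr_on (g t) (lo t) (hi t))" "drel1 (\<lambda>t. incr_on (\<lambda>s. - g t s) (lo t) (hi t))"
  unfolding drel1_def by (intro dint dfun2_app[OF g] dfun1_app[OF lo] dfun1_app[OF hi])+
 have "EV t. const_on (g t) (lo t) (hi t)"
  if "EV t. \<not> incr_on (g t) (lo t) (hi t)" "EV t. \<not> incr_on (\<lambda>s. - g t s) (lo t) (hi t)"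
  using 1 that by eventually_elim blast then show ?thesis
  unfolding mono_piece_def using lo hi le ev_dichotomy_right[OF d(1), of 0] ev_dichotomy_right[OF d(2), of 0] by blast
qed

text \<open>The cuts are the frontier points of the sets of local extrema and not the extrema
  themselves, which may fill intervals. Their number is eventually constant, and the induction
  splits off the smallest one.\<close>

lemma mono_piece_chain:
 assumes g: "dfun2 g" and lo: "dfun1 lo" and hi: "dfun1 hi" and le: "EV t. lo t < hi t"
  and cont: "EV t. continuous_on {lo t<..<hi t} (g t)"
  and bd: "EV t. - M \<le> lo t \<and> hi t \<le> M"
 shows "(mono_piece g)\<^sup>+\<^sup>+ lo hi"
proof -
 define B where "B t y \<longleftrightarrow> y \<in> frontier {y. locmax (g t) y} \<or> y \<in> frontier {y. locmax (\<lambda>s. - g t s) y}" for t y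
 have dB: "drel2 B" unfolding drel2_def B_def by (intro dint dfun2_app[OF g])
 have finB: "finite {y. B t y}" for t
 proof -
  have "drel1 (\<lambda>y. locmax (g t) y)" "drel1 (\<lambda>y. locmax (\<lambda>s. - g t s) y)"
   unfolding drel1_def by (intro dint dfun2_app[OF g])+
  then have "finite (frontier {y. locmax (g t) y} \<union> frontier {y. locmax (\<lambda>s. - g t s) y})"
   by (intro finite_UnI finite_frontier)
  then show ?thesis by (simp add: B_def Un_def)
 qed
 have "(mono_piece g)\<^sup>+\<^sup>+ lo hi" if "EV t. card {y. lo t < y \<and> y < hi t \<and> B t y} = n" for n
  using that lo le cont bd
 proof (induction n arbitrary: lo)
  case 0
  have "EV t. {y. lo t < y \<and> y < hi t \<and> B t y} = {}" using 0(1)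
  proof eventually_elim
   case (elim t)
   have "finite {y. lo t < y \<and> y < hi t \<and> B t y}" by (rule rev_finite_subset[OF finB[of t]]) auto
   then show ?case using elim by simp
  qed
  then have "mono_piece g lo hi" by (intro mono_pieceI g 0 hi) (auto simp: B_def elim!: eventually_mono)
  then show ?case by (rule tranclp.r_into_trancl[of "mono_piece g"])
 next
  case (Suc n)
  define a where "a t = the0 (\<lambda>y. (lo t < y \<and> y < hi t \<and> B t y) \<and> (\<forall>z. lo t < z \<and> z < hi t \<and> B t z \<longrightarrow> y \<le> z))" for t
  have da: "dfun1 a" unfolding dfun1_def a_def by (intro dint drel2_app[OF dB] dfun1_app[OF Suc.prems(2)] dfun1_app[OF hi])
  have a: "EV t. lo t < a t \<and> a t < hi t \<and> {y. lo t < y \<and> y < a t \<and> B t y} = {} \<and>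
    card {y. a t < y \<and> y < hi t \<and> B t y} = n" using Suc.prems(1)
  proof eventually_elim
   case (elim t)
   define W where "W = {y. lo t < y \<and> y < hi t \<and> B t y}"
   have "card W = Suc n" using elim by (simp add: W_def)
   then have W: "finite W" "W \<noteq> {}" using card.infinite[of W] by (metis nat.distinct(1), force)
   then have m: "Min W \<in> W" "\<And>z. z \<in> W \<Longrightarrow> Min W \<le> z" by auto
   then have at: "a t = Min W" unfolding a_def by (intro the0_eq) (auto simp: W_def intro: antisym)
   have "{y. a t < y \<and> y < hi t \<and> B t y} = W - {Min W}" using m W(1) by (auto simp: at W_def less_le)
   then have "card {y. a t < y \<and> y < hi t \<and> B t y} = n" using elim m(1) by (simp add: W_def[symmetric] card_Diff_singleton)
   moreover have "{y. lo t < y \<and> y < a t \<and> B t y} = {}" using m by (force simp: at W_def)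
   moreover have "a t \<in> W" using m(1) by (simp only: at)
   then have "lo t < a t \<and> a t < hi t" by (simp add: W_def)
   ultimately show ?case by blast
  qed
  have "(mono_piece g)\<^sup>+\<^sup>+ a hi"
  proof (rule Suc.IH[OF _ da])
   show "EV t. continuous_on {a t<..<hi t} (g t)"
    using a Suc.prems(4) by eventually_elim (auto elim: continuous_on_subset)
   show "EV t. - M \<le> a t \<and> hi t \<le> M" using a Suc.prems(5) by eventually_elim auto
  qed (use a in \<open>auto elim: eventually_mono\<close>)
  moreover have "mono_piece g lo a"
  proof (rule mono_pieceI[OF g Suc.prems(2) da])
   show "EV t. continuous_on {lo t<..<a t} (g t)"
    using a Suc.prems(4) by eventually_elim (auto elim: continuous_on_subset)
  qed (use a in \<open>auto simp: B_def elim!: eventually_mono\<close>)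
  ultimately show ?case using tranclp_into_tranclp2[of "mono_piece g" lo a hi] by blast
 qed
 moreover have "\<exists>n. (EV t. card {y. lo t < y \<and> y < hi t \<and> B t y} = n)"
 proof (rule uniform_finiteness[of _ M])
  show "drel2 (\<lambda>t y. lo t < y \<and> y < hi t \<and> B t y)"
   unfolding drel2_def by (intro dint drel2_app[OF dB] dfun1_app[OF lo] dfun1_app[OF hi])
  show "EV t. finite {y. lo t < y \<and> y < hi t \<and> B t y}"
   by (intro always_eventually allI rev_finite_subset[OF finB]) auto
  show "EV t. \<forall>y. lo t < y \<and> y < hi t \<and> B t y \<longrightarrow> \<bar>y\<bar> \<le> M"
   using bd by eventually_elim (auto simp: abs_le_iff)
 qed
 ultimately show ?thesis by blast
qed

end

text \<open>A first-order form of the supremum, so that \<open>the0 (is_lub V)\<close> depends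
  definably on the parameters of \<open>V\<close>.\<close>

definition is_lub :: "(real \<Rightarrow> bool) \<Rightarrow> real \<Rightarrow> bool" where
 "is_lub V z \<longleftrightarrow> (\<forall>y. V y \<longrightarrow> y \<le> z) \<and> (\<forall>z'. (\<forall>y. V y \<longrightarrow> y \<le> z') \<longrightarrow> z \<le> z')"

lemma the0_is_lub:
 assumes "V x" "\<And>y. V y \<Longrightarrow> y \<le> x'" shows "is_lub V (the0 (is_lub V))"
proof -
 have ne: "Collect V \<noteq> {}" "bdd_above (Collect V)" using assms by (auto intro: bdd_aboveI[of _ x'])
 have lub: "is_lub V (Sup (Collect V))"
  unfolding is_lub_def using ne by (auto intro: cSup_upper cSup_least)
 have "the0 (is_lub V) = Sup (Collect V)"
 proof (rule the0_eq[of "is_lub V", OF lub])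
  fix z assume "is_lub V z"
  then show "z = Sup (Collect V)" using lub unfolding is_lub_def by (meson antisym)
 qed
 with lub show ?thesis by simp
qed

lemma is_lub_between:
 assumes "V x" "\<And>y. V y \<Longrightarrow> y \<le> x'" shows "x \<le> the0 (is_lub V) \<and> the0 (is_lub V) \<le> x'"
 using the0_is_lub[of V x x', OF assms] assms unfolding is_lub_def by blast

lemma is_lub_witness:
 assumes "V x" "\<And>y. V y \<Longrightarrow> y \<le> x'" "z < the0 (is_lub V)" shows "\<exists>y. V y \<and> z < y"
 using the0_is_lub[of V x x', OF assms(1,2)] assms(3) unfolding is_lub_def by (meson not_le)

section \<open>The inverse of a definable function increasing in the second variable\<close>

text \<open>One strictly increasing piece of |f| in a sector, with its ends included. Nonnegativity
  at the lower end and positive order at the upper end carry over to all arcs in between.\<close>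

locale increasing_slice = polynomially_bounded_ominimal_structure +
 fixes g :: "real \<Rightarrow> real \<Rightarrow> real" and lo hi :: "real \<Rightarrow> real"
 assumes dg: "dfun2 g" and dlo: "dfun1 lo" and dhi: "dfun1 hi"
  and le: "EV t. lo t < hi t"
  and cont: "EV t. continuous_on {lo t..hi t} (g t)"
  and incr: "EV t. \<forall>s s'. lo t \<le> s \<longrightarrow> s < s' \<longrightarrow> s' \<le> hi t \<longrightarrow> g t s < g t s'"
  and nonneg: "EV t. 0 \<le> g t (lo t)"
  and ordpos: "0 < order_at_0 (\<lambda>t. g t (hi t))"
begin

definition ok :: "real \<Rightarrow> bool" where
 "ok t \<longleftrightarrow> 0 < t \<and> t < 1 \<and> lo t < hi t \<and> continuous_on {lo t..hi t} (g t) \<and>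
   (\<forall>s s'. lo t \<le> s \<longrightarrow> s < s' \<longrightarrow> s' \<le> hi t \<longrightarrow> g t s < g t s') \<and> 0 \<le> g t (lo t)"

lemma ev_ok: "ev ok"
 using ev_pos ev_less[OF zero_less_one] le cont incr nonneg by eventually_elim (simp add: ok_def)

definition gl :: "real \<Rightarrow> real" where "gl t = g t (lo t)"
definition gh :: "real \<Rightarrow> real" where "gh t = g t (hi t)"
definition \<sigma> :: "real \<Rightarrow> real \<Rightarrow> real" where "\<sigma> t u = the0 (\<lambda>s. lo t \<le> s \<and> s \<le> hi t \<and> g t s = u)"
definition D :: "real \<Rightarrow> real \<Rightarrow> real" where "D t u = \<sigma> t (2 * u) - \<sigma> t u"
definition r :: "real \<Rightarrow> real \<Rightarrow> real" where "r t u = D t (2 * u) / D t u"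

lemma dgl: "dfun1 gl" and dgh: "dfun1 gh"
 unfolding dfun1_def gl_def gh_def by (intro dint dfun2_app[OF dg] dfun1_app[OF dlo] dfun1_app[OF dhi])+

lemma dsig: "dfun2 \<sigma>"
 unfolding dfun2_def \<sigma>_def by (intro dint dfun2_app[OF dg] dfun1_app[OF dlo] dfun1_app[OF dhi])

lemma dD: "dfun2 D"
 unfolding dfun2_def D_def by (intro dint dfun2_app[OF dsig])

lemma dr: "dfun2 r"
 unfolding dfun2_def r_def by (intro dint dfun2_app[OF dD])

lemma g_inj: "ok t \<Longrightarrow> lo t \<le> s \<Longrightarrow> s \<le> hi t \<Longrightarrow> lo t \<le> s' \<Longrightarrow> s' \<le> hi t \<Longrightarrow> g t s = g t s' \<Longrightarrow> s = s'"
 unfolding ok_def by (metis less_irrefl linorder_less_linear)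

lemma g_mono: "ok t \<Longrightarrow> lo t \<le> s \<Longrightarrow> s \<le> s' \<Longrightarrow> s' \<le> hi t \<Longrightarrow> g t s \<le> g t s'"
 unfolding ok_def by (metis le_less)

lemma sig:
 assumes "ok t" "gl t \<le> u" "u \<le> gh t" shows "lo t \<le> \<sigma> t u" "\<sigma> t u \<le> hi t" "g t (\<sigma> t u) = u"
proof -
 obtain s where s: "lo t \<le> s" "s \<le> hi t" "g t s = u"
  using IVT'[of "g t" "lo t" u "hi t"] assms unfolding ok_def gl_def gh_def by auto
 then have "\<sigma> t u = s" unfolding \<sigma>_def using g_inj[OF assms(1)] by (intro the0_eq) auto
 then show "lo t \<le> \<sigma> t u" "\<sigma> t u \<le> hi t" "g t (\<sigma> t u) = u" using s by auto
qed

lemma sig_g: "ok t \<Longrightarrow> lo t \<le> s \<Longrightarrow> s \<le> hi t \<Longrightarrow> \<sigma> t (g t s) = s"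
 unfolding \<sigma>_def using g_inj[of t] by (intro the0_eq) auto

lemma g_range: "ok t \<Longrightarrow> lo t \<le> s \<Longrightarrow> s \<le> hi t \<Longrightarrow> gl t \<le> g t s \<and> g t s \<le> gh t"
 unfolding gl_def gh_def using g_mono[of t] by auto

lemma sig_less:
 assumes "ok t" "gl t \<le> u" "u < u'" "u' \<le> gh t" shows "\<sigma> t u < \<sigma> t u'"
proof (rule ccontr)
 assume "\<not> \<sigma> t u < \<sigma> t u'"
 then have "g t (\<sigma> t u') \<le> g t (\<sigma> t u)" using assms by (intro g_mono sig) auto
 then show False using assms sig(3)[OF assms(1)] by simp
qed

lemma sig_le: "ok t \<Longrightarrow> gl t \<le> u \<Longrightarrow> u \<le> u' \<Longrightarrow> u' \<le> gh t \<Longrightarrow> \<sigma> t u \<le> \<sigma> t u'"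
 using sig_less[of t u u'] by (cases "u = u'") auto

lemma sig_ends: "ok t \<Longrightarrow> \<sigma> t (gl t) = lo t" "ok t \<Longrightarrow> \<sigma> t (gh t) = hi t"
 unfolding gl_def gh_def by (intro sig_g; simp add: ok_def)+

lemma gl_less_gh: "ok t \<Longrightarrow> 0 \<le> gl t \<and> gl t < gh t"
 unfolding gl_def gh_def ok_def by auto

lemma sig_cont: assumes "ok t" shows "continuous_on {gl t..gh t} (\<sigma> t)"
proof -
 have "continuous_on (g t ` {lo t..hi t}) (\<sigma> t)"
  using assms sig_g[OF assms] by (intro continuous_on_inv) (auto simp: ok_def)
 moreover have "{gl t..gh t} \<subseteq> g t ` {lo t..hi t}"
 proof
  fix u assume "u \<in> {gl t..gh t}"
  then show "u \<in> g t ` {lo t..hi t}" using sig[OF assms, of u] by (intro image_eqI[of _ _ "\<sigma> t u"]) auto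
 qed
 ultimately show ?thesis by (rule continuous_on_subset)
qed

lemma D_pos: "ok t \<Longrightarrow> gl t \<le> u \<Longrightarrow> 0 < u \<Longrightarrow> 2 * u \<le> gh t \<Longrightarrow> 0 < D t u"
 unfolding D_def using sig_less[of t u "2 * u"] by simp

text \<open>The ratio at u reads \<sigma> at levels up to 4 * u, hence the bound gh t / 4.\<close>

lemma r_cont: assumes "ok t" shows "continuous_on {gl t<..<gh t / 4} (r t)"
proof -
 have 1: "continuous_on {gl t<..<gh t / 4} (\<lambda>u. \<sigma> t (c * u))" if "1 \<le> c" "c \<le> 4" for c
 proof (rule continuous_on_compose2[OF sig_cont[OF assms]])
  show "(\<lambda>u. c * u) ` {gl t<..<gh t / 4} \<subseteq> {gl t..gh t}"
  proof clarify
   fix u assume "u \<in> {gl t<..<gh t / 4}"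
   moreover from this have "1 * u \<le> c * u" "c * u \<le> 4 * u"
    using that gl_less_gh[OF assms] by (intro mult_right_mono; simp)+
   ultimately show "c * u \<in> {gl t..gh t}" by simp
  qed
 qed (intro continuous_intros)
 have "continuous_on {gl t<..<gh t / 4} (\<lambda>u. (\<sigma> t (4 * u) - \<sigma> t (2 * u)) / (\<sigma> t (2 * u) - \<sigma> t (1 * u)))"
 proof (intro continuous_intros 1 ballI)
  fix u assume "u \<in> {gl t<..<gh t / 4}"
  then show "\<sigma> t (2 * u) - \<sigma> t (1 * u) \<noteq> 0"
   using D_pos[OF assms, of u] gl_less_gh[OF assms] by (auto simp: D_def)
 qed auto
 then show ?thesis by (simp add: r_def[abs_def] D_def)
qed

text \<open>The function \<open>gh\<close> is eventually nonzero, so its order is finite; \<open>b = \<infinity>\<close> is possible.\<close>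

definition a :: real where "a = real_of_ereal (order_at_0 gh)"

lemma ord_gh: "order_at_0 gh = ereal a" "a \<in> \<FF>" "0 < a" "ord_is gh a"
proof -
 have "\<not> (EV t. gh t = 0)"
 proof
  assume "EV t. gh t = 0"
  then have "EV t. False" using ev_ok by eventually_elim (use gl_less_gh in force)
  then show False by simp
 qed
 then obtain p where p: "p \<in> \<FF>" "ord_is gh p" "order_at_0 gh = ereal p"
  by (cases rule: order_cases[OF dgh]) auto
 then have "a = p" by (simp add: a_def)
 then show "order_at_0 gh = ereal a" "a \<in> \<FF>" "0 < a" "ord_is gh a"
  using p ordpos by (simp_all add: gh_def[abs_def])
qed

definition b :: ereal where "b = order_at_0 gl"

lemma below_hi: assumes "a < q" shows "EV t. \<kappa> * t powr q < gh t"
proof -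
 have "EV t. \<bar>gh t\<bar> > \<kappa> * t powr q" using assms by (intro order_lt_large dgh) (simp add: ord_gh)
 then show ?thesis using ev_ok
 proof eventually_elim
  case (elim t)
  then show ?case using gl_less_gh[OF elim(2)] by linarith
 qed
qed

lemma below_hi_a: shows "\<exists>\<kappa>0>0. \<forall>\<kappa>. 0 < \<kappa> \<longrightarrow> \<kappa> < \<kappa>0 \<longrightarrow> (EV t. \<kappa> * t powr a < gh t)"
proof -
 obtain c C where c: "c > 0" "C > 0" "EV t. c * t powr a \<le> \<bar>gh t\<bar> \<and> \<bar>gh t\<bar> \<le> C * t powr a"
  using ord_gh(4) by (rule ord_is_bounds)
 have "EV t. \<kappa> * t powr a < gh t" if "\<kappa> < c" for \<kappa> using c(3) ev_ok ev_pos
 proof eventually_elim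
  case (elim t)
  have "\<kappa> * t powr a < c * t powr a" using elim that by (intro mult_strict_right_mono) auto
  then show ?case using elim gl_less_gh[of t] by linarith
 qed
 then show ?thesis using c(1) by blast
qed

lemma above_lo: assumes "ereal q < b" "0 < \<kappa>" shows "EV t. gl t < \<kappa> * t powr q"
proof -
 have "EV t. \<bar>gl t\<bar> < \<kappa> * t powr q" using assms by (intro order_gt_small dgl) (simp_all add: b_def)
 then show ?thesis by eventually_elim auto
qed

lemma above_lo_b: assumes "b = ereal q"
 shows "\<exists>K>0. \<forall>\<kappa>. K < \<kappa> \<longrightarrow> (EV t. gl t < \<kappa> * t powr q)"
proof -
 have "ord_is gl q" using order_finite[OF dgl, of q] assms by (simp add: b_def)
 then obtain c0 C where c: "c0 > 0" "C > 0" "EV t. c0 * t powr q \<le> \<bar>gl t\<bar> \<and> \<bar>gl t\<bar> \<le> C * t powr q"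
  by (rule ord_is_bounds)
 have "EV t. gl t < \<kappa> * t powr q" if "C < \<kappa>" for \<kappa> using c(3) ev_pos
 proof eventually_elim
  case (elim t)
  have "C * t powr q < \<kappa> * t powr q" using elim that by (intro mult_strict_right_mono) auto
  then show ?case using elim by linarith
 qed
 then show ?thesis using c(2) by blast
qed

definition band :: "real \<Rightarrow> real \<Rightarrow> real \<Rightarrow> real set" where
 "band q q' t = {t powr q'..t powr q}"

text \<open>Near \<open>u = t powr p\<close> with \<open>p\<close> between \<open>q\<close> and \<open>q'\<close>, no level is crossed by the ratio \<open>r\<close>.\<close>

definition flat :: "real \<Rightarrow> real \<Rightarrow> bool" where
 "flat q q' \<longleftrightarrow> (\<forall>x. (EV t. \<forall>u\<in>band q q' t. r t u \<le> x) \<or> (EV t. \<forall>u\<in>band q q' t. r t u \<ge> x))"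

definition flat_off :: "real set \<Rightarrow> (real \<Rightarrow> real) \<Rightarrow> (real \<Rightarrow> real) \<Rightarrow> bool" where
 "flat_off Q v w \<longleftrightarrow> (\<forall>q q'. q \<in> \<FF> \<longrightarrow> q' \<in> \<FF> \<longrightarrow> q \<le> q' \<longrightarrow> (\<forall>p\<in>Q. \<not> (q \<le> p \<and> p \<le> q')) \<longrightarrow>
   (EV t. v t < t powr q' \<and> t powr q < w t) \<longrightarrow> flat q q')"

lemma order_between:
 assumes "dfun1 v" "EV t. t powr q' \<le> v t \<and> v t \<le> t powr q"
 obtains p where "order_at_0 v = ereal p" "q \<le> p" "p \<le> q'"
proof -
 have "EV t. \<bar>v t\<bar> \<le> 1 * t powr q" "EV t. 1 * t powr q' \<le> \<bar>v t\<bar>"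
  using assms(2) ev_pos by (eventually_elim; smt (verit) powr_gt_zero)+
 then have "ereal q \<le> order_at_0 v" "order_at_0 v \<le> ereal q'"
  using order_ge_iff[OF assms(1), of q] order_le_iff[OF assms(1), of q'] zero_less_one by blast+
 then show ?thesis using that by (cases "order_at_0 v") auto
qed

text \<open>If r passed through the level x inside the band, the point of passage would be a level
  curve with order between q and q'. The level curves form a definable family with parameter x, so
  \<open>finite_orders\<close> leaves finitely many such orders, and these are the exceptional
  exponents.\<close>

lemma flat_piece:
 assumes "mono_piece r v w" shows "\<exists>Q. finite Q \<and> Q \<subseteq> \<FF> \<and> flat_off Q v w"
proof -
 have dv: "dfun1 v" and dw: "dfun1 w" using assms by (simp_all add: mono_piece_def)
 \<comment> \<open>L gives the level curves where r increases, G where r decreases.\<close>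
 define L where "L x t = the0 (is_lub (\<lambda>y. v t < y \<and> y < w t \<and> r t y \<le> x))" for x t
 define G where "G x t = the0 (is_lub (\<lambda>y. v t < y \<and> y < w t \<and> r t y \<ge> x))" for x t
 have dL: "dfun2 L" and dG: "dfun2 G"
  unfolding dfun2_def L_def G_def is_lub_def by (intro dint dfun2_app[OF dr] dfun1_app[OF dv] dfun1_app[OF dw])+
 have dLx: "dfun1 (L x)" and dGx: "dfun1 (G x)" for x
  unfolding dfun1_def by (intro dint dfun2_app[OF dL] dfun2_app[OF dG])+
 define Q where "Q = {p. ereal p \<in> range (\<lambda>x. order_at_0 (L x)) \<union> range (\<lambda>x. order_at_0 (G x))}"
 have "finite Q"
 proof -
  have "finite (ereal -` (range (\<lambda>x. order_at_0 (L x)) \<union> range (\<lambda>x. order_at_0 (G x))))"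
   by (intro finite_vimageI finite_UnI finite_orders dL dG) (simp add: inj_on_def)
  then show ?thesis by (simp add: Q_def vimage_def)
 qed
 moreover have "Q \<subseteq> \<FF>"
 proof
  fix p assume "p \<in> Q"
  then obtain x where "order_at_0 (L x) = ereal p \<or> order_at_0 (G x) = ereal p" unfolding Q_def by force
  then show "p \<in> \<FF>" using order_finite(1)[OF dLx[of x]] order_finite(1)[OF dGx[of x]] by blast
 qed
 moreover have "flat_off Q v w" unfolding flat_off_def flat_def
 proof (intro allI impI, rule ccontr)
  fix q q' x
  assume q: "q \<in> \<FF>" "q' \<in> \<FF>" "q \<le> q'" "\<forall>p\<in>Q. \<not> (q \<le> p \<and> p \<le> q')"
   and vw: "EV t. v t < t powr q' \<and> t powr q < w t"
   and no: "\<not> ((EV t. \<forall>u\<in>band q q' t. r t u \<le> x) \<or> (EV t. \<forall>u\<in>band q q' t. r t u \<ge> x))"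
  have d: "drel1 (\<lambda>t. \<forall>u. pw q' t \<le> u \<longrightarrow> u \<le> pw q t \<longrightarrow> r t u \<le> x)"
   "drel1 (\<lambda>t. \<forall>u. pw q' t \<le> u \<longrightarrow> u \<le> pw q t \<longrightarrow> r t u \<ge> x)"
   unfolding drel1_def by (intro dint q dfun2_app[OF dr])+
  have conv: "EV t. (\<forall>u. pw q' t \<le> u \<longrightarrow> u \<le> pw q t \<longrightarrow> P t u) \<longleftrightarrow> (\<forall>u\<in>band q q' t. P t u)" for P
   using pw_ev[of q] pw_ev[of q'] by eventually_elim (auto simp: band_def)
  have "\<not> (EV t. \<forall>u. pw q' t \<le> u \<longrightarrow> u \<le> pw q t \<longrightarrow> r t u \<le> x)"
   using no eventually_subst[OF conv[of "\<lambda>t u. r t u \<le> x"]] by simp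
  then have "EV t. \<not> (\<forall>u. pw q' t \<le> u \<longrightarrow> u \<le> pw q t \<longrightarrow> r t u \<le> x)"
   using ev_dichotomy_right[OF d(1), of 0] by blast
  then have 1: "EV t. \<exists>u\<in>band q q' t. r t u > x"
   using conv[of "\<lambda>t u. r t u \<le> x"] by eventually_elim (auto simp: not_le)
  have "\<not> (EV t. \<forall>u. pw q' t \<le> u \<longrightarrow> u \<le> pw q t \<longrightarrow> r t u \<ge> x)"
   using no eventually_subst[OF conv[of "\<lambda>t u. r t u \<ge> x"]] by simp
  then have "EV t. \<not> (\<forall>u. pw q' t \<le> u \<longrightarrow> u \<le> pw q t \<longrightarrow> r t u \<ge> x)"
   using ev_dichotomy_right[OF d(2), of 0] by blast
  then have 2: "EV t. \<exists>u\<in>band q q' t. r t u < x"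
   using conv[of "\<lambda>t u. r t u \<ge> x"] by eventually_elim (auto simp: not_le)
  have inQ: False if "dfun1 z" "order_at_0 z \<in> range (\<lambda>x. order_at_0 (L x)) \<union> range (\<lambda>x. order_at_0 (G x))"
   "EV t. t powr q' \<le> z t \<and> z t \<le> t powr q" for z
   using order_between[OF that(1,3)] that(2) q(4) unfolding Q_def by (metis mem_Collect_eq)
  consider "EV t. incr_on (r t) (v t) (w t)" | "EV t. incr_on (\<lambda>s. - r t s) (v t) (w t)"
   | "EV t. const_on (r t) (v t) (w t)" using assms by (auto simp: mono_piece_def)
  then show False
  proof cases
   case 1
   have "EV t. t powr q' \<le> L x t \<and> L x t \<le> t powr q" using 1 vw \<open>(EV t. \<exists>u\<in>band q q' t. r t u > x)\<close> 2
   proof eventually_elim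
    case (elim t)
    then obtain u1 u2 where u: "u1 \<in> band q q' t" "u2 \<in> band q q' t" "r t u1 < x" "r t u2 > x" by blast
    have "u1 \<le> L x t \<and> L x t \<le> u2" unfolding L_def
    proof (rule is_lub_between)
     show "v t < u1 \<and> u1 < w t \<and> r t u1 \<le> x" using u elim by (auto simp: band_def)
     fix y assume y: "v t < y \<and> y < w t \<and> r t y \<le> x"
     show "y \<le> u2"
     proof (rule ccontr)
      assume "\<not> y \<le> u2"
      then have "r t u2 < r t y" using elim(1) y u(2) elim(2) unfolding incr_on_def band_def by auto
      then show False using y u by simp
     qed
    qed
    then show ?case using u by (auto simp: band_def)
   qed
   then show False by (rule inQ[OF dLx, rotated]) simp
  next
   case 2
   have "EV t. t powr q' \<le> G x t \<and> G x t \<le> t powr q" using 2 vw 1 \<open>(EV t. \<exists>u\<in>band q q' t. r t u < x)\<close>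
   proof eventually_elim
    case (elim t)
    then obtain u1 u2 where u: "u1 \<in> band q q' t" "u2 \<in> band q q' t" "r t u1 < x" "r t u2 > x" by blast
    have "u2 \<le> G x t \<and> G x t \<le> u1" unfolding G_def
    proof (rule is_lub_between)
     show "v t < u2 \<and> u2 < w t \<and> r t u2 \<ge> x" using u elim by (auto simp: band_def)
     fix y assume y: "v t < y \<and> y < w t \<and> r t y \<ge> x"
     show "y \<le> u1"
     proof (rule ccontr)
      assume "\<not> y \<le> u1"
      then have "- r t u1 < - r t y" using elim(1) y u(1) elim(2) unfolding incr_on_def band_def by auto
      then show False using y u by simp
     qed
    qed
    then show ?case using u by (auto simp: band_def)
   qed
   then show False by (rule inQ[OF dGx, rotated]) simp
  next
   case 3
   have "EV t. False" using 3 vw 1 2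
   proof eventually_elim
    case (elim t)
    then obtain u1 u2 where u: "u1 \<in> band q q' t" "u2 \<in> band q q' t" "r t u1 < x" "r t u2 > x" by blast
    then have "r t u1 = r t u2"
     using elim(1,2) unfolding const_on_def band_def by (cases u1 u2 rule: linorder_cases) auto
    then show ?case using u by simp
   qed
   then show False by simp
  qed
 qed
 ultimately show ?thesis by blast
qed

text \<open>The order of each breakpoint becomes exceptional too. A band that avoids it lies
  entirely on one side of the breakpoint, hence in one of the two pieces.\<close>

lemma flat_chain:
 assumes "(mono_piece r)\<^sup>+\<^sup>+ v w" "EV t. 0 \<le> v t" shows "\<exists>Q. finite Q \<and> Q \<subseteq> \<FF> \<and> flat_off Q v w \<and> (EV t. v t < w t)"
 using assms(1)
proof (induction rule: tranclp_induct)
 case (base y)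
 then show ?case using flat_piece[OF base] by (auto simp: mono_piece_def)
next
 case (step y z)
 obtain Q1 where Q1: "finite Q1" "flat_off Q1 v y" "EV t. v t < y t" "Q1 \<subseteq> \<FF>" using step.IH by blast
 obtain Q2 where Q2: "finite Q2" "flat_off Q2 y z" "Q2 \<subseteq> \<FF>" using flat_piece[OF step.hyps(2)] by blast
 have dy: "dfun1 y" and yz: "EV t. y t < z t" using step.hyps(2) by (auto simp: mono_piece_def)
 define Q where "Q = Q1 \<union> Q2 \<union> {p. ereal p = order_at_0 y}"
 have "finite {p. ereal p = order_at_0 y}" by (cases "order_at_0 y") (auto simp: ereal_eq_0)
 then have "finite Q" using Q1 Q2 by (simp add: Q_def)
 moreover have "Q \<subseteq> \<FF>" using Q1(4) Q2(3) order_finite(1)[OF dy] by (auto simp: Q_def)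
 moreover have "flat_off Q v z" unfolding flat_off_def
 proof (intro allI impI)
  fix q q'
  assume q: "q \<in> \<FF>" "q' \<in> \<FF>" "q \<le> q'" "\<forall>p\<in>Q. \<not> (q \<le> p \<and> p \<le> q')"
   and vz: "EV t. v t < t powr q' \<and> t powr q < z t"
  have ypos: "EV t. 0 < y t" using Q1(3) assms(2) by eventually_elim simp
  have "order_at_0 y < ereal q \<or> ereal q' < order_at_0 y"
   using q(4) by (cases "order_at_0 y") (auto simp: Q_def not_le)
  then show "flat q q'"
  proof
   assume "order_at_0 y < ereal q"
   from order_lt_large[OF dy this, of 1] have "EV t. t powr q < y t" using ypos by eventually_elim auto
   then have "EV t. v t < t powr q' \<and> t powr q < y t" using vz by eventually_elim auto
   then show ?thesis using Q1(2) q unfolding flat_off_def Q_def by blast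
  next
   assume "ereal q' < order_at_0 y"
   from order_gt_small[OF dy this zero_less_one] have "EV t. y t < t powr q'"
    using ypos by eventually_elim auto
   then have "EV t. y t < t powr q' \<and> t powr q < z t" using vz by eventually_elim auto
   then show ?thesis using Q2(2) q unfolding flat_off_def Q_def by blast
  qed
 qed
 moreover have "EV t. v t < z t" using Q1(3) yz by eventually_elim auto
 ultimately show ?case by blast
qed

text \<open>For exponents strictly between a and b, the levels eventually lie between gl and gh / 4,
  where the ratio only reads genuine values of \<sigma>.\<close>

lemma flat_exceptions:
 assumes "ereal a < b"
 shows "\<exists>Q. finite Q \<and> Q \<subseteq> \<FF> \<and> (\<forall>q q'. q \<in> \<FF> \<longrightarrow> q' \<in> \<FF> \<longrightarrow> q \<le> q' \<longrightarrow> a < q \<longrightarrow> ereal q' < b \<longrightarrow>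
   (\<forall>p\<in>Q. \<not> (q \<le> p \<and> p \<le> q')) \<longrightarrow> flat q q')"
proof -
 have dgh4: "dfun1 (\<lambda>t. gh t / 4)" unfolding dfun1_def by (intro dint dfun1_app[OF dgh])
 obtain p where p: "a < p" "ereal p < b" using ereal_dense2[OF assms] by auto
 have "EV t. gl t < 1 * t powr p" by (intro above_lo p) simp
 then have lt: "EV t. gl t < gh t / 4" using below_hi[OF p(1), of 4] by eventually_elim simp
 have "EV t. \<bar>gh t\<bar> < 1 * t powr 0" by (intro order_gt_small dgh) (simp_all add: ord_gh)
 then have bd: "EV t. - 1 \<le> gl t \<and> gh t / 4 \<le> 1" using ev_ok
 proof eventually_elim
  case (elim t)
  have "t powr 0 \<le> 1" by simp
  then have "\<bar>gh t\<bar> < 1" using elim(1) by linarith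
  then show ?case using gl_less_gh[OF elim(2)] by linarith
 qed
 have "EV t. continuous_on {gl t<..<gh t / 4} (r t)" using ev_ok by eventually_elim (rule r_cont)
 from mono_piece_chain[OF dr dgl dgh4 lt this bd]
 have "(mono_piece r)\<^sup>+\<^sup>+ gl (\<lambda>t. gh t / 4)" .
 moreover have "EV t. 0 \<le> gl t" using ev_ok by eventually_elim (use gl_less_gh in blast)
 ultimately obtain Q where Q: "finite Q" "flat_off Q gl (\<lambda>t. gh t / 4)" "Q \<subseteq> \<FF>" using flat_chain by blast
 have "flat q q'" if "q \<in> \<FF>" "q' \<in> \<FF>" "q \<le> q'" "a < q" "ereal q' < b" "\<forall>p\<in>Q. \<not> (q \<le> p \<and> p \<le> q')" for q q'
 proof -
  have "EV t. gl t < 1 * t powr q'" by (intro above_lo that) simp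
  then have "EV t. gl t < t powr q' \<and> t powr q < gh t / 4"
   using below_hi[OF that(4), of 4] by eventually_elim simp
  then show ?thesis using Q(2) that unfolding flat_off_def by blast
 qed
 then show ?thesis using Q(1,3) by blast
qed

end

section \<open>Piecewise affine growth exponents\<close>

context polynomially_bounded_ominimal_structure
begin

text \<open>Rational numbers are exponents of every such structure.\<close>

lemma FF_dense: "x < y \<Longrightarrow> \<exists>q\<in>\<FF>. x < q \<and> q < y"
 using Rats_dense_in_real[of x y] FF_Rats by blast

lemma FF_dense_ereal: assumes "ereal x < y" shows "\<exists>q\<in>\<FF>. x < q \<and> ereal q < y"
proof -
 obtain z where "x < z" "ereal z < y" using ereal_dense2[OF assms] by auto
 then show ?thesis using FF_dense[of x z] by (metis less_ereal.simps(1) less_trans)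
qed

lemma drel_order_eq:
 assumes "dfun2 E" "\<mu> \<in> \<FF>" shows "drel1 (\<lambda>\<kappa>. order_at_0 (E \<kappa>) = ereal \<mu>)"
proof -
 have dE: "dfun1 (E \<kappa>)" for \<kappa> unfolding dfun1_def by (intro dint dfun2_app[OF assms(1)])
 have "order_at_0 (E \<kappa>) = ereal \<mu> \<longleftrightarrow> (\<exists>a. a \<noteq> 0 \<and> ((\<lambda>t. E \<kappa> t / pw \<mu> t) \<longlongrightarrow> a) (at_right 0))" for \<kappa>
 proof -
  have "((\<lambda>t. E \<kappa> t / pw \<mu> t) \<longlongrightarrow> a) (at_right 0) \<longleftrightarrow> ((\<lambda>t. E \<kappa> t / t powr \<mu>) \<longlongrightarrow> a) (at_right 0)" for a
   by (rule tendsto_cong) (use pw_ev[of \<mu>] in eventually_elim, simp)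
  then show ?thesis using order_finite(2)[OF dE] ord_is_order[of "E \<kappa>" \<mu>] by (auto simp: ord_is_def)
 qed
 moreover have "drel1 (\<lambda>\<kappa>. \<exists>a. a \<noteq> 0 \<and> ((\<lambda>t. E \<kappa> t / pw \<mu> t) \<longlongrightarrow> a) (at_right 0))"
  unfolding drel1_def by (intro dint dfun2_app[OF assms(1)] assms(2))
 ultimately show ?thesis by simp
qed

text \<open>Each of the finitely many orders is attained for all small \<kappa> or for no small
  \<kappa>. If the latter held for every one of them, no value would be left.\<close>

lemma eventually_constant_order:
 assumes E: "dfun2 E" and nz: "ev (\<lambda>\<kappa>. \<not> (EV t. E \<kappa> t = 0))"
 shows "\<exists>\<mu>\<in>\<FF>. ev (\<lambda>\<kappa>. order_at_0 (E \<kappa>) = ereal \<mu>)"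
proof (rule ccontr)
 assume no: "\<not> ?thesis"
 have dE: "dfun1 (E \<kappa>)" for \<kappa> unfolding dfun1_def by (intro dint dfun2_app[OF E])
 define R where "R = range (\<lambda>\<kappa>. order_at_0 (E \<kappa>))"
 have "ev (\<lambda>\<kappa>. order_at_0 (E \<kappa>) \<noteq> \<rho>)" if "\<rho> \<in> R" for \<rho>
 proof (cases "\<rho> = \<infinity>")
  case True
  then show ?thesis using nz by (simp add: order_infty)
 next
  case False
  from that obtain \<kappa> where "\<rho> = order_at_0 (E \<kappa>)" by (auto simp: R_def)
  with False obtain \<mu> where \<mu>: "\<mu> \<in> \<FF>" "\<rho> = ereal \<mu>" by (cases rule: order_cases[OF dE[of \<kappa>]]) auto
  show ?thesis using no \<mu> ev_dichotomy_right[OF drel_order_eq[OF E \<mu>(1)], of 0] by blast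
 qed
 then have "ev (\<lambda>\<kappa>. \<forall>\<rho>\<in>R. order_at_0 (E \<kappa>) \<noteq> \<rho>)"
  unfolding R_def by (intro eventually_ball_finite finite_orders E) blast
 moreover have "\<not> (\<forall>\<rho>\<in>R. order_at_0 (E \<kappa>) \<noteq> \<rho>)" for \<kappa> by (auto simp: R_def)
 ultimately show False by simp
qed

text \<open>
 If the order of \<open>E \<kappa>\<close> is \<open>\<mu>\<close> for all small \<open>\<kappa>\<close>, then \<open>t powr (\<mu> + \<delta>) \<le> \<bar>E \<kappa> t\<bar> \<le> t powr (\<mu> - \<delta>)\<close> holds
 for \<open>t < \<tau> \<kappa>\<close> with a definable \<open>\<tau>\<close>, which is bounded below by a power of \<open>\<kappa>\<close>.
\<close>

lemma diagonal_order:
 assumes E: "dfun2 E" and \<mu>: "\<mu> \<in> \<FF>" and ord: "ev (\<lambda>\<kappa>. order_at_0 (E \<kappa>) = ereal \<mu>)" and \<delta>: "\<delta> > 0"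
 shows "\<exists>p0>0. \<forall>p\<in>\<FF>. 0 < p \<longrightarrow> p < p0 \<longrightarrow>
   ereal (\<mu> - \<delta>) \<le> order_at_0 (\<lambda>t. E (pw p t) t) \<and> order_at_0 (\<lambda>t. E (pw p t) t) \<le> ereal (\<mu> + \<delta>)"
proof -
 obtain \<epsilon> where \<epsilon>: "\<epsilon> \<in> \<FF>" "0 < \<epsilon>" "\<epsilon> < \<delta>" using FF_dense[OF \<delta>] by blast
 have dE: "dfun1 (E \<kappa>)" for \<kappa> unfolding dfun1_def by (intro dint dfun2_app[OF E])
 have dm: "\<mu> + \<epsilon> \<in> \<FF>" "\<mu> - \<epsilon> \<in> \<FF>" using \<mu> \<epsilon> by (auto intro: FF_add FF_diff)
 define V where "V \<kappa> \<tau> \<longleftrightarrow> 0 < \<tau> \<and> \<tau> \<le> 1 \<and> (\<forall>t. 0 < t \<longrightarrow> t < \<tau> \<longrightarrow> pw (\<mu> + \<epsilon>) t \<le> \<bar>E \<kappa> t\<bar> \<and> \<bar>E \<kappa> t\<bar> \<le> pw (\<mu> - \<epsilon>) t)" for \<kappa> \<tau>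
 define \<tau> where "\<tau> \<kappa> = the0 (is_lub (V \<kappa>))" for \<kappa>
 have d\<tau>: "dfun1 \<tau>" unfolding dfun1_def \<tau>_def is_lub_def V_def by (intro dint dm dfun2_app[OF E])
 have \<tau>: "ev (\<lambda>\<kappa>. 0 < \<tau> \<kappa> \<and> (\<forall>z < \<tau> \<kappa>. \<exists>y. V \<kappa> y \<and> z < y))" using ord
 proof eventually_elim
  case (elim \<kappa>)
  have "EV t. 1 * t powr (\<mu> + \<epsilon>) < \<bar>E \<kappa> t\<bar>" "EV t. \<bar>E \<kappa> t\<bar> < 1 * t powr (\<mu> - \<epsilon>)"
   using elim \<epsilon> by (intro order_lt_large order_gt_small dE; simp)+
  then have "EV t. pw (\<mu> + \<epsilon>) t \<le> \<bar>E \<kappa> t\<bar> \<and> \<bar>E \<kappa> t\<bar> \<le> pw (\<mu> - \<epsilon>) t"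
   using ev_pos by eventually_elim (simp add: pw_def)
  then obtain b where b: "b > 0" "\<And>t. 0 < t \<Longrightarrow> t < b \<Longrightarrow> pw (\<mu> + \<epsilon>) t \<le> \<bar>E \<kappa> t\<bar> \<and> \<bar>E \<kappa> t\<bar> \<le> pw (\<mu> - \<epsilon>) t"
   by (auto simp: eventually_at_right_field)
  then have "V \<kappa> (min b 1)" by (auto simp: V_def)
  moreover have "y \<le> 1" if "V \<kappa> y" for y using that by (simp add: V_def)
  ultimately have "min b 1 \<le> \<tau> \<kappa>" "\<forall>z < \<tau> \<kappa>. \<exists>y. V \<kappa> y \<and> z < y"
   unfolding \<tau>_def using is_lub_between[of "V \<kappa>"] is_lub_witness[of "V \<kappa>"] by blast+
  then show ?case using b(1) by auto
 qed
 have "\<not> ev (\<lambda>\<kappa>. \<tau> \<kappa> = 0)"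
 proof
  assume "ev (\<lambda>\<kappa>. \<tau> \<kappa> = 0)"
  then have "ev (\<lambda>\<kappa>. False)" using \<tau> by eventually_elim simp
  then show False by simp
 qed
 then obtain \<rho> where \<rho>: "order_at_0 \<tau> = ereal \<rho>" by (cases rule: order_cases[OF d\<tau>]) auto
 \<comment> \<open>N exceeds the order of \<tau>, so \<kappa> powr N < \<tau> \<kappa> for small
   \<kappa>. With \<kappa> = t powr p and p < 1 / N this gives t < \<tau> \<kappa>, so the two
   bounds apply on the curve \<kappa> = t powr p.\<close>
 define N where "N = max \<rho> 0 + 1"
 have "ev (\<lambda>\<kappa>. \<bar>\<tau> \<kappa>\<bar> > 1 * \<kappa> powr N)" by (intro order_lt_large d\<tau>) (simp add: \<rho> N_def)
 then have key: "ev (\<lambda>\<kappa>. \<forall>t. 0 < t \<longrightarrow> t < \<kappa> powr N \<longrightarrow> pw (\<mu> + \<epsilon>) t \<le> \<bar>E \<kappa> t\<bar> \<and> \<bar>E \<kappa> t\<bar> \<le> pw (\<mu> - \<epsilon>) t)"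
  using \<tau>
 proof eventually_elim
  case (elim \<kappa>)
  show ?case
  proof (intro allI impI)
   fix t assume t: "0 < t" "t < \<kappa> powr N"
   then have "t < \<tau> \<kappa>" using elim by simp
   then obtain y where "V \<kappa> y" "t < y" using elim(2) by blast
   then show "pw (\<mu> + \<epsilon>) t \<le> \<bar>E \<kappa> t\<bar> \<and> \<bar>E \<kappa> t\<bar> \<le> pw (\<mu> - \<epsilon>) t" using t by (simp add: V_def)
  qed
 qed
 have "N > 0" by (simp add: N_def)
 have "ereal (\<mu> - \<delta>) \<le> order_at_0 (\<lambda>t. E (pw p t) t) \<and> order_at_0 (\<lambda>t. E (pw p t) t) \<le> ereal (\<mu> + \<delta>)"
  if p: "p \<in> \<FF>" "0 < p" "p < 1 / N" for p
 proof -
  have d: "dfun1 (\<lambda>t. E (pw p t) t)" unfolding dfun1_def by (intro dint dfun2_app[OF E] p)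
  have "filterlim (\<lambda>t. t powr p) (at_right 0) (at_right 0)" using p(2) by real_asymp
  from eventually_compose_filterlim[OF key this] ev_pos ev_less[OF zero_less_one]
  have bnd: "EV t. t powr (\<mu> + \<epsilon>) \<le> \<bar>E (pw p t) t\<bar> \<and> \<bar>E (pw p t) t\<bar> \<le> t powr (\<mu> - \<epsilon>)"
  proof eventually_elim
   case (elim t)
   have "p * N < 1" using p \<open>N > 0\<close> by (simp add: field_simps)
   then have "t powr 1 < t powr (p * N)" using elim by (intro powr_less_mono') auto
   then have "t < (t powr p) powr N" using elim by (simp add: powr_powr)
   then show ?case using elim by (simp add: pw_def)
  qed
  have "EV t. \<bar>E (pw p t) t\<bar> \<le> 1 * t powr (\<mu> - \<epsilon>)" "EV t. 1 * t powr (\<mu> + \<epsilon>) \<le> \<bar>E (pw p t) t\<bar>"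
   using bnd by (auto elim: eventually_mono)
  then have "ereal (\<mu> - \<epsilon>) \<le> order_at_0 (\<lambda>t. E (pw p t) t)" "order_at_0 (\<lambda>t. E (pw p t) t) \<le> ereal (\<mu> + \<epsilon>)"
   using order_ge_iff[OF d] order_le_iff[OF d] zero_less_one by blast+
  then show ?thesis using \<epsilon>(3) by (meson ereal_less_eq(3) order_trans less_imp_le add_left_mono diff_left_mono)
 qed
 then show ?thesis using \<open>N > 0\<close> by (intro exI[of _ "1 / N"]) simp
qed

end

section \<open>Dyadic iteration and slopes of the growth exponent\<close>

context increasing_slice
begin

lemma dyadic_floor:
 assumes "0 < U'" "U' \<le> U"
 obtains n where "2 ^ n * U' \<le> U" "U < 2 ^ Suc n * U'" "real n \<le> log 2 (U / U')" "log 2 (U / U') \<le> real n + 1"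
proof -
 define L where "L = log 2 (U / U')"
 have L: "L \<ge> 0" "2 powr L = U / U'" using assms by (simp_all add: L_def)
 define n where "n = nat \<lfloor>L\<rfloor>"
 have n: "real n \<le> L" "L < real n + 1" using L(1) unfolding n_def by (simp_all add: of_nat_nat)
 have "2 powr real n \<le> 2 powr L" "2 powr L < 2 powr (real n + 1)" using n by simp_all
 then have "2 ^ n \<le> U / U'" "U / U' < 2 ^ Suc n" unfolding L(2) by (simp_all add: powr_realpow powr_add)
 then show ?thesis using n assms by (intro that[of n]) (simp_all add: field_simps L_def)
qed

lemma D_step:
 assumes "ok t" "gl t \<le> u" "0 < u" "4 * u \<le> gh t" shows "D t (2 * u) = r t u * D t u"
 using D_pos[OF assms(1-3)] assms(3,4) by (simp add: r_def)

text \<open>Replacing the integer n by the real L changes the power by at most one factor x; on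
  which side of 1 the base lies decides which of the two bounds pays for it.\<close>

lemma powr_log_bound:
 assumes "0 < x" "real n \<le> L" "L \<le> real n + 1"
 shows "x ^ n \<le> max 1 (1 / x) * x powr L" "min 1 (1 / x) * x powr L \<le> x ^ n"
proof -
 have x: "x ^ n = x powr real n" "x powr (real n + 1) = x * x powr real n"
  using assms(1) by (simp_all add: powr_realpow powr_add)
 show "x ^ n \<le> max 1 (1 / x) * x powr L"
 proof (cases "x \<ge> 1")
  case True
  then have "x powr real n \<le> x powr L" using assms(2) by (intro powr_mono) auto
  moreover have "1 * x powr L \<le> max 1 (1 / x) * x powr L" by (intro mult_right_mono) auto
  ultimately show ?thesis using x by simp
 next
  case False
  then have "x powr (real n + 1) \<le> x powr L" using assms by (intro powr_mono') auto
  then have "x powr real n \<le> 1 / x * x powr L" using x assms(1) by (simp add: field_simps)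
  moreover have "1 / x * x powr L \<le> max 1 (1 / x) * x powr L" by (intro mult_right_mono) auto
  ultimately show ?thesis using x by simp
 qed
 show "min 1 (1 / x) * x powr L \<le> x ^ n"
 proof (cases "x \<ge> 1")
  case True
  then have "x powr L \<le> x powr (real n + 1)" using assms(3) by (intro powr_mono) auto
  then have "1 / x * x powr L \<le> x powr real n" using x assms(1) by (simp add: field_simps)
  moreover have "min 1 (1 / x) * x powr L \<le> 1 / x * x powr L" by (intro mult_right_mono) auto
  ultimately show ?thesis using x by simp
 next
  case False
  then have "x powr L \<le> x powr real n" using assms by (intro powr_mono') auto
  moreover have "min 1 (1 / x) * x powr L \<le> 1 * x powr L" by (intro mult_right_mono) auto
  ultimately show ?thesis using x by simp
 qed
qed

lemma ratio_powr: assumes "0 < U'" "U' \<le> U" "0 < x" shows "x powr (log 2 (U / U')) = (U / U') powr (log 2 x)"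
 using assms by (simp add: powr_def log_def field_simps)

text \<open>Doubling from U' reaches V with V \<le> U < 2 * V, and each step multiplies
  \<open>D\<close> by at most x. The band at U lies within those at V and 2 * V, which costs the
  factor 1 + x; passing from the number of steps to log 2 (U / U') costs max 1 (1 / x).\<close>

lemma iter_le:
 assumes t: "ok t" and U: "0 < U'" "U' \<le> U" "gl t \<le> U'" "4 * U \<le> gh t" and x: "0 < x"
  and r: "\<And>u. U' \<le> u \<Longrightarrow> u \<le> U \<Longrightarrow> r t u \<le> x"
 shows "D t U \<le> (1 + x) * max 1 (1 / x) * (U / U') powr (log 2 x) * D t U'"
proof -
 obtain n where n: "2 ^ n * U' \<le> U" "U < 2 ^ Suc n * U'" "real n \<le> log 2 (U / U')" "log 2 (U / U') \<le> real n + 1"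
  by (rule dyadic_floor[OF U(1,2)])
 have in_range: "U' \<le> 2 ^ i * U'" "2 ^ i * U' \<le> U" if "i \<le> n" for i
 proof -
  show "U' \<le> 2 ^ i * U'" using U(1) by simp
  have "2 ^ i * U' \<le> 2 ^ n * U'" using U(1) that by simp
  then show "2 ^ i * U' \<le> U" using n(1) by simp
 qed
 have up: "D t (2 * u) \<le> x * D t u" if "U' \<le> u" "u \<le> U" for u
  using D_step[OF t, of u] D_pos[OF t, of u] r[OF that] that U by (simp add: mult_right_mono)
 have pw: "D t (2 ^ i * U') \<le> x ^ i * D t U'" if "i \<le> n" for i using that
 proof (induction i)
  case (Suc i)
  have "D t (2 * (2 ^ i * U')) \<le> x * D t (2 ^ i * U')" using Suc.prems in_range[of i] by (intro up) auto
  also have "\<dots> \<le> x * (x ^ i * D t U')" using Suc x by (intro mult_left_mono) auto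
  finally show ?case by (simp add: mult.assoc)
 qed simp
 define V where "V = 2 ^ n * U'"
 have V: "U' \<le> V" "V \<le> U" "U < 2 * V" using n in_range[of n] by (simp_all add: V_def)
 have "D t U \<le> \<sigma> t (4 * V) - \<sigma> t V"
  unfolding D_def using sig_le[OF t, of "2 * U" "4 * V"] sig_le[OF t, of V U] V U by simp
 also have "\<dots> = D t V + D t (2 * V)" by (simp add: D_def)
 also have "\<dots> \<le> (1 + x) * D t V" using up[of V] V by (simp add: algebra_simps)
 also have "\<dots> \<le> (1 + x) * (x ^ n * D t U')" using pw[of n] x by (simp add: V_def)
 also have "\<dots> \<le> (1 + x) * ((max 1 (1 / x) * x powr (log 2 (U / U'))) * D t U')"
  using powr_log_bound(1)[OF x n(3,4)] D_pos[OF t, of U'] U x by (intro mult_left_mono mult_right_mono) auto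
 also have "\<dots> = (1 + x) * max 1 (1 / x) * (U / U') powr (log 2 x) * D t U'"
  using ratio_powr[OF U(1,2) x] by simp
 finally show ?thesis .
qed

text \<open>Here the band at V is enlarged to those at U / 2 and U, so U / 2 has to stay above U';
  hence the hypothesis 2 * U' \<le> U.\<close>

lemma iter_ge:
 assumes t: "ok t" and U: "0 < U'" "2 * U' \<le> U" "gl t \<le> U'" "4 * U \<le> gh t" and x: "0 < x"
  and r: "\<And>u. U' \<le> u \<Longrightarrow> u \<le> U \<Longrightarrow> x \<le> r t u"
 shows "min 1 (1 / x) * (U / U') powr (log 2 x) * D t U' \<le> (1 + 1 / x) * D t U"
proof -
 have U'': "U' \<le> U" using U by simp
 obtain n where n: "2 ^ n * U' \<le> U" "U < 2 ^ Suc n * U'" "real n \<le> log 2 (U / U')" "log 2 (U / U') \<le> real n + 1"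
  by (rule dyadic_floor[OF U(1) U''])
 have in_range: "U' \<le> 2 ^ i * U'" "2 ^ i * U' \<le> U" if "i \<le> n" for i
 proof -
  show "U' \<le> 2 ^ i * U'" using U(1) by simp
  have "2 ^ i * U' \<le> 2 ^ n * U'" using U(1) that by simp
  then show "2 ^ i * U' \<le> U" using n(1) by simp
 qed
 have up: "x * D t u \<le> D t (2 * u)" if "U' \<le> u" "u \<le> U" for u
  using D_step[OF t, of u] D_pos[OF t, of u] r[OF that] that U by (simp add: mult_right_mono)
 have pw: "x ^ i * D t U' \<le> D t (2 ^ i * U')" if "i \<le> n" for i using that
 proof (induction i)
  case (Suc i)
  have "x * (x ^ i * D t U') \<le> x * D t (2 ^ i * U')" using Suc x by (intro mult_left_mono) auto
  also have "\<dots> \<le> D t (2 * (2 ^ i * U'))" using Suc.prems in_range[of i] by (intro up) auto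
  finally show ?case by (simp add: mult.assoc)
 qed simp
 define V where "V = 2 ^ n * U'"
 have V: "U' \<le> V" "V \<le> U" "U < 2 * V" using n in_range[of n] by (simp_all add: V_def)
 have "min 1 (1 / x) * (U / U') powr (log 2 x) * D t U' = (min 1 (1 / x) * x powr (log 2 (U / U'))) * D t U'"
  using ratio_powr[OF U(1) U'' x] by simp
 also have "\<dots> \<le> x ^ n * D t U'"
  using powr_log_bound(2)[OF x n(3,4)] D_pos[OF t, of U'] U by (intro mult_right_mono) auto
 also have "\<dots> \<le> D t V" using pw[of n] by (simp add: V_def)
 also have "\<dots> \<le> \<sigma> t (2 * U) - \<sigma> t (U / 2)"
  unfolding D_def using sig_le[OF t, of "2 * V" "2 * U"] sig_le[OF t, of "U / 2" V] V U by simp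
 also have "\<dots> = D t (U / 2) + D t U" by (simp add: D_def)
 also have "\<dots> \<le> (1 + 1 / x) * D t U" using up[of "U / 2"] U x by (simp add: field_simps)
 finally show ?thesis .
qed

abbreviation "ordD \<kappa> q \<equiv> order_at_0 (\<lambda>t. D t (\<kappa> * pw q t))"
abbreviation "level \<kappa> q \<equiv> (\<lambda>t. \<sigma> t (\<kappa> * pw q t))"

text \<open>The growth exponent of the width at level t powr q. It is meaningful for a < q < b,
  where the order is finite.\<close>

definition m :: "real \<Rightarrow> real" where "m q = real_of_ereal (order_at_0 (\<lambda>t. D t (pw q t)))"

lemma dDq: "q \<in> \<FF> \<Longrightarrow> dfun1 (\<lambda>t. D t (\<kappa> * pw q t))"
 unfolding dfun1_def by (intro dint dfun2_app[OF dD])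

lemma dDq1: "q \<in> \<FF> \<Longrightarrow> dfun1 (\<lambda>t. D t (pw q t))"
 unfolding dfun1_def by (intro dint dfun2_app[OF dD])

text \<open>The level \<kappa> * t powr q lies in the range of g; the factor 8 leaves room for the
  dyadic bands above it.\<close>

definition dom :: "real \<Rightarrow> real \<Rightarrow> bool" where
 "dom \<kappa> q \<longleftrightarrow> 0 < \<kappa> \<and> q \<in> \<FF> \<and> (EV t. gl t < \<kappa> * t powr q \<and> 8 * \<kappa> * t powr q < gh t)"

lemma dom_inner: "a < q \<Longrightarrow> ereal q < b \<Longrightarrow> 0 < \<kappa> \<Longrightarrow> q \<in> \<FF> \<Longrightarrow> dom \<kappa> q"
 unfolding dom_def using eventually_conj[OF above_lo[of q \<kappa>] below_hi[of q "8 * \<kappa>"]] by simp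

lemma dom_order:
 assumes "dom \<kappa> q" obtains \<mu> where "\<mu> \<in> \<FF>" "ordD \<kappa> q = ereal \<mu>"
proof -
 have q: "q \<in> \<FF>" "0 < \<kappa>" using assms by (auto simp: dom_def)
 have "EV t. gl t < \<kappa> * t powr q \<and> 8 * \<kappa> * t powr q < gh t" using assms by (simp add: dom_def)
 then have "EV t. D t (\<kappa> * pw q t) > 0" using ev_ok ev_pos
 proof eventually_elim
  case (elim t)
  have "0 < \<kappa> * t powr q" using elim q by simp
  then show ?case using elim by (intro D_pos) (auto simp: pw_def)
 qed
 then have "EV t. False" if "EV t. D t (\<kappa> * pw q t) = 0" using that by eventually_elim simp
 then show ?thesis using that by (cases rule: order_cases[OF dDq[OF q(1)], of \<kappa>]) auto
qed

lemma m_order: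
 assumes "a < q" "ereal q < b" "q \<in> \<FF>"
 shows "order_at_0 (\<lambda>t. D t (pw q t)) = ereal (m q)" "m q \<in> \<FF>" "ord_is (\<lambda>t. D t (pw q t)) (m q)"
proof -
 obtain \<mu> where \<mu>: "\<mu> \<in> \<FF>" "ordD 1 q = ereal \<mu>" using dom_order[OF dom_inner[of q 1]] assms by auto
 then have "m q = \<mu>" by (simp add: m_def)
 then show "order_at_0 (\<lambda>t. D t (pw q t)) = ereal (m q)" "m q \<in> \<FF>" using \<mu> by simp_all
 then show "ord_is (\<lambda>t. D t (pw q t)) (m q)" using order_finite(2)[OF dDq1[OF assms(3)]] by blast
qed

text \<open>From level t powr q' up to t powr q there are about (q' - q) * log 2 (1 / t) doublings.
  If each multiplies the width by at most x, the order drops by at most (q' - q) * log 2 x.\<close>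

lemma slope_le:
 assumes q: "q \<in> \<FF>" "q' \<in> \<FF>" "a < q" "q < q'" "ereal q' < b" and x: "0 < x"
  and r: "EV t. \<forall>u\<in>band q q' t. r t u \<le> x"
 shows "m q' - m q \<le> (q' - q) * log 2 x"
proof -
 have q'': "a < q'" "ereal q < b" using q less_trans[of "ereal q" "ereal q'" b] by simp_all
 obtain c C where C: "C > 0" "EV t. c * t powr m q' \<le> \<bar>D t (pw q' t)\<bar> \<and> \<bar>D t (pw q' t)\<bar> \<le> C * t powr m q'"
  using m_order(3)[OF q''(1) q(5,2)] by (rule ord_is_bounds)
 define K where "K = (1 + x) * max 1 (1 / x)"
 have K: "K > 0" using x by (simp add: K_def)
 have "EV t. \<bar>D t (pw q t)\<bar> \<le> K * C * t powr (m q' - (q' - q) * log 2 x)"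
  using C(2) ev_ok ev_pos ev_less[OF zero_less_one] above_lo[OF q(5) zero_less_one] below_hi[OF q(3), of 4] r
 proof eventually_elim
  case (elim t)
  have lt: "t powr q' \<le> t powr q" using elim q by (intro powr_mono') auto
  have p: "pw q t = t powr q" "pw q' t = t powr q'" using elim by (simp_all add: pw_def)
  have pp: "0 < t powr q" "0 < t powr q'" using elim(3) by simp_all
  have Dp: "0 < D t (t powr q)" "0 < D t (t powr q')"
   using elim(5,6) lt pp by (intro D_pos[OF elim(2)]; linarith)+
  have "D t (t powr q) \<le> K * (t powr q / t powr q') powr (log 2 x) * D t (t powr q')"
   unfolding K_def using elim lt x by (intro iter_le) (auto simp: band_def)
  also have "(t powr q / t powr q') powr (log 2 x) = t powr (- (q' - q) * log 2 x)"
   using elim by (simp add: powr_diff[symmetric] powr_powr)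
  also have "K * t powr (- (q' - q) * log 2 x) * D t (t powr q') \<le> K * t powr (- (q' - q) * log 2 x) * (C * t powr m q')"
   using elim(1) K Dp p by (intro mult_left_mono) auto
  also have "\<dots> = K * C * t powr (m q' - (q' - q) * log 2 x)"
   using elim by (simp add: powr_add[symmetric] powr_diff powr_minus field_simps)
  finally show ?case using Dp p by simp
 qed
 then have "ereal (m q' - (q' - q) * log 2 x) \<le> order_at_0 (\<lambda>t. D t (pw q t))"
  using order_ge_iff[OF dDq1[OF q(1)]] by blast
 then show ?thesis using m_order(1)[OF q(3) q''(2) q(1)] by simp
qed

lemma slope_ge:
 assumes q: "q \<in> \<FF>" "q' \<in> \<FF>" "a < q" "q < q'" "ereal q' < b" and x: "0 < x"
  and r: "EV t. \<forall>u\<in>band q q' t. r t u \<ge> x"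
 shows "m q' - m q \<ge> (q' - q) * log 2 x"
proof -
 have q'': "a < q'" "ereal q < b" using q less_trans[of "ereal q" "ereal q'" b] by simp_all
 obtain c C where C: "c > 0" "EV t. c * t powr m q' \<le> \<bar>D t (pw q' t)\<bar> \<and> \<bar>D t (pw q' t)\<bar> \<le> C * t powr m q'"
  using m_order(3)[OF q''(1) q(5,2)] by (rule ord_is_bounds)
 define K where "K = min 1 (1 / x)"
 have K: "K > 0" using x by (simp add: K_def)
 \<comment> \<open>This makes the two levels differ by a factor of at least 2, as
   \<open>iter_ge\<close> requires.\<close>
 have "((\<lambda>t. 2 * t powr (q' - q)) \<longlongrightarrow> 0) (at_right 0)" using q(4) by real_asymp
 then have half: "EV t. 2 * t powr (q' - q) < 1" by (rule order_tendstoD) simp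
 have "EV t. (K * c / (1 + 1 / x)) * t powr (m q' - (q' - q) * log 2 x) \<le> \<bar>D t (pw q t)\<bar>"
  using C(2) ev_ok ev_pos half above_lo[OF q(5) zero_less_one] below_hi[OF q(3), of 4] r
 proof eventually_elim
  case (elim t)
  have lt: "2 * t powr q' \<le> t powr q" using elim(3,4) by (simp add: powr_diff field_simps)
  have pos: "0 < t powr q'" using elim(3) by simp
  have lt': "t powr q' \<le> t powr q" using lt pos by linarith
  have p: "pw q t = t powr q" "pw q' t = t powr q'" using elim by (simp_all add: pw_def)
  have Dp: "0 < D t (t powr q)" "0 < D t (t powr q')"
   using elim(5,6) lt' pos by (intro D_pos[OF elim(2)]; linarith)+
  have "K * c * t powr (m q' - (q' - q) * log 2 x) = K * t powr (- (q' - q) * log 2 x) * (c * t powr m q')"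
   using elim by (simp add: powr_add[symmetric] powr_diff powr_minus field_simps)
  also have "\<dots> \<le> K * t powr (- (q' - q) * log 2 x) * D t (t powr q')"
   using elim(1) K Dp p by (intro mult_left_mono) auto
  also have "t powr (- (q' - q) * log 2 x) = (t powr q / t powr q') powr (log 2 x)"
   using elim by (simp add: powr_diff[symmetric] powr_powr)
  also have "K * (t powr q / t powr q') powr (log 2 x) * D t (t powr q') \<le> (1 + 1 / x) * D t (t powr q)"
   unfolding K_def using elim lt x pos by (intro iter_ge) (auto simp: band_def)
  finally show ?case using Dp p x by (simp add: field_simps)
 qed
 moreover have "K * c / (1 + 1 / x) > 0" using K C x by (simp add: add_pos_pos)
 ultimately have "order_at_0 (\<lambda>t. D t (pw q t)) \<le> ereal (m q' - (q' - q) * log 2 x)"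
  using order_le_iff[OF dDq1[OF q(1)]] by blast
 then show ?thesis using m_order(1)[OF q(3) q''(2) q(1)] by simp
qed

end

section \<open>Gaps between exceptional exponents\<close>

context increasing_slice
begin

text \<open>The end h may be infinite because the order of g at the lower end may be. Larger
  exponents correspond to lower levels, so l is the end at the top of the strip.\<close>

definition gap :: "real \<Rightarrow> ereal \<Rightarrow> bool" where
 "gap l h \<longleftrightarrow> a \<le> l \<and> h \<le> b \<and> ereal l < h \<and>
   (\<forall>q q'. q \<in> \<FF> \<longrightarrow> q' \<in> \<FF> \<longrightarrow> l < q \<longrightarrow> q \<le> q' \<longrightarrow> ereal q' < h \<longrightarrow> flat q q')"

definition in_gap :: "real \<Rightarrow> ereal \<Rightarrow> real \<Rightarrow> bool" where
 "in_gap l h q \<longleftrightarrow> q \<in> \<FF> \<and> l < q \<and> ereal q < h"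

lemma in_gapD: assumes "gap l h" "in_gap l h q" shows "q \<in> \<FF>" "a < q" "ereal q < b"
 using assms by (auto simp: gap_def in_gap_def)

lemma band_mono: "qa \<le> q \<Longrightarrow> q' \<le> qb \<Longrightarrow> 0 < t \<Longrightarrow> t < 1 \<Longrightarrow> band q q' t \<subseteq> band qa qb t"
 unfolding band_def by (auto intro: order_trans[OF powr_mono'] order_trans[OF _ powr_mono'])

lemma ev_band_mono:
 assumes "EV t. \<forall>u\<in>band qa qb t. P t u" "qa \<le> q" "q' \<le> qb" shows "EV t. \<forall>u\<in>band q q' t. P t u"
 using assms(1) ev_pos ev_less[OF zero_less_one]
 by eventually_elim (use band_mono[OF assms(2,3)] in blast)

text \<open>If the slopes on two adjacent intervals differed, take L strictly between them. By
  flatness r stays on one side of 2 powr L over both intervals, so both slopes lie on the same side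
  of L.\<close>

lemma gap_slope:
 assumes g: "gap l h" and q: "in_gap l h qb" "in_gap l h qc" "in_gap l h qd" "qb < qc" "qc < qd"
 shows "(m qc - m qb) / (qc - qb) = (m qd - m qc) / (qd - qc)"
proof (rule ccontr)
 define s where "s = (m qc - m qb) / (qc - qb)"
 define s' where "s' = (m qd - m qc) / (qd - qc)"
 have s: "m qc - m qb = (qc - qb) * s" "m qd - m qc = (qd - qc) * s'" using q by (simp_all add: s_def s'_def)
 note i = in_gapD[OF g q(1)] in_gapD[OF g q(2)] in_gapD[OF g q(3)]
 assume "(m qc - m qb) / (qc - qb) \<noteq> (m qd - m qc) / (qd - qc)"
 then have ne: "s \<noteq> s'" by (simp add: s_def s'_def)
 define L where "L = (s + s') / 2"
 define x :: real where "x = 2 powr L"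
 have x: "x > 0" "log 2 x = L" by (simp_all add: x_def)
 have "flat qb qd" using g q unfolding gap_def in_gap_def by auto
 then consider "EV t. \<forall>u\<in>band qb qd t. r t u \<le> x" | "EV t. \<forall>u\<in>band qb qd t. r t u \<ge> x"
  unfolding flat_def by blast
 then show False
 proof cases
  case 1
  have "m qc - m qb \<le> (qc - qb) * L" "m qd - m qc \<le> (qd - qc) * L"
   using slope_le[of qb qc x] slope_le[of qc qd x] ev_band_mono[OF 1, of qb qc] ev_band_mono[OF 1, of qc qd] q i x by auto
  then have "s \<le> L" "s' \<le> L" using q s by (simp_all add: mult_le_cancel_left)
  then show False using ne by (simp add: L_def)
 next
  case 2
  have "m qc - m qb \<ge> (qc - qb) * L" "m qd - m qc \<ge> (qd - qc) * L"
   using slope_ge[of qb qc x] slope_ge[of qc qd x] ev_band_mono[OF 2, of qb qc] ev_band_mono[OF 2, of qc qd] q i x by auto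
  then have "s \<ge> L" "s' \<ge> L" using q s by (simp_all add: mult_le_cancel_left)
  then show False using ne by (simp add: L_def)
 qed
qed

text \<open>Equal slopes on adjacent intervals determine m from its values at two points p0 < p1,
  and the coefficients lie in \<open>\<FF>\<close> because these values do.\<close>

lemma gap_affine:
 assumes g: "gap l h"
 obtains \<alpha> d where "\<alpha> \<in> \<FF>" "d \<in> \<FF>" "\<And>q. in_gap l h q \<Longrightarrow> m q = \<alpha> * q + d"
proof -
 have "ereal l < h" using g by (simp add: gap_def)
 then obtain p0 where p0: "in_gap l h p0" using FF_dense_ereal[of l h] by (auto simp: in_gap_def)
 then obtain p1 where p1: "in_gap l h p1" "p0 < p1" using FF_dense_ereal[of p0 h] by (auto simp: in_gap_def)
 note i = in_gapD[OF g p0] in_gapD[OF g p1(1)]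
 define \<alpha> where "\<alpha> = (m p1 - m p0) / (p1 - p0)"
 define d where "d = m p0 - \<alpha> * p0"
 have "m p0 \<in> \<FF>" "m p1 \<in> \<FF>" using m_order(2) i by auto
 then have F: "\<alpha> \<in> \<FF>" "d \<in> \<FF>" using i unfolding \<alpha>_def d_def by (auto intro!: FF_divide FF_diff FF_mult)
 have p1_eq: "m p1 = m p0 + \<alpha> * (p1 - p0)" using p1(2) by (simp add: \<alpha>_def)
 have "m q = \<alpha> * q + d" if q: "in_gap l h q" for q
 proof -
  consider "q < p0" | "q = p0" | "p0 < q" "q < p1" | "q = p1" | "p1 < q" by linarith then show ?thesis
  proof cases
   case 1
   then have "m p0 - m q = \<alpha> * (p0 - q)"
    using gap_slope[OF g q p0 p1(1) 1 p1(2)] by (simp add: \<alpha>_def[symmetric] field_simps)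
   then show ?thesis by (simp add: d_def algebra_simps)
  next
   case 3
   define s where "s = (m q - m p0) / (q - p0)"
   have s: "(m p1 - m q) / (p1 - q) = s" using gap_slope[OF g p0 q p1(1) 3] by (simp add: s_def)
   have "m q - m p0 = s * (q - p0)" "m p1 - m q = s * (p1 - q)"
    using 3 by (simp add: s_def, simp add: s[symmetric])
   then have "\<alpha> * (p1 - p0) = s * (p1 - p0)" using p1_eq by (simp add: algebra_simps)
   then have "s = \<alpha>" using p1(2) by simp
   then show ?thesis using \<open>m q - m p0 = s * (q - p0)\<close> by (simp add: d_def algebra_simps)
  next
   case 5
   then have "m q - m p1 = \<alpha> * (q - p1)"
    using gap_slope[OF g p0 p1(1) q p1(2) 5] by (simp add: \<alpha>_def[symmetric] field_simps)
   then show ?thesis using p1_eq by (simp add: d_def algebra_simps)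
  qed (simp_all add: d_def p1_eq algebra_simps)
 qed
 with F show ?thesis by (rule that)
qed

lemma gap_extend:
 assumes "gap l h" "in_gap l h q" obtains q' where "in_gap l h q'" "q < q'"
 using assms FF_dense_ereal[of q h] unfolding in_gap_def by (meson less_trans)

lemma gap_extend_left:
 assumes "gap l h" "in_gap l h q" obtains q' where "in_gap l h q'" "q' < q"
proof -
 obtain q' where "q' \<in> \<FF>" "l < q'" "q' < q" using FF_dense[of l q] assms(2) by (auto simp: in_gap_def)
 moreover from this have "ereal q' < h" using assms(2) less_trans[of "ereal q'" "ereal q" h] by (simp add: in_gap_def)
 ultimately show ?thesis using that by (simp add: in_gap_def)
qed

text \<open>Flatness leaves r on one side of x. A lower bound x > 2 powr \<alpha> would make m
  steeper than \<alpha>, and an upper bound x < 2 powr \<alpha> would make it less steep; so in each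
  case r lies on the other side.\<close>

lemma gap_r_bounds:
 assumes g: "gap l h" and m: "\<And>q. in_gap l h q \<Longrightarrow> m q = \<alpha> * q + d" and q: "in_gap l h q" "in_gap l h q'" "q \<le> q'"
 shows "2 powr \<alpha> < x \<Longrightarrow> EV t. \<forall>u\<in>band q q' t. r t u \<le> x"
  and "0 < x \<Longrightarrow> x < 2 powr \<alpha> \<Longrightarrow> EV t. \<forall>u\<in>band q q' t. x \<le> r t u"
proof -
 \<comment> \<open>The case q = q' is included, but slopes need a proper interval, hence the
   enlargement to q''.\<close>
 obtain q'' where q'': "in_gap l h q''" "q' < q''" using gap_extend[OF g q(2)] .
 note i = in_gapD[OF g q(1)] in_gapD[OF g q(2)] in_gapD[OF g q''(1)]
 have fl: "flat q q''" using g q q'' unfolding gap_def in_gap_def by auto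
 have mm: "m q'' - m q = (q'' - q) * \<alpha>" using m[OF q(1)] m[OF q''(1)] by (simp add: algebra_simps)
 show "EV t. \<forall>u\<in>band q q' t. r t u \<le> x" if x: "2 powr \<alpha> < x"
 proof -
  have x0: "x > 0" using x powr_gt_zero[of 2 \<alpha>] by linarith
  have "\<alpha> < log 2 x" using x x0 by (simp add: less_log_iff)
  have "\<not> (EV t. \<forall>u\<in>band q q'' t. x \<le> r t u)"
  proof
   assume "EV t. \<forall>u\<in>band q q'' t. x \<le> r t u"
   then have "(q'' - q) * log 2 x \<le> (q'' - q) * \<alpha>" using slope_ge[of q q'' x] i q q'' x0 mm by simp
   then show False using \<open>\<alpha> < log 2 x\<close> q q'' by (simp add: mult_le_cancel_left)
  qed
  then have "EV t. \<forall>u\<in>band q q'' t. r t u \<le> x" using fl unfolding flat_def by blast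
  from ev_band_mono[OF this, of q q'] q'' show ?thesis by simp
 qed
 show "EV t. \<forall>u\<in>band q q' t. x \<le> r t u" if x: "0 < x" "x < 2 powr \<alpha>"
 proof -
  have "log 2 x < \<alpha>" using x by (simp add: log_less_iff)
  have "\<not> (EV t. \<forall>u\<in>band q q'' t. r t u \<le> x)"
  proof
   assume "EV t. \<forall>u\<in>band q q'' t. r t u \<le> x"
   then have "(q'' - q) * \<alpha> \<le> (q'' - q) * log 2 x" using slope_le[of q q'' x] i q q'' x mm by simp
   then show False using \<open>log 2 x < \<alpha>\<close> q q'' by (simp add: mult_le_cancel_left)
  qed
  then have "EV t. \<forall>u\<in>band q q'' t. x \<le> r t u" using fl unfolding flat_def by blast
  from ev_band_mono[OF this, of q q'] q'' show ?thesis by simp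
 qed
qed

lemma in_band: assumes "qb < q" "q < qc" "0 < \<kappa>" shows "EV t. \<kappa> * t powr q \<in> band qb qc t"
proof -
 have "((\<lambda>t. \<kappa> * t powr (q - qb)) \<longlongrightarrow> 0) (at_right 0)" using assms by real_asymp
 then have 1: "EV t. \<kappa> * t powr (q - qb) < 1" by (rule order_tendstoD) simp
 have "((\<lambda>t. t powr (qc - q)) \<longlongrightarrow> 0) (at_right 0)" using assms by real_asymp
 then have 2: "EV t. t powr (qc - q) < \<kappa>" using assms(3) by (rule order_tendstoD)
 show ?thesis using 1 2 ev_pos by eventually_elim (auto simp: band_def powr_diff field_simps)
qed

text \<open>Near the level \<kappa> * t powr q the ratio r is within a factor 2 of 2 powr \<alpha>,
  so the widths of the bands at \<kappa> and 2 * \<kappa> are comparable.\<close>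

lemma gap_double:
 assumes g: "gap l h" and q: "in_gap l h q" and \<kappa>: "0 < \<kappa>" shows "ordD (2 * \<kappa>) q = ordD \<kappa> q"
proof -
 obtain \<alpha> d where m: "\<And>q. in_gap l h q \<Longrightarrow> m q = \<alpha> * q + d" using gap_affine[OF g] by blast
 obtain qb where qb: "in_gap l h qb" "qb < q" using gap_extend_left[OF g q] .
 obtain qc where qc: "in_gap l h qc" "q < qc" using gap_extend[OF g q] .
 define x :: real where "x = 2 powr \<alpha>"
 have x: "x > 0" by (simp add: x_def)
 have up: "EV t. \<forall>u\<in>band qb qc t. r t u \<le> 2 * x"
  by (rule gap_r_bounds(1)[OF g m qb(1) qc(1)]) (use qb qc x in \<open>auto simp: x_def\<close>)
 have dn: "EV t. \<forall>u\<in>band qb qc t. x / 2 \<le> r t u"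
  by (rule gap_r_bounds(2)[OF g m qb(1) qc(1)]) (use qb qc x in \<open>auto simp: x_def\<close>)
 note i = in_gapD[OF g q]
 have "EV t. D t (2 * \<kappa> * pw q t) \<le> 2 * x * D t (\<kappa> * pw q t) \<and> x / 2 * D t (\<kappa> * pw q t) \<le> D t (2 * \<kappa> * pw q t) \<and>
   0 < D t (\<kappa> * pw q t) \<and> 0 < D t (2 * \<kappa> * pw q t)"
  using up dn in_band[OF qb(2) qc(2) \<kappa>] ev_ok ev_pos above_lo[OF i(3) \<kappa>] below_hi[OF i(2), of "4 * \<kappa>"]
 proof eventually_elim
  case (elim t)
  have p: "pw q t = t powr q" "0 < \<kappa> * t powr q" using elim \<kappa> by (simp_all add: pw_def)
  have D: "0 < D t (\<kappa> * t powr q)" "0 < D t (2 * \<kappa> * t powr q)"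
   using elim(6,7) p(2) by (intro D_pos[OF elim(4)]; linarith)+
  have "D t (2 * (\<kappa> * t powr q)) = r t (\<kappa> * t powr q) * D t (\<kappa> * t powr q)"
   using elim(6,7) p(2) by (intro D_step[OF elim(4)]; linarith)
  moreover have "r t (\<kappa> * t powr q) * D t (\<kappa> * t powr q) \<le> 2 * x * D t (\<kappa> * t powr q)"
   "x / 2 * D t (\<kappa> * t powr q) \<le> r t (\<kappa> * t powr q) * D t (\<kappa> * t powr q)"
   using elim D by (intro mult_right_mono; simp)+
  ultimately show ?case using D by (simp add: p mult.assoc)
 qed
 then have "EV t. \<bar>D t (2 * \<kappa> * pw q t)\<bar> \<le> 2 * x * \<bar>D t (\<kappa> * pw q t)\<bar>"
  "EV t. \<bar>D t (\<kappa> * pw q t)\<bar> \<le> 2 / x * \<bar>D t (2 * \<kappa> * pw q t)\<bar>"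
  using x by (auto elim!: eventually_mono simp: field_simps) then show ?thesis
  using order_antimono[OF dDq[OF i(1)] dDq[OF i(1)]] by (intro antisym) blast+
qed

lemma gap_double_iter:
 assumes "gap l h" "in_gap l h q" "0 < \<kappa>" shows "ordD (2 ^ n * \<kappa>) q = ordD \<kappa> q"
proof (induction n)
 case (Suc n)
 then show ?case using gap_double[OF assms(1,2), of "2 ^ n * \<kappa>"] assms(3) by (simp add: mult.assoc)
qed simp

lemma gap_dyadic:
 assumes g: "gap l h" and q: "in_gap l h q"
 shows "order_at_0 (\<lambda>t. D t (2 ^ i * (1 / 2 ^ n) * pw q t)) = ereal (m q)"
proof -
 note i = in_gapD[OF g q]
 have 1: "order_at_0 (\<lambda>t. D t (2 ^ n * (1 / 2 ^ n) * pw q t)) = ereal (m q)"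
  using m_order(1)[OF i(2,3,1)] by simp
 have 2: "order_at_0 (\<lambda>t. D t (2 ^ j * (1 / 2 ^ n) * pw q t)) = ordD (1 / 2 ^ n) q" for j
  by (rule gap_double_iter[OF g q]) simp
 show ?thesis using 1 2[of n] 2[of i] by (simp only:)
qed

text \<open>At an end of a gap the order of the width may depend on \<kappa>. As \<kappa> tends to 0
  the levels approach the gap of exponents above q, and the order becomes constant. For q = a it is
  also the smallness of \<kappa> that keeps the level below gh.\<close>

lemma upper_end_order:
 assumes q: "q \<in> \<FF>" "a \<le> q" "ereal q < b"
 shows "\<exists>\<mu>\<in>\<FF>. \<exists>\<kappa>0>0. \<forall>\<kappa>. 0 < \<kappa> \<longrightarrow> \<kappa> < \<kappa>0 \<longrightarrow> dom \<kappa> q \<and> ordD \<kappa> q = ereal \<mu>"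
proof -
 have "\<exists>\<kappa>0>0. \<forall>\<kappa>. 0 < \<kappa> \<longrightarrow> \<kappa> < \<kappa>0 \<longrightarrow> dom \<kappa> q"
 proof (cases "a = q")
  case True
  obtain \<kappa>0 where \<kappa>0: "\<kappa>0 > 0" "\<And>\<kappa>. 0 < \<kappa> \<Longrightarrow> \<kappa> < \<kappa>0 \<Longrightarrow> EV t. \<kappa> * t powr a < gh t" using below_hi_a by blast
  have "dom \<kappa> q" if "0 < \<kappa>" "\<kappa> < \<kappa>0 / 8" for \<kappa>
   using eventually_conj[OF above_lo[OF q(3) that(1)] \<kappa>0(2)[of "8 * \<kappa>"]] that q(1) True by (simp add: dom_def)
  then show ?thesis using \<kappa>0(1) by (intro exI[of _ "\<kappa>0 / 8"]) auto
 next
  case False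
  then have "a < q" using q by simp
  then show ?thesis using dom_inner q by (intro exI[of _ 1]) auto
 qed
 then obtain \<kappa>0 where \<kappa>0: "\<kappa>0 > 0" "\<And>\<kappa>. 0 < \<kappa> \<Longrightarrow> \<kappa> < \<kappa>0 \<Longrightarrow> dom \<kappa> q" by blast
 have dE: "dfun2 (\<lambda>\<kappa> t. D t (\<kappa> * pw q t))" unfolding dfun2_def by (intro dint dfun2_app[OF dD] q)
 have "ev (\<lambda>\<kappa>. \<not> (EV t. D t (\<kappa> * pw q t) = 0))" using ev_pos ev_less[OF \<kappa>0(1)]
 proof eventually_elim
  case (elim \<kappa>)
  then obtain \<mu> where "ordD \<kappa> q = ereal \<mu>" using dom_order[OF \<kappa>0(2)] by metis
  then show ?case by (metis PInfty_neq_ereal(1) order_infty)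
 qed
 from eventually_constant_order[OF dE this]
 obtain \<mu> where \<mu>: "\<mu> \<in> \<FF>" "ev (\<lambda>\<kappa>. ordD \<kappa> q = ereal \<mu>)" by blast
 then obtain e where "e > 0" "\<And>\<kappa>. 0 < \<kappa> \<Longrightarrow> \<kappa> < e \<Longrightarrow> ordD \<kappa> q = ereal \<mu>"
  by (auto simp: eventually_at_right_field)
 then show ?thesis using \<mu>(1) \<kappa>0 by (intro bexI[of _ \<mu>] exI[of _ "min e \<kappa>0"]) auto
qed

text \<open>As \<kappa> grows the levels approach the gap of exponents below q. The parameter is
  inverted because \<open>eventually_constant_order\<close> speaks about parameters near 0.\<close>

lemma lower_end_order:
 assumes q: "q \<in> \<FF>" "a < q" "ereal q \<le> b" shows "\<exists>\<mu>\<in>\<FF>. \<exists>K>0. \<forall>\<kappa>. K < \<kappa> \<longrightarrow> dom \<kappa> q \<and> ordD \<kappa> q = ereal \<mu>"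
proof -
 have "\<exists>K>0. \<forall>\<kappa>. K < \<kappa> \<longrightarrow> dom \<kappa> q"
 proof (cases "b = ereal q")
  case True
  obtain K where K: "K > 0" "\<And>\<kappa>. K < \<kappa> \<Longrightarrow> EV t. gl t < \<kappa> * t powr q" using above_lo_b[OF True] by blast
  have "dom \<kappa> q" if "K < \<kappa>" for \<kappa>
   using eventually_conj[OF K(2)[OF that] below_hi[OF q(2), of "8 * \<kappa>"]] that q(1) K(1) by (simp add: dom_def)
  then show ?thesis using K(1) by blast
 next
  case False
  then have "ereal q < b" using q by simp
  then show ?thesis using dom_inner q by (intro exI[of _ 1]) auto
 qed
 then obtain K where K: "K > 0" "\<And>\<kappa>. K < \<kappa> \<Longrightarrow> dom \<kappa> q" by blast
 have dE: "dfun2 (\<lambda>\<kappa> t. D t (inverse \<kappa> * pw q t))" unfolding dfun2_def by (intro dint dfun2_app[OF dD] q)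
 have "inverse K > 0" using K(1) by simp
 have "ev (\<lambda>\<kappa>. \<not> (EV t. D t (inverse \<kappa> * pw q t) = 0))" using ev_pos ev_less[OF \<open>inverse K > 0\<close>]
 proof eventually_elim
  case (elim \<kappa>)
  then have "K < inverse \<kappa>" using K(1) by (simp add: field_simps)
  then obtain \<mu> where "ordD (inverse \<kappa>) q = ereal \<mu>" using dom_order[OF K(2)] by metis
  then show ?case by (metis PInfty_neq_ereal(1) order_infty)
 qed
 from eventually_constant_order[OF dE this]
 obtain \<mu> where \<mu>: "\<mu> \<in> \<FF>" "ev (\<lambda>\<kappa>. ordD (inverse \<kappa>) q = ereal \<mu>)" by blast
 then obtain e where e: "e > 0" "\<And>\<kappa>. 0 < \<kappa> \<Longrightarrow> \<kappa> < e \<Longrightarrow> ordD (inverse \<kappa>) q = ereal \<mu>"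
  by (auto simp: eventually_at_right_field)
 have "ordD \<kappa> q = ereal \<mu>" if "inverse e < \<kappa>" for \<kappa>
 proof -
  have "0 < \<kappa>" using that e(1) by (meson inverse_positive_iff_positive less_trans)
  then show ?thesis using e(2)[of "inverse \<kappa>"] that e(1) by (simp add: field_simps)
 qed
 then show ?thesis using \<mu>(1) K by (intro bexI[of _ \<mu>] exI[of _ "max (inverse e) K"]) auto
qed

text \<open>Continuity of an affine function along exponents l + s * p with p in
  \<open>\<FF>\<close>, which is dense; s = 1 approaches l from above and s = -1 from below.\<close>

lemma affine_limit:
 fixes \<alpha> d l \<mu> :: real
 assumes "s = 1 \<or> s = -1"
  and "\<And>\<delta>. \<delta> > 0 \<Longrightarrow> \<exists>p0>0. \<forall>p\<in>\<FF>. 0 < p \<longrightarrow> p < p0 \<longrightarrow> \<bar>\<alpha> * (l + s * p) + d - \<mu>\<bar> \<le> \<delta>"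
 shows "\<mu> = \<alpha> * l + d"
proof (rule ccontr)
 assume "\<mu> \<noteq> \<alpha> * l + d"
 define e where "e = \<bar>\<alpha> * l + d - \<mu>\<bar>"
 have e: "e > 0" using \<open>\<mu> \<noteq> \<alpha> * l + d\<close> by (simp add: e_def)
 then obtain p0 where p0: "p0 > 0" "\<And>p. p \<in> \<FF> \<Longrightarrow> 0 < p \<Longrightarrow> p < p0 \<Longrightarrow> \<bar>\<alpha> * (l + s * p) + d - \<mu>\<bar> \<le> e / 2"
  using assms(2)[of "e / 2"] by auto
 have "0 < min p0 (e / (4 * (\<bar>\<alpha>\<bar> + 1)))" using p0 e by (simp add: divide_pos_pos)
 then obtain p where p: "p \<in> \<FF>" "0 < p" "p < p0" "p < e / (4 * (\<bar>\<alpha>\<bar> + 1))" using FF_dense by (metis min_less_iff_conj)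
 have "\<bar>\<alpha>\<bar> * p \<le> (\<bar>\<alpha>\<bar> + 1) * p" using p by simp
 also have "\<dots> < e / 4" using p(4) by (simp add: field_simps)
 finally have 1: "\<bar>\<alpha> * p\<bar> < e / 4" using p(2) by (simp add: abs_mult)
 have 2: "\<bar>\<alpha> * (l + s * p) + d - \<mu>\<bar> \<le> e / 2" using p0(2) p by blast
 have "\<alpha> * (l + s * p) + d - \<mu> = (\<alpha> * l + d - \<mu>) + \<alpha> * p \<or> \<alpha> * (l + s * p) + d - \<mu> = (\<alpha> * l + d - \<mu>) - \<alpha> * p"
  using assms(1) by (auto simp: algebra_simps)
 then have "\<bar>(\<alpha> * l + d - \<mu>) + \<alpha> * p\<bar> \<le> e / 2 \<or> \<bar>(\<alpha> * l + d - \<mu>) - \<alpha> * p\<bar> \<le> e / 2" using 2 by metis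
 then show False using 1 e abs_triangle_ineq2[of "\<alpha> * l + d - \<mu>" "\<alpha> * p"] abs_triangle_ineq2[of "\<alpha> * l + d - \<mu>" "- (\<alpha> * p)"]
  unfolding e_def[symmetric] by (auto simp del: mult_minus_right mult_minus_left)
qed

text \<open>For \<kappa> = t powr p the level \<kappa> * t powr l is t powr (l + p), which lies in
  the gap, so its order is \<alpha> * (l + p) + d. By \<open>diagonal_order\<close> it is within
  \<delta> of \<mu> for small p, and p tends to 0.\<close>

lemma upper_end_affine:
 assumes g: "gap l h" and m: "\<And>q. in_gap l h q \<Longrightarrow> m q = \<alpha> * q + d" and l: "l \<in> \<FF>" and \<mu>: "\<mu> \<in> \<FF>"
  and \<kappa>0: "\<kappa>0 > 0" "\<And>\<kappa>. 0 < \<kappa> \<Longrightarrow> \<kappa> < \<kappa>0 \<Longrightarrow> ordD \<kappa> l = ereal \<mu>"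
 shows "\<mu> = \<alpha> * l + d"
proof (rule affine_limit[of 1])
 fix \<delta> :: real assume "\<delta> > 0"
 have dE: "dfun2 (\<lambda>\<kappa> t. D t (\<kappa> * pw l t))" unfolding dfun2_def by (intro dint dfun2_app[OF dD] l)
 have "ev (\<lambda>\<kappa>. ordD \<kappa> l = ereal \<mu>)" using ev_pos ev_less[OF \<kappa>0(1)] by eventually_elim (rule \<kappa>0(2))
 from diagonal_order[OF dE \<mu> this \<open>\<delta> > 0\<close>]
 obtain p0 where p0: "p0 > 0" "\<And>p. p \<in> \<FF> \<Longrightarrow> 0 < p \<Longrightarrow> p < p0 \<Longrightarrow>
   ereal (\<mu> - \<delta>) \<le> order_at_0 (\<lambda>t. D t (pw p t * pw l t)) \<and> order_at_0 (\<lambda>t. D t (pw p t * pw l t)) \<le> ereal (\<mu> + \<delta>)"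
  by blast
 have "ereal l < h" using g by (simp add: gap_def)
 then obtain l1 where l1: "l < l1" "ereal l1 < h" using ereal_dense2 by (metis less_ereal.simps(1))
 have "\<bar>\<alpha> * (l + 1 * p) + d - \<mu>\<bar> \<le> \<delta>" if p: "p \<in> \<FF>" "0 < p" "p < min p0 (l1 - l)" for p
 proof -
  have "ereal (l + p) < h" using p l1(2) by (intro less_trans[OF _ l1(2)]) simp
  then have ig: "in_gap l h (l + p)" using p l by (simp add: in_gap_def FF_add)
  have "order_at_0 (\<lambda>t. D t (pw p t * pw l t)) = order_at_0 (\<lambda>t. D t (pw (l + p) t))"
   by (rule order_cong) (use ev_pos in eventually_elim, simp add: pw_def powr_add mult.commute)
  then have "order_at_0 (\<lambda>t. D t (pw p t * pw l t)) = ereal (m (l + p))" using m_order(1) in_gapD[OF g ig] by simp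
  then show ?thesis using p0(2)[OF p(1,2)] p(3) m[OF ig] by (auto simp: abs_le_iff)
 qed
 then show "\<exists>p0>0. \<forall>p\<in>\<FF>. 0 < p \<longrightarrow> p < p0 \<longrightarrow> \<bar>\<alpha> * (l + 1 * p) + d - \<mu>\<bar> \<le> \<delta>"
  using p0(1) l1(1) by (intro exI[of _ "min p0 (l1 - l)"]) auto
qed simp

text \<open>The same with the constant t powr - p, which moves the exponent from h into the gap at h
  - p.\<close>

lemma lower_end_affine:
 assumes g: "gap l (ereal h)" and m: "\<And>q. in_gap l (ereal h) q \<Longrightarrow> m q = \<alpha> * q + d" and h: "h \<in> \<FF>" and \<mu>: "\<mu> \<in> \<FF>"
  and K: "K > 0" "\<And>\<kappa>. K < \<kappa> \<Longrightarrow> ordD \<kappa> h = ereal \<mu>"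
 shows "\<mu> = \<alpha> * h + d"
proof (rule affine_limit[of "-1"])
 fix \<delta> :: real assume "\<delta> > 0"
 have dE: "dfun2 (\<lambda>\<kappa> t. D t (inverse \<kappa> * pw h t))" unfolding dfun2_def by (intro dint dfun2_app[OF dD] h)
 have "inverse K > 0" using K(1) by simp
 have "ev (\<lambda>\<kappa>. ordD (inverse \<kappa>) h = ereal \<mu>)" using ev_pos ev_less[OF \<open>inverse K > 0\<close>]
  by eventually_elim (rule K(2), use K(1) in \<open>simp add: field_simps\<close>)
 from diagonal_order[OF dE \<mu> this \<open>\<delta> > 0\<close>]
 obtain p0 where p0: "p0 > 0" "\<And>p. p \<in> \<FF> \<Longrightarrow> 0 < p \<Longrightarrow> p < p0 \<Longrightarrow>
   ereal (\<mu> - \<delta>) \<le> order_at_0 (\<lambda>t. D t (inverse (pw p t) * pw h t)) \<and> order_at_0 (\<lambda>t. D t (inverse (pw p t) * pw h t)) \<le> ereal (\<mu> + \<delta>)"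
  by blast
 have "l < h" using g by (simp add: gap_def)
 have "\<bar>\<alpha> * (h + - 1 * p) + d - \<mu>\<bar> \<le> \<delta>" if p: "p \<in> \<FF>" "0 < p" "p < min p0 (h - l)" for p
 proof -
  have ig: "in_gap l (ereal h) (h - p)" using p h by (simp add: in_gap_def FF_diff)
  have "order_at_0 (\<lambda>t. D t (inverse (pw p t) * pw h t)) = order_at_0 (\<lambda>t. D t (pw (h - p) t))"
   by (rule order_cong) (use ev_pos in eventually_elim, simp add: pw_def powr_diff field_simps)
  then have "order_at_0 (\<lambda>t. D t (inverse (pw p t) * pw h t)) = ereal (m (h - p))" using m_order(1) in_gapD[OF g ig] by simp
  then show ?thesis using p0(2)[OF p(1,2)] p(3) m[OF ig] by (auto simp: abs_le_iff)
 qed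
 then show "\<exists>p0>0. \<forall>p\<in>\<FF>. 0 < p \<longrightarrow> p < p0 \<longrightarrow> \<bar>\<alpha> * (h + - 1 * p) + d - \<mu>\<bar> \<le> \<delta>"
  using p0(1) \<open>l < h\<close> by (intro exI[of _ "min p0 (h - l)"]) auto
qed simp

end

section \<open>Slices with affine widths\<close>

context polynomially_bounded_ominimal_structure
begin

abbreviation sign_definite where
 "sign_definite g x y \<equiv> (EV t. \<forall>s. x t < s \<longrightarrow> s < y t \<longrightarrow> g t s = 0) \<or> (EV t. \<forall>s. x t < s \<longrightarrow> s < y t \<longrightarrow> g t s \<noteq> 0)"

abbreviation ord_diff :: "(real \<Rightarrow> real) \<Rightarrow> (real \<Rightarrow> real) \<Rightarrow> ereal" where
 "ord_diff x y \<equiv> order_at_0 (\<lambda>t. y t - x t)"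

definition inS :: "(real \<Rightarrow> real) \<Rightarrow> (real \<Rightarrow> real) \<Rightarrow> (real \<Rightarrow> real) \<Rightarrow> bool" where
 "inS x y s \<longleftrightarrow> dfun1 s \<and> (EV t. x t \<le> s t \<and> s t \<le> y t)"

definition ordg :: "(real \<Rightarrow> real \<Rightarrow> real) \<Rightarrow> (real \<Rightarrow> real) \<Rightarrow> ereal" where
 "ordg g s = order_at_0 (\<lambda>t. g t (s t))"

definition Qs :: "(real \<Rightarrow> real \<Rightarrow> real) \<Rightarrow> (real \<Rightarrow> real) \<Rightarrow> (real \<Rightarrow> real) \<Rightarrow> ereal set" where
 "Qs g x y = {ordg g s | s. inS x y s}"

definition width :: "(real \<Rightarrow> real \<Rightarrow> real) \<Rightarrow> (real \<Rightarrow> real) \<Rightarrow> (real \<Rightarrow> real) \<Rightarrow> (real \<Rightarrow> real) \<Rightarrow> ereal" where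
 "width g x y s = Inf {1 + ord_diff s1 s2 | s1 s2. inS x y s1 \<and> inS x y s2 \<and>
   (EV t. s1 t < s2 t) \<and> inS s1 s2 s \<and> (\<exists>q. Qs g s1 s2 = {q})}"

definition seg :: "ereal \<Rightarrow> ereal \<Rightarrow> ereal set" where
 "seg p q = {x \<in> order_values S. min p q \<le> x \<and> x \<le> max p q}"

text \<open>The conditions on a pizza slice, in terms of the slopes of arcs. By the formula for the order of
 tangency of two arcs, Hoelder exponents are orders of differences of slopes plus \<open>1\<close>.\<close>

definition good_slice :: "(real \<Rightarrow> real \<Rightarrow> real) \<Rightarrow> (real \<Rightarrow> real) \<Rightarrow> (real \<Rightarrow> real) \<Rightarrow> bool" where
 "good_slice g x y \<longleftrightarrow> dfun1 x \<and> dfun1 y \<and> (EV t. x t < y t) \<and>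
   (\<forall>s1 s s2. inS x y s1 \<longrightarrow> inS x y s2 \<longrightarrow> inS s1 s2 s \<longrightarrow> ordg g s1 = ordg g s2 \<longrightarrow> ordg g s = ordg g s1) \<and>
   sign_definite g x y \<and>
   Qs g x y = seg (ordg g x) (ordg g y) \<and>
   (\<exists>\<mu>. affine_width S (Qs g x y) \<mu> \<and> min (\<mu> (ordg g x)) (\<mu> (ordg g y)) = 1 + ord_diff x y \<and>
    (\<forall>s. inS x y s \<longrightarrow> width g x y s = \<mu> (ordg g s)))"

definition wmono :: "(real \<Rightarrow> real \<Rightarrow> real) \<Rightarrow> (real \<Rightarrow> real) \<Rightarrow> (real \<Rightarrow> real) \<Rightarrow> bool" where
 "wmono g x y \<longleftrightarrow> (EV t. \<forall>s s'. x t \<le> s \<longrightarrow> s \<le> s' \<longrightarrow> s' \<le> y t \<longrightarrow> 0 \<le> g t s \<and> g t s \<le> g t s')"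

lemma order_values_iff: "q \<in> order_values S \<longleftrightarrow> q = \<infinity> \<or> (\<exists>p\<in>\<FF>. 0 < p \<and> q = ereal p)"
 by (auto simp: order_values_def \<FF>_def)

lemma dfun1_comp2: "dfun2 g \<Longrightarrow> dfun1 s \<Longrightarrow> dfun1 (\<lambda>t. g t (s t))"
 unfolding dfun1_def[of "\<lambda>t. g t (s t)"] by (intro dint dfun2_app[of g] dfun1_app[of s]) auto

lemma dfun1_diff: "dfun1 s \<Longrightarrow> dfun1 s' \<Longrightarrow> dfun1 (\<lambda>t. s t - s' t)"
 unfolding dfun1_def[of "\<lambda>t. s t - s' t"] by (intro dint dfun1_app[of s] dfun1_app[of s']) auto

lemma order_values_order: "dfun1 v \<Longrightarrow> 0 < order_at_0 v \<Longrightarrow> order_at_0 v \<in> order_values S"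
 by (cases rule: order_cases[of v]) (auto simp: order_values_iff)

lemma wmono_order:
 assumes g: "dfun2 g" and m: "wmono g x y" and s: "dfun1 s" "dfun1 s'" "EV t. x t \<le> s t \<and> s t \<le> s' t \<and> s' t \<le> y t"
 shows "ordg g s' \<le> ordg g s"
 unfolding ordg_def
proof (rule order_antimono[where C = 1])
 show "EV t. \<bar>g t (s t)\<bar> \<le> 1 * \<bar>g t (s' t)\<bar>" using m s(3) unfolding wmono_def
 by eventually_elim fastforce
qed (rule dfun1_comp2[OF g s(1)], rule dfun1_comp2[OF g s(2)])

lemma inS_trans: assumes "inS x y s1" "inS x y s2" "inS s1 s2 s" shows "inS x y s"
proof -
 have e: "EV t. x t \<le> s1 t \<and> s1 t \<le> y t" "EV t. x t \<le> s2 t \<and> s2 t \<le> y t" "EV t. s1 t \<le> s t \<and> s t \<le> s2 t"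
  using assms by (auto simp: inS_def)
 have "EV t. x t \<le> s t \<and> s t \<le> y t" using e by eventually_elim auto
 then show ?thesis using assms(3) by (simp add: inS_def)
qed

lemma wmono_between:
 assumes g: "dfun2 g" and m: "wmono g x y" and s: "inS x y s1" "inS x y s2" "inS s1 s2 s"
 shows "ordg g s2 \<le> ordg g s" "ordg g s \<le> ordg g s1"
proof -
 have d: "dfun1 s1" "dfun1 s2" "dfun1 s" using s by (auto simp: inS_def)
 have e: "EV t. x t \<le> s1 t \<and> s1 t \<le> y t" "EV t. x t \<le> s2 t \<and> s2 t \<le> y t" "EV t. s1 t \<le> s t \<and> s t \<le> s2 t"
  using s by (auto simp: inS_def)
 show "ordg g s2 \<le> ordg g s" by (rule wmono_order[OF g m d(3,2)]) (use e in eventually_elim, auto)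
 show "ordg g s \<le> ordg g s1" by (rule wmono_order[OF g m d(1,3)]) (use e in eventually_elim, auto)
qed

lemma inS_ends: "dfun1 x \<Longrightarrow> dfun1 y \<Longrightarrow> EV t. x t < y t \<Longrightarrow> inS x y x \<and> inS x y y"
 unfolding inS_def by (auto elim: eventually_mono)

lemma order_diff_mono:
 assumes "dfun1 s1" "dfun1 s2" "dfun1 x" "dfun1 y" "EV t. x t \<le> s1 t \<and> s1 t \<le> s2 t \<and> s2 t \<le> y t"
 shows "ord_diff x y \<le> ord_diff s1 s2"
proof (rule order_antimono[where C = 1])
 show "EV t. \<bar>s2 t - s1 t\<bar> \<le> 1 * \<bar>y t - x t\<bar>" using assms(5) by eventually_elim auto
qed (intro dfun1_diff assms)+

lemma order_diff_finite:
 assumes "dfun1 x" "dfun1 y" "EV t. x t < y t"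
 obtains p where "p \<in> \<FF>" "ord_diff x y = ereal p"
proof -
 have "EV t. False" if "EV t. y t - x t = 0" using that assms(3) by eventually_elim simp
 then show ?thesis using that by (cases rule: order_cases[OF dfun1_diff[OF assms(2,1)]]) auto
qed

text \<open>Monotonicity squeezes every order between those of the sides, so \<open>Q\<close> is a
  point. The slice itself then competes in the infimum that defines the width, and being the largest
  triangle it has the least exponent.\<close>

lemma point_slice:
 assumes g: "dfun2 g" and x: "dfun1 x" and y: "dfun1 y" and xy: "EV t. x t < y t"
  and m: "wmono g x y" and eq: "ordg g x = ordg g y" and pos: "0 < ordg g y"
  and sgn: "sign_definite g x y"
 shows "good_slice g x y"
proof -
 define q where "q = ordg g y"
 have ends: "inS x y x" "inS x y y" using inS_ends[OF x y xy] by auto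
 have const: "ordg g s = q" if "inS x y s" for s
  using wmono_between[OF g m ends that] eq by (simp add: q_def)
 then have Q: "Qs g x y = {q}" using ends by (auto simp: Qs_def)
 have qv: "q \<in> order_values S"
  unfolding q_def ordg_def by (rule order_values_order[OF dfun1_comp2[OF g y]]) (use pos in \<open>simp add: ordg_def\<close>)
 obtain p where p: "p \<in> \<FF>" "ord_diff x y = ereal p" by (rule order_diff_finite[OF x y xy])
 have w: "width g x y s = ereal (1 + p)" if s: "inS x y s" for s unfolding width_def
 proof (rule antisym)
  show "Inf {1 + ord_diff s1 s2 | s1 s2. inS x y s1 \<and> inS x y s2 \<and>
    (EV t. s1 t < s2 t) \<and> inS s1 s2 s \<and> (\<exists>q. Qs g s1 s2 = {q})} \<le> ereal (1 + p)"
   by (rule Inf_lower, rule CollectI, rule exI[of _ x], rule exI[of _ y]) (use s ends xy Q p in \<open>auto simp: one_ereal_def\<close>)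
  show "ereal (1 + p) \<le> Inf {1 + ord_diff s1 s2 | s1 s2. inS x y s1 \<and> inS x y s2 \<and>
    (EV t. s1 t < s2 t) \<and> inS s1 s2 s \<and> (\<exists>q. Qs g s1 s2 = {q})}"
  proof (rule Inf_greatest, clarify)
   fix s1 s2 assume s12: "inS x y s1" "inS x y s2" "EV t. s1 t < s2 t"
   have "EV t. x t \<le> s1 t" "EV t. s2 t \<le> y t" using s12 unfolding inS_def by (auto elim: eventually_mono)
   then have e: "EV t. x t \<le> s1 t \<and> s1 t \<le> s2 t \<and> s2 t \<le> y t" using s12(3) by eventually_elim auto
   have "ereal p \<le> ord_diff s1 s2" using order_diff_mono[OF _ _ x y e] s12 p by (simp add: inS_def)
   then show "ereal (1 + p) \<le> 1 + ord_diff s1 s2" by (cases "ord_diff s1 s2") (auto simp: one_ereal_def)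
  qed
 qed
 have aff: "affine_width S (Qs g x y) (\<lambda>_. ereal (1 + p))" unfolding affine_width_def Q
 using FF_add[OF FF_1 p(1)] FF_0 by (fastforce simp: \<FF>_def)
 show ?thesis unfolding good_slice_def
 proof (intro conjI x y xy sgn allI impI)
  show "Qs g x y = seg (ordg g x) (ordg g y)" using qv by (auto simp: Q seg_def eq q_def)
  show "ordg g s = ordg g s1" if "inS x y s1" "inS x y s2" "inS s1 s2 s" for s1 s s2
   using const[OF that(1)] const[OF inS_trans[OF that]] by simp
  show "\<exists>\<mu>. affine_width S (Qs g x y) \<mu> \<and> min (\<mu> (ordg g x)) (\<mu> (ordg g y)) = 1 + ord_diff x y \<and>
    (\<forall>s. inS x y s \<longrightarrow> width g x y s = \<mu> (ordg g s))"
   using aff w p by (intro exI[of _ "\<lambda>_. ereal (1 + p)"]) (simp add: one_ereal_def)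
 qed
qed

text \<open>Bookkeeping for the slice over a gap. The exponent of the slice has to be the smaller of
  the two end widths. If the order at x is infinite, the width must tend to \<infinity> there, which
  is what 0 < \<alpha> ensures, and the smaller end is y.\<close>

lemma affine_slice:
 assumes g: "dfun2 g" and x: "dfun1 x" and y: "dfun1 y" and xy: "EV t. x t < y t"
  and m: "wmono g x y" and lt: "ordg g y = ereal l" "ereal l < ordg g x" and pos: "0 < l"
  and sgn: "EV t. \<forall>s. x t < s \<longrightarrow> s < y t \<longrightarrow> g t s \<noteq> 0"
  and surj: "\<And>q. q \<in> \<FF> \<Longrightarrow> l < q \<Longrightarrow> ereal q < ordg g x \<Longrightarrow> \<exists>s. inS x y s \<and> ordg g s = ereal q"
  and F: "\<alpha> \<in> \<FF>" "d \<in> \<FF>"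
  and w: "\<And>s q. inS x y s \<Longrightarrow> ordg g s = ereal q \<Longrightarrow> width g x y s = 1 + ereal (\<alpha> * q + d)"
  and w_inf: "\<And>s. inS x y s \<Longrightarrow> ordg g s = \<infinity> \<Longrightarrow> width g x y s = \<infinity>"
  and end_inf: "ordg g x = \<infinity> \<Longrightarrow> 0 < \<alpha> \<and> ord_diff x y = ereal (\<alpha> * l + d)"
  and end_fin: "\<And>h. ordg g x = ereal h \<Longrightarrow> ord_diff x y = ereal (min (\<alpha> * l + d) (\<alpha> * h + d))"
 shows "good_slice g x y"
proof -
 have ends: "inS x y x" "inS x y y" using inS_ends[OF x y xy] by auto
 have btw: "ereal l \<le> ordg g s \<and> ordg g s \<le> ordg g x" if "inS x y s" for s
  using wmono_between[OF g m ends that] lt by simp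
 have mm: "min (ordg g x) (ordg g y) = ereal l" "max (ordg g x) (ordg g y) = ordg g x" using lt by (auto simp: min_def max_def)
 have Q: "Qs g x y = seg (ordg g x) (ordg g y)"
 proof (intro set_eqI iffI)
  fix q assume "q \<in> Qs g x y"
  then obtain s where s: "inS x y s" "q = ordg g s" by (auto simp: Qs_def)
  have "dfun1 s" using s by (simp add: inS_def)
  have "0 < q" using btw[OF s(1)] s(2) pos by (metis ereal_less(2) less_le_trans)
  then have "q \<in> order_values S"
   using order_values_order[OF dfun1_comp2[OF g \<open>dfun1 s\<close>]] s by (simp add: ordg_def)
  then show "q \<in> seg (ordg g x) (ordg g y)" using btw[OF s(1)] s(2) by (simp add: seg_def mm)
 next
  fix q assume "q \<in> seg (ordg g x) (ordg g y)"
  then have q: "q \<in> order_values S" "ereal l \<le> q" "q \<le> ordg g x" by (simp_all add: seg_def mm)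
  show "q \<in> Qs g x y"
  proof (cases "q = ereal l \<or> q = ordg g x")
   case True
   then have "q = ordg g y \<or> q = ordg g x" using lt(1) by simp
   then show ?thesis using ends unfolding Qs_def by blast
  next
   case False
   then obtain p where "q = ereal p" "p \<in> \<FF>" using q by (auto simp: order_values_iff)
   then show ?thesis using surj[of p] False q unfolding Qs_def by (force simp: less_le)
  qed
 qed
 \<comment> \<open>\<alpha> and d describe orders of differences of slopes; the added 1 converts
   them to Hoelder exponents.\<close>
 define \<mu> :: "ereal \<Rightarrow> ereal" where "\<mu> q = (if q = \<infinity> then \<infinity> else ereal (\<alpha> * real_of_ereal q + (1 + d)))" for q
 have \<mu>: "\<mu> (ereal q) = 1 + ereal (\<alpha> * q + d)" for q by (simp add: \<mu>_def one_ereal_def)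
 have Qfin: "q = \<infinity> \<or> (\<exists>p\<in>\<FF>. q = ereal p)" if "q \<in> Qs g x y" for q
  using that by (auto simp: Q seg_def order_values_iff)
 have aff: "affine_width S (Qs g x y) \<mu>" unfolding affine_width_def
 proof (intro conjI impI ballI)
  show "\<mu> q \<in> insert \<infinity> (ereal ` exponent_field S)" if "q \<in> Qs g x y" for q
  proof -
   from Qfin[OF that] have "q = \<infinity> \<or> \<alpha> * real_of_ereal q + (1 + d) \<in> \<FF>"
    using F FF_1 by (auto intro!: FF_add FF_mult)
   then show ?thesis by (auto simp: \<mu>_def \<FF>_def)
  qed
  show "\<exists>c\<in>exponent_field S. \<exists>d\<in>exponent_field S. (\<forall>q. ereal q \<in> Qs g x y \<longrightarrow> \<mu> (ereal q) = ereal (c * q + d)) \<and>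
    (\<infinity> \<in> Qs g x y \<longrightarrow> ((\<lambda>q. ereal (c * q + d)) \<longlongrightarrow> \<mu> \<infinity>) at_top)"
  proof (rule bexI[of _ \<alpha>], rule bexI[of _ "1 + d"], intro conjI allI impI)
   show "\<mu> (ereal q) = ereal (\<alpha> * q + (1 + d))" for q by (simp add: \<mu>_def)
   assume "\<infinity> \<in> Qs g x y"
   then have "ordg g x = \<infinity>" by (auto simp: Q seg_def mm)
   then have "0 < \<alpha>" using end_inf by simp
   then have "filterlim (\<lambda>q. \<alpha> * q + (1 + d)) at_top at_top" by real_asymp
   then show "((\<lambda>q. ereal (\<alpha> * q + (1 + d))) \<longlongrightarrow> \<mu> \<infinity>) at_top"
    by (simp add: \<mu>_def tendsto_PInfty filterlim_at_top_dense)
  qed (use F FF_add[OF FF_1 F(2)] in \<open>simp_all add: \<FF>_def\<close>)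
 qed
 have minw: "min (\<mu> (ordg g x)) (\<mu> (ordg g y)) = 1 + ord_diff x y"
 proof (cases "ordg g x")
  case (real h)
  then show ?thesis using end_fin[OF real] lt(1) by (simp add: \<mu>_def one_ereal_def min_def)
 next
  case PInf
  then show ?thesis using end_inf lt(1) by (simp add: \<mu>_def one_ereal_def)
 qed (use lt in auto)
 show ?thesis unfolding good_slice_def
 proof (intro conjI x y xy disjI2[OF sgn] Q allI impI)
  show "ordg g s = ordg g s1" if "inS x y s1" "inS x y s2" "inS s1 s2 s" "ordg g s1 = ordg g s2" for s1 s s2
   using wmono_between[OF g m that(1-3)] that(4) by simp
  have "width g x y s = \<mu> (ordg g s)" if s: "inS x y s" for s
  proof (cases "ordg g s")
   case (real q)
   then show ?thesis using w[OF s real] by (simp add: \<mu>)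
  next
   case PInf
   then show ?thesis using w_inf[OF s] by (simp add: \<mu>_def)
  qed (use btw[OF s] in auto)
  then show "\<exists>\<mu>. affine_width S (Qs g x y) \<mu> \<and> min (\<mu> (ordg g x)) (\<mu> (ordg g y)) = 1 + ord_diff x y \<and>
    (\<forall>s. inS x y s \<longrightarrow> width g x y s = \<mu> (ordg g s))"
   using aff minw by blast
 qed
qed

lemma order_add_ge:
 assumes "dfun1 v" "dfun1 w" "ereal M \<le> order_at_0 v" "ereal M \<le> order_at_0 w"
 shows "ereal M \<le> order_at_0 (\<lambda>t. v t + w t)"
proof -
 obtain C C' where C: "EV t. \<bar>v t\<bar> \<le> C * t powr M" "EV t. \<bar>w t\<bar> \<le> C' * t powr M"
  using assms order_ge_iff by blast
 have "EV t. \<bar>v t + w t\<bar> \<le> (C + C') * t powr M" using C by eventually_elim (simp add: algebra_simps)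
 moreover have "dfun1 (\<lambda>t. v t + w t)" unfolding dfun1_def by (intro dint dfun1_app[OF assms(1)] dfun1_app[OF assms(2)])
 ultimately show ?thesis using order_ge_iff by blast
qed

end

context polynomially_bounded_ominimal_structure
begin

lemma order_eqI:
 assumes "dfun1 v" "c > 0" "EV t. c * t powr p \<le> \<bar>v t\<bar>" "EV t. \<bar>v t\<bar> \<le> C * t powr p"
 shows "order_at_0 v = ereal p"
 using assms order_ge_iff[OF assms(1), of p] order_le_iff[OF assms(1), of p] by (metis antisym)

lemma dfun1_app2: "dfun2 f \<Longrightarrow> dfun1 v \<Longrightarrow> dfun1 (\<lambda>t. f t (v t))"
 by (rule dfun1_comp2)

end

text \<open>A gap cut off at the level c * t powr l above and C * t powr h below, with c so small
  and C so large that the orders of the dyadic widths have settled to the affine values at both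
  ends. For h = \<infinity> the strip reaches down to gl, which is then eventually 0.\<close>

locale gap_slice = increasing_slice +
 fixes l :: real and h :: ereal and \<alpha> d c :: real and bot :: "real \<Rightarrow> real"
 assumes gap: "gap l h"
  and F: "\<alpha> \<in> \<FF>" "d \<in> \<FF>" "l \<in> \<FF>"
  and affine: "\<And>q. in_gap l h q \<Longrightarrow> m q = \<alpha> * q + d"
  and c: "c > 0" "\<And>\<kappa>. 0 < \<kappa> \<Longrightarrow> \<kappa> \<le> 8 * c \<Longrightarrow> dom \<kappa> l \<and> ordD \<kappa> l = ereal (\<alpha> * l + d)"
  and dbot: "dfun1 bot"
  and bot: "(\<exists>h' C. h = ereal h' \<and> h' \<in> \<FF> \<and> C > 0 \<and> bot = (\<lambda>t. C * pw h' t) \<and>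
     (\<forall>\<kappa>\<ge>C. dom \<kappa> h' \<and> ordD \<kappa> h' = ereal (\<alpha> * h' + d))) \<or>
    h = \<infinity> \<and> b = \<infinity> \<and> bot = gl"
begin

definition top :: "real \<Rightarrow> real" where "top t = c * pw l t"
definition M :: "real \<Rightarrow> real" where "M p = \<alpha> * p + d"

lemma dtop: "dfun1 top"
 unfolding dfun1_def top_def by (intro dint F)

lemma l_pos: "0 < l" "a \<le> l"
 using gap ord_gh(3) by (auto simp: gap_def)

lemma ev_top: "EV t. top t = c * t powr l \<and> gl t < top t \<and> 8 * top t < gh t \<and> 0 < top t"
proof -
 have "EV t. gl t < c * t powr l \<and> 8 * c * t powr l < gh t" using c(2)[of c] c(1) by (simp add: dom_def)
 then show ?thesis using ev_pos by eventually_elim (use c(1) in \<open>simp add: top_def pw_def\<close>)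
qed

lemma powr_lt: "q < q' \<Longrightarrow> 0 < \<kappa>' \<Longrightarrow> EV t. \<kappa> * t powr q' < \<kappa>' * t powr q"
proof -
 assume "q < q'" "0 < \<kappa>'"
 then have "((\<lambda>t. \<kappa> * t powr (q' - q)) \<longlongrightarrow> 0) (at_right 0)" by real_asymp
 then have "EV t. \<kappa> * t powr (q' - q) < \<kappa>'" using \<open>0 < \<kappa>'\<close> by (rule order_tendstoD)
 then show ?thesis using ev_pos by eventually_elim (simp add: powr_diff field_simps)
qed

lemma bot_below:
 assumes "ereal q < h" "0 < \<kappa>" shows "EV t. bot t < \<kappa> * t powr q" using bot
proof (elim disjE exE conjE)
 fix h' C assume "h = ereal h'" "bot = (\<lambda>t. C * pw h' t)"
 then have "EV t. C * t powr h' < \<kappa> * t powr q" using assms by (intro powr_lt) auto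
 then show ?thesis using ev_pos by eventually_elim (simp add: \<open>bot = _\<close> pw_def)
qed (use above_lo[of q \<kappa>] assms in simp)

lemma ev_bot: "EV t. gl t \<le> bot t \<and> bot t < top t"
proof -
 have "ereal l < h" using gap by (simp add: gap_def)
 have "EV t. gl t \<le> bot t" using bot
 proof (elim disjE exE conjE)
  fix h' C assume b: "bot = (\<lambda>t. C * pw h' t)" and "\<forall>\<kappa>\<ge>C. dom \<kappa> h' \<and> ordD \<kappa> h' = ereal (\<alpha> * h' + d)"
  then have "EV t. gl t < C * t powr h' \<and> 8 * C * t powr h' < gh t" by (simp add: dom_def)
  then show ?thesis using ev_pos by eventually_elim (simp add: b pw_def)
 qed simp
 then show ?thesis using bot_below[OF \<open>ereal l < h\<close> c(1)] ev_top by eventually_elim simp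
qed

lemma order_top: "order_at_0 top = ereal l"
 unfolding top_def[abs_def] by (rule ord_is_order[OF ord_is_pw]) (use c(1) in simp)

lemma order_bot: "order_at_0 bot = h"
 using bot
proof (elim disjE exE conjE)
 fix h' C assume "h = ereal h'" "C > 0" "bot = (\<lambda>t. C * pw h' t)"
 then show ?thesis using ord_is_order[OF ord_is_pw[of C h']] by simp
qed (simp add: b_def)

lemma ev_all: "EV t. ok t \<and> 0 \<le> gl t \<and> gl t \<le> bot t \<and> bot t < top t \<and> 8 * top t < gh t \<and> 0 < top t"
 using ev_ok ev_bot ev_top by eventually_elim (use gl_less_gh in auto)

lemma order_range:
 assumes "dfun1 v" "EV t. bot t \<le> v t \<and> v t \<le> 2 * top t" "order_at_0 v = ereal p"
 shows "p \<in> \<FF>" "p = l \<or> in_gap l h p \<or> h = ereal p" "l \<le> p"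
proof -
 show p: "p \<in> \<FF>" using order_finite(1)[OF assms(1,3)] .
 have "EV t. \<bar>v t\<bar> \<le> 2 * c * t powr l" using assms(2) ev_all ev_top by eventually_elim auto
 then have "ereal l \<le> order_at_0 v" using order_ge_iff[OF assms(1)] by blast
 then show "l \<le> p" using assms(3) by simp
 have "order_at_0 v \<le> h" unfolding order_bot[symmetric]
  by (rule order_antimono[OF dbot assms(1), of 1]) (use assms(2) ev_all in eventually_elim, auto)
 then show "p = l \<or> in_gap l h p \<or> h = ereal p"
  using assms(3) p \<open>l \<le> p\<close> by (auto simp: in_gap_def less_le)
qed

lemma dsig1: "dfun1 v \<Longrightarrow> dfun1 (\<lambda>t. \<sigma> t (v t))"
 by (rule dfun1_app2[OF dsig])

lemma dsub: "dfun1 v \<Longrightarrow> dfun1 w \<Longrightarrow> dfun1 (\<lambda>t. \<sigma> t (v t) - \<sigma> t (w t))"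
 by (rule dfun1_diff[OF dsig1 dsig1])

text \<open>The segment from v to w is covered by n adjacent dyadic bands with n independent of t;
  their widths telescope, and a finite sum does not lower the order.\<close>

lemma sum_order:
 assumes p: "p \<in> \<FF>" and \<kappa>: "0 < \<kappa>"
  and D: "\<And>i. i < n \<Longrightarrow> ereal K \<le> ordD (2 ^ i * \<kappa>) p"
  and v: "dfun1 v" "dfun1 w"
  and e: "EV t. gl t \<le> \<kappa> * t powr p \<and> \<kappa> * t powr p \<le> v t \<and> v t \<le> w t \<and> w t \<le> 2 ^ n * \<kappa> * t powr p \<and> 2 ^ n * \<kappa> * t powr p \<le> gh t"
 shows "ereal K \<le> order_at_0 (\<lambda>t. \<sigma> t (w t) - \<sigma> t (v t))"
proof -
 have dk: "dfun1 (\<lambda>t. k * pw p t)" for k unfolding dfun1_def by (intro dint p)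
 have tel: "ereal K \<le> order_at_0 (\<lambda>t. \<sigma> t (2 ^ j * \<kappa> * pw p t) - \<sigma> t (\<kappa> * pw p t))" if "j \<le> n" for j
  using that
 proof (induction j)
  case 0
  have "order_at_0 (\<lambda>t. \<sigma> t (2 ^ 0 * \<kappa> * pw p t) - \<sigma> t (\<kappa> * pw p t)) = \<infinity>" by (simp add: order_infty)
  then show ?case by simp
 next
  case (Suc j)
  have "ereal K \<le> order_at_0 (\<lambda>t. (\<sigma> t (2 ^ j * \<kappa> * pw p t) - \<sigma> t (\<kappa> * pw p t)) + D t (2 ^ j * \<kappa> * pw p t))"
   using Suc D[of j] by (intro order_add_ge dsub dk dDq p) auto
  then show ?case by (simp add: D_def mult.assoc)
 qed
 have "order_at_0 (\<lambda>t. \<sigma> t (2 ^ n * \<kappa> * pw p t) - \<sigma> t (\<kappa> * pw p t)) \<le> order_at_0 (\<lambda>t. \<sigma> t (w t) - \<sigma> t (v t))"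
 proof (rule order_diff_mono[OF dsig1[OF v(1)] dsig1[OF v(2)] dsig1[OF dk] dsig1[OF dk]])
  show "EV t. \<sigma> t (\<kappa> * pw p t) \<le> \<sigma> t (v t) \<and> \<sigma> t (v t) \<le> \<sigma> t (w t) \<and> \<sigma> t (w t) \<le> \<sigma> t (2 ^ n * \<kappa> * pw p t)"
   using e ev_ok ev_pos
  proof eventually_elim
   case (elim t)
   then have "pw p t = t powr p" by (simp add: pw_def)
   then show ?case using elim(1) by (intro conjI sig_le[OF elim(2)]) auto
  qed
 qed
 then show ?thesis using tel[of n] by simp
qed

text \<open>Levels of the same order p differ by at most a constant factor, so a fixed number of
  dyadic bands of order M p covers the segment. Which constants are available depends on whether p
  is inside the gap or at one of its ends.\<close>

lemma seg_ge:
 assumes v: "dfun1 v" "dfun1 w" and e: "EV t. bot t \<le> v t \<and> v t \<le> w t \<and> w t \<le> 2 * top t"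
  and ord: "order_at_0 v = ereal p" "order_at_0 w = ereal p"
 shows "ereal (M p) \<le> order_at_0 (\<lambda>t. \<sigma> t (w t) - \<sigma> t (v t))"
proof -
 have "EV t. bot t \<le> v t \<and> v t \<le> 2 * top t" using e by eventually_elim auto
 note rng = order_range[OF v(1) this ord(1)]
 obtain c1 C1' where c1: "c1 > 0" "C1' > 0" "EV t. c1 * t powr p \<le> \<bar>v t\<bar> \<and> \<bar>v t\<bar> \<le> C1' * t powr p"
  using order_finite(2)[OF v(1) ord(1)] by (rule ord_is_bounds)
 obtain c1' C1 where C1: "c1' > 0" "C1 > 0" "EV t. c1' * t powr p \<le> \<bar>w t\<bar> \<and> \<bar>w t\<bar> \<le> C1 * t powr p"
  using order_finite(2)[OF v(2) ord(2)] by (rule ord_is_bounds)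
 have vw: "EV t. c1 * t powr p \<le> v t \<and> v t \<le> w t \<and> w t \<le> C1 * t powr p"
  using e ev_all c1(3) C1(3) by eventually_elim auto
 \<comment> \<open>One power of 2 beats the constants 1 / c1, C1 and c / c1 that occur in the cases
   below.\<close>
 have "\<exists>n. max (max (1 / c1) C1) (c / c1) < 2 ^ n" by (rule real_arch_pow) simp
 then obtain n where n: "max (max (1 / c1) C1) (c / c1) < 2 ^ n" by blast
 have n1: "1 / 2 ^ n \<le> c1" "C1 \<le> 2 ^ n" "c / 2 ^ n \<le> c1" using n c1(1) by (auto simp: field_simps)
 have mulle: "k * t powr p \<le> k' * t powr p" if "k \<le> k'" for k k' t :: real using that by (intro mult_right_mono) auto
 show ?thesis using rng(2)
 proof (elim disjE)
  assume p: "p = l"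
  have k: "0 < 2 ^ i * (c / 2 ^ n)" "2 ^ i * (c / 2 ^ n) \<le> 8 * c" if "i < Suc n" for i
  proof -
   have "(2::real) ^ i \<le> 2 ^ n" using that by (intro power_increasing) auto
   then have "2 ^ i * c \<le> 2 ^ n * (8 * c)" using c(1) by (intro mult_mono) auto
   then show "2 ^ i * (c / 2 ^ n) \<le> 8 * c" by (simp add: field_simps)
  qed (use c(1) in simp)
  have "dom (c / 2 ^ n) l" using c(2)[OF k(1)[of 0] k(2)[of 0]] by simp
  then have e2: "EV t. gl t < c / 2 ^ n * t powr l" unfolding dom_def by (auto elim: eventually_mono)
  show ?thesis
  proof (rule sum_order[of p "c / 2 ^ n" "Suc n"])
   show "ereal (M p) \<le> order_at_0 (\<lambda>t. D t (2 ^ i * (c / 2 ^ n) * pw p t))" if "i < Suc n" for i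
    using c(2)[OF k[OF that]] p by (simp add: M_def)
   show "EV t. gl t \<le> c / 2 ^ n * t powr p \<and> c / 2 ^ n * t powr p \<le> v t \<and> v t \<le> w t \<and>
     w t \<le> 2 ^ Suc n * (c / 2 ^ n) * t powr p \<and> 2 ^ Suc n * (c / 2 ^ n) * t powr p \<le> gh t"
    using e e2 vw ev_all ev_top
   proof eventually_elim
    case (elim t)
    have "c / 2 ^ n * t powr p \<le> c1 * t powr p" by (rule mulle[OF n1(3)])
    moreover have "2 ^ Suc n * (c / 2 ^ n) * t powr p = 2 * top t" using elim p by simp
    ultimately show ?case using elim p by simp
   qed
  qed (use v rng c(1) in auto)
 next
  assume p: "in_gap l h p"
  note i = in_gapD[OF gap p]
  show ?thesis
  proof (rule sum_order[of p "1 / 2 ^ n" "2 * n"])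
   show "ereal (M p) \<le> order_at_0 (\<lambda>t. D t (2 ^ i * (1 / 2 ^ n) * pw p t))" for i
    using gap_dyadic[OF gap p] affine[OF p] by (simp add: M_def)
   have "0 < 1 / (2::real) ^ n" by simp
   show "EV t. gl t \<le> 1 / 2 ^ n * t powr p \<and> 1 / 2 ^ n * t powr p \<le> v t \<and> v t \<le> w t \<and>
     w t \<le> 2 ^ (2 * n) * (1 / 2 ^ n) * t powr p \<and> 2 ^ (2 * n) * (1 / 2 ^ n) * t powr p \<le> gh t"
    using vw above_lo[OF i(3) \<open>0 < 1 / 2 ^ n\<close>] below_hi[OF i(2), of "2 ^ n"]
   proof eventually_elim
    case (elim t)
    have "(2::real) ^ (2 * n) * (1 / 2 ^ n) = 2 ^ n" by (simp add: mult_2 power_add)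
    moreover have "1 / 2 ^ n * t powr p \<le> c1 * t powr p" "C1 * t powr p \<le> 2 ^ n * t powr p"
     by (rule mulle[OF n1(1)], rule mulle[OF n1(2)])
    ultimately show ?case using elim by simp
   qed
  qed (use v rng in auto)
 next
  assume p: "h = ereal p"
  then obtain C where C: "C > 0" "bot = (\<lambda>t. C * pw p t)"
   "\<And>\<kappa>. C \<le> \<kappa> \<Longrightarrow> dom \<kappa> p \<and> ordD \<kappa> p = ereal (\<alpha> * p + d)" using bot by auto
  have "\<exists>k. C1 / C < 2 ^ k" by (rule real_arch_pow) simp
  then obtain k where k: "C1 / C < 2 ^ k" by blast
  have Ck: "C \<le> 2 ^ i * C" for i using C(1) by simp
  have e2: "EV t. 2 ^ k * C * t powr p \<le> gh t"
  proof -
   have "EV t. 8 * (2 ^ k * C) * t powr p < gh t" using C(3)[OF Ck[of k]] unfolding dom_def by (auto elim: eventually_mono)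
   then show ?thesis
   proof eventually_elim
    case (elim t)
    have "0 \<le> 2 ^ k * C * t powr p" using C(1) by simp
    moreover have "8 * (2 ^ k * C) * t powr p = 8 * (2 ^ k * C * t powr p)" by simp
    ultimately show ?case using elim by linarith
   qed
  qed
  show ?thesis
  proof (rule sum_order[of p C k])
   show "ereal (M p) \<le> ordD (2 ^ i * C) p" for i using C(3)[OF Ck] by (simp add: M_def)
   show "EV t. gl t \<le> C * t powr p \<and> C * t powr p \<le> v t \<and> v t \<le> w t \<and>
     w t \<le> 2 ^ k * C * t powr p \<and> 2 ^ k * C * t powr p \<le> gh t" using vw e2 e ev_all ev_pos
   proof eventually_elim
    case (elim t)
    have "C1 * t powr p \<le> 2 ^ k * C * t powr p" using k C(1) by (intro mulle) (simp add: field_simps)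
    then have "w t \<le> 2 ^ k * C * t powr p" using elim by linarith
    moreover have "bot t = C * t powr p" using elim by (simp add: C(2) pw_def)
    ultimately show ?case using elim by simp
   qed
  qed (use v rng C in auto)
 qed
qed

lemma seg_order_le:
 assumes "q \<in> \<FF>" "0 < \<kappa>" "dfun1 v" "dfun1 w"
  and e: "EV t. gl t \<le> v t \<and> v t \<le> \<kappa> * t powr q \<and> 2 * \<kappa> * t powr q \<le> w t \<and> w t \<le> gh t"
 shows "order_at_0 (\<lambda>t. \<sigma> t (w t) - \<sigma> t (v t)) \<le> ordD \<kappa> q"
proof (rule order_antimono[OF dDq[OF assms(1)] dsub[OF assms(4,3)], where C = 1])
 show "EV t. \<bar>D t (\<kappa> * pw q t)\<bar> \<le> 1 * \<bar>\<sigma> t (w t) - \<sigma> t (v t)\<bar>" using e ev_ok ev_pos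
 proof eventually_elim
  case (elim t)
  have p: "pw q t = t powr q" "0 < \<kappa> * t powr q" using elim assms(2) by (simp_all add: pw_def)
  have "\<sigma> t (v t) \<le> \<sigma> t (\<kappa> * t powr q)" "\<sigma> t (2 * (\<kappa> * t powr q)) \<le> \<sigma> t (w t)"
   using elim(1) p by (intro sig_le[OF elim(2)]; simp)+
  moreover have "0 < D t (\<kappa> * t powr q)" using elim(1) p by (intro D_pos[OF elim(2)]) auto
  ultimately show ?case by (simp add: p(1) D_def)
 qed
qed

text \<open>\<open>min\<close> and \<open>max\<close> with multiples of t powr p enlarge v to a
  segment that contains a full dyadic band, without changing the order p of its ends. At an end of
  the gap the segment stops at \<open>top\<close> or \<open>bot\<close> instead.\<close>

lemma seg_le:
 assumes v: "dfun1 v" and e: "EV t. bot t \<le> v t \<and> v t \<le> top t" and ord: "order_at_0 v = ereal p"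
 obtains v1 v2 where "dfun1 v1" "dfun1 v2" "EV t. bot t \<le> v1 t \<and> v1 t \<le> v t \<and> v t \<le> v2 t \<and> v2 t \<le> top t \<and> v1 t < v2 t"
  "order_at_0 v1 = ereal p" "order_at_0 v2 = ereal p" "order_at_0 (\<lambda>t. \<sigma> t (v2 t) - \<sigma> t (v1 t)) \<le> ereal (M p)"
proof -
 have "EV t. bot t \<le> v t \<and> v t \<le> 2 * top t" using e ev_all by eventually_elim auto
 note rng = order_range[OF v this ord]
 have dk: "dfun1 (\<lambda>t. k * pw p t)" for k unfolding dfun1_def by (intro dint rng)
 have dmin: "dfun1 (\<lambda>t. min (v t) (k * pw p t))" for k unfolding dfun1_def by (intro dint rng dfun1_app[OF v])
 have dmax: "dfun1 (\<lambda>t. max (v t) (k * pw p t))" for k unfolding dfun1_def by (intro dint rng dfun1_app[OF v])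
 obtain c1 C1 where c1: "c1 > 0" "C1 > 0" "EV t. c1 * t powr p \<le> \<bar>v t\<bar> \<and> \<bar>v t\<bar> \<le> C1 * t powr p"
  using order_finite(2)[OF v ord] by (rule ord_is_bounds)
 have vb: "EV t. c1 * t powr p \<le> v t \<and> v t \<le> C1 * t powr p \<and> bot t \<le> v t \<and> v t \<le> top t \<and> pw p t = t powr p \<and> 0 < t powr p"
  using e ev_all c1(3) ev_pos by eventually_elim (auto simp: pw_def)
 have omin: "order_at_0 (\<lambda>t. min (v t) (k * pw p t)) = ereal p" if "k > 0" for k
 proof (rule order_eqI[OF dmin])
  show "EV t. min c1 k * t powr p \<le> \<bar>min (v t) (k * pw p t)\<bar>" using vb
  proof eventually_elim
   case (elim t)
   have "min c1 k * t powr p \<le> c1 * t powr p" "min c1 k * t powr p \<le> k * t powr p" by (intro mult_right_mono; simp)+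
   moreover have "0 < c1 * t powr p" "0 < k * t powr p" using c1(1) that elim by simp_all
   moreover have "min (v t) (k * pw p t) = v t \<or> min (v t) (k * pw p t) = k * t powr p" using elim by (auto simp: min_def)
   ultimately show ?case using elim by linarith
  qed
  show "EV t. \<bar>min (v t) (k * pw p t)\<bar> \<le> k * t powr p" using vb
  proof eventually_elim
   case (elim t)
   have "0 < c1 * t powr p" "0 < k * t powr p" using c1(1) that elim by simp_all
   then show ?case using elim by (auto simp: min_def)
  qed
 qed (use that c1 in auto)
 have omax: "order_at_0 (\<lambda>t. max (v t) (k * pw p t)) = ereal p" if "k > 0" for k
 proof (rule order_eqI[OF dmax])
  show "EV t. k * t powr p \<le> \<bar>max (v t) (k * pw p t)\<bar>" using vb by eventually_elim auto
  show "EV t. \<bar>max (v t) (k * pw p t)\<bar> \<le> max C1 k * t powr p" using vb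
  proof eventually_elim
   case (elim t)
   have "C1 * t powr p \<le> max C1 k * t powr p" "k * t powr p \<le> max C1 k * t powr p" by (intro mult_right_mono; simp)+
   moreover have "0 < c1 * t powr p" "0 < k * t powr p" using c1(1) that elim by simp_all
   moreover have "max (v t) (k * pw p t) = v t \<or> max (v t) (k * pw p t) = k * t powr p" using elim by (auto simp: max_def)
   ultimately show ?case using elim by linarith
  qed
 qed (use that in auto)
 show ?thesis using rng(2)
 proof (elim disjE)
  assume p: "p = l"
  have od: "ordD (c / 2) p = ereal (M p)" using c(2)[of "c / 2"] c(1) p by (simp add: M_def)
  have b: "EV t. bot t < c / 2 * t powr p" using bot_below[of l "c / 2"] gap c(1) p by (simp add: gap_def)
  have e1: "EV t. bot t \<le> min (v t) (c / 2 * pw p t) \<and> min (v t) (c / 2 * pw p t) \<le> v t \<and> v t \<le> top t \<and> top t \<le> top t \<and> min (v t) (c / 2 * pw p t) < top t"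
   using vb b ev_all ev_top by eventually_elim (use p in auto)
  show ?thesis
  proof (rule that[OF dmin dtop e1 omin])
   show "order_at_0 (\<lambda>t. \<sigma> t (top t) - \<sigma> t (min (v t) (c / 2 * pw p t))) \<le> ereal (M p)"
    unfolding od[symmetric]
    by (rule seg_order_le[OF rng(1) _ dmin dtop]) (use c(1) in simp, use e1 vb ev_all ev_top in eventually_elim, use p in auto)
  qed (use c(1) p order_top in auto)
 next
  assume p: "in_gap l h p"
  note i = in_gapD[OF gap p]
  have od: "ordD 1 p = ereal (M p)" using m_order(1)[OF i(2,3,1)] affine[OF p] by (simp add: M_def)
  have b: "EV t. bot t < 1 * t powr p" "EV t. 2 * t powr p < c * t powr l"
   using bot_below[of p 1] powr_lt[of l p c 2] p c(1) by (auto simp: in_gap_def)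
  have e1: "EV t. bot t \<le> min (v t) (1 * pw p t) \<and> min (v t) (1 * pw p t) \<le> v t \<and> v t \<le> max (v t) (2 * pw p t) \<and> max (v t) (2 * pw p t) \<le> top t \<and>
    min (v t) (1 * pw p t) < max (v t) (2 * pw p t)" using vb b ev_all ev_top by eventually_elim auto
  show ?thesis
  proof (rule that[OF dmin dmax e1 omin omax])
   show "order_at_0 (\<lambda>t. \<sigma> t (max (v t) (2 * pw p t)) - \<sigma> t (min (v t) (1 * pw p t))) \<le> ereal (M p)"
    unfolding od[symmetric]
    by (rule seg_order_le[OF rng(1) _ dmin dmax]) (simp, use e1 vb ev_all in eventually_elim, auto)
  qed auto
 next
  assume p: "h = ereal p"
  then obtain C where C: "C > 0" "bot = (\<lambda>t. C * pw p t)"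
   "\<And>\<kappa>. C \<le> \<kappa> \<Longrightarrow> dom \<kappa> p \<and> ordD \<kappa> p = ereal (\<alpha> * p + d)" using bot by auto
  have od: "ordD C p = ereal (M p)" using C(3)[of C] by (simp add: M_def)
  have "l < p" using gap p by (simp add: gap_def)
  then have b: "EV t. 2 * C * t powr p < c * t powr l" using c(1) by (intro powr_lt)
  have e1: "EV t. bot t \<le> bot t \<and> bot t \<le> v t \<and> v t \<le> max (v t) (2 * C * pw p t) \<and> max (v t) (2 * C * pw p t) \<le> top t \<and>
    bot t < max (v t) (2 * C * pw p t)" using vb b ev_top
  proof eventually_elim
   case (elim t)
   have "0 < C * t powr p" using elim C(1) by simp
   then show ?case using elim by (auto simp: C(2) less_max_iff_disj)
  qed
  show ?thesis
  proof (rule that[OF dbot dmax e1 _ omax])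
   show "order_at_0 (\<lambda>t. \<sigma> t (max (v t) (2 * C * pw p t)) - \<sigma> t (bot t)) \<le> ereal (M p)"
    unfolding od[symmetric]
    by (rule seg_order_le[OF rng(1) C(1) dbot dmax]) (use e1 vb ev_all in eventually_elim, auto simp: C(2))
  qed (use C(1) p order_bot in auto)
 qed
qed

lemma M_between: "l \<le> q \<Longrightarrow> q \<le> p \<Longrightarrow> min (M l) (M p) \<le> M q"
proof -
 assume "l \<le> q" "q \<le> p" then show ?thesis
  by (cases "0 \<le> \<alpha>") (auto simp: M_def min_le_iff_disj mult_left_mono mult_left_mono_neg)
qed

text \<open>From v up to \<open>top\<close> there are about log (1 / t) dyadic bands, so the sum is
  not finite uniformly in t. All bands are at most t powr (M0 - \<delta>) wide, the logarithm costs
  another t powr - \<delta>, and \<delta> can be chosen as small as desired.\<close>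

lemma big_sum:
 assumes v: "dfun1 v" and e: "EV t. bot t \<le> v t \<and> v t \<le> top t" and ord: "order_at_0 v = ereal p"
 shows "ereal (min (M l) (M p)) \<le> order_at_0 (\<lambda>t. \<sigma> t (top t) - \<sigma> t (v t))"
proof -
 define M0 where "M0 = min (M l) (M p)"
 have e2: "EV t. bot t \<le> v t \<and> v t \<le> 2 * top t" using e ev_all by eventually_elim auto
 note rng = order_range[OF v e2 ord]
 have FM: "M q \<in> \<FF>" if "q \<in> \<FF>" for q unfolding M_def using F that by (intro FF_add FF_mult)
 have FM0: "M0 \<in> \<FF>" using FM[OF rng(1)] FM[OF F(3)] by (simp add: M0_def min_def)
 obtain c1 C1 where c1: "c1 > 0" "C1 > 0" "EV t. c1 * t powr p \<le> \<bar>v t\<bar> \<and> \<bar>v t\<bar> \<le> C1 * t powr p"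
  using order_finite(2)[OF v ord] by (rule ord_is_bounds)
 have vpos: "EV t. c1 * t powr p \<le> v t \<and> 0 < v t" using e ev_all c1(3) ev_pos
 proof eventually_elim
  case (elim t)
  have "0 < c1 * t powr p" using c1(1) elim by simp
  then show ?case using elim by auto
 qed
 have step: "ereal (M0 - 2 * \<delta>) \<le> order_at_0 (\<lambda>t. \<sigma> t (top t) - \<sigma> t (v t))" if \<delta>: "\<delta> \<in> \<FF>" "\<delta> > 0" for \<delta>
 proof -
  have Fd: "M0 - \<delta> \<in> \<FF>" using FM0 \<delta> by (intro FF_diff)
  \<comment> \<open>\<open>V t u\<close> says that the band at u is too wide. If such u existed for
    all small t, their supremum z would be a definable level with some order q between l and p, and
    \<open>seg_ge\<close> would apply near it.\<close>
  define V where "V t u \<longleftrightarrow> v t \<le> u \<and> u \<le> top t \<and> pw (M0 - \<delta>) t < D t u" for t u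
  have A: "EV t. \<not> (\<exists>u. V t u)"
  proof (rule ccontr)
   have "drel1 (\<lambda>t. \<exists>u. V t u)"
    unfolding drel1_def V_def by (intro dint Fd dfun1_app[OF v] dfun1_app[OF dtop] dfun2_app[OF dD])
   moreover assume "\<not> (EV t. \<not> (\<exists>u. V t u))"
   ultimately have ex: "EV t. \<exists>u. V t u" using ev_dichotomy_right by blast
   define z where "z t = the0 (is_lub (V t))" for t
   have dz: "dfun1 z"
    unfolding dfun1_def z_def is_lub_def V_def by (intro dint Fd dfun1_app[OF v] dfun1_app[OF dtop] dfun2_app[OF dD])
   have z: "EV t. v t \<le> z t \<and> z t \<le> top t \<and> (\<exists>u. V t u \<and> z t / 2 < u \<and> u \<le> z t)" using ex vpos
   proof eventually_elim
    case (elim t)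
    then obtain u where u: "V t u" by blast
    have ub: "y \<le> top t" if "V t y" for y using that by (simp add: V_def)
    have bt: "u \<le> z t" "z t \<le> top t" using is_lub_between[of "V t", OF u ub] by (auto simp: z_def)
    have vz: "v t \<le> z t" using bt u by (simp add: V_def)
    then have "z t / 2 < the0 (is_lub (V t))" using elim by (simp add: z_def[symmetric])
    from is_lub_witness[of "V t", OF u ub this] obtain u1 where u1: "V t u1" "z t / 2 < u1" by blast
    have "u1 \<le> z t" using is_lub_between[of "V t", OF u1(1) ub] by (simp add: z_def)
    then show ?case using u1 vz bt by blast
   qed
   have "order_at_0 z \<le> ereal p" unfolding ord[symmetric]
    by (rule order_antimono[OF v dz, of 1]) (use z vpos in eventually_elim, auto)
   moreover have "ereal l \<le> order_at_0 z" unfolding order_top[symmetric]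
    by (rule order_antimono[OF dz dtop, of 1]) (use z vpos in eventually_elim, auto)
   ultimately obtain q where q: "order_at_0 z = ereal q" "l \<le> q" "q \<le> p" by (cases "order_at_0 z") auto
   \<comment> \<open>Some too wide band starts at u with z / 2 < u \<le> z. The segment from w1 to
     w2 contains this band, while both of its ends keep the order q of z.\<close>
   define w1 where "w1 t = max (v t) (z t / 2)" for t
   define w2 where "w2 t = 2 * z t" for t
   have dw: "dfun1 w1" "dfun1 w2" unfolding dfun1_def w1_def w2_def by (intro dint dfun1_app[OF v] dfun1_app[OF dz])+
   have ow1: "order_at_0 w1 = ereal q" unfolding q(1)[symmetric]
    by (rule antisym; rule order_antimono[where C = 2]) (use dw dz in simp, use dw dz in simp, use z vpos in eventually_elim, simp add: w1_def, use dw dz in simp, use dw dz in simp, use z vpos in eventually_elim, auto simp: w1_def)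
   have ow2: "order_at_0 w2 = ereal q" unfolding q(1)[symmetric]
    by (rule antisym; rule order_antimono[where C = 2]) (use dw dz in simp, use dw dz in simp, use z vpos in eventually_elim, simp add: w2_def, use dw dz in simp, use dw dz in simp, use z vpos in eventually_elim, simp add: w2_def)
   have "ereal (M q) \<le> order_at_0 (\<lambda>t. \<sigma> t (w2 t) - \<sigma> t (w1 t))"
   proof (rule seg_ge[OF dw _ ow1 ow2])
    show "EV t. bot t \<le> w1 t \<and> w1 t \<le> w2 t \<and> w2 t \<le> 2 * top t"
     using z vpos e by eventually_elim (auto simp: w1_def w2_def)
   qed
   moreover have "order_at_0 (\<lambda>t. \<sigma> t (w2 t) - \<sigma> t (w1 t)) \<le> ereal (M0 - \<delta>)"
   proof -
    have "EV t. 1 * t powr (M0 - \<delta>) \<le> \<bar>\<sigma> t (w2 t) - \<sigma> t (w1 t)\<bar>" using z vpos e ev_all pw_ev[of "M0 - \<delta>"]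
    proof eventually_elim
     case (elim t)
     then obtain u where u: "V t u" "z t / 2 < u" "u \<le> z t" by blast
     have "w1 t \<le> u" using u by (simp add: w1_def V_def)
     have "gl t \<le> v t" using elim by linarith
     then have "gl t \<le> w1 t" by (simp add: w1_def max.coboundedI1)
     have "\<sigma> t (w1 t) \<le> \<sigma> t u" using elim u \<open>gl t \<le> w1 t\<close> \<open>w1 t \<le> u\<close> by (intro sig_le) auto
     moreover have "\<sigma> t (2 * u) \<le> \<sigma> t (w2 t)"
      using elim u \<open>gl t \<le> w1 t\<close> \<open>w1 t \<le> u\<close> by (intro sig_le) (auto simp: w2_def)
     moreover have "t powr (M0 - \<delta>) < \<sigma> t (2 * u) - \<sigma> t u" using u(1) elim(5) by (simp add: V_def D_def)
     ultimately show ?case by linarith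
    qed
    then show ?thesis using order_le_iff[OF dsub[OF dw(2,1)]] zero_less_one by blast
   qed
   ultimately have "ereal (M q) \<le> ereal (M0 - \<delta>)" by (rule order_trans)
   then show False using M_between[OF q(2,3)] \<delta>(2) by (simp add: M0_def)
  qed
  \<comment> \<open>The quotient of \<open>top\<close> and v is at most K * t powr (l - p), which
    bounds the number of bands by a logarithm.\<close>
  define K where "K = c / c1"
  have K: "K > 0" using c(1) c1(1) by (simp add: K_def)
  have "((\<lambda>t. (log 2 (K * t powr (l - p)) + 1) * t powr \<delta>) \<longlongrightarrow> 0) (at_right 0)" using K \<delta>(2) by real_asymp
  then have lg: "EV t. (log 2 (K * t powr (l - p)) + 1) * t powr \<delta> < 1" by (rule order_tendstoD) simp
  have "EV t. \<bar>\<sigma> t (top t) - \<sigma> t (v t)\<bar> \<le> 1 * t powr (M0 - 2 * \<delta>)"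
   using A lg vpos e ev_all ev_top pw_ev[of "M0 - \<delta>"] ev_pos
  proof eventually_elim
   case (elim t)
   have v0: "0 < v t" "v t \<le> top t" using elim by auto
   obtain n where n: "2 ^ n * v t \<le> top t" "top t < 2 ^ Suc n * v t" "real n \<le> log 2 (top t / v t)"
    "log 2 (top t / v t) \<le> real n + 1" by (rule dyadic_floor[OF v0])
   have tel: "\<sigma> t (2 ^ j * v t) - \<sigma> t (v t) \<le> real j * t powr (M0 - \<delta>)" if "j \<le> Suc n" for j using that
   proof (induction j)
    case (Suc j)
    have "v t \<le> 2 ^ j * v t" using elim(3) by simp
    moreover have "2 ^ j * v t \<le> 2 ^ n * v t" using elim(3) Suc.prems by simp
    ultimately have "\<not> pw (M0 - \<delta>) t < D t (2 ^ j * v t)" using elim(1) n(1) unfolding V_def by (meson order_trans)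
    then have "\<sigma> t (2 * (2 ^ j * v t)) - \<sigma> t (2 ^ j * v t) \<le> t powr (M0 - \<delta>)" using elim(7) by (simp add: D_def)
    then show ?case using Suc by (simp add: algebra_simps)
   qed simp
   have "\<sigma> t (top t) \<le> \<sigma> t (2 ^ Suc n * v t)" using elim n by (intro sig_le) auto
   then have "\<sigma> t (top t) - \<sigma> t (v t) \<le> (real n + 1) * t powr (M0 - \<delta>)"
    using tel[of "Suc n"] by (simp add: algebra_simps)
   also have "\<dots> \<le> (log 2 (K * t powr (l - p)) + 1) * t powr (M0 - \<delta>)"
   proof (intro mult_right_mono add_right_mono)
    have "top t / v t \<le> c * t powr l / (c1 * t powr p)" using elim c1(1) by (intro frac_le) auto
    also have "\<dots> = K * t powr (l - p)" by (simp add: K_def powr_diff)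
    finally have "log 2 (top t / v t) \<le> log 2 (K * t powr (l - p))" using elim by (intro log_mono) auto
    then show "real n \<le> log 2 (K * t powr (l - p))" using n(3) by simp
   qed simp
   also have "\<dots> = ((log 2 (K * t powr (l - p)) + 1) * t powr \<delta>) * t powr (M0 - 2 * \<delta>)"
    by (simp add: powr_add[symmetric] mult.assoc)
   also have "\<dots> \<le> 1 * t powr (M0 - 2 * \<delta>)" using elim(2) by (intro mult_right_mono) auto
   finally have "\<sigma> t (top t) - \<sigma> t (v t) \<le> 1 * t powr (M0 - 2 * \<delta>)" .
   moreover have "\<sigma> t (v t) \<le> \<sigma> t (top t)" using elim by (intro sig_le) auto
   ultimately show ?case by simp
  qed
  then show ?thesis using order_ge_iff[OF dsub[OF dtop v]] by blast
 qed
 show ?thesis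
 proof (rule ccontr)
  assume "\<not> ?thesis"
  then have "order_at_0 (\<lambda>t. \<sigma> t (top t) - \<sigma> t (v t)) < ereal M0" by (simp only: M0_def not_le)
  then obtain y where y: "order_at_0 (\<lambda>t. \<sigma> t (top t) - \<sigma> t (v t)) < ereal y" "y < M0" using ereal_dense2 by (metis less_ereal.simps(1))
  then obtain \<delta> where d: "\<delta> \<in> \<FF>" "0 < \<delta>" "\<delta> < (M0 - y) / 2" using FF_dense[of 0 "(M0 - y) / 2"] by auto
  have "ereal (M0 - 2 * \<delta>) < ereal y" using step[OF d(1,2)] y(1) by (rule le_less_trans)
  then show False using d(3) by simp
 qed
qed

end

context increasing_slice
begin

lemma wmono_sub:
 assumes "EV t. lo t \<le> x t \<and> y t \<le> hi t" shows "wmono g x y" unfolding wmono_def using assms ev_ok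
proof eventually_elim
 case (elim t)
 show ?case
 proof (intro allI impI)
  fix s s' assume s: "x t \<le> s" "s \<le> s'" "s' \<le> y t"
  then show "0 \<le> g t s \<and> g t s \<le> g t s'"
   using g_mono[OF elim(2), of s s'] g_range[OF elim(2), of s] gl_less_gh[OF elim(2)] elim(1) by auto
 qed
qed

lemma sign_sub:
 assumes "EV t. lo t \<le> x t \<and> y t \<le> hi t" shows "EV t. \<forall>s. x t < s \<longrightarrow> s < y t \<longrightarrow> g t s \<noteq> 0"
 using assms ev_ok
proof eventually_elim
 case (elim t)
 show ?case
 proof (intro allI impI)
  fix s assume s: "x t < s" "s < y t"
  then have "g t (lo t) < g t s" using elim unfolding ok_def by auto
  then show "g t s \<noteq> 0" using elim unfolding ok_def by auto
 qed
qed

lemma sub_point_slice: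
 assumes "dfun1 x" "dfun1 y" "EV t. x t < y t" "EV t. lo t \<le> x t \<and> y t \<le> hi t" "ordg g x = ordg g y"
 shows "good_slice g x y"
proof (rule point_slice[OF dg assms(1-3) wmono_sub[OF assms(4)] assms(5)])
 have "ordg g hi \<le> ordg g y"
  by (rule wmono_order[OF dg wmono_sub[of lo hi] assms(2) dhi]) (simp, use assms(3,4) in eventually_elim, auto)
 then show "0 < ordg g y" using ordpos by (auto simp: ordg_def intro: less_le_trans)
 show "sign_definite g x y" using sign_sub[OF assms(4)] by simp
qed

lemma dsig1: "dfun1 v \<Longrightarrow> dfun1 (\<lambda>t. \<sigma> t (v t))"
 by (rule dfun1_app2[OF dsig])

lemma ordg_sig:
 assumes "EV t. gl t \<le> v t \<and> v t \<le> gh t" shows "ordg g (\<lambda>t. \<sigma> t (v t)) = order_at_0 v"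
 unfolding ordg_def by (rule order_cong) (use assms ev_ok in eventually_elim, simp add: sig)

end

section \<open>The slice over a gap: widths of its arcs and its exponent\<close>

context gap_slice
begin

text \<open>The left arc only has to agree eventually with \<sigma> t (bot t): for h = \<infinity>
  the slice starts at lo itself, which is the inverse image of gl only for small t.\<close>

context
 fixes x :: "real \<Rightarrow> real"
 assumes dx: "dfun1 x" and x_eq: "EV t. x t = \<sigma> t (bot t)"
begin

definition y :: "real \<Rightarrow> real" where "y t = \<sigma> t (top t)"

lemma dy: "dfun1 y" unfolding y_def[abs_def] by (rule dsig1[OF dtop])

lemma xy_ev: "EV t. ok t \<and> x t = \<sigma> t (bot t) \<and> gl t \<le> bot t \<and> bot t < top t \<and> 8 * top t < gh t \<and> 0 < top t \<and> lo t \<le> x t \<and> x t < y t \<and> y t \<le> hi t"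
 using ev_all x_eq
proof eventually_elim
 case (elim t)
 then have "\<sigma> t (bot t) < \<sigma> t (top t)" by (intro sig_less) auto
 moreover have "lo t \<le> \<sigma> t (bot t)" "\<sigma> t (top t) \<le> hi t" using elim by (intro sig; simp)+
 ultimately show ?case using elim by (simp add: y_def)
qed

lemma xy: "EV t. x t < y t"
 using xy_ev by eventually_elim simp

lemma sub: "EV t. lo t \<le> x t \<and> y t \<le> hi t"
 using xy_ev by eventually_elim simp

lemmas wm = wmono_sub[OF sub]

lemma in_slice:
 assumes "inS x y s" shows "EV t. bot t \<le> g t (s t) \<and> g t (s t) \<le> top t \<and> \<sigma> t (g t (s t)) = s t"
proof -
 have "EV t. x t \<le> s t \<and> s t \<le> y t" using assms by (simp add: inS_def) then show ?thesis using xy_ev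
 proof eventually_elim
  case (elim t)
  have ok: "ok t" using elim by simp
  have 1: "g t (x t) = bot t" "g t (y t) = top t" using elim by (auto simp: y_def intro: sig(3)[OF ok])
  have "g t (x t) \<le> g t (s t)" "g t (s t) \<le> g t (y t)" using elim by (intro g_mono[OF ok]; simp)+
  moreover have "\<sigma> t (g t (s t)) = s t" using elim by (intro sig_g[OF ok]) auto
  ultimately show ?case using 1 by simp
 qed
qed

lemma slice_of_value:
 assumes "dfun1 v" "EV t. bot t \<le> v t \<and> v t \<le> top t"
 shows "inS x y (\<lambda>t. \<sigma> t (v t))" "ordg g (\<lambda>t. \<sigma> t (v t)) = order_at_0 v"
proof -
 have "EV t. x t \<le> \<sigma> t (v t) \<and> \<sigma> t (v t) \<le> y t" using assms(2) xy_ev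
 proof eventually_elim
  case (elim t)
  have "\<sigma> t (bot t) \<le> \<sigma> t (v t)" "\<sigma> t (v t) \<le> \<sigma> t (top t)" using elim by (intro sig_le; simp)+
  then show ?case using elim by (simp add: y_def)
 qed
 then show "inS x y (\<lambda>t. \<sigma> t (v t))" using dsig1[OF assms(1)] by (simp add: inS_def)
 show "ordg g (\<lambda>t. \<sigma> t (v t)) = order_at_0 v"
  by (rule ordg_sig) (use assms(2) xy_ev in eventually_elim, auto)
qed

lemma ends: "inS x y x" "inS x y y" "ordg g x = h" "ordg g y = ereal l"
proof -
 show "inS x y x" "inS x y y" using inS_ends[OF dx dy xy] by auto
 have "ordg g y = order_at_0 top"
  unfolding y_def[abs_def] by (rule slice_of_value(2)[OF dtop]) (use ev_all in eventually_elim, simp)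
 then show "ordg g y = ereal l" by (simp add: order_top)
 have "ordg g x = order_at_0 bot"
  unfolding ordg_def by (rule order_cong) (use xy_ev in eventually_elim, auto intro: sig(3))
 then show "ordg g x = h" by (simp add: order_bot)
qed

lemma dgs: "inS x y s \<Longrightarrow> dfun1 (\<lambda>t. g t (s t))"
 unfolding inS_def using dfun1_comp2[OF dg] by blast

lemma sub_slice_ge:
 assumes s: "inS x y s1" "inS x y s2" "EV t. s1 t < s2 t" "ordg g s1 = ereal p" "ordg g s2 = ereal p"
 shows "ereal (M p) \<le> ord_diff s1 s2"
proof -
 have "ereal (M p) \<le> order_at_0 (\<lambda>t. \<sigma> t (g t (s2 t)) - \<sigma> t (g t (s1 t)))"
 proof (rule seg_ge[OF dgs[OF s(1)] dgs[OF s(2)]])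
  have e: "EV t. x t \<le> s1 t" "EV t. s2 t \<le> y t" using s unfolding inS_def by (auto elim: eventually_mono)
  show "EV t. bot t \<le> g t (s1 t) \<and> g t (s1 t) \<le> g t (s2 t) \<and> g t (s2 t) \<le> 2 * top t"
   using in_slice[OF s(1)] in_slice[OF s(2)] s(3) xy_ev e
  proof eventually_elim
   case (elim t)
   have "g t (s1 t) \<le> g t (s2 t)" using elim by (intro g_mono) auto
   then show ?case using elim by simp
  qed
 qed (use s in \<open>simp_all add: ordg_def\<close>)
 also have "order_at_0 (\<lambda>t. \<sigma> t (g t (s2 t)) - \<sigma> t (g t (s1 t))) = ord_diff s1 s2"
  by (rule order_cong) (use in_slice[OF s(1)] in_slice[OF s(2)] in eventually_elim, simp)
 finally show ?thesis .
qed

lemma sub_slice_le: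
 assumes s: "inS x y s" and p: "ordg g s = ereal p"
 obtains s1 s2 where "inS x y s1" "inS x y s2" "EV t. s1 t < s2 t" "inS s1 s2 s" "ordg g s1 = ereal p" "ordg g s2 = ereal p"
  "ord_diff s1 s2 \<le> ereal (M p)"
proof -
 have "EV t. bot t \<le> g t (s t) \<and> g t (s t) \<le> top t" using in_slice[OF s] by eventually_elim simp
 from seg_le[OF dgs[OF s] this p[unfolded ordg_def]]
 obtain v1 v2 where v: "dfun1 v1" "dfun1 v2"
  "EV t. bot t \<le> v1 t \<and> v1 t \<le> g t (s t) \<and> g t (s t) \<le> v2 t \<and> v2 t \<le> top t \<and> v1 t < v2 t"
  "order_at_0 v1 = ereal p" "order_at_0 v2 = ereal p" "order_at_0 (\<lambda>t. \<sigma> t (v2 t) - \<sigma> t (v1 t)) \<le> ereal (M p)" .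
 have e: "EV t. bot t \<le> v1 t \<and> v1 t \<le> top t" "EV t. bot t \<le> v2 t \<and> v2 t \<le> top t"
  using v(3) by (eventually_elim; simp)+
 have "EV t. \<sigma> t (v1 t) < \<sigma> t (v2 t) \<and> \<sigma> t (v1 t) \<le> s t \<and> s t \<le> \<sigma> t (v2 t)"
  using v(3) in_slice[OF s] xy_ev
 proof eventually_elim
  case (elim t)
  have "\<sigma> t (v1 t) < \<sigma> t (v2 t)" using elim by (intro sig_less) auto
  moreover have "\<sigma> t (v1 t) \<le> \<sigma> t (g t (s t))" "\<sigma> t (g t (s t)) \<le> \<sigma> t (v2 t)" using elim by (intro sig_le; simp)+
  ultimately show ?case using elim by simp
 qed
 then show ?thesis using that[OF slice_of_value(1)[OF v(1) e(1)] slice_of_value(1)[OF v(2) e(2)]]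
   slice_of_value(2)[OF v(1) e(1)] slice_of_value(2)[OF v(2) e(2)] v s
  by (auto simp: inS_def eventually_conj_iff)
qed

text \<open>If \<open>Q\<close> of a triangle around s is a point, both sides have the order p of s,
  so \<open>sub_slice_ge\<close> bounds its exponent from below. \<open>sub_slice_le\<close>
  provides such a triangle whose exponent is no larger than the bound.\<close>

lemma width_finite:
 assumes s: "inS x y s" and p: "ordg g s = ereal p" shows "width g x y s = 1 + ereal (M p)"
proof -
 define W where "W = {1 + ord_diff s1 s2 | s1 s2. inS x y s1 \<and> inS x y s2 \<and>
   (EV t. s1 t < s2 t) \<and> inS s1 s2 s \<and> (\<exists>q. Qs g s1 s2 = {q})}"
 have lower: "1 + ereal (M p) \<le> w" if wW: "w \<in> W" for w
 proof -
  obtain s1 s2 q where w: "w = 1 + ord_diff s1 s2" "inS x y s1" "inS x y s2"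
   "EV t. s1 t < s2 t" "inS s1 s2 s" "Qs g s1 s2 = {q}" using wW unfolding W_def by blast
  have "inS s1 s2 s1" "inS s1 s2 s2" using inS_ends[OF _ _ w(4)] w(2,3) by (auto simp: inS_def)
  then have "ordg g s1 \<in> {q}" "ordg g s2 \<in> {q}" "ordg g s \<in> {q}" using w(5) unfolding w(6)[symmetric] Qs_def by blast+
  then have "ereal (M p) \<le> ord_diff s1 s2" using sub_slice_ge[OF w(2-4)] p by auto
  then show ?thesis unfolding w(1) by (rule add_left_mono)
 qed
 obtain s1 s2 where s12: "inS x y s1" "inS x y s2" "EV t. s1 t < s2 t" "inS s1 s2 s" "ordg g s1 = ereal p" "ordg g s2 = ereal p"
  "ord_diff s1 s2 \<le> ereal (M p)" by (rule sub_slice_le[OF s p])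
 have "Qs g s1 s2 = {ereal p}"
 proof -
  have "ordg g s' = ereal p" if "inS s1 s2 s'" for s'
   using wmono_between[OF dg wm s12(1,2) that] s12(5,6) by simp
  then have "Qs g s1 s2 \<subseteq> {ereal p}" unfolding Qs_def by auto
  moreover have "ordg g s \<in> Qs g s1 s2" using s12(4) unfolding Qs_def by blast
  ultimately show ?thesis using p by auto
 qed
 then have "1 + ord_diff s1 s2 \<in> W" using s12 unfolding W_def by blast
 moreover have "1 + ord_diff s1 s2 \<le> 1 + ereal (M p)" using s12(7) by (rule add_left_mono)
 ultimately have "Inf W \<le> 1 + ereal (M p)" by (meson Inf_lower order_trans)
 moreover have "1 + ereal (M p) \<le> Inf W" using lower by (rule Inf_greatest)
 ultimately show ?thesis unfolding width_def W_def by (rule antisym)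
qed

text \<open>In a triangle around s with a single order, g would vanish on the right side, which lies
  strictly above lo, against strict monotonicity. So the infimum is over the empty set.\<close>

lemma width_infinite:
 assumes s: "inS x y s" and p: "ordg g s = \<infinity>" shows "width g x y s = \<infinity>"
proof -
 have "False" if w: "inS x y s1" "inS x y s2" "EV t. s1 t < s2 t" "inS s1 s2 s" "Qs g s1 s2 = {q}" for s1 s2 q
 proof -
  have "inS s1 s2 s2" using inS_ends[OF _ _ w(3)] w(1,2) by (auto simp: inS_def)
  then have "ordg g s2 \<in> {q}" "ordg g s \<in> {q}" using w(4) unfolding w(5)[symmetric] Qs_def by blast+
  then have "EV t. g t (s2 t) = 0" using p by (simp add: ordg_def order_infty)
  moreover have "EV t. x t \<le> s1 t" "EV t. s2 t \<le> y t" using w unfolding inS_def by (auto elim: eventually_mono)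
  ultimately have "EV t. False" using xy_ev w(3)
  proof eventually_elim
   case (elim t)
   have "ok t" "lo t < s2 t" "s2 t \<le> hi t" using elim by auto
   then have "g t (lo t) < g t (s2 t)" "0 \<le> g t (lo t)" unfolding ok_def by auto
   then show ?case using elim(1) by simp
  qed
  then show False by simp
 qed
 then have "{1 + ord_diff s1 s2 | s1 s2. inS x y s1 \<and> inS x y s2 \<and>
   (EV t. s1 t < s2 t) \<and> inS s1 s2 s \<and> (\<exists>q. Qs g s1 s2 = {q})} = {}" by blast
 then show ?thesis unfolding width_def by (simp only: Inf_empty top_ereal_def)
qed

lemma order_xy_le:
 assumes s: "inS x y s" "ordg g s = ereal p" shows "ord_diff x y \<le> ereal (M p)"
proof -
 obtain s1 s2 where s12: "inS x y s1" "inS x y s2" "EV t. s1 t < s2 t" "ord_diff s1 s2 \<le> ereal (M p)"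
  by (rule sub_slice_le[OF s])
 have "EV t. x t \<le> s1 t" "EV t. s2 t \<le> y t" using s12 unfolding inS_def by (auto elim: eventually_mono)
 then have e: "EV t. x t \<le> s1 t \<and> s1 t \<le> s2 t \<and> s2 t \<le> y t" using s12(3) by eventually_elim auto
 have "ord_diff x y \<le> ord_diff s1 s2"
  by (rule order_diff_mono[OF _ _ dx dy e]) (use s12 in \<open>simp_all add: inS_def\<close>)
 then show ?thesis using s12(4) by (rule order_trans)
qed

lemma order_sub_ge:
 assumes s: "inS x y s" "ordg g s = ereal p" shows "ereal (min (M l) (M p)) \<le> ord_diff s y"
proof -
 have "EV t. bot t \<le> g t (s t) \<and> g t (s t) \<le> top t" using in_slice[OF s(1)] by eventually_elim simp
 from big_sum[OF dgs[OF s(1)] this s(2)[unfolded ordg_def]]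
 have "ereal (min (M l) (M p)) \<le> order_at_0 (\<lambda>t. \<sigma> t (top t) - \<sigma> t (g t (s t)))" .
 also have "\<dots> = ord_diff s y"
  by (rule order_cong) (use in_slice[OF s(1)] in eventually_elim, simp add: y_def)
 finally show ?thesis .
qed

text \<open>The slice contains narrow triangles at both of its sides, with orders at most M l and M
  q, which bounds its own order from above; \<open>big_sum\<close> bounds it from below.\<close>

lemma order_xy_finite:
 assumes "h = ereal q" shows "ord_diff x y = ereal (min (M l) (M q))"
using order_xy_le[OF ends(2,4)] order_xy_le[OF ends(1), of q] ends(3) assms order_sub_ge[OF ends(1), of q] by (auto simp: min_def)

text \<open>For \<open>h = \<infinity>\<close> we compare with the arc \<open>x + t powr N\<close>, on which the order of \<open>g\<close> is finite.\<close>

lemma shifted_arc: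
 assumes h: "h = \<infinity>" and N: "N \<in> \<FF>" "ord_diff x y < ereal N"
 obtains p where "inS x y (\<lambda>t. x t + pw N t)" "ordg g (\<lambda>t. x t + pw N t) = ereal p" "l \<le> p"
  "EV t. 2 * pw N t < y t - x t"
proof -
 have e: "EV t. 2 * pw N t < y t - x t"
  using order_lt_large[OF dfun1_diff[OF dy dx] N(2), of 2] pw_ev[of N] xy by eventually_elim simp
 have d: "dfun1 (\<lambda>t. x t + pw N t)" unfolding dfun1_def by (intro dint N dfun1_app[OF dx])
 have pos: "EV t. 0 < pw N t" using ev_pos by eventually_elim (simp add: pw_def)
 have i: "inS x y (\<lambda>t. x t + pw N t)" using d e pos unfolding inS_def by (auto elim: eventually_elim2)
 have "\<not> (EV t. g t (x t + pw N t) = 0)"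
 proof
  assume "EV t. g t (x t + pw N t) = 0"
  then have "EV t. False" using sign_sub[OF sub] e pos by eventually_elim (smt (verit))
  then show False by simp
 qed
 then obtain p where p: "ordg g (\<lambda>t. x t + pw N t) = ereal p"
  unfolding ordg_def by (cases rule: order_cases[OF dgs[OF i]]) auto
 moreover have "ereal l \<le> ordg g (\<lambda>t. x t + pw N t)" using wmono_between(1)[OF dg wm ends(1,2) i] ends(4) by simp
 ultimately show ?thesis using that[OF i p] e by simp
qed

lemma order_xy_real: obtains \<rho> where "ord_diff x y = ereal \<rho>"
 using order_diff_finite[OF dx dy xy] by metis

text \<open>Suppose \<alpha> \<le> 0. Near an arc of order q = p + 1 there is a triangle of order at
  most M q \<le> M l. It lies between x and x + t powr n, where the order is only p, so its order is
  at least n, although n was chosen above M l.\<close>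

lemma \<alpha>_pos: assumes h: "h = \<infinity>" shows "0 < \<alpha>"
proof (rule ccontr)
 assume neg: "\<not> 0 < \<alpha>"
 obtain \<rho> where \<rho>: "ord_diff x y = ereal \<rho>" by (rule order_xy_real)
 obtain n :: nat where n: "max \<rho> (M l) < real n" using reals_Archimedean2 by blast
 obtain p where p: "inS x y (\<lambda>t. x t + pw (real n) t)" "ordg g (\<lambda>t. x t + pw (real n) t) = ereal p" "l \<le> p"
  by (rule shifted_arc[OF h FF_of_nat, of n]) (use \<rho> n in auto)
 let ?s = "\<lambda>t. x t + pw (real n) t"
 have pF: "p \<in> \<FF>" using order_finite(1)[OF dgs[OF p(1)]] p(2) by (simp add: ordg_def)
 define q where "q = p + 1"
 have q: "q \<in> \<FF>" "p < q" "in_gap l h q" using pF FF_add[OF _ FF_1] p(3) h by (auto simp: q_def in_gap_def)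
 have dq: "dfun1 (pw q)" by (rule dfun1_pw[OF q(1)])
 have oq: "order_at_0 (pw q) = ereal q" using ord_is_order[OF ord_is_pw[of 1 q]] by simp
 have bq: "EV t. bot t < 1 * t powr q" using h by (intro bot_below) auto
 have tq: "EV t. 1 * t powr q < c * t powr l" using q p(3) c(1) by (intro powr_lt) auto
 have eq: "EV t. bot t \<le> pw q t \<and> pw q t \<le> top t" using bq tq ev_top pw_ev[of q] by eventually_elim simp
 note sv = slice_of_value[OF dq eq]
 obtain s1 s2 where s12: "inS x y s1" "inS x y s2" "EV t. s1 t < s2 t" "inS s1 s2 (\<lambda>t. \<sigma> t (pw q t))"
  "ordg g s1 = ereal q" "ordg g s2 = ereal q" "ord_diff s1 s2 \<le> ereal (M q)"
  by (rule sub_slice_le[OF sv(1)]) (use sv(2) oq in auto)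
 \<comment> \<open>Otherwise the arc ?s would lie below s2 and, by monotonicity, its order p would
   be at least q.\<close>
 have less: "EV t. s2 t < ?s t"
 proof (rule ccontr)
  have ds: "dfun1 s2" "dfun1 ?s" using s12 p by (simp_all add: inS_def)
  have "drel1 (\<lambda>t. s2 t < ?s t)" unfolding drel1_def by (intro dint dfun1_app[OF ds(1)] dfun1_app[OF dx] FF_of_nat)
  moreover assume "\<not> (EV t. s2 t < ?s t)"
  ultimately have "EV t. ?s t \<le> s2 t" using ev_dichotomy_right[of "\<lambda>t. s2 t < ?s t" 0] by (simp add: not_less)
  moreover have "EV t. x t \<le> ?s t" "EV t. s2 t \<le> y t"
   using p(1) s12(2) unfolding inS_def by (auto elim: eventually_mono)
  ultimately have "EV t. x t \<le> ?s t \<and> ?s t \<le> s2 t \<and> s2 t \<le> y t" by eventually_elim simp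
  then have "ordg g s2 \<le> ordg g ?s" by (rule wmono_order[OF dg wm ds(2,1)])
  then show False using s12(6) p(2) q(2) by simp
 qed
 have "ereal (real n) \<le> ord_diff s1 s2"
 proof -
  have "EV t. x t \<le> s1 t" using s12(1) unfolding inS_def by (auto elim: eventually_mono)
  then have "EV t. \<bar>s2 t - s1 t\<bar> \<le> 1 * t powr (real n)"
   using less s12(3) pw_ev[of "real n"] by eventually_elim simp
  moreover have "dfun1 (\<lambda>t. s2 t - s1 t)" using s12(1,2) by (intro dfun1_diff) (simp_all add: inS_def)
  ultimately show ?thesis using order_ge_iff by blast
 qed
 then have "ereal (real n) \<le> ereal (M q)" using s12(7) by (rule order_trans)
 moreover have "M q \<le> M l" using neg q(2) p(3) by (simp add: M_def mult_left_mono_neg)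
 ultimately show False using n by simp
qed

text \<open>Passing from x to x + t powr n loses less than half of y - x, and on the new arc the
  order is finite, so \<open>big_sum\<close> applies; as 0 < \<alpha>, the minimum of M l and M p is
  M l.\<close>

lemma order_xy_infinite:
 assumes h: "h = \<infinity>" shows "ord_diff x y = ereal (M l)"
proof (rule antisym)
 show "ord_diff x y \<le> ereal (M l)" by (rule order_xy_le[OF ends(2,4)])
 obtain \<rho> where \<rho>: "ord_diff x y = ereal \<rho>" by (rule order_xy_real)
 obtain n :: nat where n: "\<rho> < real n" using reals_Archimedean2 by blast
 let ?s = "\<lambda>t. x t + pw (real n) t"
 obtain p where p: "inS x y ?s" "ordg g ?s = ereal p" "l \<le> p" "EV t. 2 * pw (real n) t < y t - x t"
  by (rule shifted_arc[OF h FF_of_nat, of n]) (use \<rho> n in auto)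
 have "M l \<le> M p" using \<alpha>_pos[OF h] p(3) by (simp add: M_def)
 then have "ereal (M l) \<le> order_at_0 (\<lambda>t. y t - ?s t)" using order_sub_ge[OF p(1,2)] by (simp add: min_def)
 also have "\<dots> \<le> ord_diff x y"
 proof (rule order_antimono[where C = 2])
  show "EV t. \<bar>y t - x t\<bar> \<le> 2 * \<bar>y t - ?s t\<bar>" using p(4) xy by eventually_elim auto
 qed (use p(1) dx dy in \<open>auto simp: inS_def intro: dfun1_diff\<close>)
 finally show "ereal (M l) \<le> ord_diff x y" .
qed

lemma gap_good_slice: "good_slice g x (level c l)"
proof -
 have "good_slice g x y"
 proof (rule affine_slice[OF dg dx dy xy wm ends(4) _ l_pos(1) sign_sub[OF sub] _ F(1,2)])
  show "ereal l < ordg g x" using gap ends(3) by (simp add: gap_def)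
  show "\<exists>s. inS x y s \<and> ordg g s = ereal q" if q: "q \<in> \<FF>" "l < q" "ereal q < ordg g x" for q
  proof -
   have bq: "EV t. bot t < 1 * t powr q" using q ends(3) by (intro bot_below) auto
   have tq: "EV t. 1 * t powr q < c * t powr l" using q c(1) by (intro powr_lt) auto
   have "EV t. bot t \<le> pw q t \<and> pw q t \<le> top t" using bq tq ev_top pw_ev[of q] by eventually_elim simp
   from slice_of_value[OF dfun1_pw[OF q(1)] this] show ?thesis
    using ord_is_order[OF ord_is_pw[of 1 q]] by auto
  qed
  show "width g x y s = 1 + ereal (\<alpha> * q + d)" if "inS x y s" "ordg g s = ereal q" for s q
   using width_finite[OF that] by (simp add: M_def)
  show "0 < \<alpha> \<and> ord_diff x y = ereal (\<alpha> * l + d)" if "ordg g x = \<infinity>"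
   using \<alpha>_pos order_xy_infinite ends(3) that by (simp add: M_def)
  show "ord_diff x y = ereal (min (\<alpha> * l + d) (\<alpha> * q + d))" if "ordg g x = ereal q" for q
   using order_xy_finite[of q] ends(3) that by (simp add: M_def)
 qed (rule width_infinite)
 then show ?thesis by (simp add: y_def[abs_def] top_def)
qed

end

end

section \<open>Decomposition of a sector into slices\<close>

context increasing_slice
begin

lemma dk: "q \<in> \<FF> \<Longrightarrow> dfun1 (\<lambda>t. k * pw q t)"
 unfolding dfun1_def by (intro dint)

lemma dom_ev: "dom \<kappa> q \<Longrightarrow> EV t. ok t \<and> gl t < \<kappa> * pw q t \<and> \<kappa> * pw q t < gh t"
proof -
 assume d: "dom \<kappa> q"
 then have d1: "EV t. gl t < \<kappa> * t powr q \<and> 8 * \<kappa> * t powr q < gh t" and d2: "0 < \<kappa>" by (auto simp: dom_def)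
 show ?thesis using d1 ev_ok pw_ev[of q]
 proof eventually_elim
  case (elim t)
  have "0 \<le> \<kappa> * t powr q" using d2 by simp
  then show ?case using elim by auto
 qed
qed

lemma gap_link_upper:
 assumes g: "gap q h" and q: "q \<in> \<FF>" and m: "\<And>p. in_gap q h p \<Longrightarrow> m p = \<alpha> * p + d"
 shows "\<exists>\<kappa>1>0. \<forall>\<kappa>. 0 < \<kappa> \<longrightarrow> \<kappa> \<le> 8 * \<kappa>1 \<longrightarrow> dom \<kappa> q \<and> ordD \<kappa> q = ereal (\<alpha> * q + d)"
proof -
 have "a \<le> q" "ereal q < b" using g unfolding gap_def by (auto intro: less_le_trans)
 then obtain \<mu> \<kappa>0 where \<mu>: "\<mu> \<in> \<FF>" "\<kappa>0 > 0"
  "\<And>\<kappa>. 0 < \<kappa> \<Longrightarrow> \<kappa> < \<kappa>0 \<Longrightarrow> dom \<kappa> q \<and> ordD \<kappa> q = ereal \<mu>" using upper_end_order[OF q] by blast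
 have "\<mu> = \<alpha> * q + d" by (rule upper_end_affine[OF g m q \<mu>(1,2)]) (use \<mu>(3) in auto)
 \<comment> \<open>Division by 9 turns \<kappa> \<le> 8 * \<kappa>1 into \<kappa> <
   \<kappa>0.\<close>
 then show ?thesis using \<mu>(2,3) by (intro exI[of _ "\<kappa>0 / 9"]) auto
qed

text \<open>c stays free below a bound and C above one, so that slices over neighbouring gaps can be
  joined by a point slice between two levels with the same exponent.\<close>

lemma gap_link_finite:
 assumes g: "gap q (ereal q')" and q: "q \<in> \<FF>" "q' \<in> \<FF>" shows "\<exists>\<kappa>1>0. \<exists>K>0. \<forall>c C. 0 < c \<longrightarrow> c < \<kappa>1 \<longrightarrow> K < C \<longrightarrow>
   good_slice g (level C q') (level c q)"
proof -
 obtain \<alpha> d where m: "\<alpha> \<in> \<FF>" "d \<in> \<FF>" "\<And>p. in_gap q (ereal q') p \<Longrightarrow> m p = \<alpha> * p + d"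
  using gap_affine[OF g] by blast
 obtain \<kappa>1 where \<kappa>1: "\<kappa>1 > 0" "\<And>\<kappa>. 0 < \<kappa> \<Longrightarrow> \<kappa> \<le> 8 * \<kappa>1 \<Longrightarrow> dom \<kappa> q \<and> ordD \<kappa> q = ereal (\<alpha> * q + d)"
  using gap_link_upper[OF g q(1) m(3)] by blast
 have "a < q'" "ereal q' \<le> b" using g unfolding gap_def by auto
 then obtain \<mu> K where \<mu>: "\<mu> \<in> \<FF>" "K > 0"
  "\<And>\<kappa>. K < \<kappa> \<Longrightarrow> dom \<kappa> q' \<and> ordD \<kappa> q' = ereal \<mu>" using lower_end_order[OF q(2)] by blast
 have \<mu>': "\<mu> = \<alpha> * q' + d" by (rule lower_end_affine[OF g m(3) q(2) \<mu>(1,2)]) (use \<mu>(3) in auto)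
 have "good_slice g (level C q') (level c q)" if c: "0 < c" "c < \<kappa>1" and C: "K < C" for c C
 proof -
  interpret G: gap_slice S g lo hi q "ereal q'" \<alpha> d c "\<lambda>t. C * pw q' t"
  proof unfold_locales
   show "gap q (ereal q')" by (rule g)
   show "dom \<kappa> q \<and> ordD \<kappa> q = ereal (\<alpha> * q + d)" if "0 < \<kappa>" "\<kappa> \<le> 8 * c" for \<kappa>
    using \<kappa>1(2)[of \<kappa>] that c by simp
   have "\<forall>\<kappa>\<ge>C. dom \<kappa> q' \<and> ordD \<kappa> q' = ereal (\<alpha> * q' + d)" using \<mu>(3) C \<mu>' by auto
   then show "(\<exists>h' C'. ereal q' = ereal h' \<and> h' \<in> \<FF> \<and> C' > 0 \<and> (\<lambda>t. C * pw q' t) = (\<lambda>t. C' * pw h' t) \<and>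
     (\<forall>\<kappa>\<ge>C'. dom \<kappa> h' \<and> ordD \<kappa> h' = ereal (\<alpha> * h' + d))) \<or>
     ereal q' = \<infinity> \<and> b = \<infinity> \<and> (\<lambda>t. C * pw q' t) = gl"
    using q(2) \<mu>(2) C by (intro disjI1 exI[of _ q'] exI[of _ C]) auto
  qed (use m q c dk in auto)
  show ?thesis by (rule G.gap_good_slice) (rule dsig1[OF dk[OF q(2)]], simp)
 qed
 then show ?thesis using \<kappa>1(1) \<mu>(2) by blast
qed

lemma gap_link_infinite:
 assumes g: "gap q \<infinity>" and q: "q \<in> \<FF>" shows "\<exists>\<kappa>1>0. \<forall>c. 0 < c \<longrightarrow> c < \<kappa>1 \<longrightarrow> good_slice g lo (level c q)"
proof -
 obtain \<alpha> d where m: "\<alpha> \<in> \<FF>" "d \<in> \<FF>" "\<And>p. in_gap q \<infinity> p \<Longrightarrow> m p = \<alpha> * p + d" using gap_affine[OF g] by blast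
 obtain \<kappa>1 where \<kappa>1: "\<kappa>1 > 0" "\<And>\<kappa>. 0 < \<kappa> \<Longrightarrow> \<kappa> \<le> 8 * \<kappa>1 \<Longrightarrow> dom \<kappa> q \<and> ordD \<kappa> q = ereal (\<alpha> * q + d)"
  using gap_link_upper[OF g q m(3)] by blast
 have binf: "b = \<infinity>" using g by (simp add: gap_def)
 have "good_slice g lo (level c q)" if c: "0 < c" "c < \<kappa>1" for c
 proof -
  interpret G: gap_slice S g lo hi q \<infinity> \<alpha> d c gl
  proof unfold_locales
   show "gap q \<infinity>" by (rule g)
   show "dom \<kappa> q \<and> ordD \<kappa> q = ereal (\<alpha> * q + d)" if "0 < \<kappa>" "\<kappa> \<le> 8 * c" for \<kappa>
    using \<kappa>1(2)[of \<kappa>] that c by simp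
  qed (use m q c dgl binf in auto)
  have "EV t. lo t = \<sigma> t (gl t)" using ev_ok by eventually_elim (simp add: sig_ends)
  with dlo show ?thesis by (rule G.gap_good_slice)
 qed
 then show ?thesis using \<kappa>1(1) by blast
qed

lemma ordg_sig_pw: assumes "dom \<kappa> q" shows "ordg g (level \<kappa> q) = ereal q"
proof -
 have "ordg g (level \<kappa> q) = order_at_0 (\<lambda>t. \<kappa> * pw q t)"
  by (rule ordg_sig) (use dom_ev[OF assms] in eventually_elim, simp)
 then show ?thesis using ord_is_order[OF ord_is_pw[of \<kappa> q]] assms by (simp add: dom_def)
qed

lemma ordg_ends: "ordg g lo = b" "ordg g hi = ereal a"
 using ord_gh(1) by (simp_all add: ordg_def b_def gl_def[abs_def] gh_def[abs_def])

lemma sig_dom: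
 assumes "dom \<kappa> q" shows "EV t. lo t < \<sigma> t (\<kappa> * pw q t) \<and> \<sigma> t (\<kappa> * pw q t) < hi t" "dfun1 (level \<kappa> q)"
proof -
 show "EV t. lo t < \<sigma> t (\<kappa> * pw q t) \<and> \<sigma> t (\<kappa> * pw q t) < hi t" using dom_ev[OF assms]
 proof eventually_elim
  case (elim t)
  have "\<sigma> t (gl t) < \<sigma> t (\<kappa> * pw q t)" "\<sigma> t (\<kappa> * pw q t) < \<sigma> t (gh t)" using elim by (intro sig_less; simp)+
  then show ?case using elim by (simp add: sig_ends)
 qed
 show "dfun1 (level \<kappa> q)" using assms by (intro dsig1 dk) (simp add: dom_def)
qed

text \<open>This bridges the range of constants at an exceptional q where the order of the dyadic
  width is not controlled: the order of g is q throughout the strip, and no widths of bands are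
  needed for that.\<close>

lemma point_link:
 assumes "dom \<kappa> q" "dom \<kappa>' q" "\<kappa> < \<kappa>'" shows "good_slice g (level \<kappa> q) (level \<kappa>' q)"
proof (rule sub_point_slice)
 show "EV t. \<sigma> t (\<kappa> * pw q t) < \<sigma> t (\<kappa>' * pw q t)" using dom_ev[OF assms(1)] dom_ev[OF assms(2)] ev_pos
 proof eventually_elim
  case (elim t)
  have "\<kappa> * pw q t < \<kappa>' * pw q t" using assms(3) elim by (intro mult_strict_right_mono) (simp_all add: pw_def)
  then show ?case using elim by (intro sig_less) auto
 qed
 show "EV t. lo t \<le> \<sigma> t (\<kappa> * pw q t) \<and> \<sigma> t (\<kappa>' * pw q t) \<le> hi t"
  using sig_dom(1)[OF assms(1)] sig_dom(1)[OF assms(2)] by eventually_elim simp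
qed (use sig_dom(2) ordg_sig_pw assms in auto)

lemma b_ge_a: "ereal a \<le> b"
proof -
 have e: "EV t. lo t \<le> lo t \<and> lo t \<le> hi t \<and> hi t \<le> hi t" using le by eventually_elim simp
 have w: "wmono g lo hi" by (rule wmono_sub) simp
 show ?thesis using wmono_order[OF dg w dlo dhi e] ordg_ends by simp
qed

lemma b_FF: "b = ereal q \<Longrightarrow> q \<in> \<FF>"
 unfolding b_def using order_finite(1)[OF dgl] by blast

text \<open>Induction on the number of exceptional exponents between q and b. The gap below the
  level c * t powr q ends at b or at the next exceptional q'; in the latter case a point slice joins
  it to the chain that the induction provides for q'.\<close>

lemma lower_chain:
 assumes Q: "finite Q" "Q \<subseteq> \<FF>"
  "\<And>q q'. q \<in> \<FF> \<Longrightarrow> q' \<in> \<FF> \<Longrightarrow> q \<le> q' \<Longrightarrow> a < q \<Longrightarrow> ereal q' < b \<Longrightarrow> \<forall>p\<in>Q. \<not> (q \<le> p \<and> p \<le> q') \<Longrightarrow> flat q q'"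
  and q: "q \<in> \<FF>" "a \<le> q" "ereal q < b"
 shows "\<exists>\<kappa>1>0. \<forall>c. 0 < c \<longrightarrow> c < \<kappa>1 \<longrightarrow> (good_slice g)\<^sup>*\<^sup>* lo (level c q)"
 using q
proof (induction "card {p\<in>Q. q < p \<and> ereal p < b}" arbitrary: q rule: less_induct)
 case less
 define P where "P = {p\<in>Q. q < p \<and> ereal p < b}"
 have P: "finite P" using Q(1) by (simp add: P_def)
 show ?case
 proof (cases "P = {}")
  case True
  have g: "gap q b" unfolding gap_def
  proof (intro conjI allI impI)
   fix p p' assume p: "p \<in> \<FF>" "p' \<in> \<FF>" "q < p" "p \<le> p'" "ereal p' < b"
   have "\<not> (p \<le> x \<and> x \<le> p')" if "x \<in> Q" for x
   proof
    assume x: "p \<le> x \<and> x \<le> p'"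
    then have "ereal x < b" using p(5) by (intro le_less_trans[of "ereal x" "ereal p'"]) auto
    then have "x \<in> P" using that x p(3) by (simp add: P_def)
    then show False using True by simp
   qed
   then show "flat p p'" using Q(3) p less.prems by simp
  qed (use less.prems in auto)
  show ?thesis
  proof (cases b)
   case (real b')
   \<comment> \<open>For finite b, the order is b on the whole strip from lo up to a level with a
     large constant, which gives a point slice.\<close>
   then have b': "b' \<in> \<FF>" "a < b'" "gap q (ereal b')" using b_FF g less.prems by auto
   obtain \<kappa>1 K where \<kappa>: "\<kappa>1 > 0" "K > 0" "\<And>c C. 0 < c \<Longrightarrow> c < \<kappa>1 \<Longrightarrow> K < C \<Longrightarrow>
    good_slice g (level C b') (level c q)" using gap_link_finite[OF b'(3) less.prems(1) b'(1)] by blast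
   obtain K' where K': "K' > 0" "\<And>\<kappa>. K' < \<kappa> \<Longrightarrow> dom \<kappa> b'" using lower_end_order[OF b'(1,2)] real by auto
   define C where "C = max K K' + 1"
   have dC: "dom C b'" using K'(2) by (simp add: C_def)
   have "good_slice g lo (level C b')" by (rule sub_point_slice)
      (use dlo sig_dom[OF dC] ordg_sig_pw[OF dC] ordg_ends real in \<open>auto elim: eventually_mono\<close>)
   moreover have "good_slice g (level C b') (level c q)" if "0 < c" "c < \<kappa>1" for c
    using \<kappa>(3)[OF that] by (simp add: C_def)
   ultimately show ?thesis using \<kappa>(1) by (meson rtranclp.rtrancl_refl rtranclp.rtrancl_into_rtrancl)
  next
   case PInf
   then show ?thesis using gap_link_infinite[of q] g less.prems(1) by (metis r_into_rtranclp)
  qed (use b_ge_a in auto)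
 next
  case False
  define q' where "q' = Min P"
  have q': "q' \<in> P" "\<And>p. p \<in> P \<Longrightarrow> q' \<le> p" using P False by (auto simp: q'_def)
  then have q'F: "q' \<in> \<FF>" "q < q'" "ereal q' < b" "a < q'" using Q(2) less.prems by (auto simp: P_def)
  have g: "gap q (ereal q')" unfolding gap_def
  proof (intro conjI allI impI)
   fix p p' assume p: "p \<in> \<FF>" "p' \<in> \<FF>" "q < p" "p \<le> p'" "ereal p' < ereal q'"
   have pb: "ereal p' < b" using p(5) q'F(3) by (rule less_trans)
   have "\<not> (p \<le> x \<and> x \<le> p')" if "x \<in> Q" for x
   proof
    assume x: "p \<le> x \<and> x \<le> p'"
    then have "ereal x < b" using pb by (intro le_less_trans[of "ereal x" "ereal p'"]) auto
    then have "x \<in> P" using that x p(3) by (simp add: P_def)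
    then show False using q'(2) x p(5) by force
   qed
   then show "flat p p'" using Q(3) p pb less.prems by simp
  qed (use q'F less.prems in auto)
  have "{p\<in>Q. q' < p \<and> ereal p < b} \<subset> P" using q' q'F by (auto simp: P_def)
  then have "card {p\<in>Q. q' < p \<and> ereal p < b} < card P" by (rule psubset_card_mono[OF P])
  then obtain \<kappa>2 where \<kappa>2: "\<kappa>2 > 0" "\<And>c. 0 < c \<Longrightarrow> c < \<kappa>2 \<Longrightarrow> (good_slice g)\<^sup>*\<^sup>* lo (level c q')"
   using less.hyps[of q'] q'F unfolding P_def by force
  obtain \<kappa>1 K where \<kappa>: "\<kappa>1 > 0" "K > 0" "\<And>c C. 0 < c \<Longrightarrow> c < \<kappa>1 \<Longrightarrow> K < C \<Longrightarrow>
    good_slice g (level C q') (level c q)" using gap_link_finite[OF g less.prems(1) q'F(1)] by blast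
  \<comment> \<open>c' is small enough for the chain up to q' and smaller than C, so the two levels
    at q' bound a point slice.\<close>
  define c' where "c' = min (\<kappa>2 / 2) K"
  define C where "C = K + 1"
  have s1: "(good_slice g)\<^sup>*\<^sup>* lo (level c' q')" using \<kappa>2 \<kappa>(2) by (simp add: c'_def min_less_iff_disj)
  have s2: "good_slice g (level c' q') (level C q')"
   by (rule point_link) (use dom_inner[OF q'F(4,3)] q'F(1) \<kappa>2(1) \<kappa>(2) in \<open>auto simp: c'_def C_def\<close>)
  have s3: "(good_slice g)\<^sup>*\<^sup>* lo (level C q')"
   by (rule rtranclp.rtrancl_into_rtrancl[of "good_slice g", OF s1 s2])
  have s4: "good_slice g (level C q') (level c q)" if "0 < c" "c < \<kappa>1" for c
   using \<kappa>(3)[OF that] by (simp add: C_def)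
  have "(good_slice g)\<^sup>*\<^sup>* lo (level c q)" if "0 < c" "c < \<kappa>1" for c
   by (rule rtranclp.rtrancl_into_rtrancl[of "good_slice g", OF s3 s4[OF that]])
  then show ?thesis using \<kappa>(1) by blast
 qed
qed

text \<open>\<open>lower_chain\<close> reaches a level with exponent a and a small constant; from
  there up to hi the order is constantly a, which is one more point slice. If b = a, the whole piece
  is a point slice.\<close>

theorem increasing_chain: "(good_slice g)\<^sup>*\<^sup>* lo hi"
proof (cases "b = ereal a")
 case True
 have "good_slice g lo hi" by (rule sub_point_slice) (use dlo dhi le ordg_ends True in auto)
 then show ?thesis by (rule r_into_rtranclp[of "good_slice g"])
next
 case False
 then have ab: "ereal a < b" using b_ge_a by simp
 obtain Q where "finite Q" "Q \<subseteq> \<FF>" "\<And>q q'. q \<in> \<FF> \<Longrightarrow> q' \<in> \<FF> \<Longrightarrow> q \<le> q' \<Longrightarrow> a < q \<Longrightarrow> ereal q' < b \<Longrightarrow>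
   \<forall>p\<in>Q. \<not> (q \<le> p \<and> p \<le> q') \<Longrightarrow> flat q q'" using flat_exceptions[OF ab] by auto
 from lower_chain[OF this ord_gh(2) order_refl ab]
 obtain \<kappa>1 where \<kappa>1: "\<kappa>1 > 0" "\<And>c. 0 < c \<Longrightarrow> c < \<kappa>1 \<Longrightarrow> (good_slice g)\<^sup>*\<^sup>* lo (level c a)" by blast
 obtain \<kappa>0 where \<kappa>0: "\<kappa>0 > 0" "\<And>\<kappa>. 0 < \<kappa> \<Longrightarrow> \<kappa> < \<kappa>0 \<Longrightarrow> dom \<kappa> a"
  using upper_end_order[OF ord_gh(2) order_refl ab] by blast
 define c where "c = min \<kappa>0 \<kappa>1 / 2"
 have c: "0 < c" "c < \<kappa>1" "dom c a" using \<kappa>0 \<kappa>1(1) by (auto simp: c_def min_def)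
 have "good_slice g (level c a) hi" by (rule sub_point_slice)
    (use dhi sig_dom[OF c(3)] ordg_sig_pw[OF c(3)] ordg_ends in \<open>auto elim: eventually_mono\<close>)
 then show ?thesis using \<kappa>1(2)[OF c(1,2)] by (rule rtranclp.rtrancl_into_rtrancl[rotated])
qed

end

text \<open>Continuity only gives weak inequalities at the ends; two interior points p < q supply
  the strict one.\<close>

lemma incr_on_closed:
 fixes f :: "real \<Rightarrow> real"
 assumes cont: "continuous_on {a..b} f" and inc: "incr_on f a b" and s: "a \<le> s" "s < s'" "s' \<le> b"
 shows "f s < f s'"
proof -
 define p where "p = (2 * s + s') / 3"
 define q where "q = (s + 2 * s') / 3"
 have pq: "s < p" "p < q" "q < s'" using s by (simp_all add: p_def q_def)
 have "f s \<le> f p"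
 proof (rule continuous_le_on_closure[of "{s<..<p}" f])
  show "continuous_on (closure {s<..<p}) f" using pq s by (auto intro: continuous_on_subset[OF cont])
  show "s \<in> closure {s<..<p}" using pq by simp
  show "f x \<le> f p" if "x \<in> {s<..<p}" for x
  proof -
   have "f x < f p" using inc that pq s unfolding incr_on_def by auto
   then show ?thesis by simp
  qed
 qed
 moreover have "f p < f q" using inc pq s unfolding incr_on_def by auto
 moreover have "f q \<le> f s'"
 proof (rule continuous_ge_on_closure[of "{q<..<s'}" f])
  show "continuous_on (closure {q<..<s'}) f" using pq s by (auto intro: continuous_on_subset[OF cont])
  show "s' \<in> closure {q<..<s'}" using pq by simp
  show "f q \<le> f x" if "x \<in> {q<..<s'}" for x
  proof -
   have "f q < f x" using inc that pq s unfolding incr_on_def by auto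
   then show ?thesis by simp
  qed
 qed
 ultimately show ?thesis by simp
qed

lemma const_on_closed:
 fixes f :: "real \<Rightarrow> real"
 assumes cont: "continuous_on {a..b} f" and "const_on f a b" "a < b" "s \<in> {a..b}"
 shows "f s = f ((a + b) / 2)"
proof (rule continuous_constant_on_closure[of "{a<..<b}" f])
 show "continuous_on (closure {a<..<b}) f" using assms by simp
 show "s \<in> closure {a<..<b}" using assms by simp
 show "f x = f ((a + b) / 2)" if "x \<in> {a<..<b}" for x
 proof -
  have m: "a < (a + b) / 2" "(a + b) / 2 < b" using assms(3) by simp_all
  show ?thesis using assms(2) that m unfolding const_on_def
   by (metis greaterThanLessThan_iff linorder_neq_iff)
 qed
qed

section \<open>Reflection of slopes and the chain of slices across a sector\<close>

context polynomially_bounded_ominimal_structure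
begin

definition neg :: "(real \<Rightarrow> real) \<Rightarrow> real \<Rightarrow> real" where "neg s t = - s t"

lemma neg_neg [simp]: "neg (neg s) = s"
 by (simp add: neg_def fun_eq_iff)

lemma dneg: "dfun1 (neg s) \<longleftrightarrow> dfun1 s"
proof -
 have "dfun1 (neg s)" if "dfun1 s" for s unfolding dfun1_def neg_def by (intro dint dfun1_app[OF that])
 then show ?thesis using neg_neg by metis
qed

text \<open>Reflecting the slopes makes a decreasing piece increasing, so that
  \<open>increasing_chain\<close> covers both kinds; the ends of the piece are interchanged.\<close>

definition flip :: "(real \<Rightarrow> real \<Rightarrow> real) \<Rightarrow> real \<Rightarrow> real \<Rightarrow> real" where "flip g t s = g t (- s)"

lemma inS_neg: "inS (neg y) (neg x) s \<longleftrightarrow> inS x y (neg s)"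
 by (simp add: inS_def dneg) (simp add: neg_def minus_le_iff le_minus_iff conj_commute)

lemma ordg_flip: "ordg (flip g) s = ordg g (neg s)"
 by (simp add: ordg_def flip_def neg_def)

lemma Qs_flip: "Qs (flip g) (neg y) (neg x) = Qs g x y"
proof (intro subset_antisym subsetI)
 fix w assume "w \<in> Qs (flip g) (neg y) (neg x)"
 then show "w \<in> Qs g x y" unfolding Qs_def ordg_flip inS_neg by blast
next
 fix w assume "w \<in> Qs g x y"
 then obtain s where s: "w = ordg g s" "inS x y s" unfolding Qs_def by blast
 have "w = ordg g (neg (neg s))" "inS x y (neg (neg s))" using s by simp_all
 then show "w \<in> Qs (flip g) (neg y) (neg x)" unfolding Qs_def ordg_flip inS_neg by blast
qed

lemma width_flip: "width (flip g) (neg y) (neg x) s = width g x y (neg s)"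
proof -
 have "{1 + ord_diff s1 s2 | s1 s2. inS (neg y) (neg x) s1 \<and> inS (neg y) (neg x) s2 \<and>
    (EV t. s1 t < s2 t) \<and> inS s1 s2 s \<and> (\<exists>q. Qs (flip g) s1 s2 = {q})} =
   {1 + ord_diff s1 s2 | s1 s2. inS x y s1 \<and> inS x y s2 \<and>
    (EV t. s1 t < s2 t) \<and> inS s1 s2 (neg s) \<and> (\<exists>q. Qs g s1 s2 = {q})}" (is "?A = ?B")
 proof (intro subset_antisym subsetI)
  fix w assume "w \<in> ?A"
  then obtain s1 s2 q where w: "w = 1 + ord_diff s1 s2" "inS (neg y) (neg x) s1" "inS (neg y) (neg x) s2"
    "EV t. s1 t < s2 t" "inS s1 s2 s" "Qs (flip g) s1 s2 = {q}" by blast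
  have "w = 1 + order_at_0 (\<lambda>t. neg s1 t - neg s2 t)" using w(1) by (simp add: neg_def)
  moreover have "inS x y (neg s1)" "inS x y (neg s2)" "EV t. neg s2 t < neg s1 t" using w(2-4) by (simp_all add: inS_neg) (simp add: neg_def)
  moreover have "inS (neg s2) (neg s1) (neg s)" using w(5) by (simp add: inS_neg)
  moreover have "Qs g (neg s2) (neg s1) = {q}" using w(6) Qs_flip[of g "neg s1" "neg s2"] by simp
  ultimately show "w \<in> ?B" by blast
 next
  fix w assume "w \<in> ?B"
  then obtain s1 s2 q where w: "w = 1 + ord_diff s1 s2" "inS x y s1" "inS x y s2"
    "EV t. s1 t < s2 t" "inS s1 s2 (neg s)" "Qs g s1 s2 = {q}" by blast
  have "w = 1 + order_at_0 (\<lambda>t. neg s1 t - neg s2 t)" using w(1) by (simp add: neg_def)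
  moreover have "inS (neg y) (neg x) (neg s1)" "inS (neg y) (neg x) (neg s2)" "EV t. neg s2 t < neg s1 t"
   using w(2-4) by (simp_all add: inS_neg) (simp add: neg_def)
  moreover have "inS (neg s2) (neg s1) s" using w(5) by (simp add: inS_neg)
  moreover have "Qs (flip g) (neg s2) (neg s1) = {q}" using w(6) Qs_flip[of g s2 s1] by simp
  ultimately show "w \<in> ?A" by blast
 qed
 then show ?thesis by (simp add: width_def)
qed

lemma good_slice_flip:
 assumes "good_slice (flip g) x y" shows "good_slice g (neg y) (neg x)"
proof -
 have a: "dfun1 x" "dfun1 y" "EV t. x t < y t"
  and el: "\<And>s1 s s2. inS x y s1 \<Longrightarrow> inS x y s2 \<Longrightarrow> inS s1 s2 s \<Longrightarrow> ordg (flip g) s1 = ordg (flip g) s2 \<Longrightarrow> ordg (flip g) s = ordg (flip g) s1"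
  and sg: "(EV t. \<forall>s. x t < s \<longrightarrow> s < y t \<longrightarrow> flip g t s = 0) \<or> (EV t. \<forall>s. x t < s \<longrightarrow> s < y t \<longrightarrow> flip g t s \<noteq> 0)"
  and Q: "Qs (flip g) x y = seg (ordg (flip g) x) (ordg (flip g) y)"
  using assms unfolding good_slice_def by blast+
 obtain \<mu> where \<mu>: "affine_width S (Qs (flip g) x y) \<mu>"
  "min (\<mu> (ordg (flip g) x)) (\<mu> (ordg (flip g) y)) = 1 + ord_diff x y"
  "\<And>s. inS x y s \<Longrightarrow> width (flip g) x y s = \<mu> (ordg (flip g) s)"
  using assms unfolding good_slice_def by blast
 have Qf: "Qs (flip g) x y = Qs g (neg y) (neg x)" using Qs_flip[of g "neg x" "neg y"] by simp
 have flipped: "(\<forall>s. - y t < s \<longrightarrow> s < - x t \<longrightarrow> P (g t s)) \<longleftrightarrow> (\<forall>s. x t < s \<longrightarrow> s < y t \<longrightarrow> P (flip g t s))" for t P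
  unfolding flip_def by (metis minus_less_iff less_minus_iff minus_minus)
 show ?thesis unfolding good_slice_def
 proof (intro conjI allI impI)
  show "dfun1 (neg y)" "dfun1 (neg x)" "EV t. neg y t < neg x t" using a by (simp_all add: dneg) (simp add: neg_def)
  show "ordg g s = ordg g s1" if "inS (neg y) (neg x) s1" "inS (neg y) (neg x) s2" "inS s1 s2 s" "ordg g s1 = ordg g s2" for s1 s s2
   using el[of "neg s2" "neg s1" "neg s"] that by (simp add: ordg_flip inS_neg)
  show "(EV t. \<forall>s. neg y t < s \<longrightarrow> s < neg x t \<longrightarrow> g t s = 0) \<or> (EV t. \<forall>s. neg y t < s \<longrightarrow> s < neg x t \<longrightarrow> g t s \<noteq> 0)"
   using sg unfolding neg_def flipped[of _ "\<lambda>z. z = 0"] flipped[of _ "\<lambda>z. z \<noteq> 0"] .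
  show "Qs g (neg y) (neg x) = seg (ordg g (neg y)) (ordg g (neg x))"
   using Q unfolding Qf ordg_flip seg_def by (simp add: min.commute max.commute)
  have "width g (neg y) (neg x) s = \<mu> (ordg g s)" if "inS (neg y) (neg x) s" for s
   using \<mu>(3)[of "neg s"] that width_flip[of g "neg x" "neg y" "neg s"] by (simp add: inS_neg ordg_flip)
  moreover have "order_at_0 (\<lambda>t. neg x t - neg y t) = ord_diff x y" by (simp add: neg_def)
  ultimately show "\<exists>\<mu>. affine_width S (Qs g (neg y) (neg x)) \<mu> \<and>
    min (\<mu> (ordg g (neg y))) (\<mu> (ordg g (neg x))) = 1 + order_at_0 (\<lambda>t. neg x t - neg y t) \<and>
    (\<forall>s. inS (neg y) (neg x) s \<longrightarrow> width g (neg y) (neg x) s = \<mu> (ordg g s))"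
   using \<mu>(1,2) unfolding Qf ordg_flip by (intro exI[of _ \<mu>]) (simp add: min.commute)
 qed
qed

lemma good_chain_flip: "(good_slice (flip g))\<^sup>*\<^sup>* x y \<Longrightarrow> (good_slice g)\<^sup>*\<^sup>* (neg y) (neg x)"
proof (induction rule: rtranclp_induct)
 case (step y z)
 then show ?case using good_slice_flip[OF step.hyps(2)] by (meson converse_rtranclp_into_rtranclp)
qed simp

lemma piece_chain:
 assumes g: "dfun2 g" and p: "mono_piece g x y" and bd: "EV t. - 1 \<le> x t \<and> y t \<le> 1"
  and cont: "EV t. continuous_on {-1..1} (g t)" and nn: "EV t. \<forall>s. 0 \<le> g t s"
  and small: "\<And>s. inS (\<lambda>t. -1) (\<lambda>t. 1) s \<Longrightarrow> 0 < ordg g s"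
 shows "(good_slice g)\<^sup>*\<^sup>* x y"
proof -
 have xy: "dfun1 x" "dfun1 y" "EV t. x t < y t" using p by (simp_all add: mono_piece_def)
 have c: "EV t. continuous_on {x t..y t} (g t)"
  using cont bd by eventually_elim (auto elim: continuous_on_subset)
 have i: "inS (\<lambda>t. -1) (\<lambda>t. 1) x" "inS (\<lambda>t. -1) (\<lambda>t. 1) y"
 proof -
  have "EV t. -1 \<le> x t \<and> x t \<le> 1" "EV t. -1 \<le> y t \<and> y t \<le> 1" using bd xy(3) by (eventually_elim, simp)+
  then show "inS (\<lambda>t. -1) (\<lambda>t. 1) x" "inS (\<lambda>t. -1) (\<lambda>t. 1) y" using xy unfolding inS_def by blast+
 qed
 consider "EV t. incr_on (g t) (x t) (y t)" | "EV t. incr_on (\<lambda>s. - g t s) (x t) (y t)" | "EV t. const_on (g t) (x t) (y t)"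
  using p by (auto simp: mono_piece_def) then show ?thesis
 proof cases
  case 1
  have "EV t. \<forall>s s'. x t \<le> s \<longrightarrow> s < s' \<longrightarrow> s' \<le> y t \<longrightarrow> g t s < g t s'"
   using 1 c by eventually_elim (auto intro: incr_on_closed)
  moreover have "EV t. 0 \<le> g t (x t)" using nn by eventually_elim blast
  ultimately interpret increasing_slice S g x y
   using g xy c small[OF i(2)] unfolding ordg_def by unfold_locales
  show ?thesis by (rule increasing_chain)
 next
  case 2
  have fg: "dfun2 (flip g)" unfolding dfun2_def flip_def by (intro dint dfun2_app[OF g])
  have fc: "EV t. continuous_on {neg y t..neg x t} (flip g t)" using c
  proof eventually_elim
   case (elim t)
   show ?case
    unfolding flip_def by (rule continuous_on_compose2[OF elim]) (auto simp: neg_def intro!: continuous_intros)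
  qed
  have "EV t. \<forall>s s'. neg y t \<le> s \<longrightarrow> s < s' \<longrightarrow> s' \<le> neg x t \<longrightarrow> flip g t s < flip g t s'" using 2 c
  proof eventually_elim
   case (elim t)
   have "- g t s < - g t s'" if "x t \<le> s" "s < s'" "s' \<le> y t" for s s'
    by (rule incr_on_closed[OF _ elim(1) that]) (intro continuous_intros elim)
   then show ?case by (auto simp: flip_def neg_def)
  qed
  moreover have "0 < ordg (flip g) (neg x)" using small[OF i(1)] by (simp add: ordg_flip)
  moreover have "EV t. neg y t < neg x t" using xy(3) by (simp add: neg_def)
  moreover have "EV t. 0 \<le> flip g t (neg y t)" using nn unfolding flip_def by eventually_elim blast
  ultimately interpret increasing_slice S "flip g" "neg y" "neg x"
   using fg fc dneg[THEN iffD2, OF xy(1)] dneg[THEN iffD2, OF xy(2)] unfolding ordg_def by unfold_locales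
  show ?thesis using good_chain_flip[OF increasing_chain] by simp
 next
  case 3
  have cc: "EV t. \<forall>s. x t \<le> s \<longrightarrow> s \<le> y t \<longrightarrow> g t s = g t ((x t + y t) / 2)"
   using 3 c xy(3) by eventually_elim (auto intro: const_on_closed)
  have m: "dterm (\<lambda>e. (x (e 0) + y (e 0)) / 2)" by (intro dint dfun1_app[OF xy(1)] dfun1_app[OF xy(2)])
  have d: "drel1 (\<lambda>t. g t ((x t + y t) / 2) = 0)"
   unfolding drel1_def by (rule dpred_eq[OF dfun2_app[OF g dterm_var m] dterm_const])
  have "good_slice g x y"
  proof (rule point_slice[OF g xy])
   show "wmono g x y" unfolding wmono_def using cc nn
   proof eventually_elim
    case (elim t)
    show ?case
    proof (intro allI impI)
     fix s s' assume "x t \<le> s" "s \<le> s'" "s' \<le> y t"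
     then have "g t s = g t ((x t + y t) / 2)" "g t s' = g t ((x t + y t) / 2)"
      using elim(1)[rule_format, of s] elim(1)[rule_format, of s'] by linarith+
     then show "0 \<le> g t s \<and> g t s \<le> g t s'" using elim(2)[rule_format, of s] by simp
    qed
   qed
   show "ordg g x = ordg g y"
    unfolding ordg_def by (rule order_cong) (use cc xy(3) in eventually_elim, metis less_imp_le order_refl)
   show "0 < ordg g y" by (rule small[OF i(2)])
   show "sign_definite g x y" using ev_dichotomy_right[OF d, of 0]
   proof
    assume "EV t. g t ((x t + y t) / 2) = 0"
    then have "EV t. \<forall>s. x t < s \<longrightarrow> s < y t \<longrightarrow> g t s = 0" using cc by eventually_elim (metis less_imp_le)
    then show ?thesis ..
   next
    assume "EV t. g t ((x t + y t) / 2) \<noteq> 0"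
    then have "EV t. \<forall>s. x t < s \<longrightarrow> s < y t \<longrightarrow> g t s \<noteq> 0" using cc by eventually_elim (metis less_imp_le)
    then show ?thesis ..
   qed
  qed
  then show ?thesis by (rule r_into_rtranclp[of "good_slice g"])
 qed
qed

lemma pieces_chain:
 assumes g: "dfun2 g" and cont: "EV t. continuous_on {-1..1} (g t)" and nn: "EV t. \<forall>s. 0 \<le> g t s"
  and small: "\<And>s. inS (\<lambda>t. -1) (\<lambda>t. 1) s \<Longrightarrow> 0 < ordg g s"
  and "(mono_piece g)\<^sup>+\<^sup>+ x y" "EV t. -1 \<le> x t" "EV t. y t \<le> 1"
 shows "(good_slice g)\<^sup>*\<^sup>* x y"
proof -
 have piece: "(good_slice g)\<^sup>*\<^sup>* u v" if "mono_piece g u v" "EV t. -1 \<le> u t" "EV t. v t \<le> 1" for u v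
  by (rule piece_chain[OF g that(1) eventually_conj[OF that(2,3)] cont nn small])
 have "(EV t. x t < y t) \<and> ((EV t. y t \<le> 1) \<longrightarrow> (good_slice g)\<^sup>*\<^sup>* x y)" using assms(5)
 proof (induction rule: tranclp_induct)
  case (base y)
  then show ?case using piece assms(6) by (simp add: mono_piece_def)
 next
  case (step y z)
  have yz: "EV t. y t < z t" using step.hyps(2) by (simp add: mono_piece_def)
  have xy: "EV t. x t < y t" using step.IH by blast
  have "(good_slice g)\<^sup>*\<^sup>* x z" if z: "EV t. z t \<le> 1"
  proof -
   have "EV t. y t \<le> 1" using yz z by eventually_elim simp
   then have 1: "(good_slice g)\<^sup>*\<^sup>* x y" using step.IH by blast
   have "EV t. -1 \<le> y t" using xy assms(6) by eventually_elim simp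
   then have "(good_slice g)\<^sup>*\<^sup>* y z" by (rule piece[OF step.hyps(2) _ z])
   with 1 show ?thesis by (rule rtranclp_trans)
  qed
  moreover have "EV t. x t < z t" using xy yz by eventually_elim simp
  ultimately show ?case by blast
 qed
 then show ?thesis using assms(7) by blast
qed

theorem sector_chain:
 assumes g: "dfun2 g" and cont: "EV t. continuous_on {-1..1} (g t)" and nn: "EV t. \<forall>s. 0 \<le> g t s"
  and small: "\<And>s. inS (\<lambda>t. -1) (\<lambda>t. 1) s \<Longrightarrow> 0 < ordg g s"
 shows "(good_slice g)\<^sup>*\<^sup>* (\<lambda>t. -1) (\<lambda>t. 1)"
proof -
 have dc: "dfun1 (\<lambda>t. k)" for k unfolding dfun1_def by (intro dint)
 have c: "EV t. continuous_on {-1<..<1} (g t)"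
  using cont by eventually_elim (erule continuous_on_subset, auto)
 have "(mono_piece g)\<^sup>+\<^sup>+ (\<lambda>t. -1) (\<lambda>t. 1)" by (rule mono_piece_chain[OF g dc dc _ c, of 1]) simp_all
 from pieces_chain[OF g cont nn small this] show ?thesis by simp
qed

end

section \<open>Wedges in the plane\<close>

definition pol :: "real \<Rightarrow> real \<Rightarrow> real \<times> real" where
 "pol \<rho> \<theta> = (\<rho> * cos \<theta>, \<rho> * sin \<theta>)"

lemma norm_pol [simp]: "norm (pol \<rho> \<theta>) = \<bar>\<rho>\<bar>"
proof -
 have "(\<rho> * cos \<theta>)\<^sup>2 + (\<rho> * sin \<theta>)\<^sup>2 = \<rho>\<^sup>2 * ((sin \<theta>)\<^sup>2 + (cos \<theta>)\<^sup>2)"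
  by (simp only: power_mult_distrib ring_distribs add.commute)
 then show ?thesis by (simp add: pol_def norm_Pair)
qed

lemma pol_0 [simp]: "pol 0 \<theta> = 0"
 by (simp add: pol_def zero_prod_def)

lemma pol_2pi [simp]: "pol \<rho> (\<theta> + 2 * pi) = pol \<rho> \<theta>"
 by (simp add: pol_def)

lemma continuous_on_pol [continuous_intros]:
 fixes f g :: "'a :: t2_space \<Rightarrow> real"
 shows "continuous_on A f \<Longrightarrow> continuous_on A g \<Longrightarrow> continuous_on A (\<lambda>x. pol (f x) (g x))"
 unfolding pol_def by (intro continuous_on_Pair continuous_on_mult continuous_on_cos continuous_on_sin)

lemma pol_inj:
 assumes "0 < \<rho>" "pol \<rho> \<theta> = pol \<rho> \<theta>'" "\<bar>\<theta> - \<theta>'\<bar> < 2 * pi" shows "\<theta> = \<theta>'"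
using assms(1,2) sin_cos_eq_iff[of \<theta> \<theta>'] assms(3) by (auto simp: pol_def abs_mult)

lemma pol_cases:
 obtains \<theta> where "a \<le> \<theta>" "\<theta> < a + 2 * pi" "x = pol (norm x) \<theta>"
proof -
 define z where "z = Complex (fst x) (snd x)"
 define n where "n = \<lfloor>(Arg z - a) / (2 * pi)\<rfloor>"
 have "norm x = cmod z" by (simp add: z_def norm_prod_def cmod_def)
 moreover have "rcis (cmod z) (Arg z) = z" by (rule rcis_cmod_Arg)
 ultimately have 1: "x = pol (norm x) (Arg z)"
  by (simp add: z_def pol_def rcis_def complex_eq_iff prod_eq_iff)
 have "cos (Arg z - 2 * pi * n) = cos (Arg z)" "sin (Arg z - 2 * pi * n) = sin (Arg z)"
  by (simp_all add: cos_diff sin_diff)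
 with 1 have "x = pol (norm x) (Arg z - 2 * pi * n)" by (simp add: pol_def)
 moreover have "of_int n \<le> (Arg z - a) / (2 * pi)" "(Arg z - a) / (2 * pi) < of_int n + 1"
  by (simp_all add: n_def)
 then have "a \<le> Arg z - 2 * pi * n" "Arg z - 2 * pi * n < a + 2 * pi" by (simp_all add: field_simps)
 ultimately show thesis using that by blast
qed

text \<open>The bounds are real-valued lifts of angles, so that intervals of angles make sense;
  shifting both lifts by 2 * pi gives the same wedge.\<close>

definition OW :: "(real \<Rightarrow> real) \<Rightarrow> (real \<Rightarrow> real) \<Rightarrow> (real \<times> real) set" where
 "OW \<alpha> \<beta> = {pol \<rho> \<theta> | \<rho> \<theta>. 0 < \<rho> \<and> \<alpha> \<rho> < \<theta> \<and> \<theta> < \<beta> \<rho>}"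

definition CW :: "(real \<Rightarrow> real) \<Rightarrow> (real \<Rightarrow> real) \<Rightarrow> (real \<times> real) set" where
 "CW \<alpha> \<beta> = insert 0 {pol \<rho> \<theta> | \<rho> \<theta>. 0 < \<rho> \<and> \<alpha> \<rho> \<le> \<theta> \<and> \<theta> \<le> \<beta> \<rho>}"

lemma pol_eq_pos: "pol \<rho> \<theta> = pol \<rho>' \<theta>' \<Longrightarrow> 0 < \<rho> \<Longrightarrow> 0 < \<rho>' \<Longrightarrow> \<rho> = \<rho>'"
 by (metis abs_of_pos norm_pol)

lemma pol_in_CW: "0 < \<rho> \<Longrightarrow> pol \<rho> \<theta> \<in> CW \<alpha> \<beta> \<longleftrightarrow> (\<exists>\<theta>'. pol \<rho> \<theta> = pol \<rho> \<theta>' \<and> \<alpha> \<rho> \<le> \<theta>' \<and> \<theta>' \<le> \<beta> \<rho>)"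
proof -
 assume \<rho>: "0 < \<rho>"
 then have "pol \<rho> \<theta> \<noteq> 0" using norm_pol[of \<rho> \<theta>] by (metis abs_of_pos less_irrefl norm_zero)
 then show ?thesis using \<rho> unfolding CW_def by (auto dest: pol_eq_pos)
qed

lemma pol_in_OW: "0 < \<rho> \<Longrightarrow> pol \<rho> \<theta> \<in> OW \<alpha> \<beta> \<longleftrightarrow> (\<exists>\<theta>'. pol \<rho> \<theta> = pol \<rho> \<theta>' \<and> \<alpha> \<rho> < \<theta>' \<and> \<theta>' < \<beta> \<rho>)"
 unfolding OW_def by (auto dest: pol_eq_pos)

lemma pol_in_OW_I: "0 < \<rho> \<Longrightarrow> \<alpha> \<rho> < \<theta> \<Longrightarrow> \<theta> < \<beta> \<rho> \<Longrightarrow> pol \<rho> \<theta> \<in> OW \<alpha> \<beta>"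
 unfolding OW_def by blast

lemma pol_in_CW_I: "0 < \<rho> \<Longrightarrow> \<alpha> \<rho> \<le> \<theta> \<Longrightarrow> \<theta> \<le> \<beta> \<rho> \<Longrightarrow> pol \<rho> \<theta> \<in> CW \<alpha> \<beta>"
 unfolding CW_def by blast

text \<open>An angular width strictly between 0 and 2 * pi makes \<open>pol\<close> injective on the
  open wedge, and it makes the opposite side a wedge again, with bounds \<beta> and \<alpha> + 2 *
  pi.\<close>

locale wedge =
 fixes e :: real and \<alpha> \<beta> :: "real \<Rightarrow> real"
 assumes e: "0 < e" and contA: "continuous_on {0<..<e} \<alpha>" and contB: "continuous_on {0<..<e} \<beta>"
  and lt: "\<And>\<rho>. 0 < \<rho> \<Longrightarrow> \<rho> < e \<Longrightarrow> \<alpha> \<rho> < \<beta> \<rho> \<and> \<beta> \<rho> < \<alpha> \<rho> + 2 * pi"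
begin

lemma co_wedge: "wedge e \<beta> (\<lambda>\<rho>. \<alpha> \<rho> + 2 * pi)"
 using e contA contB lt by unfold_locales (auto intro!: continuous_intros)

lemma in_CW_iff:
 assumes "0 < \<rho>" "\<rho> < e" "\<alpha> \<rho> \<le> \<theta>" "\<theta> < \<alpha> \<rho> + 2 * pi" shows "pol \<rho> \<theta> \<in> CW \<alpha> \<beta> \<longleftrightarrow> \<theta> \<le> \<beta> \<rho>"
proof
 assume "pol \<rho> \<theta> \<in> CW \<alpha> \<beta>"
 then obtain \<theta>' where "pol \<rho> \<theta> = pol \<rho> \<theta>'" "\<alpha> \<rho> \<le> \<theta>'" "\<theta>' \<le> \<beta> \<rho>" using pol_in_CW[OF assms(1)] by auto
 moreover from this have "\<bar>\<theta> - \<theta>'\<bar> < 2 * pi" using lt[OF assms(1,2)] assms(3,4) by linarith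
 ultimately show "\<theta> \<le> \<beta> \<rho>" using pol_inj[OF assms(1), of \<theta> \<theta>'] by simp
qed (use assms pol_in_CW_I in auto)

lemma in_OW_iff:
 assumes "0 < \<rho>" "\<rho> < e" "\<alpha> \<rho> \<le> \<theta>" "\<theta> < \<alpha> \<rho> + 2 * pi" shows "pol \<rho> \<theta> \<in> OW \<alpha> \<beta> \<longleftrightarrow> \<alpha> \<rho> < \<theta> \<and> \<theta> < \<beta> \<rho>"
proof
 assume "pol \<rho> \<theta> \<in> OW \<alpha> \<beta>"
 then obtain \<theta>' where "pol \<rho> \<theta> = pol \<rho> \<theta>'" "\<alpha> \<rho> < \<theta>'" "\<theta>' < \<beta> \<rho>" using pol_in_OW[OF assms(1)] by auto
 moreover from this have "\<bar>\<theta> - \<theta>'\<bar> < 2 * pi" using lt[OF assms(1,2)] assms(3,4) by linarith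
 ultimately show "\<alpha> \<rho> < \<theta> \<and> \<theta> < \<beta> \<rho>" using pol_inj[OF assms(1), of \<theta> \<theta>'] by simp
qed (use assms pol_in_OW_I in auto)

lemma in_coOW_iff:
 assumes "0 < \<rho>" "\<rho> < e" "\<alpha> \<rho> \<le> \<theta>" "\<theta> < \<alpha> \<rho> + 2 * pi" shows "pol \<rho> \<theta> \<in> OW \<beta> (\<lambda>\<rho>. \<alpha> \<rho> + 2 * pi) \<longleftrightarrow> \<beta> \<rho> < \<theta>"
proof
 assume "pol \<rho> \<theta> \<in> OW \<beta> (\<lambda>\<rho>. \<alpha> \<rho> + 2 * pi)"
 then obtain \<theta>' where "pol \<rho> \<theta> = pol \<rho> \<theta>'" "\<beta> \<rho> < \<theta>'" "\<theta>' < \<alpha> \<rho> + 2 * pi" using pol_in_OW[OF assms(1)] by auto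
 moreover from this have "\<bar>\<theta> - \<theta>'\<bar> < 2 * pi" using lt[OF assms(1,2)] assms(3,4) by linarith
 ultimately show "\<beta> \<rho> < \<theta>" using pol_inj[OF assms(1), of \<theta> \<theta>'] by simp
qed (use assms pol_in_OW_I in auto)

lemma point_cases:
 assumes "norm x < e" "x \<noteq> 0"
 obtains \<rho> \<theta> where "0 < \<rho>" "\<rho> < e" "norm x = \<rho>" "x = pol \<rho> \<theta>" "\<alpha> \<rho> \<le> \<theta>" "\<theta> < \<alpha> \<rho> + 2 * pi"
 using pol_cases[of "\<alpha> (norm x)" x] assms by (metis zero_less_norm_iff)

lemma zero_notin_OW: "0 \<notin> OW \<alpha> \<beta>"
 unfolding OW_def by (smt (verit) mem_Collect_eq norm_pol norm_zero)

text \<open>Every nonzero point near 0 has an angle in [\<alpha>, \<alpha> + 2 * pi), and \<beta>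
  separates the closed wedge from the opposite open one. Closures and interiors are computed from
  this complementarity.\<close>

lemma CW_iff_coOW:
 assumes "norm x < e" shows "x \<in> CW \<alpha> \<beta> \<longleftrightarrow> x \<notin> OW \<beta> (\<lambda>\<rho>. \<alpha> \<rho> + 2 * pi)"
proof (cases "x = 0")
 case True
 interpret co: wedge e \<beta> "\<lambda>\<rho>. \<alpha> \<rho> + 2 * pi" by (rule co_wedge)
 show ?thesis using True co.zero_notin_OW by (simp add: CW_def)
next
 case False
 then obtain \<rho> \<theta> where p: "0 < \<rho>" "\<rho> < e" "norm x = \<rho>" "x = pol \<rho> \<theta>" "\<alpha> \<rho> \<le> \<theta>" "\<theta> < \<alpha> \<rho> + 2 * pi"
  using point_cases[OF assms] by metis
 show ?thesis using in_CW_iff[OF p(1,2,5,6)] in_coOW_iff[OF p(1,2,5,6)] p(4) by auto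
qed

lemma OW_disjoint: "norm x < e \<Longrightarrow> x \<in> OW \<alpha> \<beta> \<Longrightarrow> x \<notin> OW \<beta> (\<lambda>\<rho>. \<alpha> \<rho> + 2 * pi)"
proof -
 assume x: "norm x < e" "x \<in> OW \<alpha> \<beta>"
 have "OW \<alpha> \<beta> \<subseteq> CW \<alpha> \<beta>" unfolding OW_def CW_def using less_imp_le by blast
 then show ?thesis using CW_iff_coOW[OF x(1)] x(2) by blast
qed

lemma image_OW:
 assumes "r \<le> e"
 shows "OW \<alpha> \<beta> \<inter> ball 0 r = (\<lambda>(\<rho>, u). pol \<rho> (\<alpha> \<rho> + u * (\<beta> \<rho> - \<alpha> \<rho>))) ` ({0<..<r} \<times> {0<..<1})"
proof (intro subset_antisym subsetI)
 fix x assume "x \<in> OW \<alpha> \<beta> \<inter> ball 0 r"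
 then obtain \<rho> \<theta> where p: "x = pol \<rho> \<theta>" "0 < \<rho>" "\<rho> < r" "\<alpha> \<rho> < \<theta>" "\<theta> < \<beta> \<rho>" by (auto simp: OW_def)
 define u where "u = (\<theta> - \<alpha> \<rho>) / (\<beta> \<rho> - \<alpha> \<rho>)"
 have "\<alpha> \<rho> + u * (\<beta> \<rho> - \<alpha> \<rho>) = \<theta>" "0 < u" "u < 1" using p by (auto simp: u_def field_simps)
 then show "x \<in> (\<lambda>(\<rho>, u). pol \<rho> (\<alpha> \<rho> + u * (\<beta> \<rho> - \<alpha> \<rho>))) ` ({0<..<r} \<times> {0<..<1})"
  using p by (intro image_eqI[of _ _ "(\<rho>, u)"]) auto
next
 fix x assume "x \<in> (\<lambda>(\<rho>, u). pol \<rho> (\<alpha> \<rho> + u * (\<beta> \<rho> - \<alpha> \<rho>))) ` ({0<..<r} \<times> {0<..<1})"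
 then obtain \<rho> u where p: "x = pol \<rho> (\<alpha> \<rho> + u * (\<beta> \<rho> - \<alpha> \<rho>))" "0 < \<rho>" "\<rho> < r" "0 < u" "u < 1" by auto
 have d: "0 < \<beta> \<rho> - \<alpha> \<rho>" using lt[of \<rho>] p assms by auto
 have "0 < u * (\<beta> \<rho> - \<alpha> \<rho>)" using p d by simp
 moreover have "u * (\<beta> \<rho> - \<alpha> \<rho>) < 1 * (\<beta> \<rho> - \<alpha> \<rho>)" using p d by (intro mult_strict_right_mono)
 ultimately have "\<alpha> \<rho> < \<alpha> \<rho> + u * (\<beta> \<rho> - \<alpha> \<rho>)" "\<alpha> \<rho> + u * (\<beta> \<rho> - \<alpha> \<rho>) < \<beta> \<rho>" by auto
 with p(1,2) have "x \<in> OW \<alpha> \<beta>" by (simp add: pol_in_OW_I)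
 then show "x \<in> OW \<alpha> \<beta> \<inter> ball 0 r" using p by simp
qed

lemma connected_OW: assumes "r \<le> e" shows "connected (OW \<alpha> \<beta> \<inter> ball 0 r)"
 unfolding image_OW[OF assms]
proof (rule connected_continuous_image)
 have a: "continuous_on ({0<..<r} \<times> {0<..<1}) (\<lambda>z. \<alpha> (fst z))" "continuous_on ({0<..<r} \<times> {0<..<1}) (\<lambda>z. \<beta> (fst z))"
  using assms by (auto intro!: continuous_on_compose2[OF contA] continuous_on_compose2[OF contB] continuous_intros)
 show "continuous_on ({0<..<r} \<times> {0<..<1}) (\<lambda>(\<rho>, u). pol \<rho> (\<alpha> \<rho> + u * (\<beta> \<rho> - \<alpha> \<rho>)))"
  unfolding case_prod_beta by (intro continuous_intros a)
 show "connected ({0<..<r} \<times> {0<..<1::real})" by (intro convex_connected convex_Times) auto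
qed

lemma nonempty_OW: "r \<le> e \<Longrightarrow> 0 < r \<Longrightarrow> OW \<alpha> \<beta> \<inter> ball 0 r \<noteq> {}"
 unfolding image_OW by simp

text \<open>The wedge is the injective continuous image of an open set of polar coordinates, so
  invariance of domain applies.\<close>

lemma open_OW: assumes "r \<le> e" shows "open (OW \<alpha> \<beta> \<inter> ball 0 r)"
proof -
 define A where "A = {z. z \<in> {0<..<r} \<times> UNIV \<and> \<alpha> (fst z) < snd z \<and> snd z < \<beta> (fst z)}"
 have o: "open ({0<..<r} \<times> (UNIV :: real set))" by (intro open_Times) auto
 have a: "continuous_on ({0<..<r} \<times> UNIV) (\<lambda>z. \<alpha> (fst z))" "continuous_on ({0<..<r} \<times> UNIV) (\<lambda>z. \<beta> (fst z))"
  using assms by (auto intro!: continuous_on_compose2[OF contA] continuous_on_compose2[OF contB] continuous_intros)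
 have "open (({0<..<r} \<times> UNIV) \<inter> (\<lambda>z. min (snd z - \<alpha> (fst z)) (\<beta> (fst z) - snd z)) -` {0<..})"
  by (rule continuous_open_preimage[OF _ o]) (auto intro!: continuous_intros a)
 moreover have "({0<..<r} \<times> UNIV) \<inter> (\<lambda>z. min (snd z - \<alpha> (fst z)) (\<beta> (fst z) - snd z)) -` {0<..} = A"
  by (auto simp: A_def)
 ultimately have oA: "open A" by simp
 have "inj_on (\<lambda>z. pol (fst z) (snd z)) A"
 proof (rule inj_onI)
  fix z w assume z: "z \<in> A" "w \<in> A" "pol (fst z) (snd z) = pol (fst w) (snd w)"
  then have f: "fst z = fst w" by (auto simp: A_def dest: pol_eq_pos)
  have "\<beta> (fst w) < \<alpha> (fst w) + 2 * pi" using lt[of "fst w"] z(2) assms by (auto simp: A_def)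
  then have "\<bar>snd z - snd w\<bar> < 2 * pi" using z f by (auto simp: A_def)
  then have "snd z = snd w" using pol_inj[of "fst w" "snd z" "snd w"] z f by (auto simp: A_def)
  with f show "z = w" by (rule prod_eqI)
 qed
 then have "open ((\<lambda>z. pol (fst z) (snd z)) ` A)"
  by (rule invariance_of_domain[OF _ oA, rotated]) (intro continuous_intros)
 moreover have "(\<lambda>z. pol (fst z) (snd z)) ` A = OW \<alpha> \<beta> \<inter> ball 0 r"
 by (force simp: OW_def A_def pol_in_OW_I)
 ultimately show ?thesis by simp
qed

text \<open>The arcs enter as an unordered pair, because it is not known which of them comes first
  in angle.\<close>

lemma complement_arcs:
 assumes "r \<le> e" and \<gamma>: "\<And>\<rho>. 0 \<le> \<rho> \<Longrightarrow> \<rho> < e \<Longrightarrow> {\<gamma>1 \<rho>, \<gamma>2 \<rho>} = {pol \<rho> (\<alpha> \<rho>), pol \<rho> (\<beta> \<rho>)}"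
 shows "ball 0 r - (arc_image \<gamma>1 \<union> arc_image \<gamma>2) = (OW \<alpha> \<beta> \<inter> ball 0 r) \<union> (OW \<beta> (\<lambda>\<rho>. \<alpha> \<rho> + 2 * pi) \<inter> ball 0 r)"
proof -
 have "x \<notin> arc_image \<gamma>1 \<union> arc_image \<gamma>2 \<longleftrightarrow> x \<in> OW \<alpha> \<beta> \<or> x \<in> OW \<beta> (\<lambda>\<rho>. \<alpha> \<rho> + 2 * pi)" if x: "norm x < r" for x
 proof -
  have "x \<in> arc_image \<gamma>1 \<union> arc_image \<gamma>2 \<longleftrightarrow> x \<in> {\<gamma>1 (norm x), \<gamma>2 (norm x)}" by (auto simp: arc_image_def)
  also have "\<dots> \<longleftrightarrow> x \<in> {pol (norm x) (\<alpha> (norm x)), pol (norm x) (\<beta> (norm x))}" using \<gamma>[of "norm x"] x assms(1) by simp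
  finally have 1: "x \<in> arc_image \<gamma>1 \<union> arc_image \<gamma>2 \<longleftrightarrow> x \<in> {pol (norm x) (\<alpha> (norm x)), pol (norm x) (\<beta> (norm x))}" .
  show ?thesis
  proof (cases "x = 0")
   case True
   interpret co: wedge e \<beta> "\<lambda>\<rho>. \<alpha> \<rho> + 2 * pi" by (rule co_wedge)
   show ?thesis unfolding 1 using True zero_notin_OW co.zero_notin_OW by simp
  next
   case False
   then obtain \<rho> \<theta> where p: "0 < \<rho>" "\<rho> < e" "norm x = \<rho>" "x = pol \<rho> \<theta>" "\<alpha> \<rho> \<le> \<theta>" "\<theta> < \<alpha> \<rho> + 2 * pi"
    using point_cases[of x] x assms(1) by (metis less_le_trans)
   have "pol \<rho> \<theta> = pol \<rho> (\<alpha> \<rho>) \<longleftrightarrow> \<theta> = \<alpha> \<rho>" "pol \<rho> \<theta> = pol \<rho> (\<beta> \<rho>) \<longleftrightarrow> \<theta> = \<beta> \<rho>"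
    using pol_inj[OF p(1), of \<theta> "\<alpha> \<rho>"] pol_inj[OF p(1), of \<theta> "\<beta> \<rho>"] lt[OF p(1,2)] p(5,6) by auto
   then show ?thesis unfolding 1 unfolding p(3) unfolding p(4)
    using in_OW_iff[OF p(1,2,5,6)] in_coOW_iff[OF p(1,2,5,6)] p(5,6) lt[OF p(1,2)] by auto
  qed
 qed
 then show ?thesis by (intro set_eqI) (simp only: Diff_iff Int_iff Un_iff mem_ball_0, blast)
qed

lemma components_arcs:
 assumes r: "0 < r" "r \<le> e" and \<gamma>: "\<And>\<rho>. 0 \<le> \<rho> \<Longrightarrow> \<rho> < e \<Longrightarrow> {\<gamma>1 \<rho>, \<gamma>2 \<rho>} = {pol \<rho> (\<alpha> \<rho>), pol \<rho> (\<beta> \<rho>)}"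
 shows "components (ball 0 r - (arc_image \<gamma>1 \<union> arc_image \<gamma>2)) =
   {OW \<alpha> \<beta> \<inter> ball 0 r, OW \<beta> (\<lambda>\<rho>. \<alpha> \<rho> + 2 * pi) \<inter> ball 0 r}"
proof -
 interpret co: wedge e \<beta> "\<lambda>\<rho>. \<alpha> \<rho> + 2 * pi" by (rule co_wedge)
 have c: "ball 0 r - (arc_image \<gamma>1 \<union> arc_image \<gamma>2) = (OW \<alpha> \<beta> \<inter> ball 0 r) \<union> (OW \<beta> (\<lambda>\<rho>. \<alpha> \<rho> + 2 * pi) \<inter> ball 0 r)"
  by (rule complement_arcs[OF r(2) \<gamma>])
 show ?thesis unfolding c
 proof (rule components_open_unique)
  show "\<Union> {OW \<alpha> \<beta> \<inter> ball 0 r, OW \<beta> (\<lambda>\<rho>. \<alpha> \<rho> + 2 * pi) \<inter> ball 0 r} =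
    (OW \<alpha> \<beta> \<inter> ball 0 r) \<union> (OW \<beta> (\<lambda>\<rho>. \<alpha> \<rho> + 2 * pi) \<inter> ball 0 r)" by simp
  show "disjoint {OW \<alpha> \<beta> \<inter> ball 0 r, OW \<beta> (\<lambda>\<rho>. \<alpha> \<rho> + 2 * pi) \<inter> ball 0 r}"
   using OW_disjoint r by (auto simp: pairwise_def disjnt_iff)
 qed (use open_OW[OF r(2)] co.open_OW[OF r(2)] connected_OW[OF r(2)] co.connected_OW[OF r(2)]
   nonempty_OW[OF r(2,1)] co.nonempty_OW[OF r(2,1)] in blast)
qed

text \<open>The opposite wedge is open and disjoint from this one, so the closure cannot leave the
  closed wedge; conversely a boundary point is approached from inside along a circle around the
  origin.\<close>

lemma closure_OW:
 assumes r: "0 < r" "r \<le> e" shows "ball 0 r \<inter> closure (OW \<alpha> \<beta> \<inter> ball 0 r) = ball 0 r \<inter> CW \<alpha> \<beta>"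
proof (intro subset_antisym subsetI)
 interpret co: wedge e \<beta> "\<lambda>\<rho>. \<alpha> \<rho> + 2 * pi" by (rule co_wedge)
 fix x assume x: "x \<in> ball 0 r \<inter> closure (OW \<alpha> \<beta> \<inter> ball 0 r)"
 have "(OW \<beta> (\<lambda>\<rho>. \<alpha> \<rho> + 2 * pi) \<inter> ball 0 r) \<inter> (OW \<alpha> \<beta> \<inter> ball 0 r) = {}" using OW_disjoint r by auto
 then have "(OW \<beta> (\<lambda>\<rho>. \<alpha> \<rho> + 2 * pi) \<inter> ball 0 r) \<inter> closure (OW \<alpha> \<beta> \<inter> ball 0 r) = {}"
  using open_Int_closure_eq_empty[OF co.open_OW[OF r(2)]] by blast
 then show "x \<in> ball 0 r \<inter> CW \<alpha> \<beta>" using x CW_iff_coOW[of x] r by auto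
next
 fix x assume x: "x \<in> ball 0 r \<inter> CW \<alpha> \<beta>"
 have *: "pol \<rho> \<theta> \<in> closure (OW \<alpha> \<beta> \<inter> ball 0 r)" if "0 < \<rho>" "\<rho> < r" "\<alpha> \<rho> \<le> \<theta>" "\<theta> \<le> \<beta> \<rho>" for \<rho> \<theta>
 proof -
  have "pol \<rho> ` closure {\<alpha> \<rho><..<\<beta> \<rho>} \<subseteq> closure (OW \<alpha> \<beta> \<inter> ball 0 r)"
  proof (rule image_closure_subset)
   show "continuous_on (closure {\<alpha> \<rho><..<\<beta> \<rho>}) (pol \<rho>)" by (intro continuous_intros)
   show "pol \<rho> ` {\<alpha> \<rho><..<\<beta> \<rho>} \<subseteq> closure (OW \<alpha> \<beta> \<inter> ball 0 r)"
    using closure_subset[of "OW \<alpha> \<beta> \<inter> ball 0 r"] that(1,2) by (force simp: OW_def)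
  qed simp
  moreover have "\<theta> \<in> closure {\<alpha> \<rho><..<\<beta> \<rho>}" using that lt[of \<rho>] r by simp
  ultimately show ?thesis by blast
 qed
 show "x \<in> ball 0 r \<inter> closure (OW \<alpha> \<beta> \<inter> ball 0 r)"
 proof (cases "x = 0")
  case True
  have "\<exists>y\<in>OW \<alpha> \<beta> \<inter> ball 0 r. dist y 0 < d" if d: "0 < d" for d
  proof -
   define \<rho> where "\<rho> = min d r / 2"
   have \<rho>: "0 < \<rho>" "\<rho> < r" "\<rho> < d" using d r by (auto simp: \<rho>_def min_def)
   have "pol \<rho> ((\<alpha> \<rho> + \<beta> \<rho>) / 2) \<in> OW \<alpha> \<beta>" using \<rho> lt[of \<rho>] r by (force simp: OW_def)
   then show ?thesis using \<rho> by (intro bexI[of _ "pol \<rho> ((\<alpha> \<rho> + \<beta> \<rho>) / 2)"]) auto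
  qed
  then show ?thesis using True r by (auto simp: closure_approachable)
 next
  case False
  then obtain \<rho> \<theta> where "x = pol \<rho> \<theta>" "0 < \<rho>" "\<alpha> \<rho> \<le> \<theta>" "\<theta> \<le> \<beta> \<rho>" using x by (auto simp: CW_def)
  then show ?thesis using *[of \<rho> \<theta>] x by auto
 qed
qed

text \<open>A boundary point lies in the closure of the opposite open wedge, so no neighbourhood of
  it stays inside the closed wedge.\<close>

lemma interior_CW: "ball 0 e \<inter> interior (CW \<alpha> \<beta>) \<subseteq> OW \<alpha> \<beta>"
proof
 interpret co: wedge e \<beta> "\<lambda>\<rho>. \<alpha> \<rho> + 2 * pi" by (rule co_wedge)
 fix x assume x: "x \<in> ball 0 e \<inter> interior (CW \<alpha> \<beta>)"
 have "interior (CW \<alpha> \<beta>) \<inter> (OW \<beta> (\<lambda>\<rho>. \<alpha> \<rho> + 2 * pi) \<inter> ball 0 e) = {}"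
  using CW_iff_coOW interior_subset[of "CW \<alpha> \<beta>"] by auto
 then have "interior (CW \<alpha> \<beta>) \<inter> closure (OW \<beta> (\<lambda>\<rho>. \<alpha> \<rho> + 2 * pi) \<inter> ball 0 e) = {}"
  using open_Int_closure_eq_empty[OF open_interior] by blast
 then have "x \<notin> CW \<beta> (\<lambda>\<rho>. \<alpha> \<rho> + 2 * pi)" using x co.closure_OW[OF e order_refl] by blast
 then have "x \<in> OW (\<lambda>\<rho>. \<alpha> \<rho> + 2 * pi) (\<lambda>\<rho>. \<beta> \<rho> + 2 * pi)" using co.CW_iff_coOW[of x] x by auto
 then obtain \<rho> \<theta> where p: "x = pol \<rho> \<theta>" "0 < \<rho>" "\<alpha> \<rho> + 2 * pi < \<theta>" "\<theta> < \<beta> \<rho> + 2 * pi" by (auto simp: OW_def)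
 have "x = pol \<rho> (\<theta> - 2 * pi)" using pol_2pi[of \<rho> "\<theta> - 2 * pi"] p(1) by simp
 then show "x \<in> OW \<alpha> \<beta>" using p pol_in_OW_I[of \<rho> \<alpha> "\<theta> - 2 * pi" \<beta>] by simp
qed

end

lemma eventually_nhds_pol:
 assumes "eventually P (nhds (0 :: real \<times> real))" shows "eventually (\<lambda>t. \<forall>\<theta>. P (pol t \<theta>)) (at_right 0)"
proof -
 obtain d where d: "d > 0" "\<And>x. dist x 0 < d \<Longrightarrow> P x" using assms unfolding eventually_nhds_metric by blast
 show ?thesis unfolding eventually_at_right_field by (rule exI[of _ d]) (use d in auto)
qed

lemma nhds_norm_eventually:
 assumes "eventually P (at_right (0::real))" shows "\<forall>\<^sub>F x in nhds (0 :: real \<times> real). x \<noteq> 0 \<longrightarrow> P (norm x)"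
using assms by (force simp: eventually_at_right_field eventually_nhds_metric)

section \<open>Arcs and slopes\<close>

text \<open>The arcs in the sector of opening \<open>\<pi>/2\<close> around the direction \<open>\<phi>\<close> are parameterized by their slopes
 \<open>s\<close> with values in \<open>[-1, 1]\<close>, relative to the coordinates rotated by \<open>\<phi>\<close>.\<close>

definition ang :: "real \<Rightarrow> (real \<Rightarrow> real) \<Rightarrow> real \<Rightarrow> real" where
 "ang \<phi> s t = \<phi> + arctan (s t)"

abbreviation "sector \<phi> x y \<equiv> CW (ang \<phi> x) (ang \<phi> y)"
abbreviation "osector \<phi> x y \<equiv> OW (ang \<phi> x) (ang \<phi> y)"

definition parc :: "(real \<Rightarrow> real) \<Rightarrow> real \<Rightarrow> real \<times> real" where
 "parc \<alpha> t = pol t (\<alpha> t)"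

lemma sqrt_1_pos: "0 < sqrt (1 + x\<^sup>2)"
 by (simp add: add_pos_nonneg)

lemma cos_ang: "cos (\<phi> + arctan x) = (cos \<phi> - x * sin \<phi>) / sqrt (1 + x\<^sup>2)"
 by (simp add: cos_add cos_arctan sin_arctan diff_divide_distrib mult.commute)

lemma sin_ang: "sin (\<phi> + arctan x) = (sin \<phi> + x * cos \<phi>) / sqrt (1 + x\<^sup>2)"
 by (simp add: sin_add cos_arctan sin_arctan add_divide_distrib mult.commute)

lemma pol_shift: "pol \<rho> (\<theta> + 2 * pi * of_int n) = pol \<rho> \<theta>"
 by (simp add: pol_def cos_add sin_add)

lemma pol_eq_iff: "0 < \<rho> \<Longrightarrow> pol \<rho> \<theta> = pol \<rho> \<theta>' \<longleftrightarrow> (\<exists>n::int. \<theta> = \<theta>' + 2 * pi * of_int n)"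
 using sin_cos_eq_iff[of \<theta> \<theta>'] by (auto simp: pol_def)

text \<open>With c and s the cosine and sine of the angle between the two rays, the chord is t *
  sqrt (2 - 2 * c). Slopes in [-1, 1] keep the angle at most \<pi>/2, so 0 \<le> c, and 1 - c is
  comparable to (1 - c) * (1 + c), the square of s. Finally s is y - x divided by a * b, which lies
  between 1 and 2.\<close>

lemma chord_bounds:
 fixes x y t \<phi> :: real
 assumes "-1 \<le> x" "x < y" "y \<le> 1" "0 < t"
 defines "N \<equiv> norm (pol t (\<phi> + arctan x) - pol t (\<phi> + arctan y))"
 shows "t * (y - x) / 2 \<le> N" "N \<le> 2 * (t * (y - x))"
proof -
 define a where "a = sqrt (1 + x\<^sup>2)"
 define b where "b = sqrt (1 + y\<^sup>2)"
 have a: "1 \<le> a" "a\<^sup>2 = 1 + x\<^sup>2" and b: "1 \<le> b" "b\<^sup>2 = 1 + y\<^sup>2" by (simp_all add: a_def b_def)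
 define c where "c = (1 + x * y) / (a * b)"
 define s where "s = (y - x) / (a * b)"
 have ab: "1 \<le> a * b" using a b mult_mono[of 1 a 1 b] by simp
 have sq: "x\<^sup>2 \<le> 1" "y\<^sup>2 \<le> 1" using assms(1-3) by (auto simp: abs_square_le_1)
 have "(a * b)\<^sup>2 \<le> 2 * 2" unfolding power_mult_distrib a(2) b(2) using sq by (intro mult_mono) auto
 then have "(a * b)\<^sup>2 \<le> 2\<^sup>2" by simp
 then have ab2: "a * b \<le> 2" by (rule power2_le_imp_le) simp
 have ab0: "a * b \<noteq> 0" using ab by auto
 have "(c\<^sup>2 + s\<^sup>2) * (a * b)\<^sup>2 = (1 + x * y)\<^sup>2 + (y - x)\<^sup>2"
  unfolding distrib_right c_def s_def power_divide using ab0 by simp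
 also have "\<dots> = (1 + x\<^sup>2) * (1 + y\<^sup>2)" by (simp add: power2_eq_square algebra_simps)
 also have "\<dots> = 1 * (a * b)\<^sup>2" by (simp add: power_mult_distrib a(2) b(2))
 finally have cs: "c\<^sup>2 + s\<^sup>2 = 1" using ab0 by (subst (asm) mult_cancel_right) simp
 have "\<bar>x * y\<bar> \<le> 1 * 1" unfolding abs_mult using assms(1-3) by (intro mult_mono) auto
 then have c0: "0 \<le> c" unfolding c_def using ab by (intro divide_nonneg_nonneg) auto
 have s0: "0 \<le> s" unfolding s_def using ab assms by (intro divide_nonneg_nonneg) auto
 have "c\<^sup>2 \<le> 1\<^sup>2" using cs zero_le_power2[of s] unfolding one_power2 by linarith
 then have c1: "c \<le> 1" by (rule power2_le_imp_le) simp
 have c_eq: "cos (\<phi> + arctan x) * cos (\<phi> + arctan y) + sin (\<phi> + arctan x) * sin (\<phi> + arctan y) = c"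
 proof -
  have "cos (\<phi> + arctan x - (\<phi> + arctan y)) = cos (arctan x - arctan y)" by simp
  also have "\<dots> = c" by (simp add: cos_diff cos_arctan sin_arctan c_def a_def b_def add_divide_distrib)
  finally show ?thesis unfolding cos_diff .
 qed
 have "N\<^sup>2 = (t * cos (\<phi> + arctan x) - t * cos (\<phi> + arctan y))\<^sup>2 + (t * sin (\<phi> + arctan x) - t * sin (\<phi> + arctan y))\<^sup>2"
  unfolding N_def pol_def by (simp add: norm_Pair)
 also have "\<dots> = t\<^sup>2 * ((cos (\<phi> + arctan x) - cos (\<phi> + arctan y))\<^sup>2 + (sin (\<phi> + arctan x) - sin (\<phi> + arctan y))\<^sup>2)"
  by (simp only: right_diff_distrib[symmetric] power_mult_distrib distrib_left[symmetric])
 also have "(cos (\<phi> + arctan x) - cos (\<phi> + arctan y))\<^sup>2 + (sin (\<phi> + arctan x) - sin (\<phi> + arctan y))\<^sup>2 =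
   ((sin (\<phi> + arctan x))\<^sup>2 + (cos (\<phi> + arctan x))\<^sup>2) + ((sin (\<phi> + arctan y))\<^sup>2 + (cos (\<phi> + arctan y))\<^sup>2)
   - 2 * (cos (\<phi> + arctan x) * cos (\<phi> + arctan y) + sin (\<phi> + arctan x) * sin (\<phi> + arctan y))"
  by (simp add: power2_eq_square algebra_simps del: sin_cos_squared_add3)
 finally have N2: "N\<^sup>2 = t\<^sup>2 * (2 - 2 * c)" unfolding c_eq sin_cos_squared_add by simp
 have N0: "0 \<le> N" by (simp add: N_def)
 have "s\<^sup>2 = (1 + c) * (1 - c)" using cs by (simp add: power2_eq_square algebra_simps)
 moreover have "1 * (1 - c) \<le> (1 + c) * (1 - c)" "(1 + c) * (1 - c) \<le> 2 * (1 - c)"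
  using c0 c1 by (intro mult_right_mono; simp)+
 ultimately have s2: "s\<^sup>2 \<le> 2 - 2 * c" "2 - 2 * c \<le> 2 * s\<^sup>2" by simp_all
 have "(t * s)\<^sup>2 \<le> N\<^sup>2" unfolding N2 power_mult_distrib using s2(1) by (intro mult_left_mono) auto
 then have 1: "t * s \<le> N" using N0 by (rule power2_le_imp_le)
 have "2 - 2 * c \<le> 4 * s\<^sup>2" using s2(2) zero_le_power2[of s] by linarith
 then have "N\<^sup>2 \<le> t\<^sup>2 * (4 * s\<^sup>2)" unfolding N2 by (rule mult_left_mono) simp
 also have "\<dots> = (2 * (t * s))\<^sup>2" by (simp add: power_mult_distrib)
 finally have "N\<^sup>2 \<le> (2 * (t * s))\<^sup>2" .
 moreover have "0 \<le> 2 * (t * s)" using s0 assms(4) by simp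
 ultimately have 2: "N \<le> 2 * (t * s)" by (rule power2_le_imp_le)
 have "(y - x) / 2 \<le> s" unfolding s_def using ab ab2 assms(2) by (intro divide_left_mono) simp_all
 then have "t * ((y - x) / 2) \<le> t * s" using assms(4) by (intro mult_left_mono) auto
 with 1 show "t * (y - x) / 2 \<le> N" by simp
 have "s \<le> (y - x) / 1" unfolding s_def using ab assms(2) by (intro divide_left_mono) simp_all
 then have "t * s \<le> t * (y - x)" using assms(4) by (intro mult_left_mono) auto
 with 2 show "N \<le> 2 * (t * (y - x))" by simp
qed

section \<open>Definable arcs in a sector as definable slopes\<close>

context polynomially_bounded_ominimal_structure
begin

text \<open>Sine and cosine need not be definable, but at a fixed angle plus \<open>arctan s\<close>
  they are algebraic in s. For this reason arcs are described by slopes and not by angles.\<close>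

lemma dterm_ang:
 assumes "dterm s" shows "dterm (\<lambda>e. cos (\<phi> + arctan (s e)))" "dterm (\<lambda>e. sin (\<phi> + arctan (s e)))"
 unfolding cos_ang sin_ang by (intro dint assms)+

lemma dfun1_parc:
 assumes "dfun1 s" shows "dfun1 (\<lambda>t. fst (parc (ang \<phi> s) t))" "dfun1 (\<lambda>t. snd (parc (ang \<phi> s) t))"
 unfolding dfun1_def parc_def pol_def ang_def fst_conv snd_conv
 by (intro dint dterm_ang dfun1_app[OF assms])+

lemma definable_arc_parc:
 assumes s: "dfun1 s" shows "definable_arc S (parc (ang \<phi> s))"
proof -
 obtain d where d: "d > 0" "\<And>t. 0 < t \<Longrightarrow> t < d \<Longrightarrow> isCont s t"
  using ev_isCont[OF s, of 0] unfolding eventually_at_right_field by blast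
 have "continuous (at t within {0..<d}) (parc (ang \<phi> s))" if "t \<in> {0..<d}" for t
 proof (cases "t = 0")
  case True
  \<comment> \<open>The slope need not converge at 0; that the norm equals t gives continuity
    there.\<close>
  have "((\<lambda>t. norm (parc (ang \<phi> s) t)) \<longlongrightarrow> 0) (at 0 within {0..<d})"
   unfolding parc_def norm_pol by (rule tendsto_eq_intros refl)+ simp
  then have "(parc (ang \<phi> s) \<longlongrightarrow> 0) (at 0 within {0..<d})" by (rule tendsto_norm_zero_cancel)
  then show ?thesis using True by (simp add: continuous_within parc_def)
 next
  case False
  then have "isCont s t" using d that by auto
  then have "isCont (parc (ang \<phi> s)) t" unfolding parc_def[abs_def] pol_def ang_def by (intro continuous_intros)
  then show ?thesis by (rule continuous_at_imp_continuous_at_within)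
 qed
 then have "continuous_on {0..<d} (parc (ang \<phi> s))" by (simp add: continuous_on_eq_continuous_within)
 moreover have "drel3 (\<lambda>t x y. 0 \<le> t \<and> t < d \<and> x = fst (parc (ang \<phi> s) t) \<and> y = snd (parc (ang \<phi> s) t))"
  unfolding drel3_def by (intro dint dfun1_app[OF dfun1_parc(1)[OF s]] dfun1_app[OF dfun1_parc(2)[OF s]])
 then have "{[t, fst (parc (ang \<phi> s) t), snd (parc (ang \<phi> s) t)] | t. t \<in> {0..<d}} \<in> S 3"
  unfolding drel3_S by (rule back_subst[of "\<lambda>A. A \<in> S 3"]) auto
 moreover have "parc (ang \<phi> s) 0 = 0" by (simp add: parc_def)
 moreover have "\<forall>t\<in>{0..<d}. norm (parc (ang \<phi> s) t) = t" by (simp add: parc_def)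
 ultimately show ?thesis unfolding definable_arc_def using d(1) by blast
qed

lemma arc_norm: "definable_arc S \<gamma> \<Longrightarrow> EV t. norm (\<gamma> t) = t"
 unfolding definable_arc_def eventually_at_right_field by force

lemma arc_eventually:
 assumes "definable_arc S \<gamma>" "eventually P (nhds 0)" shows "EV t. P (\<gamma> t)"
proof -
 have p: "\<exists>\<theta>. \<gamma> t = pol (norm (\<gamma> t)) \<theta>" for t using pol_cases[of 0 "\<gamma> t"] by metis
 show ?thesis using eventually_nhds_pol[OF assms(2)] arc_norm[OF assms(1)] by eventually_elim (metis p)
qed

text \<open>The graph of an arc is given on [0, d) only; \<open>the0\<close> extends both
  coordinates by 0 to total definable functions.\<close>

lemma arc_definable:
 assumes "definable_arc S \<gamma>"
 obtains X Y where "dfun1 X" "dfun1 Y" "EV t. \<gamma> t = (X t, Y t)"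
proof -
 obtain d where d: "d > 0" "{[t, fst (\<gamma> t), snd (\<gamma> t)] | t. t \<in> {0..<d}} \<in> S 3"
  using assms unfolding definable_arc_def by blast
 define R where "R t x y \<longleftrightarrow> 0 \<le> t \<and> t < d \<and> \<gamma> t = (x, y)" for t x y
 have "{[t, x, y] | t x y. R t x y} = {[t, fst (\<gamma> t), snd (\<gamma> t)] | t. t \<in> {0..<d}}" by (auto simp: R_def)
 then have R: "drel3 R" unfolding drel3_S using d(2) by simp
 define X where "X t = the0 (\<lambda>x. \<exists>y. R t x y)" for t
 define Y where "Y t = the0 (\<lambda>y. \<exists>x. R t x y)" for t
 have "dfun1 X" unfolding dfun1_def X_def by (intro dterm_the0 dpred_ex drel3_app[OF R] dint)
 moreover have "dfun1 Y" unfolding dfun1_def Y_def by (intro dterm_the0 dpred_ex drel3_app[OF R] dint)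
 moreover have "EV t. \<gamma> t = (X t, Y t)" using ev_pos ev_less[OF d(1)]
 proof eventually_elim
  case (elim t)
  have "X t = fst (\<gamma> t)" unfolding X_def by (rule the0_eq) (use elim in \<open>auto simp: R_def intro: exI[of _ "snd (\<gamma> t)"]\<close>)
  moreover have "Y t = snd (\<gamma> t)" unfolding Y_def by (rule the0_eq) (use elim in \<open>auto simp: R_def intro: exI[of _ "fst (\<gamma> t)"]\<close>)
  ultimately show ?case by simp
 qed
 ultimately show thesis by (rule that)
qed

lemma in_sector_arctan:
 assumes "0 < t" "pol t \<theta> \<in> sector \<phi> lo hi"
 obtains \<sigma> where "pol t \<theta> = pol t (\<phi> + arctan \<sigma>)" "lo t \<le> \<sigma>" "\<sigma> \<le> hi t"
proof -
 obtain \<theta>' where \<theta>': "pol t \<theta> = pol t \<theta>'" "ang \<phi> lo t \<le> \<theta>'" "\<theta>' \<le> ang \<phi> hi t"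
  using assms pol_in_CW by blast
 have b: "- (pi / 2) < \<theta>' - \<phi>" "\<theta>' - \<phi> < pi / 2"
  using \<theta>'(2,3) arctan_lbound[of "lo t"] arctan_ubound[of "hi t"] by (auto simp: ang_def)
 then have a: "arctan (tan (\<theta>' - \<phi>)) = \<theta>' - \<phi>" by (intro arctan_tan) auto
 have "arctan (lo t) \<le> arctan (tan (\<theta>' - \<phi>))" "arctan (tan (\<theta>' - \<phi>)) \<le> arctan (hi t)"
  unfolding a using \<theta>'(2,3) by (auto simp: ang_def)
 moreover have "pol t \<theta> = pol t (\<phi> + arctan (tan (\<theta>' - \<phi>)))" unfolding a using \<theta>'(1) by simp
 ultimately show thesis by (intro that[of "tan (\<theta>' - \<phi>)"]) (simp_all only: arctan_le_iff)
qed

text \<open>The quotient of the coordinates after rotation by -\<phi>; it shows that the slope of a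
  definable arc is definable.\<close>

lemma slope_formula:
 assumes "0 < t" shows "(- fst (pol t (\<phi> + arctan \<sigma>)) * sin \<phi> + snd (pol t (\<phi> + arctan \<sigma>)) * cos \<phi>) /
  (fst (pol t (\<phi> + arctan \<sigma>)) * cos \<phi> + snd (pol t (\<phi> + arctan \<sigma>)) * sin \<phi>) = \<sigma>"
proof -
 define k where "k = t / sqrt (1 + \<sigma>\<^sup>2)"
 have k: "k \<noteq> 0" using assms sqrt_1_pos[of \<sigma>] by (auto simp: k_def)
 have p: "pol t (\<phi> + arctan \<sigma>) = (k * (cos \<phi> - \<sigma> * sin \<phi>), k * (sin \<phi> + \<sigma> * cos \<phi>))"
  by (simp add: pol_def cos_ang sin_ang k_def)
 have "fst (pol t (\<phi> + arctan \<sigma>)) * cos \<phi> + snd (pol t (\<phi> + arctan \<sigma>)) * sin \<phi> = k * ((sin \<phi>)\<^sup>2 + (cos \<phi>)\<^sup>2)"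
  unfolding p by (simp add: power2_eq_square algebra_simps del: sin_cos_squared_add3)
 moreover have "- fst (pol t (\<phi> + arctan \<sigma>)) * sin \<phi> + snd (pol t (\<phi> + arctan \<sigma>)) * cos \<phi> = k * \<sigma> * ((sin \<phi>)\<^sup>2 + (cos \<phi>)\<^sup>2)"
  unfolding p by (simp add: power2_eq_square algebra_simps del: sin_cos_squared_add3)
 ultimately show ?thesis using k by simp
qed

lemma arc_slope:
 assumes \<gamma>: "definable_arc S \<gamma>" "EV t. \<gamma> t \<in> sector \<phi> lo hi"
 obtains s where "inS lo hi s" "EV t. \<gamma> t = pol t (ang \<phi> s t)"
proof -
 obtain X Y where XY: "dfun1 X" "dfun1 Y" "EV t. \<gamma> t = (X t, Y t)" by (rule arc_definable[OF \<gamma>(1)])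
 define s where "s t = (- X t * sin \<phi> + Y t * cos \<phi>) / (X t * cos \<phi> + Y t * sin \<phi>)" for t
 have ds: "dfun1 s" unfolding dfun1_def s_def by (intro dint dfun1_app[OF XY(1)] dfun1_app[OF XY(2)])
 have "EV t. lo t \<le> s t \<and> s t \<le> hi t \<and> \<gamma> t = pol t (ang \<phi> s t)" using XY(3) \<gamma>(2) arc_norm[OF \<gamma>(1)] ev_pos
 proof eventually_elim
  case (elim t)
  obtain \<theta> where "\<gamma> t = pol t \<theta>" using pol_cases[of 0 "\<gamma> t"] elim(3) by metis
  then obtain \<sigma> where \<sigma>: "\<gamma> t = pol t (\<phi> + arctan \<sigma>)" "lo t \<le> \<sigma>" "\<sigma> \<le> hi t"
   using in_sector_arctan[OF elim(4), of \<theta> \<phi> lo hi] elim(2) by metis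
  have "X t = fst (\<gamma> t)" "Y t = snd (\<gamma> t)" using elim(1) by simp_all
  then have "s t = \<sigma>" using slope_formula[OF elim(4), of \<phi> \<sigma>] by (simp add: s_def \<sigma>(1))
  then show ?case using \<sigma> by (simp add: ang_def)
 qed
 then show thesis using ds by (intro that[of s]) (auto simp: inS_def elim: eventually_mono)
qed

lemma arc_in_sector_iff:
 assumes T: "germ_eq T (sector \<phi> lo hi)"
 shows "arc_in S \<delta> T \<longleftrightarrow> definable_arc S \<delta> \<and> (\<exists>s. inS lo hi s \<and> (EV t. \<delta> t = pol t (ang \<phi> s t)))"
proof
 assume a: "arc_in S \<delta> T"
 then have d: "definable_arc S \<delta>" by (simp add: arc_in_def)
 have "\<forall>\<^sub>F x in nhds 0. x \<in> arc_image \<delta> \<longrightarrow> x \<in> sector \<phi> lo hi"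
  using a T unfolding arc_in_def germ_subset_def germ_eq_def by (auto elim: eventually_elim2)
 from arc_eventually[OF d this] arc_norm[OF d] have "EV t. \<delta> t \<in> sector \<phi> lo hi"
  by eventually_elim (simp add: arc_image_def)
 from arc_slope[OF d this] d show "definable_arc S \<delta> \<and> (\<exists>s. inS lo hi s \<and> (EV t. \<delta> t = pol t (ang \<phi> s t)))" by metis
next
 assume "definable_arc S \<delta> \<and> (\<exists>s. inS lo hi s \<and> (EV t. \<delta> t = pol t (ang \<phi> s t)))"
 then obtain s where d: "definable_arc S \<delta>" and s: "inS lo hi s" "EV t. \<delta> t = pol t (ang \<phi> s t)" by blast
 have "EV t. 0 < t \<and> lo t \<le> s t \<and> s t \<le> hi t \<and> \<delta> t = pol t (ang \<phi> s t)"
  using s ev_pos unfolding inS_def by (auto elim: eventually_elim2 intro: eventually_conj)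
 from nhds_norm_eventually[OF this] T[unfolded germ_eq_def]
 have "\<forall>\<^sub>F x in nhds 0. x \<in> arc_image \<delta> \<longrightarrow> x \<in> T"
 proof (rule eventually_elim2)
  fix x :: "real \<times> real"
  assume x: "x \<noteq> 0 \<longrightarrow> 0 < norm x \<and> lo (norm x) \<le> s (norm x) \<and> s (norm x) \<le> hi (norm x) \<and> \<delta> (norm x) = pol (norm x) (ang \<phi> s (norm x))"
   and "x \<in> T \<longleftrightarrow> x \<in> sector \<phi> lo hi"
  moreover have "x \<in> sector \<phi> lo hi" if "x \<in> arc_image \<delta>"
  proof (cases "x = 0")
   case False
   then have "x = pol (norm x) (ang \<phi> s (norm x))" using x that by (simp add: arc_image_def)
   then show ?thesis using x False pol_in_CW_I[of "norm x" "ang \<phi> lo" "ang \<phi> s (norm x)" "ang \<phi> hi"] by (simp add: ang_def arctan_le_iff)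
  qed (simp add: CW_def)
  ultimately show "x \<in> arc_image \<delta> \<longrightarrow> x \<in> T" by blast
 qed
 then show "arc_in S \<delta> T" using d by (simp add: arc_in_def germ_subset_def)
qed

lemma order_times_t:
 assumes "dfun1 g" shows "order_at_0 (\<lambda>t. t * g t) = 1 + order_at_0 g" using assms
proof (cases rule: order_cases)
 case 1
 then have "EV t. t * g t = 0" by (auto elim: eventually_mono)
 then have "order_at_0 (\<lambda>t. t * g t) = \<infinity>" unfolding order_infty .
 then show ?thesis using 1(2) by simp
next
 case (2 r)
 then obtain a where a: "a \<noteq> 0" "((\<lambda>t. g t / t powr r) \<longlongrightarrow> a) (at_right 0)" by (auto simp: ord_is_def)
 have "EV t. g t / t powr r = t * g t / t powr (1 + r)"
  using ev_pos by eventually_elim (simp add: powr_add)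
 with a(2) have "((\<lambda>t. t * g t / t powr (1 + r)) \<longlongrightarrow> a) (at_right 0)" by (rule Lim_transform_eventually)
 then have "ord_is (\<lambda>t. t * g t) (1 + r)" using a(1) by (auto simp: ord_is_def)
 then show ?thesis using 2 by (simp add: ord_is_order)
qed

lemma tord_parc:
 assumes d: "dfun1 x" "dfun1 y" and xy: "EV t. -1 \<le> x t \<and> x t < y t \<and> y t \<le> 1"
 shows "tord (parc (ang \<phi> x)) (parc (ang \<phi> y)) = 1 + ord_diff x y"
proof -
 define N where "N t = norm (parc (ang \<phi> x) t - parc (ang \<phi> y) t)" for t
 have dyx: "dfun1 (\<lambda>t. y t - x t)" by (rule dfun1_diff[OF d(2,1)])
 then have dt: "dfun1 (\<lambda>t. t * (y t - x t))" unfolding dfun1_def by (intro dterm_mult dterm_var)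
 have "N t = sqrt ((fst (parc (ang \<phi> x) t) - fst (parc (ang \<phi> y) t))\<^sup>2 + (snd (parc (ang \<phi> x) t) - snd (parc (ang \<phi> y) t))\<^sup>2)" for t
  by (simp add: N_def norm_prod_def)
 then have dN: "dfun1 N" unfolding dfun1_def
  by (simp only:) (intro dint dfun1_app[OF dfun1_parc(1)[OF d(1)]] dfun1_app[OF dfun1_parc(2)[OF d(1)]]
   dfun1_app[OF dfun1_parc(1)[OF d(2)]] dfun1_app[OF dfun1_parc(2)[OF d(2)]])
 have b: "EV t. \<bar>N t\<bar> \<le> 2 * \<bar>t * (y t - x t)\<bar> \<and> \<bar>t * (y t - x t)\<bar> \<le> 2 * \<bar>N t\<bar>" using xy ev_pos
 proof eventually_elim
  case (elim t)
  then show ?case using chord_bounds[of "x t" "y t" t \<phi>] by (simp add: N_def parc_def ang_def)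
 qed
 have "order_at_0 N = order_at_0 (\<lambda>t. t * (y t - x t))"
  by (intro antisym order_antimono[OF dt dN, where C = 2] order_antimono[OF dN dt, where C = 2]) (use b in \<open>auto elim: eventually_mono\<close>)
 then show ?thesis unfolding tord_def N_def[symmetric] order_times_t[OF dyx] .
qed

end

section \<open>Hoelder triangles in a sector\<close>

lemma (in wedge) germ_closure:
 assumes "0 < r" "r \<le> e" "C \<inter> ball 0 r = OW \<alpha> \<beta> \<inter> ball 0 r"
 shows "ball 0 r \<inter> closure C = ball 0 r \<inter> CW \<alpha> \<beta>"
proof -
 have "ball 0 r \<inter> closure C = ball 0 r \<inter> closure (C \<inter> ball 0 r)"
 using open_Int_closure_subset[of "ball 0 r" C] closure_mono[of "C \<inter> ball 0 r" C] by (auto simp: Int_commute)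
 then show ?thesis using closure_OW[OF assms(1,2)] assms(3) by simp
qed

lemma ball_germ: "0 < r \<Longrightarrow> \<forall>\<^sub>F x in nhds (0 :: real \<times> real). x \<in> ball 0 r"
 by (rule eventually_nhds_in_open) auto

lemma germ_eq_ball: "0 < r \<Longrightarrow> ball 0 r \<inter> A = ball 0 r \<inter> B \<Longrightarrow> germ_eq A B"
 unfolding germ_eq_def by (rule eventually_mono[OF ball_germ]) blast+

lemma germ_eq_trans: "germ_eq A B \<Longrightarrow> germ_eq B C \<Longrightarrow> germ_eq A C"
 unfolding germ_eq_def by (auto elim: eventually_elim2)

lemma germ_pol:
 assumes ev: "EV t. \<forall>\<theta>. P (pol t \<theta>)" and "P 0" shows "\<forall>\<^sub>F x in nhds 0. P x"
 using nhds_norm_eventually[OF ev]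
proof eventually_elim
 case (elim x)
 obtain \<theta> where "x = pol (norm x) \<theta>" using pol_cases[of 0 x] by metis
 then show ?case using elim \<open>P 0\<close> by metis
qed

text \<open>In a sector of opening \<pi>/2 around the unit vector w, norm z \<le> 2 * (w \<bullet>
  z). A half-plane contains v / 4 + v' and v / 4 - v', where v' is orthogonal to v and of the same
  length; adding the two inequalities gives 2 * norm v \<le> norm v.\<close>

lemma sector_half_plane:
 assumes e: "0 < e" and s: "\<And>t. 0 < t \<Longrightarrow> t < e \<Longrightarrow> -1 \<le> x t \<and> y t \<le> 1"
 shows "\<not> (\<exists>v. v \<noteq> 0 \<and> germ_subset {z. v \<bullet> z > 0} (osector \<phi> x y))"
proof
 assume "\<exists>v. v \<noteq> 0 \<and> germ_subset {z. v \<bullet> z > 0} (osector \<phi> x y)"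
 then obtain v where v: "v \<noteq> 0" "germ_subset {z. v \<bullet> z > 0} (osector \<phi> x y)" by blast
 obtain d where d: "d > 0" "\<And>z. norm z < d \<Longrightarrow> v \<bullet> z > 0 \<Longrightarrow> z \<in> osector \<phi> x y"
  using v(2) unfolding germ_subset_def eventually_nhds_metric by auto
 define w where "w = pol 1 \<phi>"
 have w: "norm z \<le> 2 * (w \<bullet> z)" if "norm z < min d e" "v \<bullet> z > 0" for z
 proof -
  have "z \<in> osector \<phi> x y" using d(2)[of z] that by simp
  then obtain \<rho> \<theta> where z: "z = pol \<rho> \<theta>" "0 < \<rho>" "ang \<phi> x \<rho> < \<theta>" "\<theta> < ang \<phi> y \<rho>"
   unfolding OW_def by blast
  have "\<rho> < e" using z(1,2) that(1) by simp
  then have "arctan (-1) \<le> arctan (x \<rho>)" "arctan (y \<rho>) \<le> arctan 1"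
   using s[OF z(2)] by (simp_all only: arctan_le_iff)
  then have "- (pi / 4) \<le> arctan (x \<rho>)" "arctan (y \<rho>) \<le> pi / 4" by (simp_all add: arctan_one arctan_minus)
  \<comment> \<open>The angle is in fact at most \<pi>/4; the bound \<pi>/3 is taken because its
    cosine is 1/2.\<close>
  then have "\<bar>\<theta> - \<phi>\<bar> \<le> pi / 3" using z(3,4) pi_gt_zero unfolding ang_def abs_le_iff by linarith
  then have "cos (pi / 3) \<le> cos \<bar>\<theta> - \<phi>\<bar>" by (intro cos_monotone_0_pi_le) auto
  then have c: "1 / 2 \<le> cos (\<theta> - \<phi>)" by (simp add: cos_60)
  have "w \<bullet> z = \<rho> * cos (\<theta> - \<phi>)" by (simp add: w_def z(1) pol_def cos_diff algebra_simps)
  moreover have "\<rho> * (1 / 2) \<le> \<rho> * cos (\<theta> - \<phi>)" using c z(2) by (intro mult_left_mono) auto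
  ultimately show ?thesis using z by simp
 qed
 define v' where "v' = (- snd v, fst v)"
 have v': "v \<bullet> v' = 0" "norm v' = norm v" by (simp_all add: v'_def inner_prod_def norm_prod_def add.commute)
 \<comment> \<open>Scales both test vectors into the neighbourhood of radius min d e, on which the
   inequality for w is available.\<close>
 define k where "k = min d e / (4 * norm v)"
 have nv: "0 < norm v" using v(1) by simp
 have k: "0 < k" "k * norm v = min d e / 4" using d(1) e nv by (auto simp: k_def)
 have b: "norm (k *\<^sub>R ((1/4) *\<^sub>R v + c *\<^sub>R v')) \<le> 2 * (w \<bullet> (k *\<^sub>R ((1/4) *\<^sub>R v + c *\<^sub>R v')))" if "\<bar>c\<bar> = 1" for c
 proof (rule w)
  have "norm ((1/4) *\<^sub>R v + c *\<^sub>R v') \<le> norm ((1/4) *\<^sub>R v) + norm (c *\<^sub>R v')" by (rule norm_triangle_ineq)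
  also have "\<dots> < 2 * norm v" using that v'(2) nv by simp
  finally have "k * norm ((1/4) *\<^sub>R v + c *\<^sub>R v') < k * (2 * norm v)" using k(1) by (rule mult_strict_left_mono)
  also have "\<dots> = min d e / 2" using k(2) by simp
  also have "\<dots> < min d e" using d(1) e by (simp add: min_def)
  finally show "norm (k *\<^sub>R ((1/4) *\<^sub>R v + c *\<^sub>R v')) < min d e" using k(1) by simp
  show "0 < v \<bullet> (k *\<^sub>R ((1/4) *\<^sub>R v + c *\<^sub>R v'))" using k(1) v(1) v'(1) by (simp add: inner_add_right)
 qed
 have b': "norm ((1/4) *\<^sub>R v + c *\<^sub>R v') \<le> 2 * (w \<bullet> ((1/4) *\<^sub>R v + c *\<^sub>R v'))" if "\<bar>c\<bar> = 1" for c
 proof -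
  have "k * norm ((1/4) *\<^sub>R v + c *\<^sub>R v') \<le> k * (2 * (w \<bullet> ((1/4) *\<^sub>R v + c *\<^sub>R v')))"
   using b[OF that] k(1) by simp
  then show ?thesis using k(1) by (subst (asm) mult_le_cancel_left_pos) auto
 qed
 have "norm (2 *\<^sub>R v') = norm (((1/4) *\<^sub>R v + 1 *\<^sub>R v') - ((1/4) *\<^sub>R v + (-1) *\<^sub>R v'))" by (simp add: scaleR_2)
 also have "\<dots> \<le> norm ((1/4) *\<^sub>R v + 1 *\<^sub>R v') + norm ((1/4) *\<^sub>R v + (-1) *\<^sub>R v')" by (rule norm_triangle_ineq4)
 also have "\<dots> \<le> 2 * (w \<bullet> ((1/4) *\<^sub>R v + 1 *\<^sub>R v')) + 2 * (w \<bullet> ((1/4) *\<^sub>R v + (-1) *\<^sub>R v'))"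
  using b'[of 1] b'[of "-1"] by simp
 also have "\<dots> = w \<bullet> v" by (simp add: inner_add_right inner_diff_right)
 also have "\<dots> \<le> norm w * norm v" by (rule norm_cauchy_schwarz)
 finally show False using v'(2) nv by (simp add: w_def)
qed

text \<open>Two intervals of angles with the same pair of end rays are shifts of each other or
  complementary. The ray opposite to the bisector of [A, B] belongs to the complementary one, so
  excluding it leaves the shift.\<close>

lemma same_arcs:
 assumes "0 < t" "a < b" "b < a + 2 * pi" "A < B" "B < A + 2 * pi" "{pol t a, pol t b} = {pol t A, pol t B}"
  and no: "\<And>\<theta>. a \<le> \<theta> \<Longrightarrow> \<theta> \<le> b \<Longrightarrow> pol t \<theta> \<noteq> pol t ((A + B) / 2 + pi)"
 obtains n :: int where "a = A + 2 * pi * of_int n" "b = B + 2 * pi * of_int n"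
proof -
 have tp: "0 < 2 * pi" by simp
 consider "pol t a = pol t A" "pol t b = pol t B" | "pol t a = pol t B" "pol t b = pol t A"
  using assms(6) by (auto simp: doubleton_eq_iff)
 then show thesis
 proof cases
  case 1
  then obtain n m :: int where nm: "a = A + 2 * pi * of_int n" "b = B + 2 * pi * of_int m"
   using pol_eq_iff[OF assms(1)] by blast
  have "2 * pi * (of_int (m - n)) < 2 * pi * 1" "2 * pi * (-1) < 2 * pi * (of_int (m - n))"
   using nm assms(2-5) by (auto simp: algebra_simps)
  then have "of_int (m - n) < (1::real)" "(-1::real) < of_int (m - n)"
   unfolding mult_less_cancel_left_pos[OF tp] by simp_all
  then have "m = n" by linarith
  then show thesis using nm that by blast
 next
  case 2
  then obtain n m :: int where nm: "a = B + 2 * pi * of_int n" "b = A + 2 * pi * of_int m"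
   using pol_eq_iff[OF assms(1)] by blast
  have e: "2 * pi * (of_int (m - n)) = (b - a) + (B - A)" using nm by (simp add: algebra_simps)
  have "2 * pi * (of_int (m - n)) < 2 * pi * 2" "2 * pi * 0 < 2 * pi * (of_int (m - n))"
   unfolding e using assms(2-5) by simp_all
  then have "of_int (m - n) < (2::real)" "(0::real) < of_int (m - n)"
   unfolding mult_less_cancel_left_pos[OF tp] by simp_all
  then have "m = n + 1" by linarith
  then have b: "b = A + 2 * pi + 2 * pi * of_int n" using nm(2) by (simp add: algebra_simps)
  have "pol t ((A + B) / 2 + pi + 2 * pi * of_int n) = pol t ((A + B) / 2 + pi)" by (rule pol_shift)
  then show thesis using no[of "(A + B) / 2 + pi + 2 * pi * of_int n"] nm(1) b assms(4,5) by (simp add: field_simps)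
 qed
qed

section \<open>Correspondence between Hoelder triangles and intervals of slopes\<close>

context polynomially_bounded_ominimal_structure
begin

lemma sector_wedge:
 assumes "dfun1 x" "dfun1 y" "EV t. -1 \<le> x t \<and> x t < y t \<and> y t \<le> 1"
 obtains e where "wedge e (ang \<phi> x) (ang \<phi> y)" "\<And>t. 0 < t \<Longrightarrow> t < e \<Longrightarrow> -1 \<le> x t \<and> x t < y t \<and> y t \<le> 1"
proof -
 have "EV t. isCont x t \<and> isCont y t \<and> -1 \<le> x t \<and> x t < y t \<and> y t \<le> 1"
  using ev_isCont[OF assms(1)] ev_isCont[OF assms(2)] assms(3) by eventually_elim simp
 then obtain e where e: "e > 0" "\<And>t. 0 < t \<Longrightarrow> t < e \<Longrightarrow> isCont x t \<and> isCont y t \<and> -1 \<le> x t \<and> x t < y t \<and> y t \<le> 1"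
  unfolding eventually_at_right_field by blast
 have "wedge e (ang \<phi> x) (ang \<phi> y)"
 proof
  show "continuous_on {0<..<e} (ang \<phi> x)" "continuous_on {0<..<e} (ang \<phi> y)"
   unfolding ang_def using e(2) by (intro continuous_at_imp_continuous_on ballI continuous_intros; auto)+
  show "ang \<phi> x t < ang \<phi> y t \<and> ang \<phi> y t < ang \<phi> x t + 2 * pi" if "0 < t" "t < e" for t
   using e(2)[OF that] arctan_lbound[of "x t"] arctan_ubound[of "y t"] pi_gt_zero
   unfolding ang_def by (intro conjI; (simp add: arctan_less_iff)?; linarith)
 qed (rule e(1))
 then show thesis using that e(2) by blast
qed

lemma holder_triangle_sector:
 assumes d: "dfun1 x" "dfun1 y" and xy: "EV t. -1 \<le> x t \<and> x t < y t \<and> y t \<le> 1"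
  and T: "germ_eq T (sector \<phi> x y)" and \<beta>: "ereal \<beta> = 1 + ord_diff x y"
 shows "holder_triangle S T (parc (ang \<phi> x)) (parc (ang \<phi> y)) \<beta>"
proof -
 obtain e where w: "wedge e (ang \<phi> x) (ang \<phi> y)" and s: "\<And>t. 0 < t \<Longrightarrow> t < e \<Longrightarrow> -1 \<le> x t \<and> x t < y t \<and> y t \<le> 1"
  by (rule sector_wedge[OF d xy, of \<phi>]) blast
 interpret w: wedge e "ang \<phi> x" "ang \<phi> y" by (rule w)
 have "osector \<phi> x y \<inter> ball 0 r \<in> components (ball 0 r - (arc_image (parc (ang \<phi> x)) \<union> arc_image (parc (ang \<phi> y))))"
  if "0 < r" "r < e" for r
  using w.components_arcs[of r "parc (ang \<phi> x)" "parc (ang \<phi> y)"] that by (simp add: parc_def)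
 then have "germ_component (parc (ang \<phi> x)) (parc (ang \<phi> y)) (osector \<phi> x y)"
  unfolding germ_component_def eventually_at_right_field using w.e by blast
 moreover have "germ_eq T (closure (osector \<phi> x y))"
  using germ_eq_trans[OF T germ_eq_ball[OF w.e]] w.germ_closure[OF w.e order_refl refl] by simp
 moreover have "\<not> (\<exists>v. v \<noteq> 0 \<and> germ_subset {z. v \<bullet> z > 0} (osector \<phi> x y))"
  by (rule sector_half_plane[OF w.e]) (use s in auto)
 ultimately show ?thesis
  unfolding holder_triangle_def using definable_arc_parc d tord_parc[OF d xy] \<beta> by auto
qed

text \<open>A continuous angle is the imaginary part of a continuous logarithm, which exists because
  the interval of parameters is contractible.\<close>

lemma arc_lift:
 assumes "definable_arc S \<gamma>"
 obtains e \<alpha> where "0 < e" "continuous_on {0<..<e} \<alpha>" "\<And>t. 0 < t \<Longrightarrow> t < e \<Longrightarrow> \<gamma> t = pol t (\<alpha> t)"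
proof -
 obtain e where e: "e > 0" "continuous_on {0..<e} \<gamma>" "\<And>t. t \<in> {0..<e} \<Longrightarrow> norm (\<gamma> t) = t"
  using assms unfolding definable_arc_def by blast
 define f where "f t = Complex (fst (\<gamma> t)) (snd (\<gamma> t))" for t
 have nf: "cmod (f t) = norm (\<gamma> t)" for t by (simp add: f_def norm_prod_def cmod_def)
 have c: "continuous_on {0<..<e} \<gamma>" by (rule continuous_on_subset[OF e(2)]) auto
 have "continuous_on {0<..<e} f" unfolding f_def Complex_eq by (intro continuous_intros c)
 moreover have "f t \<noteq> 0" if "t \<in> {0<..<e}" for t using nf[of t] e(3)[of t] that by auto
 ultimately obtain g where g: "continuous_on {0<..<e} g" "\<And>t. t \<in> {0<..<e} \<Longrightarrow> f t = exp (g t)"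
  using continuous_logarithm_on_contractible[OF _ convex_imp_contractible] by (metis convex_real_interval(8))
 have "\<gamma> t = pol t (Im (g t))" if "0 < t" "t < e" for t
 proof -
  have "t = exp (Re (g t))" using nf[of t] e(3)[of t] g(2)[of t] that by simp
  then have "f t = rcis t (Im (g t))" using g(2)[of t] that by (metis exp_eq_polar greaterThanLessThan_iff rcis_def)
  then show ?thesis by (simp add: f_def pol_def rcis_def complex_eq_iff prod_eq_iff)
 qed
 moreover have "continuous_on {0<..<e} (\<lambda>t. Im (g t))" by (intro continuous_intros g(1))
 ultimately show thesis using that e(1) by blast
qed

text \<open>A finite order of tangency makes the arcs eventually distinct. Then the difference of
  the lifted angles in turns is continuous and never an integer, so it stays between n and n + 1,
  and removing n turns from the second lift gives a wedge.\<close>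

lemma arcs_wedge:
 assumes \<gamma>: "definable_arc S \<gamma>1" "definable_arc S \<gamma>2" and ne: "tord \<gamma>1 \<gamma>2 \<noteq> \<infinity>"
 obtains e \<alpha> \<beta> where "wedge e \<alpha> \<beta>" "\<And>\<rho>. 0 \<le> \<rho> \<Longrightarrow> \<rho> < e \<Longrightarrow> {\<gamma>1 \<rho>, \<gamma>2 \<rho>} = {pol \<rho> (\<alpha> \<rho>), pol \<rho> (\<beta> \<rho>)}"
proof -
 obtain X1 Y1 where 1: "dfun1 X1" "dfun1 Y1" "EV t. \<gamma>1 t = (X1 t, Y1 t)" by (rule arc_definable[OF \<gamma>(1)])
 obtain X2 Y2 where 2: "dfun1 X2" "dfun1 Y2" "EV t. \<gamma>2 t = (X2 t, Y2 t)" by (rule arc_definable[OF \<gamma>(2)])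
 have d: "drel1 (\<lambda>t. X1 t = X2 t \<and> Y1 t = Y2 t)"
  unfolding drel1_def by (intro dint dfun1_app[OF 1(1)] dfun1_app[OF 1(2)] dfun1_app[OF 2(1)] dfun1_app[OF 2(2)])
 have "\<not> (EV t. X1 t = X2 t \<and> Y1 t = Y2 t)"
 proof
  assume "EV t. X1 t = X2 t \<and> Y1 t = Y2 t"
  then have "EV t. norm (\<gamma>1 t - \<gamma>2 t) = 0" using 1(3) 2(3) by eventually_elim simp
  then show False using ne order_infty unfolding tord_def by blast
 qed
 then have "EV t. \<not> (X1 t = X2 t \<and> Y1 t = Y2 t)" using ev_dichotomy_right[OF d, of 0] by blast
 then have "EV t. \<gamma>1 t \<noteq> \<gamma>2 t" using 1(3) 2(3) by eventually_elim auto
 then obtain e0 where e0: "e0 > 0" "\<And>t. 0 < t \<Longrightarrow> t < e0 \<Longrightarrow> \<gamma>1 t \<noteq> \<gamma>2 t" unfolding eventually_at_right_field by blast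
 obtain e1 \<alpha>1 where a1: "0 < e1" "continuous_on {0<..<e1} \<alpha>1" "\<And>t. 0 < t \<Longrightarrow> t < e1 \<Longrightarrow> \<gamma>1 t = pol t (\<alpha>1 t)" by (rule arc_lift[OF \<gamma>(1)]) blast
 obtain e2 \<alpha>2 where a2: "0 < e2" "continuous_on {0<..<e2} \<alpha>2" "\<And>t. 0 < t \<Longrightarrow> t < e2 \<Longrightarrow> \<gamma>2 t = pol t (\<alpha>2 t)" by (rule arc_lift[OF \<gamma>(2)]) blast
 define e where "e = min e0 (min e1 e2)"
 have e: "e > 0" using e0 a1 a2 by (simp add: e_def)
 have c1: "continuous_on {0<..<e} \<alpha>1" by (rule continuous_on_subset[OF a1(2)]) (auto simp: e_def)
 have c2: "continuous_on {0<..<e} \<alpha>2" by (rule continuous_on_subset[OF a2(2)]) (auto simp: e_def)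
 define h where "h t = (\<alpha>2 t - \<alpha>1 t) / (2 * pi)" for t
 have ch: "continuous_on {0<..<e} h" unfolding h_def by (intro continuous_intros c1 c2) auto
 have nint: "h t \<noteq> of_int n" if "0 < t" "t < e" for t and n :: int
 proof
  assume "h t = of_int n"
  then have "\<alpha>2 t = \<alpha>1 t + 2 * pi * of_int n" by (simp add: h_def field_simps)
  then have "\<gamma>1 t = \<gamma>2 t" using a1(3)[of t] a2(3)[of t] that pol_shift[of t "\<alpha>1 t" n] by (simp add: e_def)
  then show False using e0(2)[of t] that by (simp add: e_def)
 qed
 define n where "n = \<lfloor>h (e / 2)\<rfloor>"
 have "connected (h ` {0<..<e})" by (intro connected_continuous_image ch) auto
 then have iv: "z \<in> h ` {0<..<e}" if "h s \<le> z" "z \<le> h t" "s \<in> {0<..<e}" "t \<in> {0<..<e}" for s t z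
  using that unfolding connected_iff_interval by blast
 have n: "of_int n < h t \<and> h t < of_int n + 1" if t: "0 < t" "t < e" for t
 proof -
  have m: "of_int n \<le> h (e / 2)" "h (e / 2) < of_int n + 1" "e / 2 \<in> {0<..<e}" using e by (auto simp: n_def)
  have "of_int n < h t"
  proof (rule ccontr)
   assume "\<not> of_int n < h t"
   then have "of_int n \<in> h ` {0<..<e}" using iv[of t "of_int n" "e / 2"] m t by auto
   then obtain t' where "of_int n = h t'" "t' \<in> {0<..<e}" by (rule imageE)
   then show False using nint[of t' n] by simp
  qed
  moreover have "h t < of_int n + 1"
  proof (rule ccontr)
   assume "\<not> h t < of_int n + 1"
   then have "of_int (n + 1) \<in> h ` {0<..<e}" using iv[of "e / 2" "of_int (n + 1)" t] m t by auto
   then obtain t' where "of_int (n + 1) = h t'" "t' \<in> {0<..<e}" by (rule imageE)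
   then show False using nint[of t' "n + 1"] by simp
  qed
  ultimately show ?thesis by simp
 qed
 define \<beta> where "\<beta> t = \<alpha>2 t - 2 * pi * of_int n" for t
 have "wedge e \<alpha>1 \<beta>"
 proof
  show "continuous_on {0<..<e} \<beta>" unfolding \<beta>_def by (intro continuous_intros c2)
  fix t assume t: "0 < t" "t < e"
  show "\<alpha>1 t < \<beta> t \<and> \<beta> t < \<alpha>1 t + 2 * pi" using n[OF t] by (simp add: h_def \<beta>_def field_simps)
 qed (use e c1 in auto)
 moreover have "{\<gamma>1 t, \<gamma>2 t} = {pol t (\<alpha>1 t), pol t (\<beta> t)}" if "0 \<le> t" "t < e" for t
 proof (cases "t = 0")
  case True
  then show ?thesis using \<gamma> by (simp add: definable_arc_def)
 next
  case False
  have "pol t (\<beta> t) = pol t (\<alpha>2 t)" using pol_shift[of t "\<beta> t" n] by (simp add: \<beta>_def)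
  then show ?thesis using a1(3)[of t] a2(3)[of t] that False by (simp add: e_def)
 qed
 ultimately show thesis by (rule that)
qed

text \<open>A converse of \<open>holder_triangle_sector\<close>. The triangle is one of the two
  wedges between its sides. Being contained in the sector, it misses the ray opposite to the
  bisector of the two slopes, and this singles out the wedge over the interval of slopes.\<close>

lemma holder_triangle_in_sector:
 assumes h: "holder_triangle S T \<gamma>1 \<gamma>2 \<beta>" and sub: "germ_subset T (sector \<phi> lo hi)"
  and bd: "EV t. -1 \<le> lo t \<and> hi t \<le> 1"
 obtains s1 s2 where "inS lo hi s1" "inS lo hi s2" "EV t. s1 t < s2 t"
  "germ_eq T (sector \<phi> s1 s2)" "ereal \<beta> = 1 + ord_diff s1 s2"
  "EV t. {\<gamma>1 t, \<gamma>2 t} = {pol t (ang \<phi> s1 t), pol t (ang \<phi> s2 t)}"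
proof -
 obtain C where \<gamma>: "definable_arc S \<gamma>1" "definable_arc S \<gamma>2" and t: "tord \<gamma>1 \<gamma>2 = ereal \<beta>"
  and C: "germ_component \<gamma>1 \<gamma>2 C" "germ_eq T (closure C)" using h unfolding holder_triangle_def by blast
 have "tord \<gamma>1 \<gamma>2 \<noteq> \<infinity>" using t by simp
 from arcs_wedge[OF \<gamma> this] obtain e a0 b0 where w0: "wedge e a0 b0"
  and g0: "\<And>\<rho>. 0 \<le> \<rho> \<Longrightarrow> \<rho> < e \<Longrightarrow> {\<gamma>1 \<rho>, \<gamma>2 \<rho>} = {pol \<rho> (a0 \<rho>), pol \<rho> (b0 \<rho>)}" by metis
 interpret w0: wedge e a0 b0 by (rule w0)
 obtain r0 where r0: "r0 > 0" "\<And>r. 0 < r \<Longrightarrow> r < r0 \<Longrightarrow> C \<inter> ball 0 r \<in> components (ball 0 r - (arc_image \<gamma>1 \<union> arc_image \<gamma>2))"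
  using C(1) unfolding germ_component_def eventually_at_right_field by blast
 define r where "r = min e r0 / 2"
 have r: "0 < r" "r \<le> e" "r < r0" using w0.e r0(1) by (auto simp: r_def min_def)
 have "C \<inter> ball 0 r \<in> {OW a0 b0 \<inter> ball 0 r, OW b0 (\<lambda>\<rho>. a0 \<rho> + 2 * pi) \<inter> ball 0 r}"
  using r0(2)[OF r(1,3)] w0.components_arcs[OF r(1,2), of \<gamma>1 \<gamma>2] g0 by simp
 then obtain a b where w: "wedge e a b" and g: "\<And>\<rho>. 0 \<le> \<rho> \<Longrightarrow> \<rho> < e \<Longrightarrow> {\<gamma>1 \<rho>, \<gamma>2 \<rho>} = {pol \<rho> (a \<rho>), pol \<rho> (b \<rho>)}"
  and Cw: "C \<inter> ball 0 r = OW a b \<inter> ball 0 r"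
 proof
  assume "C \<inter> ball 0 r = OW a0 b0 \<inter> ball 0 r"
  with w0 g0 show thesis by (rule that)
 next
  assume "C \<inter> ball 0 r \<in> {OW b0 (\<lambda>\<rho>. a0 \<rho> + 2 * pi) \<inter> ball 0 r}"
  then show thesis using g0 by (intro that[OF w0.co_wedge]) (auto simp: insert_commute)
 qed
 interpret w: wedge e a b by (rule w)
 have T: "germ_eq T (CW a b)"
  by (rule germ_eq_trans[OF C(2) germ_eq_ball[OF r(1) w.germ_closure[OF r(1,2) Cw]]])
 have in0: "EV t. \<forall>\<theta>. pol t \<theta> \<in> CW a b \<longrightarrow> pol t \<theta> \<in> sector \<phi> lo hi"
  using eventually_nhds_pol[OF T[unfolded germ_eq_def]] eventually_nhds_pol[OF sub[unfolded germ_subset_def]]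
  by eventually_elim blast
 have ed: "EV t. a t < b t \<and> b t < a t + 2 * pi \<and> {\<gamma>1 t, \<gamma>2 t} = {pol t (a t), pol t (b t)}"
  using ev_pos ev_less[OF w.e] by eventually_elim (use w.lt g in auto)
 have "EV t. \<gamma>1 t \<in> sector \<phi> lo hi \<and> \<gamma>2 t \<in> sector \<phi> lo hi" using in0 ed ev_pos
 proof eventually_elim
  case (elim t)
  have "pol t (a t) \<in> CW a b" "pol t (b t) \<in> CW a b" using elim(2,3) pol_in_CW_I[of t a _ b] by auto
  then have "{pol t (a t), pol t (b t)} \<subseteq> sector \<phi> lo hi" using elim(1) by blast
  then show ?case using elim(2) by blast
 qed
 then have in1: "EV t. \<gamma>1 t \<in> sector \<phi> lo hi" and in2: "EV t. \<gamma>2 t \<in> sector \<phi> lo hi"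
  by (auto elim: eventually_mono)
 obtain \<sigma>1 where \<sigma>1: "inS lo hi \<sigma>1" "EV t. \<gamma>1 t = pol t (ang \<phi> \<sigma>1 t)" by (rule arc_slope[OF \<gamma>(1) in1])
 obtain \<sigma>2 where \<sigma>2: "inS lo hi \<sigma>2" "EV t. \<gamma>2 t = pol t (ang \<phi> \<sigma>2 t)" by (rule arc_slope[OF \<gamma>(2) in2])
 note \<sigma> = \<sigma>1 \<sigma>2
 have ne: "EV t. \<sigma>1 t \<noteq> \<sigma>2 t" using \<sigma>(2,4) ed ev_pos
 proof eventually_elim
  case (elim t)
  have "pol t (a t) \<noteq> pol t (b t)" using pol_inj[of t "a t" "b t"] elim(3,4) by auto
  then have "\<gamma>1 t \<noteq> \<gamma>2 t" using elim(3) by (auto simp: doubleton_eq_iff)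
  then show ?case using elim by (auto simp: ang_def)
 qed
 \<comment> \<open>Which side has the smaller slope is the same for all small t, by the dichotomy
   for definable sets.\<close>
 have d: "drel1 (\<lambda>t. \<sigma>1 t < \<sigma>2 t)"
  using \<sigma>(1,3) unfolding drel1_def inS_def by (intro dpred_less dfun1_app[of \<sigma>1] dfun1_app[of \<sigma>2] dterm_var) auto
 obtain s1 s2 where s: "inS lo hi s1" "inS lo hi s2" "EV t. s1 t < s2 t"
  "EV t. {\<gamma>1 t, \<gamma>2 t} = {pol t (ang \<phi> s1 t), pol t (ang \<phi> s2 t)}"
  "EV t. norm (\<gamma>1 t - \<gamma>2 t) = norm (parc (ang \<phi> s1) t - parc (ang \<phi> s2) t)"
  using ev_dichotomy_right[OF d, of 0]
 proof
  assume lt: "EV t. \<sigma>1 t < \<sigma>2 t"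
  have "EV t. {\<gamma>1 t, \<gamma>2 t} = {pol t (ang \<phi> \<sigma>1 t), pol t (ang \<phi> \<sigma>2 t)}" using \<sigma>(2,4) by eventually_elim simp
  moreover have "EV t. norm (\<gamma>1 t - \<gamma>2 t) = norm (parc (ang \<phi> \<sigma>1) t - parc (ang \<phi> \<sigma>2) t)"
   using \<sigma>(2,4) by eventually_elim (simp add: parc_def)
  ultimately show thesis by (rule that[OF \<sigma>(1,3) lt])
 next
  assume "EV t. \<not> \<sigma>1 t < \<sigma>2 t"
  with ne have lt: "EV t. \<sigma>2 t < \<sigma>1 t" by eventually_elim auto
  have "EV t. {\<gamma>1 t, \<gamma>2 t} = {pol t (ang \<phi> \<sigma>2 t), pol t (ang \<phi> \<sigma>1 t)}"
   using \<sigma>(2,4) by eventually_elim (metis insert_commute)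
  moreover have "EV t. norm (\<gamma>1 t - \<gamma>2 t) = norm (parc (ang \<phi> \<sigma>2) t - parc (ang \<phi> \<sigma>1) t)"
   using \<sigma>(2,4) by eventually_elim (metis norm_minus_commute parc_def)
  ultimately show thesis by (rule that[OF \<sigma>(3,1) lt])
 qed
 have bds: "EV t. -1 \<le> s1 t \<and> s1 t < s2 t \<and> s2 t \<le> 1"
 proof -
  have "EV t. lo t \<le> s1 t" "EV t. s2 t \<le> hi t" using s(1,2) unfolding inS_def by (auto elim: eventually_mono)
  then show ?thesis using s(3) bd by eventually_elim simp
 qed
 have "EV t. \<forall>\<theta>. pol t \<theta> \<in> CW a b \<longleftrightarrow> pol t \<theta> \<in> sector \<phi> s1 s2" using bds s(4) in0 ed ev_pos bd
 proof eventually_elim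
  case (elim t)
  define A where "A = ang \<phi> s1 t"
  define B where "B = ang \<phi> s2 t"
  have q: "arctan (-1) \<le> arctan (s1 t)" "arctan (s1 t) < arctan (s2 t)" "arctan (s2 t) \<le> arctan 1"
   using elim(1) by (simp_all only: arctan_le_iff arctan_less_iff)
  then have AB: "\<phi> - pi / 4 \<le> A" "A < B" "B \<le> \<phi> + pi / 4"
   by (simp_all add: A_def B_def ang_def arctan_one arctan_minus)
  have no: "pol t \<theta> \<noteq> pol t ((A + B) / 2 + pi)" if "a t \<le> \<theta>" "\<theta> \<le> b t" for \<theta>
  proof
   assume eq: "pol t \<theta> = pol t ((A + B) / 2 + pi)"
   have "pol t \<theta> \<in> CW a b" using that elim(5) by (intro pol_in_CW_I)
   then have "pol t \<theta> \<in> sector \<phi> lo hi" using elim(3) by blast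
   then obtain \<sigma> where \<sigma>: "pol t \<theta> = pol t (\<phi> + arctan \<sigma>)" "lo t \<le> \<sigma>" "\<sigma> \<le> hi t"
    by (rule in_sector_arctan[OF elim(5)])
   have "arctan (-1) \<le> arctan \<sigma>" "arctan \<sigma> \<le> arctan 1" using \<sigma>(2,3) elim(6) unfolding arctan_le_iff by linarith+
   then have b: "- (pi / 4) \<le> arctan \<sigma>" "arctan \<sigma> \<le> pi / 4" by (simp_all add: arctan_one arctan_minus)
   have "(A + B) / 2 + pi = \<phi> + arctan \<sigma>"
   proof (rule pol_inj[OF elim(5)])
    show "pol t ((A + B) / 2 + pi) = pol t (\<phi> + arctan \<sigma>)" using eq \<sigma>(1) by simp
    show "\<bar>(A + B) / 2 + pi - (\<phi> + arctan \<sigma>)\<bar> < 2 * pi" using AB b pi_gt_zero by (simp add: abs_less_iff field_simps)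
   qed
   then show False using AB b pi_gt_zero by (simp add: field_simps)
  qed
  obtain n :: int where n: "a t = A + 2 * pi * of_int n" "b t = B + 2 * pi * of_int n"
   by (rule same_arcs[OF elim(5), of "a t" "b t" A B])
     (use elim(2,4) AB pi_gt_zero no in \<open>auto simp: A_def B_def\<close>)
  have "pol t \<theta> \<in> CW a b \<longleftrightarrow> pol t \<theta> \<in> sector \<phi> s1 s2" for \<theta>
  proof
   assume "pol t \<theta> \<in> CW a b"
   then obtain \<theta>' where \<theta>': "pol t \<theta> = pol t \<theta>'" "a t \<le> \<theta>'" "\<theta>' \<le> b t" using pol_in_CW[OF elim(5)] by blast
   have "pol t \<theta>' = pol t (\<theta>' - 2 * pi * of_int n)" using pol_shift[of t "\<theta>' - 2 * pi * of_int n" n] by simp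
   moreover have "A \<le> \<theta>' - 2 * pi * of_int n" "\<theta>' - 2 * pi * of_int n \<le> B" using \<theta>' n by auto
   ultimately show "pol t \<theta> \<in> sector \<phi> s1 s2" unfolding \<theta>'(1) A_def B_def by (simp add: pol_in_CW_I[OF elim(5)])
  next
   assume "pol t \<theta> \<in> sector \<phi> s1 s2"
   then obtain \<theta>' where \<theta>': "pol t \<theta> = pol t \<theta>'" "A \<le> \<theta>'" "\<theta>' \<le> B"
    using pol_in_CW[OF elim(5)] unfolding A_def B_def by blast
   have "pol t \<theta>' = pol t (\<theta>' + 2 * pi * of_int n)" by (rule pol_shift[symmetric])
   moreover have "a t \<le> \<theta>' + 2 * pi * of_int n" "\<theta>' + 2 * pi * of_int n \<le> b t" using \<theta>' n by auto
   ultimately show "pol t \<theta> \<in> CW a b" unfolding \<theta>'(1) by (simp add: pol_in_CW_I[OF elim(5)])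
  qed
  then show ?case ..
 qed
 from germ_pol[OF this] have "germ_eq (CW a b) (sector \<phi> s1 s2)"
  unfolding germ_eq_def by (simp add: CW_def)
 with T have Ts: "germ_eq T (sector \<phi> s1 s2)" by (rule germ_eq_trans)
 have "tord \<gamma>1 \<gamma>2 = tord (parc (ang \<phi> s1)) (parc (ang \<phi> s2))" unfolding tord_def by (rule order_cong[OF s(5)])
 also have "\<dots> = 1 + ord_diff s1 s2" using tord_parc[OF _ _ bds] s(1,2) by (simp add: inS_def)
 finally have "ereal \<beta> = 1 + ord_diff s1 s2" using t by simp
 from that[OF s(1-3) Ts this s(4)] show thesis .
qed

end

section \<open>Slices of a pizza\<close>

lemma arctan_diff_le:
 assumes "x < y" shows "arctan y - arctan x \<le> y - x"
proof -
 have "\<exists>z. x < z \<and> z < y \<and> arctan y - arctan x = (y - x) * inverse (1 + z\<^sup>2)"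
  by (rule MVT2[OF assms]) (rule DERIV_arctan)
 then obtain z where "arctan y - arctan x = (y - x) * inverse (1 + z\<^sup>2)" by blast
 moreover have "inverse (1 + z\<^sup>2) \<le> 1" by (rule inverse_le_1_iff[THEN iffD2]) simp
 then have "(y - x) * inverse (1 + z\<^sup>2) \<le> (y - x) * 1" using assms by (intro mult_left_mono) auto
 ultimately show ?thesis by simp
qed

context polynomially_bounded_ominimal_structure
begin

lemma order_pos:
 assumes h: "dfun1 h" and lim: "(h \<longlongrightarrow> 0) (at_right 0)" shows "0 < order_at_0 h" using h
proof (cases rule: order_cases)
 case 1
 then show ?thesis by simp
next
 case (2 r)
 obtain c C where c: "c > 0" "EV t. c * t powr r \<le> \<bar>h t\<bar> \<and> \<bar>h t\<bar> \<le> C * t powr r"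
  using ord_is_bounds[OF 2(2)] by metis
 have l: "EV t. \<bar>h t\<bar> < c" using lim c(1) by (auto simp: tendsto_iff dist_real_def)
 have "0 < r"
 proof (rule ccontr)
  assume r: "\<not> 0 < r"
  have "EV t. False" using c(2) l ev_pos ev_less[OF zero_less_one]
  proof eventually_elim
   case (elim t)
   have "1 \<le> t powr r" using elim(3,4) r powr_mono'[of r 0 t] by simp
   then have "c * 1 \<le> c * t powr r" using c(1) by (intro mult_left_mono) auto
   then show ?case using elim by simp
  qed
  then show False by simp
 qed
 then show ?thesis using 2(3) by simp
qed

lemma slope_unique:
 assumes "EV t. pol t (ang \<phi> s t) = pol t (ang \<phi> s' t)" shows "EV t. s t = s' t" using assms ev_pos
proof eventually_elim
 case (elim t)
 then show ?case using slope_formula[of t \<phi> "s t"] slope_formula[of t \<phi> "s' t"] by (simp add: ang_def)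
qed

lemma inS_cong: "inS lo hi s \<Longrightarrow> EV t. s t = s' t \<Longrightarrow> dfun1 s' \<Longrightarrow> inS lo hi s'"
 unfolding inS_def by (auto elim: eventually_elim2)

lemma good_sliceD:
 assumes "good_slice g x y" shows "dfun1 x" "dfun1 y" "EV t. x t < y t"
  "\<And>s1 s s2. inS x y s1 \<Longrightarrow> inS x y s2 \<Longrightarrow> inS s1 s2 s \<Longrightarrow> ordg g s1 = ordg g s2 \<Longrightarrow> ordg g s = ordg g s1"
  "sign_definite g x y"
  "Qs g x y = seg (ordg g x) (ordg g y)"
  "\<exists>\<mu>. affine_width S (Qs g x y) \<mu> \<and> min (\<mu> (ordg g x)) (\<mu> (ordg g y)) = 1 + ord_diff x y \<and>
    (\<forall>s. inS x y s \<longrightarrow> width g x y s = \<mu> (ordg g s))"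
 using assms unfolding good_slice_def by blast+

lemma in_open_sector:
 assumes "0 < t" "z = pol t \<theta>" "ang \<phi> x t < \<theta>" "\<theta> < ang \<phi> y t"
 obtains \<sigma> where "z = pol t (\<phi> + arctan \<sigma>)" "x t < \<sigma>" "\<sigma> < y t"
proof -
 have b: "- (pi / 2) < \<theta> - \<phi>" "\<theta> - \<phi> < pi / 2"
  using assms(3,4) arctan_lbound[of "x t"] arctan_ubound[of "y t"] unfolding ang_def by linarith+
 then have a: "arctan (tan (\<theta> - \<phi>)) = \<theta> - \<phi>" by (intro arctan_tan) auto
 have "arctan (x t) < arctan (tan (\<theta> - \<phi>))" "arctan (tan (\<theta> - \<phi>)) < arctan (y t)"
  unfolding a using assms(3,4) by (auto simp: ang_def)
 moreover have "z = pol t (\<phi> + arctan (tan (\<theta> - \<phi>)))" unfolding a using assms(2) by simp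
 ultimately show thesis using that[of "tan (\<theta> - \<phi>)"] unfolding arctan_less_iff by blast
qed

end

text \<open>\<open>F\<close> is a total definable function that agrees with f near the origin, where
  alone f is known to be definable.\<close>

locale plane_germ = polynomially_bounded_ominimal_structure +
 fixes f F :: "real \<times> real \<Rightarrow> real" and \<epsilon> :: real
 assumes eps: "0 < \<epsilon>" and contf: "continuous_on (ball 0 \<epsilon>) f" and f0: "f 0 = 0"
  and dF: "dfun2 (\<lambda>x y. F (x, y))" and Ff: "\<And>z. norm z < \<epsilon> \<Longrightarrow> F z = f z"
begin

text \<open>The absolute value gives the nonnegativity used on the monotone pieces and leaves all
  orders unchanged; the signs of f are recovered afterwards by connectedness.\<close>

definition G :: "real \<Rightarrow> real \<Rightarrow> real \<Rightarrow> real" where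
 "G \<phi> t s = \<bar>F (pol t (\<phi> + arctan s))\<bar>"

lemma dterm_F:
 assumes "dterm a" "dterm b" shows "dterm (\<lambda>e. F (pol (a e) (\<phi> + arctan (b e))))"
 unfolding pol_def by (intro dfun2_app[OF dF] dterm_mult dterm_ang assms)

lemma dG: "dfun2 (G \<phi>)"
 unfolding dfun2_def G_def by (intro dterm_abs dterm_F dterm_var)

lemma F_eq: "EV t. \<forall>\<theta>. F (pol t \<theta>) = f (pol t \<theta>)"
 using ev_pos ev_less[OF eps] by eventually_elim (simp add: Ff)

lemma G_cont: "EV t. continuous_on {-1..1} (G \<phi> t)"
 using ev_pos ev_less[OF eps]
proof eventually_elim
 case (elim t)
 have "continuous_on {-1..1} (\<lambda>s. \<bar>f (pol t (\<phi> + arctan s))\<bar>)"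
  by (intro continuous_intros continuous_on_compose2[OF contf]) (use elim in auto)
 then show ?case unfolding G_def using elim by (simp add: Ff)
qed

lemma f_tendsto: "(f \<longlongrightarrow> 0) (nhds 0)"
 using contf eps f0 by (metis centre_in_ball continuous_on_eq_continuous_at isContD open_ball tendsto_at_iff_tendsto_nhds)

lemma F_small: assumes "dfun1 s" shows "((\<lambda>t. F (pol t (\<phi> + arctan (s t)))) \<longlongrightarrow> 0) (at_right 0)"
proof -
 have n: "((\<lambda>t. norm (pol t (\<phi> + arctan (s t)))) \<longlongrightarrow> 0) (at_right 0)"
  unfolding norm_pol by (rule tendsto_eq_intros refl)+ simp
 have "((\<lambda>t. f (pol t (\<phi> + arctan (s t)))) \<longlongrightarrow> 0) (at_right 0)"
  by (rule filterlim_compose[OF f_tendsto tendsto_norm_zero_cancel[OF n]])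
 moreover have "EV t. f (pol t (\<phi> + arctan (s t))) = F (pol t (\<phi> + arctan (s t)))"
  using F_eq by eventually_elim simp
 ultimately show ?thesis by (rule Lim_transform_eventually)
qed

lemma dF_slope: "dfun1 s \<Longrightarrow> dfun1 (\<lambda>t. F (pol t (\<phi> + arctan (s t))))"
 unfolding dfun1_def[of "\<lambda>t. F (pol t (\<phi> + arctan (s t)))"] by (intro dterm_F dterm_var dfun1_app[of s])

lemma ordg_G: "dfun1 s \<Longrightarrow> ordg (G \<phi>) s = order_at_0 (\<lambda>t. F (pol t (\<phi> + arctan (s t))))"
 unfolding ordg_def G_def by (rule order_abs[OF dF_slope])

lemma G_small: "dfun1 s \<Longrightarrow> 0 < ordg (G \<phi>) s"
 using order_pos[OF dF_slope F_small] ordg_G by simp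

lemma ord_along_slope:
 assumes "dfun1 s" "EV t. \<delta> t = pol t (ang \<phi> s t)" shows "ord_along f \<delta> = ordg (G \<phi>) s"
 unfolding ord_along_def ordg_G[OF assms(1)]
proof (rule order_cong)
 show "EV t. f (\<delta> t) = F (pol t (\<phi> + arctan (s t)))"
  using assms(2) F_eq by eventually_elim (simp add: ang_def)
qed

lemma ord_along_parc: "dfun1 s \<Longrightarrow> ord_along f (parc (ang \<phi> s)) = ordg (G \<phi>) s"
 by (rule ord_along_slope) (simp_all add: parc_def)

lemma sector_chain_G: "(good_slice (G \<phi>))\<^sup>*\<^sup>* (\<lambda>t. -1) (\<lambda>t. 1)"
 by (rule sector_chain[OF dG G_cont]) (auto simp: G_def[abs_def] inS_def intro: G_small[unfolded G_def[abs_def]])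

lemma Q_sector:
 assumes T: "germ_eq T (sector \<phi> lo hi)" shows "Q_of S f T = Qs (G \<phi>) lo hi"
proof (intro subset_antisym subsetI)
 fix q assume "q \<in> Q_of S f T"
 then obtain \<delta> where \<delta>: "q = ord_along f \<delta>" "arc_in S \<delta> T" unfolding Q_of_def by blast
 then obtain s where "inS lo hi s" "EV t. \<delta> t = pol t (ang \<phi> s t)" using arc_in_sector_iff[OF T] by blast
 then show "q \<in> Qs (G \<phi>) lo hi" using \<delta>(1) ord_along_slope unfolding Qs_def inS_def by blast
next
 fix q assume "q \<in> Qs (G \<phi>) lo hi"
 then obtain s where s: "q = ordg (G \<phi>) s" "inS lo hi s" unfolding Qs_def by blast
 then have d: "dfun1 s" by (simp add: inS_def)
 have "EV t. parc (ang \<phi> s) t = pol t (ang \<phi> s t)" by (simp add: parc_def)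
 then have "arc_in S (parc (ang \<phi> s)) T" using arc_in_sector_iff[OF T] definable_arc_parc[OF d] s(2) by blast
 moreover have "q = ord_along f (parc (ang \<phi> s))" using s(1) ord_along_parc[OF d] by simp
 ultimately show "q \<in> Q_of S f T" unfolding Q_of_def by blast
qed

lemma germ_subset_sector:
 assumes "inS x y s1" "inS x y s2" shows "germ_subset (sector \<phi> s1 s2) (sector \<phi> x y)"
proof -
 have "EV t. \<forall>\<theta>. pol t \<theta> \<in> sector \<phi> s1 s2 \<longrightarrow> pol t \<theta> \<in> sector \<phi> x y"
  using assms[unfolded inS_def, THEN conjunct2] ev_pos
 proof eventually_elim
  case (elim t)
  have "ang \<phi> x t \<le> ang \<phi> s1 t" "ang \<phi> s2 t \<le> ang \<phi> y t" using elim by (simp_all add: ang_def arctan_le_iff)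
  then show ?case unfolding pol_in_CW[OF elim(3)] by (meson order_trans)
 qed
 from germ_pol[OF this] show ?thesis unfolding germ_subset_def by (simp add: CW_def)
qed

text \<open>Triangles inside the sector correspond to pairs of slopes with the same exponents and
  the same sets \<open>Q\<close>, so both infima are over the same set.\<close>

lemma width_sector:
 assumes d: "dfun1 x" "dfun1 y" and xy: "EV t. -1 \<le> x t \<and> x t < y t \<and> y t \<le> 1"
  and \<delta>: "definable_arc S \<delta>" "EV t. \<delta> t = pol t (ang \<phi> s t)" and s: "inS x y s"
 shows "relative_width S f (sector \<phi> x y) \<delta> = width (G \<phi>) x y s"
proof -
 have bd: "EV t. -1 \<le> x t \<and> y t \<le> 1" using xy by eventually_elim simp
 have ds: "dfun1 s" using s by (simp add: inS_def)
 have "{ereal \<beta> | \<beta> T' \<gamma>\<^sub>1 \<gamma>\<^sub>2. holder_triangle S T' \<gamma>\<^sub>1 \<gamma>\<^sub>2 \<beta> \<and> arc_in S \<delta> T' \<and>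
   germ_subset T' (sector \<phi> x y) \<and> (\<exists>q. Q_of S f T' = {q})} =
  {1 + ord_diff s1 s2 | s1 s2. inS x y s1 \<and> inS x y s2 \<and>
   (EV t. s1 t < s2 t) \<and> inS s1 s2 s \<and> (\<exists>q. Qs (G \<phi>) s1 s2 = {q})}" (is "?A = ?B")
 proof (intro subset_antisym subsetI)
  fix w assume "w \<in> ?A"
  then obtain \<beta> T' \<gamma>1 \<gamma>2 q where w: "w = ereal \<beta>" and h: "holder_triangle S T' \<gamma>1 \<gamma>2 \<beta>" and i: "arc_in S \<delta> T'"
   and sub: "germ_subset T' (sector \<phi> x y)" and q: "Q_of S f T' = {q}" by blast
  from holder_triangle_in_sector[OF h sub bd] obtain s1 s2 where 1: "inS x y s1" "inS x y s2" "EV t. s1 t < s2 t"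
   "germ_eq T' (sector \<phi> s1 s2)" "ereal \<beta> = 1 + ord_diff s1 s2" by blast
  obtain s' where s': "inS s1 s2 s'" "EV t. \<delta> t = pol t (ang \<phi> s' t)" using i arc_in_sector_iff[OF 1(4)] by blast
  have "EV t. pol t (ang \<phi> s' t) = pol t (ang \<phi> s t)" using s'(2) \<delta>(2) by eventually_elim simp
  then have "inS s1 s2 s" using inS_cong[OF s'(1) slope_unique ds] by blast
  moreover have "Qs (G \<phi>) s1 s2 = {q}" using Q_sector[OF 1(4)] q by simp
  ultimately show "w \<in> ?B" using w 1 by blast
 next
  fix w assume "w \<in> ?B"
  then obtain s1 s2 q where w: "w = 1 + ord_diff s1 s2" and 1: "inS x y s1" "inS x y s2" "EV t. s1 t < s2 t"
   and 2: "inS s1 s2 s" and q: "Qs (G \<phi>) s1 s2 = {q}" by blast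
  have d12: "dfun1 s1" "dfun1 s2" using 1 by (simp_all add: inS_def)
  obtain p where "ord_diff s1 s2 = ereal p" by (rule order_diff_finite[OF d12 1(3)])
  then have w': "ereal (1 + p) = 1 + ord_diff s1 s2" by simp
  have "EV t. -1 \<le> s1 t \<and> s1 t < s2 t \<and> s2 t \<le> 1"
   using 1(1,2)[unfolded inS_def, THEN conjunct2] 1(3) bd by eventually_elim simp
  then have "holder_triangle S (sector \<phi> s1 s2) (parc (ang \<phi> s1)) (parc (ang \<phi> s2)) (1 + p)"
   using w' by (intro holder_triangle_sector d12) (simp_all add: germ_eq_def)
  moreover have "arc_in S \<delta> (sector \<phi> s1 s2)"
   using \<delta> 2 by (subst arc_in_sector_iff) (auto simp: germ_eq_def)
  moreover have "Q_of S f (sector \<phi> s1 s2) = {q}" using q by (subst Q_sector) (auto simp: germ_eq_def)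
  moreover have "w = ereal (1 + p)" using w w' by simp
  ultimately show "w \<in> ?A" using germ_subset_sector[OF 1(1,2)] by blast
 qed
 then show ?thesis unfolding relative_width_def width_def by simp
qed

lemma elementary_sector:
 assumes g: "good_slice (G \<phi>) x y" and bd: "EV t. -1 \<le> x t \<and> y t \<le> 1"
 shows "elementary S f (sector \<phi> x y)"
 unfolding elementary_def
proof (intro allI impI, elim conjE)
 fix \<gamma>1 \<gamma>2 T' \<beta>' q \<gamma>
 assume q: "ord_along f \<gamma>1 = q" "ord_along f \<gamma>2 = q" and h: "holder_triangle S T' \<gamma>1 \<gamma>2 \<beta>'"
  and sub: "germ_subset T' (sector \<phi> x y)" and \<gamma>: "arc_in S \<gamma> T'"
  and a: "arc_in S \<gamma>1 (sector \<phi> x y)" "arc_in S \<gamma>2 (sector \<phi> x y)"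
 have refl: "germ_eq T T" for T by (simp add: germ_eq_def)
 from holder_triangle_in_sector[OF h sub bd] obtain s1 s2 where 1: "inS x y s1" "inS x y s2" "EV t. s1 t < s2 t"
  "germ_eq T' (sector \<phi> s1 s2)" "EV t. {\<gamma>1 t, \<gamma>2 t} = {pol t (ang \<phi> s1 t), pol t (ang \<phi> s2 t)}" by blast
 obtain u1 where u1: "inS x y u1" "EV t. \<gamma>1 t = pol t (ang \<phi> u1 t)" using a(1) arc_in_sector_iff[OF refl] by blast
 obtain u2 where u2: "inS x y u2" "EV t. \<gamma>2 t = pol t (ang \<phi> u2 t)" using a(2) arc_in_sector_iff[OF refl] by blast
 have d: "dfun1 s1" "dfun1 s2" "dfun1 u1" "dfun1 u2" using 1 u1 u2 by (simp_all add: inS_def)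
 have o: "ordg (G \<phi>) u1 = q" "ordg (G \<phi>) u2 = q" using q ord_along_slope[OF d(3) u1(2)] ord_along_slope[OF d(4) u2(2)] by simp_all
 have c: "EV t. (s1 t = u1 t \<and> s2 t = u2 t) \<or> (s1 t = u2 t \<and> s2 t = u1 t)" using 1(5) u1(2) u2(2) ev_pos
 proof eventually_elim
  case (elim t)
  have inj: "u t = v t" if "pol t (ang \<phi> u t) = pol t (ang \<phi> v t)" for u v
   using that slope_formula[OF elim(4), of \<phi> "u t"] slope_formula[OF elim(4), of \<phi> "v t"] by (simp add: ang_def)
  show ?case using elim(1-3) inj by (auto simp: doubleton_eq_iff)
 qed
 \<comment> \<open>The sides may carry the two slopes in either order. The dichotomy selects one
   order for all small t, and both give the order q at s1 and s2.\<close>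
 have dr: "drel1 (\<lambda>t. s1 t = u1 t \<and> s2 t = u2 t)"
  unfolding drel1_def by (intro dpred_conj dpred_eq dfun1_app[OF d(1)] dfun1_app[OF d(2)] dfun1_app[OF d(3)] dfun1_app[OF d(4)] dterm_var)
 have eqo: "ordg (G \<phi>) u = ordg (G \<phi>) v" if "EV t. u t = v t" for u v
  unfolding ordg_def by (rule order_cong) (use that in eventually_elim, simp)
 have oo: "ordg (G \<phi>) s1 = q \<and> ordg (G \<phi>) s2 = q" using ev_dichotomy_right[OF dr, of 0]
 proof
  assume e: "EV t. s1 t = u1 t \<and> s2 t = u2 t"
  have "EV t. s1 t = u1 t" "EV t. s2 t = u2 t" using e by (auto elim: eventually_mono)
  then show ?thesis using eqo o by metis
 next
  assume e: "EV t. \<not> (s1 t = u1 t \<and> s2 t = u2 t)"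
  have "EV t. s1 t = u2 t" "EV t. s2 t = u1 t" using e c by (eventually_elim, blast)+
  then show ?thesis using eqo o by metis
 qed
 obtain s where s: "inS s1 s2 s" "EV t. \<gamma> t = pol t (ang \<phi> s t)" using \<gamma> arc_in_sector_iff[OF 1(4)] by blast
 have "ordg (G \<phi>) s = ordg (G \<phi>) s1" using good_sliceD(4)[OF g 1(1,2) s(1)] oo by simp
 then show "ord_along f \<gamma> = q" using ord_along_slope[OF _ s(2)] s(1) oo by (simp add: inS_def)
qed

text \<open>On the open wedge \<open>G\<close> vanishes identically or nowhere, and in the second
  case connectedness fixes the sign of f. The weaker statement on the closed wedge serves to compare
  the signs of adjacent slices on their common arc.\<close>

lemma sign_sector:
 assumes g: "good_slice (G \<phi>) x y" and bd: "EV t. -1 \<le> x t \<and> y t \<le> 1"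
 obtains \<sigma> :: int where "\<sigma> \<in> {-1, 0, 1}"
  "\<forall>\<^sub>F z in nhds 0. (z \<in> osector \<phi> x y \<longrightarrow> sgn (f z) = of_int \<sigma>) \<and>
    (z \<in> sector \<phi> x y \<longrightarrow> sgn (f z) \<in> {0, of_int \<sigma>})"
proof -
 note gD = good_sliceD[OF g]
 have xy: "EV t. -1 \<le> x t \<and> x t < y t \<and> y t \<le> 1" using gD(3) bd by eventually_elim simp
 obtain e where w: "wedge e (ang \<phi> x) (ang \<phi> y)" using sector_wedge[OF gD(1,2) xy] by metis
 interpret w: wedge e "ang \<phi> x" "ang \<phi> y" by (rule w)
 have "\<exists>r. 0 < r \<and> r \<le> e \<and> r \<le> \<epsilon> \<and> ((\<forall>z\<in>osector \<phi> x y \<inter> ball 0 r. f z = 0) \<or> (\<forall>z\<in>osector \<phi> x y \<inter> ball 0 r. f z \<noteq> 0))"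
 proof -
  have main: "\<exists>r. 0 < r \<and> r \<le> e \<and> r \<le> \<epsilon> \<and> (\<forall>z\<in>osector \<phi> x y \<inter> ball 0 r. P (f z))"
   if G: "EV t. \<forall>s. x t < s \<longrightarrow> s < y t \<longrightarrow> Q (G \<phi> t s)" and PQ: "\<And>z. Q \<bar>z\<bar> \<Longrightarrow> P z" for P Q
  proof -
   obtain r0 where r0: "0 < r0" "\<And>t s. 0 < t \<Longrightarrow> t < r0 \<Longrightarrow> x t < s \<Longrightarrow> s < y t \<Longrightarrow> Q (G \<phi> t s)"
    using G unfolding eventually_at_right_field by blast
   define r where "r = min r0 (min e \<epsilon>)"
   have r: "0 < r" "r \<le> e" "r \<le> \<epsilon>" "r \<le> r0" using r0(1) w.e eps by (auto simp: r_def)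
   have "P (f z)" if z: "z \<in> osector \<phi> x y \<inter> ball 0 r" for z
   proof -
    obtain \<rho> \<theta> where p: "z = pol \<rho> \<theta>" "0 < \<rho>" "ang \<phi> x \<rho> < \<theta>" "\<theta> < ang \<phi> y \<rho>" using z unfolding OW_def by blast
    then have \<rho>: "\<rho> < r" using z by simp
    obtain \<sigma> where \<sigma>: "z = pol \<rho> (\<phi> + arctan \<sigma>)" "x \<rho> < \<sigma>" "\<sigma> < y \<rho>" by (rule in_open_sector[OF p(2,1,3,4)])
    have "Q (G \<phi> \<rho> \<sigma>)" using r0(2)[of \<rho> \<sigma>] \<rho> r p(2) \<sigma> by simp
    moreover have "G \<phi> \<rho> \<sigma> = \<bar>f z\<bar>" using Ff[of z] z r(3) by (simp add: G_def \<sigma>(1))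
    ultimately show ?thesis using PQ by simp
   qed
   then show ?thesis using r by blast
  qed
  from gD(5) show ?thesis using main[of "\<lambda>z. z = 0" "\<lambda>z. z = 0"] main[of "\<lambda>z. z \<noteq> 0" "\<lambda>z. z \<noteq> 0"] by auto
 qed
 then obtain r where r: "0 < r" "r \<le> e" "r \<le> \<epsilon>"
  "(\<forall>z\<in>osector \<phi> x y \<inter> ball 0 r. f z = 0) \<or> (\<forall>z\<in>osector \<phi> x y \<inter> ball 0 r. f z \<noteq> 0)" by blast
 define W where "W = osector \<phi> x y \<inter> ball 0 r"
 obtain z0 where z0: "z0 \<in> W" using w.nonempty_OW[OF r(2,1)] unfolding W_def by blast
 have cW: "continuous_on W f" by (rule continuous_on_subset[OF contf]) (use r(3) in \<open>auto simp: W_def\<close>)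
 have "connected (f ` W)" using w.connected_OW[OF r(2)] cW unfolding W_def by (intro connected_continuous_image)
 then have iv: "u \<in> f ` W" if "f a \<le> u" "u \<le> f b" "a \<in> W" "b \<in> W" for a b u
  using that unfolding connected_iff_interval by blast
 have same: "sgn (f z) = sgn (f z0)" if z: "z \<in> W" for z using r(4)
 using z z0 iv[of z 0 z0] iv[of z0 0 z] by (fastforce simp: W_def sgn_if)
 define \<sigma> :: int where "\<sigma> = (if f z0 > 0 then 1 else if f z0 = 0 then 0 else -1)"
 have \<sigma>: "sgn (f z0) = of_int \<sigma>" "\<sigma> \<in> {-1, 0, 1}" by (auto simp: \<sigma>_def sgn_if)
 have cl: "sgn (f z) \<in> {0, of_int \<sigma>}" if z: "z \<in> sector \<phi> x y" "norm z < r" for z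
 proof (rule ccontr)
  assume n: "sgn (f z) \<notin> {0, of_int \<sigma>}"
  define \<tau> where "\<tau> = sgn (f z)"
  have "continuous_on (ball 0 r) (\<lambda>w. \<tau> * f w)"
   by (intro continuous_intros continuous_on_subset[OF contf]) (use r(3) in auto)
  then have "open (ball 0 r \<inter> (\<lambda>w. \<tau> * f w) -` {0<..})" by (rule continuous_open_preimage) auto
  moreover have "z \<in> ball 0 r \<inter> (\<lambda>w. \<tau> * f w) -` {0<..}" using n z(2) by (auto simp: \<tau>_def sgn_if)
  moreover have "z \<in> ball 0 r \<inter> sector \<phi> x y" using z by simp
  then have "z \<in> closure W" using w.closure_OW[OF r(1,2)] unfolding W_def by blast
  ultimately have "ball 0 r \<inter> (\<lambda>w. \<tau> * f w) -` {0<..} \<inter> W \<noteq> {}"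
   using open_Int_closure_eq_empty[of "ball 0 r \<inter> (\<lambda>w. \<tau> * f w) -` {0<..}" W] by blast
  then obtain v where v: "v \<in> W" "0 < \<tau> * f v" by auto
  then have "sgn (f v) = \<tau>" by (auto simp: \<tau>_def sgn_if split: if_splits)
  then show False using same[OF v(1)] \<sigma>(1) n by (simp add: \<tau>_def)
 qed
 have "\<forall>\<^sub>F z in nhds 0. (z \<in> osector \<phi> x y \<longrightarrow> sgn (f z) = of_int \<sigma>) \<and>
    (z \<in> sector \<phi> x y \<longrightarrow> sgn (f z) \<in> {0, of_int \<sigma>})"
  using ball_germ[OF r(1)]
 proof eventually_elim
  case (elim z)
  then show ?case using same[of z] \<sigma>(1) cl[of z] by (simp add: W_def)
 qed
 with \<sigma>(2) show thesis by (rule that)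
qed

text \<open>The local conditions of a pizza for one slice, in terms of angles and not of slopes,
  because neighbouring sectors have different directions \<phi>. The angle of a slice with exponent
  above 1 tends to 0; this is recorded in order to find an exponent 1 in the end.\<close>

definition piece :: "(real \<Rightarrow> real) \<Rightarrow> (real \<Rightarrow> real) \<Rightarrow> pizza_slice \<Rightarrow> bool" where
 "piece \<alpha> \<beta> h \<longleftrightarrow> (\<exists>e. wedge e \<alpha> \<beta>) \<and> (EV t. \<alpha> t < \<beta> t \<and> \<beta> t \<le> \<alpha> t + pi / 2) \<and>
   holder_triangle S (CW \<alpha> \<beta>) (parc \<alpha>) (parc \<beta>) (slice_exponent h) \<and>
   slice_exponent h \<in> \<FF> \<and> 1 \<le> slice_exponent h \<and>
   (1 < slice_exponent h \<longrightarrow> ((\<lambda>t. \<beta> t - \<alpha> t) \<longlongrightarrow> 0) (at_right 0)) \<and>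
   elementary S f (CW \<alpha> \<beta>) \<and> slice_segment S h = Q_of S f (CW \<alpha> \<beta>) \<and>
   q0 h = ord_along f (parc \<alpha>) \<and> q1 h = ord_along f (parc \<beta>) \<and>
   q0 h \<in> order_values S \<and> q1 h \<in> order_values S \<and>
   (\<forall>\<delta>. arc_in S \<delta> (CW \<alpha> \<beta>) \<longrightarrow> relative_width S f (CW \<alpha> \<beta>) \<delta> = slice_width h (ord_along f \<delta>)) \<and>
   affine_width S (slice_segment S h) (slice_width h) \<and>
   min (slice_width h (q0 h)) (slice_width h (q1 h)) = ereal (slice_exponent h) \<and>
   slice_sign h \<in> {-1, 0, 1} \<and>
   (\<forall>\<^sub>F z in nhds 0. (z \<in> OW \<alpha> \<beta> \<longrightarrow> sgn (f z) = of_int (slice_sign h)) \<and>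
    (z \<in> CW \<alpha> \<beta> \<longrightarrow> sgn (f z) \<in> {0, of_int (slice_sign h)}))"

lemma good_piece:
 assumes g: "good_slice (G \<phi>) x y" and bd: "EV t. -1 \<le> x t \<and> y t \<le> 1"
 shows "\<exists>h. piece (ang \<phi> x) (ang \<phi> y) h"
proof -
 note gD = good_sliceD[OF g]
 have xy: "EV t. -1 \<le> x t \<and> x t < y t \<and> y t \<le> 1" using gD(3) bd by eventually_elim simp
 have refl: "germ_eq T T" for T by (simp add: germ_eq_def)
 obtain \<mu> where \<mu>: "affine_width S (Qs (G \<phi>) x y) \<mu>"
  "min (\<mu> (ordg (G \<phi>) x)) (\<mu> (ordg (G \<phi>) y)) = 1 + ord_diff x y"
  "\<And>s. inS x y s \<Longrightarrow> width (G \<phi>) x y s = \<mu> (ordg (G \<phi>) s)" using gD(7) by blast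
 obtain \<sigma> :: int where \<sigma>: "\<sigma> \<in> {-1, 0, 1}"
  "\<forall>\<^sub>F z in nhds 0. (z \<in> osector \<phi> x y \<longrightarrow> sgn (f z) = of_int \<sigma>) \<and>
    (z \<in> sector \<phi> x y \<longrightarrow> sgn (f z) \<in> {0, of_int \<sigma>})" by (rule sign_sector[OF g bd])
 obtain p where p: "p \<in> \<FF>" "ord_diff x y = ereal p" by (rule order_diff_finite[OF gD(1-3)])
 have dyx: "dfun1 (\<lambda>t. y t - x t)" by (rule dfun1_diff[OF gD(2,1)])
 have "EV t. \<bar>y t - x t\<bar> \<le> 2 * t powr 0" using xy ev_pos by eventually_elim simp
 then have "ereal 0 \<le> ord_diff x y" using order_ge_iff[OF dyx, of 0] by blast
 then have p0: "0 \<le> p" using p(2) by simp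
 define h where "h = \<lparr>slice_exponent = 1 + p, q0 = ordg (G \<phi>) x, q1 = ordg (G \<phi>) y, slice_sign = \<sigma>, slice_width = \<mu>\<rparr>"
 have seg: "slice_segment S h = Qs (G \<phi>) x y" unfolding gD(6) by (simp add: slice_segment_def seg_def h_def)
 have vals: "ordg (G \<phi>) s \<in> order_values S" if "dfun1 s" for s
 proof (cases "ordg (G \<phi>) s")
  case (real q)
  then have "q \<in> \<FF>" using order_finite(1)[OF dF_slope[OF that, of \<phi>]] ordg_G[OF that, of \<phi>] by simp
  then show ?thesis using G_small[OF that, of \<phi>] real by (simp add: order_values_iff)
 qed (use G_small[OF that, of \<phi>] in \<open>simp_all add: order_values_iff\<close>)
 have "piece (ang \<phi> x) (ang \<phi> y) h" unfolding piece_def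
 proof (intro conjI allI impI)
  show "\<exists>e. wedge e (ang \<phi> x) (ang \<phi> y)" using sector_wedge[OF gD(1,2) xy] by metis
  show "EV t. ang \<phi> x t < ang \<phi> y t \<and> ang \<phi> y t \<le> ang \<phi> x t + pi / 2" using xy
  proof eventually_elim
   case (elim t)
   have "arctan (-1) \<le> arctan (x t)" "arctan (x t) < arctan (y t)" "arctan (y t) \<le> arctan 1"
    using elim by (simp_all only: arctan_le_iff arctan_less_iff)
   then show ?case by (simp add: ang_def arctan_one arctan_minus)
  qed
  show "holder_triangle S (sector \<phi> x y) (parc (ang \<phi> x)) (parc (ang \<phi> y)) (slice_exponent h)"
   by (rule holder_triangle_sector[OF gD(1,2) xy refl]) (simp add: h_def p(2))
  show "slice_exponent h \<in> \<FF>" using p(1) by (simp add: h_def FF_add FF_1)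
  show "1 \<le> slice_exponent h" using p0 by (simp add: h_def)
  show "elementary S f (sector \<phi> x y)" by (rule elementary_sector[OF g bd])
  show "slice_segment S h = Q_of S f (sector \<phi> x y)" unfolding seg Q_sector[OF refl] ..
  show "q0 h = ord_along f (parc (ang \<phi> x))" "q1 h = ord_along f (parc (ang \<phi> y))"
   using ord_along_parc gD(1,2) by (simp_all add: h_def)
  show "q0 h \<in> order_values S" "q1 h \<in> order_values S" using vals gD(1,2) by (simp_all add: h_def)
  show "affine_width S (slice_segment S h) (slice_width h)" unfolding seg using \<mu>(1) by (simp add: h_def)
  show "min (slice_width h (q0 h)) (slice_width h (q1 h)) = ereal (slice_exponent h)" using \<mu>(2) p(2) by (simp add: h_def)
  show "slice_sign h \<in> {-1, 0, 1}" using \<sigma>(1) by (simp add: h_def)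
  show "\<forall>\<^sub>F z in nhds 0. (z \<in> osector \<phi> x y \<longrightarrow> sgn (f z) = of_int (slice_sign h)) \<and>
    (z \<in> sector \<phi> x y \<longrightarrow> sgn (f z) \<in> {0, of_int (slice_sign h)})" using \<sigma>(2) by (simp add: h_def)
 next
  fix \<delta> assume a: "arc_in S \<delta> (sector \<phi> x y)"
  then obtain s where s: "definable_arc S \<delta>" "inS x y s" "EV t. \<delta> t = pol t (ang \<phi> s t)" using arc_in_sector_iff[OF refl] by blast
  have "relative_width S f (sector \<phi> x y) \<delta> = \<mu> (ordg (G \<phi>) s)"
   using width_sector[OF gD(1,2) xy s(1,3,2)] \<mu>(3)[OF s(2)] by simp
  also have "ordg (G \<phi>) s = ord_along f \<delta>" using ord_along_slope[OF _ s(3)] s(2) by (simp add: inS_def)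
  finally show "relative_width S f (sector \<phi> x y) \<delta> = slice_width h (ord_along f \<delta>)" by (simp add: h_def)
 next
  assume "1 < slice_exponent h"
  then have "ereal 0 < ord_diff x y" using p(2) by (simp add: h_def)
  \<comment> \<open>An exponent above 1 means that y - x has positive order, and y - x bounds the
    angle.\<close>
  note small = order_gt_small[OF dyx this]
  show "((\<lambda>t. ang \<phi> y t - ang \<phi> x t) \<longlongrightarrow> 0) (at_right 0)" unfolding tendsto_iff
  proof (intro allI impI)
   fix d :: real assume d: "0 < d"
   show "EV t. dist (ang \<phi> y t - ang \<phi> x t) 0 < d" using small[OF d] xy ev_pos
   proof eventually_elim
    case (elim t)
    have "arctan (x t) < arctan (y t)" "arctan (y t) - arctan (x t) \<le> y t - x t"
     using elim(2) arctan_diff_le[of "x t" "y t"] by (simp_all only: arctan_less_iff)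
    then show ?case using elim by (simp add: ang_def dist_real_def)
   qed
  qed
 qed
 then show ?thesis ..
qed

lemma pieces_chain:
 assumes "(good_slice (G \<phi>))\<^sup>*\<^sup>* x y" "EV t. -1 \<le> x t" "EV t. y t \<le> 1"
 shows "(\<lambda>\<alpha> \<beta>. \<exists>h. piece \<alpha> \<beta> h)\<^sup>*\<^sup>* (ang \<phi> x) (ang \<phi> y)"
proof -
 have "(EV t. x t \<le> y t) \<and> ((EV t. -1 \<le> x t) \<longrightarrow> (\<lambda>\<alpha> \<beta>. \<exists>h. piece \<alpha> \<beta> h)\<^sup>*\<^sup>* (ang \<phi> x) (ang \<phi> y))"
  using assms(1)
 proof (induction rule: converse_rtranclp_induct)
  case base
  show ?case by simp
 next
  case (step u v)
  have uv: "EV t. u t < v t" by (rule good_sliceD(3)[OF step.hyps(1)])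
  have vy: "EV t. v t \<le> y t" using step.IH by blast
  have "(\<lambda>\<alpha> \<beta>. \<exists>h. piece \<alpha> \<beta> h)\<^sup>*\<^sup>* (ang \<phi> u) (ang \<phi> y)" if u: "EV t. -1 \<le> u t"
  proof -
   have "EV t. -1 \<le> u t \<and> v t \<le> 1" using u vy assms(3) by eventually_elim simp
   then have 1: "\<exists>h. piece (ang \<phi> u) (ang \<phi> v) h" by (rule good_piece[OF step.hyps(1)])
   have "EV t. -1 \<le> v t" using u uv by eventually_elim simp
   then have "(\<lambda>\<alpha> \<beta>. \<exists>h. piece \<alpha> \<beta> h)\<^sup>*\<^sup>* (ang \<phi> v) (ang \<phi> y)" using step.IH by blast
   then show ?thesis by (rule converse_rtranclp_into_rtranclp[of "\<lambda>\<alpha> \<beta>. \<exists>h. piece \<alpha> \<beta> h", OF 1])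
  qed
  moreover have "EV t. u t \<le> y t" using uv vy by eventually_elim simp
  ultimately show ?case by blast
 qed
 then show ?thesis using assms(2) by blast
qed

text \<open>The slopes -1 and 1 are the angles \<phi> - \<pi>/4 and \<phi> + \<pi>/4, so the sectors
  around multiples of \<pi>/2 fit together, and four of them make a full turn.\<close>

lemma full_chain: "(\<lambda>\<alpha> \<beta>. \<exists>h. piece \<alpha> \<beta> h)\<^sup>*\<^sup>* (\<lambda>t. - (pi / 4)) (\<lambda>t. - (pi / 4) + 2 * pi)"
proof -
 have c: "(\<lambda>\<alpha> \<beta>. \<exists>h. piece \<alpha> \<beta> h)\<^sup>*\<^sup>* (\<lambda>t. \<phi> - pi / 4) (\<lambda>t. \<phi> + pi / 4)" for \<phi>
  using pieces_chain[OF sector_chain_G[of \<phi>]] by (simp add: ang_def[abs_def] arctan_one arctan_minus)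
 have "(\<lambda>\<alpha> \<beta>. \<exists>h. piece \<alpha> \<beta> h)\<^sup>*\<^sup>* (\<lambda>t. - (pi / 4)) (\<lambda>t. - (pi / 4) + real n * (pi / 2))" for n
 proof (induction n)
  case (Suc n)
  have "(\<lambda>t. real n * (pi / 2) - pi / 4) = (\<lambda>t :: real. - (pi / 4) + real n * (pi / 2))" by simp
  moreover have "(\<lambda>t. real n * (pi / 2) + pi / 4) = (\<lambda>t :: real. - (pi / 4) + real (Suc n) * (pi / 2))"
   by (intro ext) (simp add: field_simps)
  ultimately have "(\<lambda>\<alpha> \<beta>. \<exists>h. piece \<alpha> \<beta> h)\<^sup>*\<^sup>* (\<lambda>t. - (pi / 4) + real n * (pi / 2)) (\<lambda>t. - (pi / 4) + real (Suc n) * (pi / 2))"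
   using c[of "real n * (pi / 2)"] by simp
  with Suc show ?case by (rule rtranclp_trans)
 qed simp
 from this[of 4] show ?thesis by simp
qed

end

section \<open>Assembling the pizza\<close>

lemma pol_in_arc_image: "0 < t \<Longrightarrow> pol t \<theta> \<in> arc_image (parc \<alpha>) \<longleftrightarrow> pol t \<theta> = pol t (\<alpha> t)"
 by (auto simp: arc_image_def parc_def)

context plane_germ
begin

lemma exists_pizza: "\<exists>H. pizza S H \<and> associated_pizza S H f"
proof -
 obtain n \<Theta> where \<Theta>: "\<Theta> 0 = (\<lambda>t. - (pi / 4))" "\<Theta> n = (\<lambda>t. - (pi / 4) + 2 * pi)" "\<forall>i<n. \<exists>h. piece (\<Theta> i) (\<Theta> (Suc i)) h"
  using full_chain unfolding rtranclp_power relpowp_fun_conv by blast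
 from \<Theta>(3) obtain h where h: "\<And>i. i < n \<Longrightarrow> piece (\<Theta> i) (\<Theta> (Suc i)) (h i)" by metis
 define ok where "ok t \<longleftrightarrow> 0 < t \<and> (\<forall>i\<in>{..<n}. \<Theta> i t < \<Theta> (Suc i) t \<and> \<Theta> (Suc i) t \<le> \<Theta> i t + pi / 2)" for t
 have "EV t. \<forall>i\<in>{..<n}. \<Theta> i t < \<Theta> (Suc i) t \<and> \<Theta> (Suc i) t \<le> \<Theta> i t + pi / 2"
  by (rule eventually_ball_finite) (use h in \<open>auto simp: piece_def\<close>)
 with ev_pos have ok: "ev ok" unfolding ok_def by (rule eventually_conj)
 have mono: "\<Theta> i t < \<Theta> j t" if "ok t" "i < j" "j \<le> n" for i j t using that(2,3)
 proof (induction j)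
  case (Suc j)
  have "\<Theta> j t < \<Theta> (Suc j) t" using that(1) Suc.prems by (simp add: ok_def)
  then show ?case using Suc by (cases "i = j") auto
 qed simp
 have mono': "\<Theta> i t \<le> \<Theta> j t" if "ok t" "i \<le> j" "j \<le> n" for i j t
  using mono[OF that(1), of i j] that by (cases "i = j") auto
 have \<Theta>n: "\<Theta> n t = \<Theta> 0 t + 2 * pi" for t by (simp add: \<Theta>)
 \<comment> \<open>Each slice has an opening of at most \<pi>/2, so a full turn takes at least four
   of them; in particular two slices cannot share both sides.\<close>
 have n4: "4 \<le> n"
 proof -
  obtain t where t: "ok t" using eventually_happens'[OF _ ok] by auto
  have "\<Theta> m t \<le> \<Theta> 0 t + real m * (pi / 2)" if "m \<le> n" for m using that
  proof (induction m)
   case (Suc m)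
   have "\<Theta> (Suc m) t \<le> \<Theta> m t + pi / 2" using t Suc.prems by (simp add: ok_def)
   then show ?case using Suc by (simp add: field_simps)
  qed simp
  from this[of n] have "2 * pi \<le> real n * (pi / 2)" using \<Theta>n by simp
  then have "4 * pi \<le> real n * pi" by simp
  then have "4 \<le> real n" by (subst (asm) mult_le_cancel_right_pos) auto
  then show ?thesis by simp
 qed
 define \<gamma> where "\<gamma> i = parc (\<Theta> i)" for i
 define T where "T i = CW (\<Theta> i) (\<Theta> (Suc i))" for i
 define H where "H = map h [0..<n]"
 have H: "length H = n" "\<And>i. i < n \<Longrightarrow> H ! i = h i" by (simp_all add: H_def)
 have next_less: "Suc i mod n < n" for i using n4 by simp
 have next_arc: "\<gamma> (Suc i mod n) = parc (\<Theta> (Suc i))" if "i < n" for i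
 proof (cases "Suc i = n")
  case True
  then show ?thesis by (auto simp: \<gamma>_def parc_def fun_eq_iff \<Theta>n)
 next
  case False
  then show ?thesis using that by (simp add: \<gamma>_def)
 qed
 have pD: "holder_triangle S (T i) (\<gamma> i) (\<gamma> (Suc i mod n)) (slice_exponent (h i))"
  "slice_exponent (h i) \<in> \<FF>" "1 \<le> slice_exponent (h i)"
  "1 < slice_exponent (h i) \<Longrightarrow> ((\<lambda>t. \<Theta> (Suc i) t - \<Theta> i t) \<longlongrightarrow> 0) (at_right 0)"
  "elementary S f (T i)" "slice_segment S (h i) = Q_of S f (T i)"
  "q0 (h i) = ord_along f (\<gamma> i)" "q1 (h i) = ord_along f (\<gamma> (Suc i mod n))"
  "q0 (h i) \<in> order_values S" "q1 (h i) \<in> order_values S"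
  "\<And>\<delta>. arc_in S \<delta> (T i) \<Longrightarrow> relative_width S f (T i) \<delta> = slice_width (h i) (ord_along f \<delta>)"
  "affine_width S (slice_segment S (h i)) (slice_width (h i))"
  "min (slice_width (h i) (q0 (h i))) (slice_width (h i) (q1 (h i))) = ereal (slice_exponent (h i))"
  "slice_sign (h i) \<in> {-1, 0, 1}"
  "\<forall>\<^sub>F z in nhds 0. (z \<in> OW (\<Theta> i) (\<Theta> (Suc i)) \<longrightarrow> sgn (f z) = of_int (slice_sign (h i))) \<and>
    (z \<in> T i \<longrightarrow> sgn (f z) \<in> {0, of_int (slice_sign (h i))})" if "i < n" for i
  using h[OF that] unfolding next_arc[OF that] \<gamma>_def[of i] T_def piece_def by blast+
 have end_in: "pol t (\<Theta> i t) \<in> T i" "pol t (\<Theta> (Suc i) t) \<in> T i" if "ok t" "i < n" for i t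
  using that unfolding T_def ok_def by (auto intro!: pol_in_CW_I less_imp_le)
 \<comment> \<open>Two angles of the same ray within one closed turn are equal or differ by 2 * pi.
   The latter occurs only on the closing arc, between the last slice and the first.\<close>
 have meet: "(j = Suc i \<and> pol t \<theta> = pol t (\<Theta> j t)) \<or> (i = 0 \<and> Suc j = n \<and> pol t \<theta> = pol t (\<Theta> 0 t))"
  if ij: "i < j" "j < n" and t: "ok t" and \<theta>: "pol t \<theta> \<in> T i" "pol t \<theta> \<in> T j" for i j t \<theta>
 proof -
  have t0: "0 < t" using t by (simp add: ok_def)
  obtain \<theta>1 where 1: "pol t \<theta> = pol t \<theta>1" "\<Theta> i t \<le> \<theta>1" "\<theta>1 \<le> \<Theta> (Suc i) t"
   using \<theta>(1) pol_in_CW[OF t0] unfolding T_def by blast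
  obtain \<theta>2 where 2: "pol t \<theta> = pol t \<theta>2" "\<Theta> j t \<le> \<theta>2" "\<theta>2 \<le> \<Theta> (Suc j) t"
   using \<theta>(2) pol_in_CW[OF t0] unfolding T_def by blast
  have m: "\<Theta> 0 t \<le> \<Theta> i t" "\<Theta> (Suc i) t \<le> \<Theta> j t" "\<Theta> (Suc j) t \<le> \<Theta> 0 t + 2 * pi"
   using mono'[OF t, of 0 i] mono'[OF t, of "Suc i" j] mono'[OF t, of "Suc j" n] ij \<Theta>n by auto
  show ?thesis
  proof (cases "\<theta>2 = \<theta>1 + 2 * pi")
   case True
   then have e: "\<theta>1 = \<Theta> 0 t" "\<Theta> i t \<le> \<Theta> 0 t" "\<Theta> n t \<le> \<Theta> (Suc j) t" using 1 2 m \<Theta>n[of t] by auto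
   have "i = 0" using mono[OF t, of 0 i] e(2) ij by (cases "i = 0") auto
   moreover have "Suc j = n" using mono[OF t, of "Suc j" n] e(3) ij by (cases "Suc j = n") auto
   ultimately show ?thesis using 1(1) e(1) by simp
  next
   case False
   then have "\<bar>\<theta>2 - \<theta>1\<bar> < 2 * pi" using 1 2 m by linarith
   then have "\<theta>2 = \<theta>1" using pol_inj[OF t0, of \<theta>2 \<theta>1] 1(1) 2(1) by simp
   then have e: "\<theta>1 = \<Theta> j t" "\<Theta> j t \<le> \<Theta> (Suc i) t" using 1 2 m by auto
   have "j = Suc i" using mono[OF t, of "Suc i" j] e(2) ij by (cases "j = Suc i") auto
   then show ?thesis using 1(1) e(1) by simp
  qed
 qed
 have zero: "0 \<in> T i" "0 \<in> arc_image (\<gamma> i)" for i by (simp_all add: T_def CW_def arc_image_def \<gamma>_def parc_def)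
 have face: "germ_eq (T i \<inter> T j) {0} \<or> (\<exists>l \<in> {i, Suc i mod n} \<inter> {j, Suc j mod n}. germ_eq (T i \<inter> T j) (arc_image (\<gamma> l)))"
  if ij: "i < j" "j < n" for i j
 proof -
  have arc: "germ_eq (T i \<inter> T j) (arc_image (\<gamma> l))"
   if l: "\<And>t \<theta>. ok t \<Longrightarrow> pol t \<theta> \<in> T i \<Longrightarrow> pol t \<theta> \<in> T j \<Longrightarrow> pol t \<theta> = pol t (\<Theta> l t)"
    "\<And>t. ok t \<Longrightarrow> pol t (\<Theta> l t) \<in> T i \<and> pol t (\<Theta> l t) \<in> T j" for l
  proof -
   have "EV t. \<forall>\<theta>. pol t \<theta> \<in> T i \<inter> T j \<longleftrightarrow> pol t \<theta> \<in> arc_image (\<gamma> l)" using ok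
   proof eventually_elim
    case (elim t)
    then have "0 < t" by (simp add: ok_def)
    have "pol t \<theta> \<in> T i \<inter> T j \<longleftrightarrow> pol t \<theta> = pol t (\<Theta> l t)" for \<theta>
    proof
     assume "pol t \<theta> \<in> T i \<inter> T j"
     then show "pol t \<theta> = pol t (\<Theta> l t)" using l(1)[OF elim] by blast
    next
     assume "pol t \<theta> = pol t (\<Theta> l t)"
     then show "pol t \<theta> \<in> T i \<inter> T j" using l(2)[OF elim] by (simp only: Int_iff)
    qed
    then show ?case unfolding \<gamma>_def pol_in_arc_image[OF \<open>0 < t\<close>] by blast
   qed
   from germ_pol[OF this] show ?thesis using zero unfolding germ_eq_def by simp
  qed
  consider "j = Suc i" | "i = 0" "Suc j = n" "j \<noteq> Suc i" | "j \<noteq> Suc i" "\<not> (i = 0 \<and> Suc j = n)" by blast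
  then show ?thesis
  proof cases
   case 1
   have "germ_eq (T i \<inter> T j) (arc_image (\<gamma> j))"
   proof (rule arc)
    show "pol t \<theta> = pol t (\<Theta> j t)" if "ok t" "pol t \<theta> \<in> T i" "pol t \<theta> \<in> T j" for t \<theta>
     using meet[OF ij that] 1 n4 by auto
    show "pol t (\<Theta> j t) \<in> T i \<and> pol t (\<Theta> j t) \<in> T j" if "ok t" for t using end_in[OF that] ij 1 by auto
   qed
   moreover have "j \<in> {i, Suc i mod n} \<inter> {j, Suc j mod n}" using 1 ij by simp
   ultimately show ?thesis by blast
  next
   case 2
   have "germ_eq (T i \<inter> T j) (arc_image (\<gamma> 0))"
   proof (rule arc)
    show "pol t \<theta> = pol t (\<Theta> 0 t)" if "ok t" "pol t \<theta> \<in> T i" "pol t \<theta> \<in> T j" for t \<theta>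
     using meet[OF ij that] 2 by auto
    show "pol t (\<Theta> 0 t) \<in> T i \<and> pol t (\<Theta> 0 t) \<in> T j" if "ok t" for t
     using end_in(1)[OF that, of i] end_in(2)[OF that, of j] ij 2 \<Theta>n[of t] by simp
   qed
   moreover have "0 \<in> {i, Suc i mod n} \<inter> {j, Suc j mod n}" using 2 by simp
   ultimately show ?thesis by blast
  next
   case 3
   have "EV t. \<forall>\<theta>. pol t \<theta> \<in> T i \<inter> T j \<longleftrightarrow> pol t \<theta> \<in> {0}" using ok
   proof eventually_elim
    case (elim t)
    have "norm (pol t \<theta>) \<noteq> 0" for \<theta> using elim unfolding norm_pol by (simp add: ok_def)
    then have "pol t \<theta> \<noteq> 0" for \<theta> by (metis norm_zero)
    then show ?case using meet[OF ij elim] 3 by blast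
   qed
   from germ_pol[OF this] show ?thesis using zero unfolding germ_eq_def by simp
  qed
 qed
 have cover: "germ_eq (\<Union>i<n. T i) UNIV"
 proof -
  have "EV t. \<forall>\<theta>. pol t \<theta> \<in> (\<Union>i<n. T i)" using ok
  proof eventually_elim
   case (elim t)
   then have t0: "0 < t" by (simp add: ok_def)
   have "pol t \<theta> \<in> (\<Union>i<n. T i)" for \<theta>
   proof -
    obtain \<theta>' where \<theta>': "\<Theta> 0 t \<le> \<theta>'" "\<theta>' < \<Theta> 0 t + 2 * pi" "pol t \<theta> = pol t \<theta>'"
     using pol_cases[of "\<Theta> 0 t" "pol t \<theta>"] t0 by auto
    have "\<exists>i<m. \<Theta> i t \<le> \<theta>' \<and> \<theta>' \<le> \<Theta> (Suc i) t" if "\<theta>' < \<Theta> m t" for m using that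
    proof (induction m)
     case 0
     then show ?case using \<theta>'(1) by simp
    next
     case (Suc m)
     then show ?case by (cases "\<theta>' < \<Theta> m t") (force simp: less_Suc_eq)+
    qed
    from this[of n] obtain i where "i < n" "\<Theta> i t \<le> \<theta>'" "\<theta>' \<le> \<Theta> (Suc i) t" using \<theta>'(2) \<Theta>n by auto
    then show ?thesis unfolding \<theta>'(3) T_def using pol_in_CW_I[OF t0] by blast
   qed
   then show ?case by blast
  qed
  moreover have "0 \<in> (\<Union>i<n. T i)" using zero(1)[of 0] n4 by (intro UN_I[of 0]) auto
  ultimately show ?thesis unfolding germ_eq_def by (simp add: germ_pol)
 qed
 have ccw: "counterclockwise n \<gamma>" unfolding counterclockwise_def using ok
 proof eventually_elim
  case (elim t)
  have "\<Theta> i t < \<Theta> j t \<and> \<Theta> j t < \<Theta> i t + 2 * pi" if "i < j" "j < n" for i j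
   using mono[OF elim, of i j] mono[OF elim, of j n] mono'[OF elim, of 0 i] that \<Theta>n[of t] by auto
  then show ?case by (intro exI[of _ "\<lambda>i. \<Theta> i t"]) (simp add: \<gamma>_def parc_def pol_def)
 qed
 have complex: "holder_complex S n (\<lambda>i. slice_exponent (H ! i)) \<gamma> T" unfolding holder_complex_def
 proof (intro conjI allI impI)
  fix i j assume ij: "i < n" "j < n" "i \<noteq> j"
  show "germ_eq (T i \<inter> T j) {0} \<or> (\<exists>l \<in> {i, Suc i mod n} \<inter> {j, Suc j mod n}. germ_eq (T i \<inter> T j) (arc_image (\<gamma> l)))"
  proof (cases "i < j")
   case True
   then show ?thesis using face ij by blast
  next
   case False
   then have "j < i" using ij by simp
   from face[OF this ij(1)] show ?thesis unfolding Int_commute[of "T i"] by blast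
  qed
 qed (use pD(1) H cover ccw in auto)
 \<comment> \<open>If all exponents exceeded 1, all angles would tend to 0, although they add up to
   2 * pi.\<close>
 have one: "1 \<in> set (map slice_exponent H)"
 proof (rule ccontr)
  assume "1 \<notin> set (map slice_exponent H)"
  then have "1 < slice_exponent (h i)" if "i < n" for i
   using pD(3)[OF that] that by (force simp: H_def less_le)
  then have "((\<lambda>t. \<Sum>i<n. \<Theta> (Suc i) t - \<Theta> i t) \<longlongrightarrow> (\<Sum>i<n. 0)) (at_right 0)"
   using pD(4) by (intro tendsto_sum) auto
  moreover have "(\<Sum>i<n. \<Theta> (Suc i) t - \<Theta> i t) = 2 * pi" for t
   using sum_lessThan_telescope[of "\<lambda>i. \<Theta> i t" n] \<Theta>n[of t] by simp
  ultimately have "((\<lambda>t :: real. 2 * pi) \<longlongrightarrow> 0) (at_right 0)" by simp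
  then have "2 * pi = 0" by (subst (asm) tendsto_const_iff) auto
  then show False by simp
 qed
 \<comment> \<open>On the common arc the sign of f is 0 or that of either slice. If the two signs
   differ, f vanishes on the arc and has infinite order there.\<close>
 have sign: "slice_sign (h i) = slice_sign (h (Suc i mod n))" if i: "i < n" and q: "q1 (h i) \<noteq> \<infinity>" for i
 proof (rule ccontr)
  assume ne: "slice_sign (h i) \<noteq> slice_sign (h (Suc i mod n))"
  define j where "j = Suc i mod n"
  have j: "j < n" "\<gamma> j = parc (\<Theta> (Suc i))" using next_less next_arc[OF i] by (simp_all add: j_def)
  have "EV t. f (\<gamma> j t) = 0"
   using eventually_nhds_pol[OF pD(15)[OF i]] eventually_nhds_pol[OF pD(15)[OF j(1)]] ok
  proof eventually_elim
   case (elim t)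
   have 1: "\<gamma> j t = pol t (\<Theta> (Suc i) t)" using j(2) by (simp add: parc_def)
   have 2: "\<gamma> j t = pol t (\<Theta> j t)" by (simp add: \<gamma>_def parc_def)
   have "sgn (f (\<gamma> j t)) \<in> {0, of_int (slice_sign (h i))}" using elim(1) end_in(2)[OF elim(3) i] unfolding 1 by blast
   moreover have "sgn (f (\<gamma> j t)) \<in> {0, of_int (slice_sign (h j))}" using elim(2) end_in(1)[OF elim(3) j(1)] unfolding 2 by blast
   ultimately have "sgn (f (\<gamma> j t)) = 0" using ne by (auto simp: j_def)
   then show ?case by (simp add: sgn_zero_iff)
  qed
  then show False using q order_infty unfolding pD(8)[OF i] ord_along_def j_def by blast
 qed
 have "pizza S H" unfolding pizza_def abstract_holder_complex_def Let_def H(1)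
 proof (intro conjI allI impI ballI)
  fix \<beta> assume "\<beta> \<in> set (map slice_exponent H)"
  then obtain i where "i < n" "\<beta> = slice_exponent (h i)" by (auto simp: H_def)
  then show "\<beta> \<in> exponent_field S" "1 \<le> \<beta>" using pD(2,3) by (simp_all add: \<FF>_def)
 next
  fix i assume i: "i < n"
  note Hi = H(2)[OF i] H(2)[OF next_less[of i]]
  show "q0 (H ! (Suc i mod n)) = q1 (H ! i)" unfolding Hi using pD(7)[OF next_less[of i]] pD(8)[OF i] by simp
  show "slice_sign (H ! i) = slice_sign (H ! (Suc i mod n))" if "q1 (H ! i) \<noteq> \<infinity>"
   using sign[OF i] that unfolding Hi by simp
 qed (use one H(2) pD(9,10,12,13,14) in auto)
 moreover have "associated_pizza S H f" unfolding associated_pizza_def Let_def H(1)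
 proof (intro exI conjI allI impI)
  show "holder_complex S n (\<lambda>i. slice_exponent (H ! i)) \<gamma> T" by (rule complex)
  fix i assume i: "i < n"
  obtain e where w: "wedge e (\<Theta> i) (\<Theta> (Suc i))" using h[OF i] unfolding piece_def by blast
  interpret w: wedge e "\<Theta> i" "\<Theta> (Suc i)" by (rule w)
  show "\<forall>\<^sub>F x in nhds 0. x \<in> interior (T i) \<longrightarrow> sgn (f x) = of_int (slice_sign (H ! i))"
   using pD(15)[OF i] ball_germ[OF w.e]
  by eventually_elim (use w.interior_CW H(2)[OF i] in \<open>force simp: T_def\<close>)
  show "slice_segment S (H ! i) = Q_of S f (T i)" using pD(6)[OF i] H(2)[OF i] by simp
  show "q0 (H ! i) = ord_along f (\<gamma> i)" "q1 (H ! i) = ord_along f (\<gamma> (Suc i mod n))" using pD(7,8)[OF i] H(2)[OF i] by simp_all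
  show "elementary S f (T i)" by (rule pD(5)[OF i])
  show "relative_width S f (T i) \<delta> = slice_width (H ! i) (ord_along f \<delta>)" if "arc_in S \<delta> (T i)" for \<delta>
   using pD(11)[OF i that] H(2)[OF i] by simp
 qed
 ultimately show ?thesis by blast
qed

end

theorem theorem3p1:
 fixes S :: "nat \<Rightarrow> real list set set" and f :: "real \<times> real \<Rightarrow> real"
 assumes "polynomially_bounded_ominimal_structure S"
  and "continuous_definable_germ S f"
 shows "\<exists>H. pizza S H \<and> associated_pizza S H f"
proof -
 interpret polynomially_bounded_ominimal_structure S by (rule assms(1))
 obtain \<epsilon> where \<epsilon>: "f 0 = 0" "0 < \<epsilon>" "continuous_on (ball 0 \<epsilon>) f" "{[x, y, f (x, y)] | x y. (x, y) \<in> ball 0 \<epsilon>} \<in> S 3"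
  using assms(2) unfolding continuous_definable_germ_def by blast
 define R where "R x y z \<longleftrightarrow> (x, y) \<in> ball 0 \<epsilon> \<and> z = f (x, y)" for x y z
 have "{[x, y, z] | x y z. R x y z} = {[x, y, f (x, y)] | x y. (x, y) \<in> ball 0 \<epsilon>}" unfolding R_def by blast
 then have R: "drel3 R" unfolding drel3_S using \<epsilon>(4) by simp
 \<comment> \<open>The graph of f is definable over the ball only; outside of it \<open>F\<close>
   takes the default value 0.\<close>
 define F where "F p = the0 (R (fst p) (snd p))" for p
 interpret plane_germ S f F \<epsilon>
 proof
  show "dfun2 (\<lambda>x y. F (x, y))"
   unfolding dfun2_def F_def fst_conv snd_conv by (intro dterm_the0 drel3_app[OF R] dterm_var)
  show "F z = f z" if "norm z < \<epsilon>" for z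
   unfolding F_def by (rule the0_eq) (use that in \<open>auto simp: R_def\<close>)
 qed (use \<epsilon> in auto)
 show ?thesis by (rule exists_pizza)
qed

end
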